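(* Let $\Lambda V$ be a free chain algebra over $k$ (with arbitrary differential $\partial$) such that $V_n=0$ for $n\ge2$. Then the spectral sequence $E^r_{p,q}\Rightarrow HH_{p+q}(\Lambda V)$ for Hochschild homology degenerates at the second term, $E^2=E^\infty$, and there is an isomorphism of graded algebras $$HH_*(\Lambda V)\cong H_*(\Lambda V\otimes\Gamma(dV),\delta).$$
   Context: Fix a commutative unital ground ring $k$. **Chain algebras.** A chain algebra is a unital $k$-algebra $A=\bigoplus_{n\ge0}A_n$, graded, with a differential $\partial:A_n\to A_{n-1}$, $\partial^2=0$, $\partial(ab)=\partial(a)b+(-1)^{|a|}a\partial(b)$, which is strictly graded commutative: $ba=(-1)^{|a||b|}ab$, and $a^2=0$ for $|a|$ odd. It is called free if, as a graded algebra, it is the graded symmetric algebra $\Lambda V$ (polynomial on even generators, exterior on odd generators) of some free non-negatively graded $k$-module $V$; no condition is imposed on $\partial$. **Hochschild homology and its spectral sequence.** Let $C_{p,q}(\Lambda V)=(\Lambda V\otimes(\Lambda V/k)^{\otimes q})_p$ (the subscript $p$ is the internal degree coming from $\Lambda V$), with the Hochschild boundary $b:C_{p,q}\to C_{p,q-1}$ and the boundary $\partial:C_{p,q}\to C_{p-1,q}$ induced by that of $\Lambda V$ (multiplied by $(-1)^q$ so that $b\partial+\partial b=0$), with the usual Koszul signs. $HH_*(\Lambda V)$ is the homology of the total complex of this double complex, a graded algebra under the shuffle product. The spectral sequence in question is the one of the column filtration: $E^1_{p,q}=H_q(C_{p,*}(\Lambda V),b)\Rightarrow HH_{p+q}(\Lambda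 V)$, with $E^2$ the homology of $E^1$ with respect to the map induced by $\partial$. **The algebra $\Lambda V\otimes\Gamma(dV)$.** $dV$ is $V$ shifted by one, $dV_n=V_{n-1}$. For a free graded module $W$, $\Gamma(W)=\Lambda(W_{odd})\otimes\Gamma(W_{even})$, where $\Gamma(W_{even})$ is the divided power algebra with divided powers $\gamma^n$. A $\gamma$-derivation is a graded derivation $\theta$ with $\theta(\gamma^n(x))=\gamma^{n-1}(x)\theta(x)$. On $\Lambda V\otimes\Gamma(dV)$ let $d$ be the $\gamma$-derivation of degree $+1$ with $v\mapsto dv$, $dv\mapsto0$, and let $\delta$ be the $\gamma$-derivation of degree $-1$ with $\delta(a)=\partial(a)$ for $a\in\Lambda V$ and $\delta(dv)=-d(\partial v)$ for $v\in V$. The homology $H_*(\Lambda V\otimes\Gamma(dV),\delta)$ is graded by total degree (with $|dv|=|v|+1$). *)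

theory Defs
  imports "HOL-Library.Poly_Mapping" "HOL-Algebra.QuotRing" "HOL-Algebra.Module"
begin

section \<open>Free modules, graded algebras and homology\<close>

text \<open>
  The free \<open>k\<close>-module on a set \<open>S\<close> of basis elements of type \<open>'b\<close> is the set of finitely supported
  functions \<^typ>\<open>'b \<Rightarrow>\<^sub>0 'k\<close> with support in \<open>S\<close>.  The multiplication \<^const>\<open>times\<close> which the library
  puts on \<^typ>\<open>'b \<Rightarrow>\<^sub>0 'k\<close> (convolution, without Koszul signs) is never used.
\<close>

abbreviation keys :: "('b \<Rightarrow>\<^sub>0 'c::zero) \<Rightarrow> 'b set"
  where "keys \<equiv> Poly_Mapping.keys"

abbreviation lookup :: "('b \<Rightarrow>\<^sub>0 'c::zero) \<Rightarrow> 'b \<Rightarrow> 'c"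
  where "lookup \<equiv> Poly_Mapping.lookup"

abbreviation single :: "'b \<Rightarrow> 'c::zero \<Rightarrow> ('b \<Rightarrow>\<^sub>0 'c)"
  where "single \<equiv> Poly_Mapping.single"

definition span_on :: "'b set \<Rightarrow> ('b \<Rightarrow>\<^sub>0 'k::comm_ring_1) set"
  where "span_on S = {x. keys x \<subseteq> S}"

abbreviation basis :: "'b \<Rightarrow> ('b \<Rightarrow>\<^sub>0 'k::comm_ring_1)"
  where "basis m \<equiv> single m 1"

definition scal :: "'k::comm_ring_1 \<Rightarrow> ('b \<Rightarrow>\<^sub>0 'k) \<Rightarrow> ('b \<Rightarrow>\<^sub>0 'k)"
  where "scal c x = Poly_Mapping.map ((*) c) x"

definition lin_ext :: "('b \<Rightarrow> ('c \<Rightarrow>\<^sub>0 'k)) \<Rightarrow> ('b \<Rightarrow>\<^sub>0 'k::comm_ring_1) \<Rightarrow> ('c \<Rightarrow>\<^sub>0 'k)"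
  where "lin_ext f x = (\<Sum>m\<in>keys x. scal (lookup x m) (f m))"

definition bilin_ext ::
    "('b \<Rightarrow> 'b \<Rightarrow> ('c \<Rightarrow>\<^sub>0 'k)) \<Rightarrow> ('b \<Rightarrow>\<^sub>0 'k::comm_ring_1) \<Rightarrow> ('b \<Rightarrow>\<^sub>0 'k) \<Rightarrow> ('c \<Rightarrow>\<^sub>0 'k)"
  where "bilin_ext f x y = lin_ext (\<lambda>m. lin_ext (f m) y) x"

record ('k, 'a) graded_algebra = "('k, 'a) module" +
  hpart :: "int \<Rightarrow> 'a set"

definition graded_derivation ::
    "('k::comm_ring_1, 'a, 'z) graded_algebra_scheme \<Rightarrow> int \<Rightarrow> ('a \<Rightarrow> 'a) \<Rightarrow> bool"
  where "graded_derivation A e \<theta> \<longleftrightarrow>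
    \<theta> \<in> carrier A \<rightarrow> carrier A \<and>
    (\<forall>x\<in>carrier A. \<forall>y\<in>carrier A. \<theta> (x \<oplus>\<^bsub>A\<^esub> y) = \<theta> x \<oplus>\<^bsub>A\<^esub> \<theta> y) \<and>
    (\<forall>c. \<forall>x\<in>carrier A. \<theta> (c \<odot>\<^bsub>A\<^esub> x) = c \<odot>\<^bsub>A\<^esub> \<theta> x) \<and>
    (\<forall>n. \<forall>x\<in>hpart A n. \<theta> x \<in> hpart A (n + e)) \<and>
    (\<forall>n. \<forall>x\<in>hpart A n. \<forall>y\<in>carrier A.
       \<theta> (x \<otimes>\<^bsub>A\<^esub> y) =
         (\<theta> x \<otimes>\<^bsub>A\<^esub> y) \<oplus>\<^bsub>A\<^esub> ((if even (e * n) then 1 else -1) \<odot>\<^bsub>A\<^esub> (x \<otimes>\<^bsub>A\<^esub> \<theta> y)))"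

definition chain_differential ::
    "('k::comm_ring_1, 'a, 'z) graded_algebra_scheme \<Rightarrow> ('a \<Rightarrow> 'a) \<Rightarrow> bool"
  where "chain_differential A \<delta> \<longleftrightarrow>
    graded_derivation A (-1) \<delta> \<and> (\<forall>x\<in>carrier A. \<delta> (\<delta> x) = \<zero>\<^bsub>A\<^esub>)"

text \<open>The graded algebra of cycles modulo boundaries of a differential graded algebra.\<close>

definition homology ::
    "('k, 'a, 'z) graded_algebra_scheme \<Rightarrow> ('a \<Rightarrow> 'a) \<Rightarrow> ('k, 'a set) graded_algebra"
  where "homology A \<delta> =
    (let Z = A\<lparr>carrier := {x \<in> carrier A. \<delta> x = \<zero>\<^bsub>A\<^esub>}\<rparr>;
         B = \<delta> ` carrier A;
         H = Z Quot B
     in \<lparr>carrier = carrier H, mult = mult H, one = one H, zero = zero H, add = add H,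
         smult = (\<lambda>c X. \<Union>x\<in>X. B +>\<^bsub>Z\<^esub> (c \<odot>\<^bsub>A\<^esub> x)),
         hpart = (\<lambda>n. (\<lambda>x. B +>\<^bsub>Z\<^esub> x) ` (hpart A n \<inter> carrier Z))\<rparr>)"

definition graded_algebra_isomorphic ::
    "('k, 'a, 'y) graded_algebra_scheme \<Rightarrow> ('k, 'b, 'z) graded_algebra_scheme \<Rightarrow> bool"
  where "graded_algebra_isomorphic A B \<longleftrightarrow>
    (\<exists>h \<in> ring_iso A B.
       (\<forall>c. \<forall>x\<in>carrier A. h (c \<odot>\<^bsub>A\<^esub> x) = c \<odot>\<^bsub>B\<^esub> h x) \<and>
       (\<forall>n. h ` hpart A n = hpart B n))"


section \<open>The algebra \<open>\<Lambda>V \<otimes> \<Gamma>(dV)\<close> and its subalgebra \<open>\<Lambda>V\<close>\<close>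

text \<open>
  The free graded module \<open>V\<close> is given by a homogeneous basis \<open>G\<close> with degrees \<open>deg\<close>.  The algebra
  \<open>\<Lambda>V \<otimes> \<Gamma>(dV)\<close> has the generators \<open>Gen v\<close> (standing for \<open>v\<close>) and \<open>DGen v\<close> (standing for \<open>dv\<close>) for
  \<open>v \<in> G\<close>.  An exponent function \<open>m\<close> stands for the monomial which is the product, in increasing
  order of the generators, of the \<open>g ^ m g\<close>, respectively of the divided powers \<open>\<gamma>\<^sup>m\<^sup>g(g)\<close> if
  \<open>g = DGen v\<close> has even degree.  The order is any fixed linear order on the generators; another
  choice changes the basis by signs only.
\<close>

datatype 'v gen = Gen 'v | DGen 'v

type_synonym 'v mono = "'v gen \<Rightarrow>\<^sub>0 nat"

fun gdeg :: "('v \<Rightarrow> nat) \<Rightarrow> 'v gen \<Rightarrow> nat"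
  where
    "gdeg deg (Gen v) = deg v"
  | "gdeg deg (DGen v) = Suc (deg v)"

definition gless :: "'v gen \<Rightarrow> 'v gen \<Rightarrow> bool"
  where "gless g h \<longleftrightarrow> g \<noteq> h \<and> (g, h) \<in> (SOME r. linear_order r)"

definition mdeg :: "('v \<Rightarrow> nat) \<Rightarrow> 'v mono \<Rightarrow> nat"
  where "mdeg deg m = (\<Sum>g\<in>keys m. lookup m g * gdeg deg g)"

definition monos_in :: "'v gen set \<Rightarrow> ('v \<Rightarrow> nat) \<Rightarrow> 'v mono set"
  where "monos_in X deg =
    {m. keys m \<subseteq> X \<and> (\<forall>g\<in>keys m. odd (gdeg deg g) \<longrightarrow> lookup m g = 1)}"

text \<open>
  The product of two monomials is a multiple of the monomial with the added exponents: it vanishes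
  if an odd generator is repeated; otherwise reordering the odd generators gives a sign, and
  \<open>\<gamma>\<^sup>i(g) \<gamma>\<^sup>j(g) = (i + j choose i) \<gamma>\<^sup>i\<^sup>+\<^sup>j(g)\<close> gives binomial coefficients.
\<close>

definition mono_coeff :: "('v \<Rightarrow> nat) \<Rightarrow> 'v mono \<Rightarrow> 'v mono \<Rightarrow> 'k::comm_ring_1"
  where "mono_coeff deg m n =
    (if \<exists>g. odd (gdeg deg g) \<and> lookup m g + lookup n g \<ge> 2 then 0
     else (-1) ^ card {(g, h). g \<in> keys m \<and> h \<in> keys n \<and>
                               odd (gdeg deg g) \<and> odd (gdeg deg h) \<and> gless h g} *
          (\<Prod>g\<in>{g \<in> keys m \<inter> keys n. g \<in> range DGen \<and> even (gdeg deg g)}.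
             of_nat ((lookup m g + lookup n g)
                       choose lookup m g)))"

definition gmult ::
    "('v \<Rightarrow> nat) \<Rightarrow> ('v mono \<Rightarrow>\<^sub>0 'k::comm_ring_1) \<Rightarrow> ('v mono \<Rightarrow>\<^sub>0 'k) \<Rightarrow> ('v mono \<Rightarrow>\<^sub>0 'k)"
  where "gmult deg = bilin_ext (\<lambda>m n. single (m + n) (mono_coeff deg m n))"

definition free_algebra ::
    "'v gen set \<Rightarrow> ('v \<Rightarrow> nat) \<Rightarrow> ('k::comm_ring_1, 'v mono \<Rightarrow>\<^sub>0 'k) graded_algebra"
  where "free_algebra X deg =
    \<lparr>carrier = span_on (monos_in X deg), mult = gmult deg, one = basis 0, zero = 0, add = (+),
     smult = scal, hpart = (\<lambda>n. span_on {m \<in> monos_in X deg. int (mdeg deg m) = n})\<rparr>"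

definition Lambda :: "'v set \<Rightarrow> ('v \<Rightarrow> nat) \<Rightarrow> ('k::comm_ring_1, 'v mono \<Rightarrow>\<^sub>0 'k) graded_algebra"
  where "Lambda G deg = free_algebra (Gen ` G) deg"

definition Lambda_Gamma ::
    "'v set \<Rightarrow> ('v \<Rightarrow> nat) \<Rightarrow> ('k::comm_ring_1, 'v mono \<Rightarrow>\<^sub>0 'k) graded_algebra"
  where "Lambda_Gamma G deg = free_algebra (Gen ` G \<union> DGen ` G) deg"

definition gvar :: "'v gen \<Rightarrow> ('v mono \<Rightarrow>\<^sub>0 'k::comm_ring_1)"
  where "gvar g = basis (single g 1)"

definition dV_even :: "'v set \<Rightarrow> ('v \<Rightarrow> nat) \<Rightarrow> ('v mono \<Rightarrow>\<^sub>0 'k::comm_ring_1) set"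
  where "dV_even G deg =
    span_on {single (DGen v) 1 | v. v \<in> G \<and> even (gdeg deg (DGen v))}"

text \<open>
  For \<open>x = (\<Sum>g. c\<^sub>g g)\<close> in the even part of \<open>dV\<close>,
  \<open>\<gamma>\<^sup>n(x) = (\<Sum>e. \<Prod>g. c\<^sub>g ^ e g * \<gamma>\<^sup>e\<^sup>g(g))\<close>, where \<open>e\<close> ranges over the exponents of total size \<open>n\<close>.
\<close>

definition divpow :: "nat \<Rightarrow> ('v mono \<Rightarrow>\<^sub>0 'k::comm_ring_1) \<Rightarrow> ('v mono \<Rightarrow>\<^sub>0 'k)"
  where "divpow n x =
    (\<Sum>e\<in>{e. (\<forall>g\<in>keys e. single g 1 \<in> keys x) \<and>
             (\<Sum>g\<in>keys e. lookup e g) = n}.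
       single e
         (\<Prod>g\<in>keys e. lookup x (single g 1) ^ lookup e g))"

definition gamma_derivation ::
    "'v set \<Rightarrow> ('v \<Rightarrow> nat) \<Rightarrow> int \<Rightarrow> (('v mono \<Rightarrow>\<^sub>0 'k::comm_ring_1) \<Rightarrow> ('v mono \<Rightarrow>\<^sub>0 'k)) \<Rightarrow> bool"
  where "gamma_derivation G deg e \<theta> \<longleftrightarrow>
    graded_derivation (Lambda_Gamma G deg) e \<theta> \<and>
    (\<forall>x\<in>dV_even G deg. \<forall>n\<ge>1. \<theta> (divpow n x) = gmult deg (divpow (n - 1) x) (\<theta> x))"


section \<open>The Hochschild double complex of \<open>\<Lambda>V\<close>\<close>

text \<open>
  Since \<open>\<Lambda>V\<close> is free on its monomials and \<open>\<Lambda>V/k\<close> on the monomials other than \<open>1\<close>, the module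
  \<open>\<Lambda>V \<otimes> (\<Lambda>V/k)\<^sup>\<otimes>\<^sup>q\<close> is free on the lists \<open>[m\<^sub>0, \<dots>, m\<^sub>q]\<close> of monomials with \<open>m\<^sub>i \<noteq> 1\<close> for \<open>i > 0\<close>.
  \<open>pure_tensor [a\<^sub>0, \<dots>, a\<^sub>q]\<close> is the class of \<open>a\<^sub>0 \<otimes> \<dots> \<otimes> a\<^sub>q\<close>; the condition on \<open>tl ms\<close> is
  reduction modulo \<open>k\<close> in the last \<open>q\<close> factors.
\<close>

type_synonym ('v, 'k) hoch = "'v mono list \<Rightarrow>\<^sub>0 'k"

definition hoch_basis :: "'v set \<Rightarrow> ('v \<Rightarrow> nat) \<Rightarrow> 'v mono list set"
  where "hoch_basis G deg =
    {ms. ms \<noteq> [] \<and> set ms \<subseteq> monos_in (Gen ` G) deg \<and> 0 \<notin> set (tl ms)}"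

definition pure_tensor :: "('v mono \<Rightarrow>\<^sub>0 'k::comm_ring_1) list \<Rightarrow> ('v, 'k) hoch"
  where "pure_tensor as =
    (\<Sum>ms\<in>{ms \<in> listset (map keys as). 0 \<notin> set (tl ms)}.
       single ms (prod_list (map2 lookup as ms)))"

definition int_deg :: "('v \<Rightarrow> nat) \<Rightarrow> 'v mono list \<Rightarrow> nat"
  where "int_deg deg ms = sum_list (map (mdeg deg) ms)"

definition hoch_b :: "('v \<Rightarrow> nat) \<Rightarrow> ('v, 'k::comm_ring_1) hoch \<Rightarrow> ('v, 'k) hoch"
  where "hoch_b deg = lin_ext (\<lambda>ms. let q = length ms - 1 in
    (\<Sum>i<q. scal ((-1) ^ i)
       (pure_tensor (map basis (take i ms) @
          [gmult deg (basis (ms ! i)) (basis (ms ! Suc i))] @ map basis (drop (i + 2) ms)))) +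
    (if q = 0 then 0
     else scal ((-1) ^ (q + mdeg deg (last ms) * int_deg deg (butlast ms)))
       (pure_tensor (gmult deg (basis (last ms)) (basis (hd ms)) #
          map basis (butlast (tl ms))))))"

definition hoch_del ::
    "('v \<Rightarrow> nat) \<Rightarrow> (('v mono \<Rightarrow>\<^sub>0 'k::comm_ring_1) \<Rightarrow> ('v mono \<Rightarrow>\<^sub>0 'k)) \<Rightarrow>
     ('v, 'k) hoch \<Rightarrow> ('v, 'k) hoch"
  where "hoch_del deg bd = lin_ext (\<lambda>ms. let q = length ms - 1 in
    (\<Sum>i\<le>q. scal ((-1) ^ (q + int_deg deg (take i ms)))
       (pure_tensor (map basis (take i ms) @ [bd (basis (ms ! i))] @
          map basis (drop (Suc i) ms)))))"

definition hoch_D ::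
    "('v \<Rightarrow> nat) \<Rightarrow> (('v mono \<Rightarrow>\<^sub>0 'k::comm_ring_1) \<Rightarrow> ('v mono \<Rightarrow>\<^sub>0 'k)) \<Rightarrow>
     ('v, 'k) hoch \<Rightarrow> ('v, 'k) hoch"
  where "hoch_D deg bd x = hoch_b deg x + hoch_del deg bd x"

text \<open>
  The signed sum of all shuffles of two lists: moving \<open>b\<close> to the front past \<open>a # as\<close> gives the sign
  of the permutation times the Koszul sign.
\<close>

fun shuffle_sum :: "('v \<Rightarrow> nat) \<Rightarrow> 'v mono list \<Rightarrow> 'v mono list \<Rightarrow> ('v, 'k::comm_ring_1) hoch"
  where
    "shuffle_sum deg [] bs = basis bs"
  | "shuffle_sum deg (a # as) [] = basis (a # as)"
  | "shuffle_sum deg (a # as) (b # bs) =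
       lin_ext (\<lambda>ms. basis (a # ms)) (shuffle_sum deg as (b # bs)) +
       scal ((-1) ^ (length (a # as) + mdeg deg b * int_deg deg (a # as)))
         (lin_ext (\<lambda>ms. basis (b # ms)) (shuffle_sum deg (a # as) bs))"

text \<open>
  The shuffle product \<open>(a\<^sub>0 \<otimes> as) (b\<^sub>0 \<otimes> bs)\<close>.  The first sign comes from moving \<open>b\<^sub>0\<close> past \<open>as\<close>.  The
  second one, for factors of bidegree \<open>(p, q)\<close> and \<open>(p', q')\<close>, is \<open>(-1) ^ (p * q')\<close>: it corresponds to
  the factor \<open>(-1) ^ q\<close> in \<^const>\<open>hoch_del\<close> and makes \<^const>\<open>hoch_D\<close> a graded derivation with
  respect to the total degree.
\<close>

definition shuffle_product ::
    "('v \<Rightarrow> nat) \<Rightarrow> ('v, 'k::comm_ring_1) hoch \<Rightarrow> ('v, 'k) hoch \<Rightarrow> ('v, 'k) hoch"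
  where "shuffle_product deg = bilin_ext (\<lambda>xs ys.
    scal ((-1) ^ (mdeg deg (hd ys) * int_deg deg (tl xs)) *
          (-1) ^ (int_deg deg xs * length (tl ys)))
      (lin_ext (\<lambda>ms. pure_tensor (gmult deg (basis (hd xs)) (basis (hd ys)) # map basis ms))
         (shuffle_sum deg (tl xs) (tl ys))))"

definition hoch_algebra ::
    "'v set \<Rightarrow> ('v \<Rightarrow> nat) \<Rightarrow> ('k::comm_ring_1, ('v, 'k) hoch) graded_algebra"
  where "hoch_algebra G deg =
    \<lparr>carrier = span_on (hoch_basis G deg), mult = shuffle_product deg, one = basis [0],
     zero = 0, add = (+), smult = scal,
     hpart = (\<lambda>n. span_on {ms \<in> hoch_basis G deg. int (int_deg deg ms + length (tl ms)) = n})\<rparr>"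

definition HH ::
    "'v set \<Rightarrow> ('v \<Rightarrow> nat) \<Rightarrow> (('v mono \<Rightarrow>\<^sub>0 'k::comm_ring_1) \<Rightarrow> ('v mono \<Rightarrow>\<^sub>0 'k)) \<Rightarrow>
     ('k, ('v, 'k) hoch set) graded_algebra"
  where "HH G deg bd = homology (hoch_algebra G deg) (hoch_D deg bd)"

definition hoch_C :: "'v set \<Rightarrow> ('v \<Rightarrow> nat) \<Rightarrow> int \<Rightarrow> int \<Rightarrow> ('v, 'k::comm_ring_1) hoch set"
  where "hoch_C G deg p q =
    span_on {ms \<in> hoch_basis G deg. int (int_deg deg ms) = p \<and> int (length (tl ms)) = q}"

text \<open>The step \<open>F\<^sub>p\<close> of the column filtration in total degree \<open>n\<close>.\<close>

definition hoch_F :: "'v set \<Rightarrow> ('v \<Rightarrow> nat) \<Rightarrow> int \<Rightarrow> int \<Rightarrow> ('v, 'k::comm_ring_1) hoch set"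
  where "hoch_F G deg p n =
    span_on {ms \<in> hoch_basis G deg.
      int (int_deg deg ms) \<le> p \<and> int (int_deg deg ms + length (tl ms)) = n}"


section \<open>The spectral sequence of the column filtration\<close>

text \<open>
  Let \<open>D\<close> be the total differential of a double complex \<open>C\<close> with column filtration \<open>F\<close>, so that
  \<open>F p (p + q)\<close> is the direct sum of \<open>C p q\<close> and \<open>F (p - 1) (p + q)\<close>.  Identifying
  \<open>E\<^sup>0\<^sub>p\<^sub>q = F p (p + q) / F (p - 1) (p + q)\<close> with \<open>C p q\<close>, all \<open>E\<^sup>r\<^sub>p\<^sub>q = Z\<^sup>r\<^sub>p\<^sub>q / B\<^sup>r\<^sub>p\<^sub>q\<close>, and also
  \<open>E\<^sup>\<infinity>\<^sub>p\<^sub>q\<close>, are subquotients of \<open>C p q\<close>; so \<open>E\<^sup>2 = E\<^sup>\<infinity>\<close> is an equality of sets of cosets.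
\<close>

definition ss_Z ::
    "(int \<Rightarrow> int \<Rightarrow> 'a::ab_group_add set) \<Rightarrow> (int \<Rightarrow> int \<Rightarrow> 'a set) \<Rightarrow> ('a \<Rightarrow> 'a) \<Rightarrow>
     nat \<Rightarrow> int \<Rightarrow> int \<Rightarrow> 'a set"
  where "ss_Z C F D r p q =
    {c \<in> C p q. \<exists>y \<in> F (p - 1) (p + q). D (c + y) \<in> F (p - int r) (p + q - 1)}"

definition ss_B ::
    "(int \<Rightarrow> int \<Rightarrow> 'a::ab_group_add set) \<Rightarrow> (int \<Rightarrow> int \<Rightarrow> 'a set) \<Rightarrow> ('a \<Rightarrow> 'a) \<Rightarrow>
     nat \<Rightarrow> int \<Rightarrow> int \<Rightarrow> 'a set"
  where "ss_B C F D r p q =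
    {c \<in> C p q. \<exists>y \<in> F (p - 1) (p + q). \<exists>w \<in> F (p + int r - 1) (p + q + 1). D w = c + y}"

definition cosets_of :: "'a::ab_group_add set \<Rightarrow> 'a set \<Rightarrow> 'a set set"
  where "cosets_of Z B = (\<lambda>c. (+) c ` B) ` Z"

definition ss_E ::
    "(int \<Rightarrow> int \<Rightarrow> 'a::ab_group_add set) \<Rightarrow> (int \<Rightarrow> int \<Rightarrow> 'a set) \<Rightarrow> ('a \<Rightarrow> 'a) \<Rightarrow>
     nat \<Rightarrow> int \<Rightarrow> int \<Rightarrow> 'a set set"
  where "ss_E C F D r p q = cosets_of (ss_Z C F D r p q) (ss_B C F D r p q)"

definition ss_E_inf ::
    "(int \<Rightarrow> int \<Rightarrow> 'a::ab_group_add set) \<Rightarrow> (int \<Rightarrow> int \<Rightarrow> 'a set) \<Rightarrow> ('a \<Rightarrow> 'a) \<Rightarrow>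
     int \<Rightarrow> int \<Rightarrow> 'a set set"
  where "ss_E_inf C F D p q =
    cosets_of (\<Inter>r. ss_Z C F D r p q) (\<Union>r. ss_B C F D r p q)"

text \<open>The differential \<open>d\<^sup>r : E\<^sup>r\<^sub>p\<^sub>,\<^sub>q \<rightarrow> E\<^sup>r\<^sub>p\<^sub>-\<^sub>r\<^sub>,\<^sub>q\<^sub>+\<^sub>r\<^sub>-\<^sub>1\<close> induced by \<open>D\<close>.\<close>

definition ss_d ::
    "(int \<Rightarrow> int \<Rightarrow> 'a::ab_group_add set) \<Rightarrow> (int \<Rightarrow> int \<Rightarrow> 'a set) \<Rightarrow> ('a \<Rightarrow> 'a) \<Rightarrow>
     nat \<Rightarrow> int \<Rightarrow> int \<Rightarrow> 'a set \<Rightarrow> 'a set"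
  where "ss_d C F D r p q X =
    \<Union>{(+) c' ` ss_B C F D r (p - int r) (q + int r - 1) | c' c y y'.
        c \<in> X \<and> y \<in> F (p - 1) (p + q) \<and>
        c' \<in> C (p - int r) (q + int r - 1) \<and> y' \<in> F (p - int r - 1) (p + q - 1) \<and>
        D (c + y) = c' + y'}"

text \<open>The zero of \<open>E\<^sup>r\<^sub>p\<^sub>q\<close> is the coset \<^const>\<open>ss_B\<close>.\<close>

definition ss_degenerates_at ::
    "(int \<Rightarrow> int \<Rightarrow> 'a::ab_group_add set) \<Rightarrow> (int \<Rightarrow> int \<Rightarrow> 'a set) \<Rightarrow> ('a \<Rightarrow> 'a) \<Rightarrow> nat \<Rightarrow> bool"
  where "ss_degenerates_at C F D s \<longleftrightarrow>
    (\<forall>r\<ge>s. \<forall>p q. \<forall>X \<in> ss_E C F D r p q.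
       ss_d C F D r p q X = ss_B C F D r (p - int r) (q + int r - 1)) \<and>
    (\<forall>p q. ss_E C F D s p q = ss_E_inf C F D p q)"

end

(*
  Write A for the free chain algebra and Omega for A tensor Gamma(dV).  The Hochschild complex of A,
  re-signed to follow the total degree, is a commutative differential graded algebra U under the shuffle
  product, and each odd generator y gives the divided powers 1 [y|...|y] in U.  Sending v to v and dv to
  1 [v] commutes with the differentials only up to a correction at dy for odd y: bd y has degree 0, hence
  only even letters, and for even letters 1 [bd y] - d(bd y) is a boundary of words [a|b] with two even
  letters.  These words also have divided powers (the alternating words), so the correction can be added
  inside the divided powers of dy; this gives a multiplicative chain map from Omega to U.
  Here the hypothesis on the degrees of V enters.

  With respect to the filtration by internal degree, the leading part of this map is the
  Hochschild-Kostant-Rosenberg map for the multiplication part of the differential.  It is a bijection on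
  homology: an algebraic Morse matching on words splits off or merges the largest variable of a letter, and
  the unmatched words are the sorted words of variables, one for each monomial in the dv.
  Since the differential of Omega lowers the filtration by exactly one, comparing leading parts shows that a
  cycle modulo filtration p - 2 can be corrected to a cycle, and that a boundary of filtration p bounds an
  element of filtration p + 1.  The first fact kills the differentials from the second page on, both together
  give E2 = Einfinity, and the comparison map induces the isomorphism of homology algebras.
*)

theory Submission
  imports Defs "HOL-Library.Multiset"
begin

section \<open>Linear maps between free modules\<close>

text \<open>Over a general ground ring the divided powers of dy are not determined by dy, so a chain
  map cannot be prescribed on dy alone: whatever is added to 1[y] must bring divided powers of its
  own, compatible with the differential. The shape of the addition comes from comparing f -> 1[f],
  which is only linear, with f -> df, which obeys the Leibniz rule: for even letters the defect a[b]
  + b[a] - [ab] on a product is the differential of the word [a|b]. The added terms have internal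
  degree 0 while 1[y] has internal degree 1, so leading parts are not disturbed. Several laws on the
  side of Omega, such as \<delta>\<delta> = 0, are not computed there but pulled back from the
  Hochschild side along the comparison map, which is injective. The variables need not be
  well-ordered; termination of the matching is therefore measured inside the finite set of variables
  of a single multidegree.\<close>

definition sgs :: "nat \<Rightarrow> 'a::ab_group_add \<Rightarrow> 'a"
  where "sgs n x = (if even n then x else - x)"

lemma sgs_0 [simp]: "sgs n 0 = 0" and sgs_zero [simp]: "sgs 0 x = x"
  by (auto simp: sgs_def)

lemma sgs_sgs: "sgs m (sgs n x) = sgs (m + n) x"
  by (auto simp: sgs_def)

lemma sgs_add: "sgs n (x + y) = sgs n x + sgs n y"
  by (auto simp: sgs_def)

lemma sgs_cong: "even m = even n \<Longrightarrow> sgs m x = sgs n x"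
  by (auto simp: sgs_def)

lemma keys_sgs [simp]: "keys (sgs n x) = keys x"
  by (auto simp: sgs_def)

lemma lookup_sgs: "lookup (sgs n x) m = sgs n (lookup x m)"
  by (auto simp: sgs_def)

lemma lookup_scal [simp]: "lookup (scal c x) m = c * lookup x m"
  by (simp add: scal_def Poly_Mapping.map.rep_eq when_def)

lemma scal_simps [simp]:
  "scal c 0 = 0" "scal 0 x = 0" "scal 1 x = x" "scal (- c) x = - scal c x" "scal c (- x) = - scal c x"
  by (auto intro!: poly_mapping_eqI)

lemma scal_scal [simp]: "scal c (scal d x) = scal (c * d) x"
  by (auto intro!: poly_mapping_eqI simp: mult.assoc)

lemma scal_single [simp]: "scal c (single m d) = single m (c * d)"
  by (auto intro!: poly_mapping_eqI simp: lookup_single when_def)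

lemma scal_add: "scal c (x + y) = scal c x + scal c y"
  by (auto intro!: poly_mapping_eqI simp: lookup_add algebra_simps)

lemma scal_diff: "scal c (x - y) = scal c x - scal c y"
  by (auto intro!: poly_mapping_eqI simp: lookup_minus right_diff_distrib)

lemma scal_add_left: "scal (c + d) x = scal c x + scal d x"
  by (auto intro!: poly_mapping_eqI simp: lookup_add algebra_simps)

lemma scal_sum: "scal c (sum f A) = (\<Sum>a\<in>A. scal c (f a))"
  by (induction A rule: infinite_finite_induct) (auto simp: scal_add)

lemma keys_scal: "keys (scal c x) \<subseteq> keys x"
  by (auto simp: in_keys_iff)

lemma poly_mapping_decomp: "x = (\<Sum>m\<in>keys x. scal (lookup x m) (basis m))"
proof (rule poly_mapping_eqI)
  fix m
  show "lookup x m = lookup (\<Sum>m\<in>keys x. scal (lookup x m) (basis m)) m"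
    by (simp add: lookup_sum lookup_single when_def sum.delta in_keys_iff if_distrib cong: if_cong)
qed

definition klinear :: "(('b \<Rightarrow>\<^sub>0 'k::comm_ring_1) \<Rightarrow> ('c \<Rightarrow>\<^sub>0 'k)) \<Rightarrow> bool"
  where "klinear T \<longleftrightarrow> (\<forall>x y. T (x + y) = T x + T y) \<and> (\<forall>c x. T (scal c x) = scal c (T x))"

lemma klinearD:
  assumes "klinear T"
  shows "T (x + y) = T x + T y" "T (scal c x) = scal c (T x)" "T 0 = 0" "T (- x) = - T x"
    "T (x - y) = T x - T y" "T (sgs n x) = sgs n (T x)" "T (sum f A) = (\<Sum>a\<in>A. T (f a))"
    "T (single m c) = scal c (T (basis m))"
proof -
  show a: "T (x + y) = T x + T y" for x y using assms by (auto simp: klinear_def)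
  show s: "T (scal c x) = scal c (T x)" for c x using assms by (auto simp: klinear_def)
  show z: "T 0 = 0" using s[of 0 0] by simp
  show n: "T (- x) = - T x" for x using s[of "-1" x] by simp
  show "T (x - y) = T x - T y" using a[of x "-y"] n by simp
  show "T (sgs n x) = sgs n (T x)" using n by (auto simp: sgs_def)
  show "T (sum f A) = (\<Sum>a\<in>A. T (f a))"
    by (induction A rule: infinite_finite_induct) (auto simp: a z)
  show "T (single m c) = scal c (T (basis m))" using s[of c "basis m"] by simp
qed

text \<open>Agreement is asked only on the support of \<open>x\<close>: most identities below hold
  on a subcomplex, while the maps involved are total functions.\<close>

lemma klinear_eq_on:
  assumes "klinear S" "klinear T" "\<And>m. m \<in> keys x \<Longrightarrow> S (basis m) = T (basis m)"
  shows "S x = T x"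
  by (subst (1 2) poly_mapping_decomp[of x])
    (simp only: klinearD(2,7)[OF assms(1)] klinearD(2,7)[OF assms(2)] assms(3) cong: sum.cong)

lemma klinear_eq: "klinear S \<Longrightarrow> klinear T \<Longrightarrow> (\<And>m. S (basis m) = T (basis m)) \<Longrightarrow> S x = T x"
  by (rule klinear_eq_on)

lemma klinear_in_span:
  assumes "klinear T" "\<And>m. m \<in> keys x \<Longrightarrow> keys (T (basis m)) \<subseteq> A"
  shows "keys (T x) \<subseteq> A"
proof -
  have "keys (T x) \<subseteq> (\<Union>m\<in>keys x. keys (scal (lookup x m) (T (basis m))))"
    by (subst poly_mapping_decomp[of x]) (simp only: klinearD(2,7)[OF assms(1)] keys_sum)
  also have "\<dots> \<subseteq> A" using assms(2) keys_scal by (meson SUP_least order_trans)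
  finally show ?thesis .
qed

lemma lin_ext_superset:
  assumes "finite A" "keys x \<subseteq> A"
  shows "lin_ext f x = (\<Sum>m\<in>A. scal (lookup x m) (f m))"
  unfolding lin_ext_def
  by (rule sum.mono_neutral_left) (use assms in \<open>auto simp: in_keys_iff\<close>)

lemma klinear_lin_ext [simp]: "klinear (lin_ext f)"
  unfolding klinear_def
proof (intro conjI allI)
  fix x y :: "'a \<Rightarrow>\<^sub>0 'b" and c
  have "lin_ext f (x + y) = (\<Sum>m\<in>keys x \<union> keys y. scal (lookup (x + y) m) (f m))"
    by (rule lin_ext_superset) (use Poly_Mapping.keys_add[of x y] in auto)
  also have "\<dots> = lin_ext f x + lin_ext f y"
    by (simp add: lookup_add scal_add_left sum.distrib
        lin_ext_superset[of "keys x \<union> keys y" x] lin_ext_superset[of "keys x \<union> keys y" y])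
  finally show "lin_ext f (x + y) = lin_ext f x + lin_ext f y" .
  show "lin_ext f (scal c x) = scal c (lin_ext f x)"
    by (subst lin_ext_superset[of "keys x"]) (auto simp: keys_scal lin_ext_def scal_sum)
qed

lemma lin_ext_basis [simp]: "lin_ext f (basis m) = f m"
  by (simp add: lin_ext_def)

lemma lin_ext_single: "lin_ext f (single m c) = scal c (f m)"
  by (subst klinearD(8)[OF klinear_lin_ext]) simp

lemmas lin_ext_simps [simp] = klinearD(1-6)[OF klinear_lin_ext] lin_ext_single

lemma lin_ext_cong: "(\<And>m. m \<in> keys x \<Longrightarrow> f m = g m) \<Longrightarrow> x = y \<Longrightarrow> lin_ext f x = lin_ext g y"
  by (auto simp: lin_ext_def)

lemma lin_ext_klinear: "klinear T \<Longrightarrow> lin_ext (\<lambda>m. T (basis m)) x = T x"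
  by (rule klinear_eq) auto

lemma lin_ext_basis_id [simp]: "lin_ext basis x = x"
  using lin_ext_klinear[of "\<lambda>x. x"] by (simp add: klinear_def)

lemma keys_lin_ext: "keys (lin_ext f x) \<subseteq> (\<Union>m\<in>keys x. keys (f m))"
  by (rule klinear_in_span) auto

lemma keys_lin_extD: "n \<in> keys (lin_ext f x) \<Longrightarrow> \<exists>m\<in>keys x. n \<in> keys (f m)"
  using keys_lin_ext by fast

lemma klinear_rules [simp]:
  "klinear (\<lambda>x. x)" "klinear (\<lambda>x. 0)"
  "klinear S \<Longrightarrow> klinear T \<Longrightarrow> klinear (\<lambda>x. S x + T x)"
  "klinear S \<Longrightarrow> klinear T \<Longrightarrow> klinear (\<lambda>x. S x - T x)"
  "klinear S \<Longrightarrow> klinear (\<lambda>x. - S x)"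
  "klinear S \<Longrightarrow> klinear (\<lambda>x. sgs n (S x))"
  "klinear S \<Longrightarrow> klinear (\<lambda>x. scal c (S x))"
  "klinear S \<Longrightarrow> klinear (\<lambda>x. lin_ext f (S x))"
  by (auto simp: klinear_def scal_add scal_diff sgs_def mult.commute)

lemma klinear_lin_ext_param [simp]:
  assumes "\<And>m. klinear (S m)"
  shows "klinear (\<lambda>y. lin_ext (\<lambda>m. S m y) x)"
  unfolding klinear_def lin_ext_def
  by (auto simp: klinearD(1,2)[OF assms] scal_add sum.distrib scal_sum mult.commute)

lemma klinear_comp: "klinear S \<Longrightarrow> klinear T \<Longrightarrow> klinear (\<lambda>x. S (T x))"
  by (simp add: klinear_def)

lemma klinear_comp' [simp]:
  assumes "klinear S" shows "klinear (\<lambda>x. bilin_ext f (S x) y)" "klinear (\<lambda>x. bilin_ext f y (S x))"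
  using assms by (auto simp: bilin_ext_def klinear_comp)

lemma klinear_bilin_ext [simp]: "klinear (bilin_ext f y)"
  by (simp add: bilin_ext_def)

lemma bilin_ext_basis [simp]: "bilin_ext f (basis m) (basis n) = f m n"
  by (simp add: bilin_ext_def)

lemma bilin_ext_basis_left: "bilin_ext f (basis m) y = lin_ext (f m) y"
  by (simp add: bilin_ext_def)

lemma bilin_ext_simps [simp]:
  "bilin_ext f (x + x') y = bilin_ext f x y + bilin_ext f x' y"
  "bilin_ext f (x - x') y = bilin_ext f x y - bilin_ext f x' y"
  "bilin_ext f (- x) y = - bilin_ext f x y" "bilin_ext f 0 y = 0"
  "bilin_ext f (scal c x) y = scal c (bilin_ext f x y)"
  "bilin_ext f (sgs n x) y = sgs n (bilin_ext f x y)"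
  "bilin_ext f x (y + y') = bilin_ext f x y + bilin_ext f x y'"
  "bilin_ext f x (y - y') = bilin_ext f x y - bilin_ext f x y'"
  "bilin_ext f x (- y) = - bilin_ext f x y" "bilin_ext f x 0 = 0"
  "bilin_ext f x (scal c y) = scal c (bilin_ext f x y)"
  "bilin_ext f x (sgs n y) = sgs n (bilin_ext f x y)"
  using klinearD(1-6)[of "\<lambda>x. bilin_ext f x y", OF klinear_comp'(1)[OF klinear_rules(1)]]
    klinearD(1-6)[of "bilin_ext f x"] by auto

lemma bilin_ext_sum:
  "bilin_ext f (sum g A) y = (\<Sum>a\<in>A. bilin_ext f (g a) y)"
  "bilin_ext f x (sum g A) = (\<Sum>a\<in>A. bilin_ext f x (g a))"
  using klinearD(7)[of "\<lambda>x. bilin_ext f x y", OF klinear_comp'(1)[OF klinear_rules(1)]]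
    klinearD(7)[of "bilin_ext f x"] by auto

lemma keys_bilin_ext: "keys (bilin_ext f x y) \<subseteq> (\<Union>m\<in>keys x. \<Union>n\<in>keys y. keys (f m n))"
  unfolding bilin_ext_def using keys_lin_ext
  by (intro order_trans[OF keys_lin_ext] UN_mono) auto

lemma keys_bilin_extD: "l \<in> keys (bilin_ext f x y) \<Longrightarrow> \<exists>m\<in>keys x. \<exists>n\<in>keys y. l \<in> keys (f m n)"
  using keys_bilin_ext by fast

lemma klinear_eq2_on:
  assumes "\<And>y. klinear (\<lambda>x. F x y)" "\<And>x. klinear (\<lambda>y. F x y)" "\<And>y. klinear (\<lambda>x. H x y)" "\<And>x. klinear (\<lambda>y. H x y)"
    "\<And>m n. m \<in> keys x \<Longrightarrow> n \<in> keys y \<Longrightarrow> F (basis m) (basis n) = H (basis m) (basis n)"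
  shows "F x y = H x y"
  by (rule klinear_eq_on[of "\<lambda>x. F x y" "\<lambda>x. H x y", OF assms(1,3)],
      rule klinear_eq_on[OF assms(2,4)], rule assms(5))

lemma klinear_eq3_on:
  assumes "\<And>y z. klinear (\<lambda>x. F x y z)" "\<And>x z. klinear (\<lambda>y. F x y z)" "\<And>x y. klinear (\<lambda>z. F x y z)"
    "\<And>y z. klinear (\<lambda>x. H x y z)" "\<And>x z. klinear (\<lambda>y. H x y z)" "\<And>x y. klinear (\<lambda>z. H x y z)"
    "\<And>l m n. l \<in> keys x \<Longrightarrow> m \<in> keys y \<Longrightarrow> n \<in> keys z \<Longrightarrow>
      F (basis l) (basis m) (basis n) = H (basis l) (basis m) (basis n)"
  shows "F x y z = H x y z"
  by (rule klinear_eq_on[of "\<lambda>x. F x y z" "\<lambda>x. H x y z", OF assms(1,4)],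
      rule klinear_eq2_on[OF assms(2,3,5,6)], rule assms(7))

section \<open>Supercommutative algebras with a basis\<close>

text \<open>An algebra is recorded by its structure constants on a basis, so each axiom speaks of
  basis elements and reaches all elements by multilinearity. Monomials, words under shuffles, and
  pairs of the two are the instances.\<close>

locale salg =
  fixes pr :: "'b \<Rightarrow> 'b \<Rightarrow> ('b \<Rightarrow>\<^sub>0 'k::comm_ring_1)" and dg :: "'b \<Rightarrow> nat" and e :: 'b
  assumes pr_dg: "n \<in> keys (pr a b) \<Longrightarrow> dg n = dg a + dg b"
    and pr_assoc: "lin_ext (\<lambda>x. pr x c) (pr a b) = lin_ext (pr a) (pr b c)"
    and pr_comm: "pr a b = sgs (dg a * dg b) (pr b a)"
    and pr_unit [simp]: "pr e a = basis a"
    and dg_e [simp]: "dg e = 0"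
begin

abbreviation mul where "mul \<equiv> bilin_ext pr"

definition hg :: "nat \<Rightarrow> ('b \<Rightarrow>\<^sub>0 'k) \<Rightarrow> bool"
  where "hg n x \<longleftrightarrow> (\<forall>b\<in>keys x. dg b = n)"

lemma hg_basis [simp]: "hg (dg b) (basis b)" and hg_0 [simp]: "hg n 0"
  by (auto simp: hg_def)

lemma hg_basisI: "dg b = n \<Longrightarrow> hg n (basis b)"
  by (auto simp: hg_def)

lemma hg_pr: "hg (dg a + dg b) (pr a b)"
  by (auto simp: hg_def pr_dg)

lemma hg_add: "hg n x \<Longrightarrow> hg n y \<Longrightarrow> hg n (x + y)"
  using Poly_Mapping.keys_add[of x y] by (fastforce simp: hg_def)

lemma hg_sgs [simp]: "hg n (sgs m x) = hg n x" and hg_minus [simp]: "hg n (- x) = hg n x"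
  by (auto simp: hg_def)

lemma hg_scal: "hg n x \<Longrightarrow> hg n (scal c x)"
  using keys_scal[of c x] by (auto simp: hg_def)

lemma hg_sum: "(\<And>a. a \<in> A \<Longrightarrow> hg n (f a)) \<Longrightarrow> hg n (sum f A)"
  by (induction A rule: infinite_finite_induct) (auto intro: hg_add)

lemma hg_mul: "hg m x \<Longrightarrow> hg n y \<Longrightarrow> hg (m + n) (mul x y)"
  unfolding hg_def
proof
  fix b assume *: "\<forall>b\<in>keys x. dg b = m" "\<forall>b\<in>keys y. dg b = n" "b \<in> keys (mul x y)"
  then obtain c d where "c \<in> keys x" "d \<in> keys y" "b \<in> keys (pr c d)"
    by (meson keys_bilin_extD)
  then show "dg b = m + n" using pr_dg * by auto
qed

lemma pr_unit_right [simp]: "pr a e = basis a"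
  using pr_comm[of a e] by simp

lemma mul_unit [simp]: "mul (basis e) x = x" "mul x (basis e) = x"
  by (rule klinear_eq; simp)+

lemma mul_assoc: "mul (mul x y) z = mul x (mul y z)"
  by (rule klinear_eq3_on[where F = "\<lambda>x y z. mul (mul x y) z" and H = "\<lambda>x y z. mul x (mul y z)"])
    (simp_all add: bilin_ext_def pr_assoc)

lemma mul_comm:
  assumes "hg m x" "hg n y"
  shows "mul x y = sgs (m * n) (mul y x)"
  by (rule klinear_eq2_on[where F = mul and H = "\<lambda>x y. sgs (m * n) (mul y x)"])
    (use assms in \<open>auto simp: hg_def intro: pr_comm[THEN trans]\<close>)

lemma mul_left_commute:
  assumes "hg m x" "hg n y"
  shows "mul x (mul y z) = sgs (m * n) (mul y (mul x z))"
  by (simp add: mul_assoc[symmetric] mul_comm[OF assms])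

text \<open>The Leibniz rule is asked on \<open>S\<close> only, because the given differential is a
  derivation only on the monomials of Lambda V, whereas structure constants exist for all
  exponents.\<close>

definition odd_deriv :: "'b set \<Rightarrow> (('b \<Rightarrow>\<^sub>0 'k) \<Rightarrow> ('b \<Rightarrow>\<^sub>0 'k)) \<Rightarrow> bool"
  where "odd_deriv S T \<longleftrightarrow> klinear T \<and> (\<forall>a\<in>S. \<forall>b\<in>S.
    T (pr a b) = mul (T (basis a)) (basis b) + sgs (dg a) (mul (basis a) (T (basis b))))"

lemma odd_deriv_mul:
  assumes T: "odd_deriv S T" and x: "hg n x" and S: "keys x \<subseteq> S" "keys y \<subseteq> S"
  shows "T (mul x y) = mul (T x) y + sgs n (mul x (T y))"
proof -
  have k: "klinear T" using T by (auto simp: odd_deriv_def)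
  have kc: "klinear f \<Longrightarrow> klinear (\<lambda>x. T (f x))" for f :: "('b \<Rightarrow>\<^sub>0 'k) \<Rightarrow> ('b \<Rightarrow>\<^sub>0 'k)"
    using k by (rule klinear_comp)
  show ?thesis
    by (rule klinear_eq2_on[where F = "\<lambda>x y. T (mul x y)" and H = "\<lambda>x y. mul (T x) y + sgs n (mul x (T y))"])
      (use T x S in \<open>auto simp: hg_def odd_deriv_def k kc subset_iff\<close>)
qed

lemma odd_deriv_add:
  assumes "odd_deriv S T" "odd_deriv S T'"
  shows "odd_deriv S (\<lambda>x. T x + T' x)"
  using assms by (auto simp: odd_deriv_def sgs_add)

end

subsection \<open>Tensor products\<close>

definition tens :: "('a \<Rightarrow>\<^sub>0 'k::comm_ring_1) \<Rightarrow> ('b \<Rightarrow>\<^sub>0 'k) \<Rightarrow> ('a \<times> 'b \<Rightarrow>\<^sub>0 'k)"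
  where "tens x y = lin_ext (\<lambda>a. lin_ext (\<lambda>b. basis (a, b)) y) x"

lemma tens_basis [simp]: "tens (basis a) (basis b) = basis (a, b)"
  by (simp add: tens_def)

lemma klinear_tens [simp]:
  "klinear f \<Longrightarrow> klinear (\<lambda>x. tens (f x) y)" "klinear g \<Longrightarrow> klinear (\<lambda>y. tens x (g y))"
  by (simp_all add: tens_def klinear_comp)

lemma tens_simps [simp]:
  "tens (x + x') y = tens x y + tens x' y" "tens (x - x') y = tens x y - tens x' y"
  "tens (- x) y = - tens x y" "tens 0 y = 0" "tens (scal c x) y = scal c (tens x y)"
  "tens (sgs n x) y = sgs n (tens x y)"
  "tens x (y + y') = tens x y + tens x y'" "tens x (y - y') = tens x y - tens x y'"
  "tens x (- y) = - tens x y" "tens x 0 = 0" "tens x (scal c y) = scal c (tens x y)"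
  "tens x (sgs n y) = sgs n (tens x y)"
  using klinearD(1-6)[of "\<lambda>x. tens x y", OF klinear_tens(1)[OF klinear_rules(1)]]
    klinearD(1-6)[of "tens x", OF klinear_tens(2)[OF klinear_rules(1)]] by auto

lemma keys_tensD: "(a, b) \<in> keys (tens x y) \<Longrightarrow> a \<in> keys x \<and> b \<in> keys y"
  unfolding tens_def by (auto dest!: keys_lin_extD split: if_splits)

definition tpr where
  "tpr prA dA prB dB = (\<lambda>(a, u) (b, v). sgs (dB u * dA b) (tens (prA a b) (prB u v)))"

lemma tpr_pair: "tpr prA dA prB dB (a, u) (b, v) = sgs (dB u * dA b) (tens (prA a b) (prB u v))"
  by (simp add: tpr_def)

definition tdg :: "('a \<Rightarrow> nat) \<Rightarrow> ('b \<Rightarrow> nat) \<Rightarrow> 'a \<times> 'b \<Rightarrow> nat"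
  where "tdg dA dB = (\<lambda>(a, u). dA a + dB u)"

locale salg_pair = A: salg prA dA eA + B: salg prB dB eB
  for prA :: "'a \<Rightarrow> 'a \<Rightarrow> ('a \<Rightarrow>\<^sub>0 'k::comm_ring_1)" and dA :: "'a \<Rightarrow> nat" and eA
    and prB :: "'b \<Rightarrow> 'b \<Rightarrow> ('b \<Rightarrow>\<^sub>0 'k)" and dB :: "'b \<Rightarrow> nat" and eB
begin

abbreviation prT where "prT \<equiv> tpr prA dA prB dB"
abbreviation dT where "dT \<equiv> tdg dA dB"

lemma tens_mul:
  assumes "B.hg n y" "A.hg m z"
  shows "bilin_ext prT (tens x y) (tens z w) = sgs (n * m) (tens (A.mul x z) (B.mul y w))"
proof -
  have 1: "bilin_ext prT (tens (basis a) y) (tens z (basis b)) = sgs (n * m) (tens (A.mul (basis a) z) (B.mul y (basis b)))"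
    for a b
    by (rule klinear_eq2_on[where F = "\<lambda>y z. bilin_ext prT (tens (basis a) y) (tens z (basis b))"
          and H = "\<lambda>y z. sgs (n * m) (tens (A.mul (basis a) z) (B.mul y (basis b)))"])
      (use assms in \<open>auto simp: B.hg_def A.hg_def tpr_pair\<close>)
  show ?thesis
    by (rule klinear_eq2_on[where F = "\<lambda>x w. bilin_ext prT (tens x y) (tens z w)"
          and H = "\<lambda>x w. sgs (n * m) (tens (A.mul x z) (B.mul y w))"]) (auto simp: 1)
qed

lemma tpr_assoc: "lin_ext (\<lambda>x. prT x c) (prT a b) = lin_ext (prT a) (prT b c)"
proof -
  obtain a1 a2 b1 b2 c1 c2 where [simp]: "a = (a1, a2)" "b = (b1, b2)" "c = (c1, c2)"
    by (cases a; cases b; cases c)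
  have "lin_ext (\<lambda>x. prT x c) (prT a b) =
      sgs (dB a2 * dA b1) (bilin_ext prT (tens (prA a1 b1) (prB a2 b2)) (tens (basis c1) (basis c2)))"
    by (simp add: bilin_ext_def tpr_pair)
  also have "\<dots> = sgs (dB a2 * dA b1 + (dB a2 + dB b2) * dA c1)
      (tens (A.mul (prA a1 b1) (basis c1)) (B.mul (prB a2 b2) (basis c2)))"
    by (subst tens_mul[OF B.hg_pr A.hg_basis]) (simp add: sgs_sgs)
  also have "A.mul (prA a1 b1) (basis c1) = A.mul (basis a1) (prA b1 c1)"
    using A.mul_assoc[of "basis a1" "basis b1" "basis c1"] by simp
  also have "B.mul (prB a2 b2) (basis c2) = B.mul (basis a2) (prB b2 c2)"
    using B.mul_assoc[of "basis a2" "basis b2" "basis c2"] by simp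
  also have "sgs (dB a2 * dA b1 + (dB a2 + dB b2) * dA c1)
      (tens (A.mul (basis a1) (prA b1 c1)) (B.mul (basis a2) (prB b2 c2))) =
      sgs (dB b2 * dA c1) (bilin_ext prT (tens (basis a1) (basis a2)) (tens (prA b1 c1) (prB b2 c2)))"
    by (subst tens_mul[OF B.hg_basis A.hg_pr]) (simp add: sgs_sgs algebra_simps)
  also have "\<dots> = lin_ext (prT a) (prT b c)"
    by (simp add: bilin_ext_def tpr_pair)
  finally show ?thesis .
qed

sublocale T: salg prT dT "(eA, eB)"
proof
  fix a b c n
  show "n \<in> keys (prT a b) \<Longrightarrow> dT n = dT a + dT b"
    by (cases n) (auto simp: tpr_def tdg_def split: prod.splits dest!: keys_tensD A.pr_dg B.pr_dg)
  show "lin_ext (\<lambda>x. prT x c) (prT a b) = lin_ext (prT a) (prT b c)"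
    by (rule tpr_assoc)
  show "prT a b = sgs (dT a * dT b) (prT b a)"
    using A.pr_comm[of "fst a" "fst b"] B.pr_comm[of "snd a" "snd b"]
    by (auto simp: tpr_def tdg_def sgs_sgs split: prod.splits intro!: sgs_cong)
  show "prT (eA, eB) a = basis a"
    by (simp add: tpr_def split: prod.splits)
  show "dT (eA, eB) = 0" by (simp add: tdg_def)
qed

lemma basis_pair: "basis (a, u) = T.mul (basis (a, eB)) (basis (eA, u))"
  by (simp add: tpr_pair)

lemma T_mul_left: "T.mul (basis (a, eB)) (basis (b, eB)) = tens (prA a b) (basis eB)"
  by (simp add: tpr_pair)

lemma dT_simps [simp]: "dT (a, u) = dA a + dB u"
  by (simp add: tdg_def)

text \<open>This is \<open>del\<close> tensored with the identity. The degree \<open>d'\<close> of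
  its values is a separate function, tied to \<open>dA\<close> only where \<open>del\<close> is
  nonzero, since a predecessor degree need not exist elsewhere.\<close>

lemma odd_deriv_left:
  assumes "A.odd_deriv S del" "\<And>a. a \<in> S \<Longrightarrow> A.hg (d' a) (del (basis a))" "\<And>a. a \<in> S \<Longrightarrow> del (basis a) \<noteq> 0 \<Longrightarrow> dA a = Suc (d' a)"
  shows "T.odd_deriv (S \<times> UNIV) (lin_ext (\<lambda>(a, u). tens (del (basis a)) (basis u)))"
  unfolding T.odd_deriv_def
proof (intro conjI ballI klinear_lin_ext)
  fix x y :: "'a \<times> 'b" assume "x \<in> S \<times> UNIV" "y \<in> S \<times> (UNIV :: 'b set)"
  then obtain a u b v where [simp]: "x = (a, u)" "y = (b, v)" "a \<in> S" "b \<in> S" by auto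
  have k: "klinear del" using assms(1) by (auto simp: A.odd_deriv_def)
  have 1: "lin_ext (\<lambda>(a, u). tens (del (basis a)) (basis u)) (tens x y) = tens (del x) y" for x y
    by (rule klinear_eq2_on[where H = "\<lambda>x y. tens (del x) y"]) (auto simp: k)
  have 2: "del (prA a b) = A.mul (del (basis a)) (basis b) + sgs (dA a) (A.mul (basis a) (del (basis b)))"
    using assms(1) by (auto simp: A.odd_deriv_def)
  have 3: "T.mul (tens (del (basis a)) (basis u)) (tens (basis b) (basis v)) =
      sgs (dB u * dA b) (tens (A.mul (del (basis a)) (basis b)) (prB u v))"
    by (subst tens_mul[OF B.hg_basis A.hg_basis]) simp
  have 4: "T.mul (tens (basis a) (basis u)) (tens (del (basis b)) (basis v)) =
      sgs (dB u * d' b) (tens (A.mul (basis a) (del (basis b))) (prB u v))"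
    by (subst tens_mul[OF B.hg_basis assms(2)]) auto
  have 5: "sgs (dB u * dA b + dA a) (tens (A.mul (basis a) (del (basis b))) (prB u v)) =
      sgs (dA a + dB u + dB u * d' b) (tens (A.mul (basis a) (del (basis b))) (prB u v))"
    using assms(3)[of b] by (cases "del (basis b) = 0") (auto intro!: sgs_cong)
  show "lin_ext (\<lambda>(a, u). tens (del (basis a)) (basis u)) (prT x y) =
      T.mul (lin_ext (\<lambda>(a, u). tens (del (basis a)) (basis u)) (basis x)) (basis y) +
      sgs (dT x) (T.mul (basis x) (lin_ext (\<lambda>(a, u). tens (del (basis a)) (basis u)) (basis y)))"
    using 3 4 5 by (simp add: tpr_pair 1 2 sgs_add sgs_sgs)
qed

text \<open>A derivation from the second factor into the tensor product extends, linearly over the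
  first factor up to signs, to an odd derivation. The Hochschild boundary has this form, because it
  moves the outer letters of a word into the coefficient.\<close>

lemma odd_deriv_right:
  assumes \<phi>: "\<And>u v. lin_ext \<phi> (prB u v) =
      T.mul (\<phi> u) (basis (eA, v)) + sgs (dB u) (T.mul (basis (eA, u)) (\<phi> v))"
    and hg: "\<And>u. T.hg (d' u) (\<phi> u)" and d': "\<And>u. \<phi> u \<noteq> 0 \<Longrightarrow> dB u = Suc (d' u)"
  shows "T.odd_deriv UNIV (lin_ext (\<lambda>(a, u). sgs (dA a) (T.mul (basis (a, eB)) (\<phi> u))))"
    (is "T.odd_deriv _ (lin_ext ?\<theta>)")
  unfolding T.odd_deriv_def
proof (intro conjI ballI klinear_lin_ext)
  fix x y :: "'a \<times> 'b"
  obtain a u b v where [simp]: "x = (a, u)" "y = (b, v)" by (cases x, cases y)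
  let ?a = "basis (a, eB)" and ?b = "basis (b, eB)" and ?u = "basis (eA, u)" and ?v = "basis (eA, v)"
  have 1: "lin_ext ?\<theta> (tens x y) = sgs n (T.mul (tens x (basis eB)) (lin_ext \<phi> y))" if "A.hg n x" for x y n
    by (rule klinear_eq2_on[where F = "\<lambda>x y. lin_ext ?\<theta> (tens x y)" and
          H = "\<lambda>x y. sgs n (T.mul (tens x (basis eB)) (lin_ext \<phi> y))"])
      (use that in \<open>auto simp: A.hg_def\<close>)
  have "lin_ext ?\<theta> (prT x y) = sgs (dB u * dA b + (dA a + dA b)) (T.mul (T.mul ?a ?b)
     (T.mul (\<phi> u) ?v + sgs (dB u) (T.mul ?u (\<phi> v))))"
    by (simp only: \<open>x = _\<close> \<open>y = _\<close> T_mul_left \<phi>[symmetric]) (simp add: tpr_pair 1[OF A.hg_pr] sgs_sgs)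
  also have "\<dots> = sgs (dB u * dA b + dA a + dA b) (T.mul ?a (T.mul ?b (T.mul (\<phi> u) ?v))) +
      sgs (dB u * dA b + dA a + dA b + dB u) (T.mul ?a (T.mul ?b (T.mul ?u (\<phi> v))))"
    by (simp add: sgs_add sgs_sgs T.mul_assoc ac_simps del: bilin_ext_basis)
  also have "T.mul ?b (T.mul (\<phi> u) ?v) = sgs (d' u * dA b) (T.mul (\<phi> u) (T.mul ?b ?v))"
    using T.mul_left_commute[OF T.hg_basis[of "(b, eB)"] hg[of u], of ?v] B.dg_e by (simp only: dT_simps mult.commute add_0_right)
  also have "T.mul ?b (T.mul ?u (\<phi> v)) = sgs (dA b * dB u) (T.mul ?u (T.mul ?b (\<phi> v)))"
    using T.mul_left_commute[OF T.hg_basis[of "(b, eB)"] T.hg_basis[of "(eA, u)"], of "\<phi> v"]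
    by (simp del: bilin_ext_basis)
  also have "sgs (dB u * dA b + dA a + dA b) (T.mul ?a (sgs (d' u * dA b) (T.mul (\<phi> u) (T.mul ?b ?v)))) =
      sgs (dA a) (T.mul (T.mul ?a (\<phi> u)) (T.mul ?b ?v))"
    using d'[of u] by (cases "\<phi> u = 0") (auto simp: sgs_sgs T.mul_assoc intro!: sgs_cong simp del: bilin_ext_basis)
  also have "sgs (dB u * dA b + dA a + dA b + dB u) (T.mul ?a (sgs (dA b * dB u) (T.mul ?u (T.mul ?b (\<phi> v))))) =
      sgs (dA a + dB u) (T.mul (T.mul ?a ?u) (sgs (dA b) (T.mul ?b (\<phi> v))))"
    by (auto simp: sgs_sgs T.mul_assoc intro!: sgs_cong simp del: bilin_ext_basis)
  finally show "lin_ext ?\<theta> (prT x y) = T.mul (lin_ext ?\<theta> (basis x)) (basis y) +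
      sgs (dT x) (T.mul (basis x) (lin_ext ?\<theta> (basis y)))"
    by (simp only: \<open>x = _\<close> \<open>y = _\<close> basis_pair[symmetric] lin_ext_basis prod.case dT_simps bilin_ext_simps)
qed

end

section \<open>The shuffle algebra on graded words\<close>

text \<open>The weight is a parameter: with shifted degrees this is the total degree of a bar word,
  with \<open>dg\<close> itself its internal degree.\<close>

definition wdg :: "('m \<Rightarrow> nat) \<Rightarrow> 'm list \<Rightarrow> nat"
  where "wdg s w = sum_list (map s w)"

lemma wdg_simps [simp]: "wdg s [] = 0" "wdg s (a # w) = s a + wdg s w" "wdg s (v @ w) = wdg s v + wdg s w"
  by (simp_all add: wdg_def)

lemma wdg_mset: "wdg s w = sum_mset (image_mset s (mset w))"
  by (induction w) auto

definition consx :: "('m \<Rightarrow>\<^sub>0 'k::comm_ring_1) \<Rightarrow> ('m list \<Rightarrow>\<^sub>0 'k) \<Rightarrow> ('m list \<Rightarrow>\<^sub>0 'k)"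
  where "consx x y = lin_ext (\<lambda>a. lin_ext (\<lambda>w. basis (a # w)) y) x"

lemma consx_basis [simp]: "consx (basis a) (basis w) = basis (a # w)"
  by (simp add: consx_def)

lemma klinear_consx [simp]:
  "klinear f \<Longrightarrow> klinear (\<lambda>x. consx (f x) y)" "klinear g \<Longrightarrow> klinear (\<lambda>y. consx x (g y))"
  by (simp_all add: consx_def klinear_comp)

lemma consx_simps [simp]:
  "consx (x + x') y = consx x y + consx x' y" "consx (x - x') y = consx x y - consx x' y"
  "consx (- x) y = - consx x y" "consx 0 y = 0" "consx (scal c x) y = scal c (consx x y)"
  "consx (sgs n x) y = sgs n (consx x y)"
  "consx x (y + y') = consx x y + consx x y'" "consx x (y - y') = consx x y - consx x y'"
  "consx x (- y) = - consx x y" "consx x 0 = 0" "consx x (scal c y) = scal c (consx x y)"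
  "consx x (sgs n y) = sgs n (consx x y)"
  using klinearD(1-6)[of "\<lambda>x. consx x y", OF klinear_consx(1)[OF klinear_rules(1)]]
    klinearD(1-6)[of "consx x", OF klinear_consx(2)[OF klinear_rules(1)]] by auto

lemma keys_consxD: "w \<in> keys (consx x y) \<Longrightarrow> \<exists>a v. w = a # v \<and> a \<in> keys x \<and> v \<in> keys y"
  unfolding consx_def by (fastforce dest!: keys_lin_extD split: if_splits)

text \<open>The Koszul signs are those of letters of degree \<open>s\<close>; with shifted degrees
  this is the shuffle product of the bar construction.\<close>

fun shp :: "('m \<Rightarrow> nat) \<Rightarrow> 'm list \<Rightarrow> 'm list \<Rightarrow> ('m list \<Rightarrow>\<^sub>0 'k::comm_ring_1)"
  where
    "shp s [] v = basis v"
  | "shp s (a # u) [] = basis (a # u)"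
  | "shp s (a # u) (b # v) =
      consx (basis a) (shp s u (b # v)) + sgs (s b * wdg s (a # u)) (consx (basis b) (shp s (a # u) v))"

lemma shp_Nil [simp]: "shp s u [] = basis u"
  by (cases u) auto

lemma mset_shp: "w \<in> keys (shp s u v :: 'm list \<Rightarrow>\<^sub>0 'k::comm_ring_1) \<Longrightarrow> mset w = mset u + mset v"
proof (induction s u v arbitrary: w rule: shp.induct)
  case (3 s a u b v)
  let ?x = "consx (basis a) (shp s u (b # v)) :: 'm list \<Rightarrow>\<^sub>0 'k"
  let ?y = "consx (basis b) (shp s (a # u) v) :: 'm list \<Rightarrow>\<^sub>0 'k"
  from 3(3) have "w \<in> keys ?x \<union> keys ?y"
    using Poly_Mapping.keys_add[of ?x "sgs (s b * wdg s (a # u)) ?y"] by auto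
  then show ?case
    by (auto dest!: keys_consxD 3(1,2))
qed auto

lemma wdg_shp: "w \<in> keys (shp s u v) \<Longrightarrow> wdg t w = wdg t u + wdg t v"
  by (simp add: wdg_mset mset_shp)

lemma shp_comm: "(shp s u v :: 'm list \<Rightarrow>\<^sub>0 'k::comm_ring_1) = sgs (wdg s u * wdg s v) (shp s v u)"
proof (induction s u v rule: shp.induct)
  case (3 s a u b v)
  have "(shp s (a # u) (b # v) :: 'm list \<Rightarrow>\<^sub>0 'k) = consx (basis a) (sgs (wdg s u * wdg s (b # v)) (shp s (b # v) u)) +
      sgs (s b * wdg s (a # u)) (consx (basis b) (sgs (wdg s (a # u) * wdg s v) (shp s v (a # u))))"
    using 3 by simp
  also have "\<dots> = sgs (wdg s (a # u) * wdg s (b # v)) (shp s (b # v) (a # u))"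
    by (auto simp: sgs_def)
  finally show ?case .
qed auto

abbreviation shm where "shm s \<equiv> bilin_ext (shp s)"

lemma shm_Nil [simp]: "shm s (basis []) x = x" "shm s x (basis []) = x"
  by (rule klinear_eq; simp)+

text \<open>The defining recursion for linear combinations. Homogeneity of the first letters and of
  the left tail makes the sign uniform.\<close>

lemma shm_consx:
  assumes "\<And>a. a \<in> keys x \<Longrightarrow> s a = p" "\<And>w. w \<in> keys y \<Longrightarrow> wdg s w = m" "\<And>a. a \<in> keys z \<Longrightarrow> s a = n"
  shows "shm s (consx x y) (consx z w) =
    (consx x (shm s y (consx z w)) + sgs (n * (p + m)) (consx z (shm s (consx x y) w)) :: 'm list \<Rightarrow>\<^sub>0 'k::comm_ring_1)"
proof -
  have 1: "shm s (consx (basis a) (basis u)) (consx z w) = consx (basis a) (shm s (basis u) (consx z w)) +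
      sgs (n * (p + m)) (consx z (shm s (consx (basis a) (basis u)) w))"
    if "a \<in> keys x" "u \<in> keys y" for a u
  proof (rule klinear_eq2_on[where F = "\<lambda>z w. shm s (consx (basis a) (basis u)) (consx z w)" and
          H = "\<lambda>z w. consx (basis a) (shm s (basis u) (consx z w)) +
            sgs (n * (p + m)) (consx z (shm s (consx (basis a) (basis u)) w))"])
    fix b v assume "b \<in> keys z"
    then show "shm s (consx (basis a) (basis u)) (consx (basis b) (basis v)) =
        consx (basis a) (shm s (basis u) (consx (basis b) (basis v))) +
            sgs (n * (p + m)) (consx (basis b) (shm s (consx (basis a) (basis u)) (basis v)))"
      using assms(1)[OF that(1)] assms(2)[OF that(2)] assms(3)[of b] by simp
  qed simp_all
  show ?thesis
    by (rule klinear_eq2_on[where F = "\<lambda>x y. shm s (consx x y) (consx z w)" and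
          H = "\<lambda>x y. consx x (shm s y (consx z w)) + sgs (n * (p + m)) (consx z (shm s (consx x y) w))"])
      (simp_all only: klinear_rules klinear_consx klinear_comp' 1)
qed

text \<open>The first letter of a triple shuffle comes from one of the three words; removing it
  reduces the total length.\<close>

lemma shp_assoc: "(shm s (shp s u v) (basis w) :: 'm list \<Rightarrow>\<^sub>0 'k::comm_ring_1) = shm s (basis u) (shp s v w)"
proof (induction "length u + length v + length w" arbitrary: u v w rule: less_induct)
  case less
  show ?case
  proof (cases "u = [] \<or> v = [] \<or> w = []")
    case False
    then obtain a u' b v' c w' where e [simp]: "u = a # u'" "v = b # v'" "w = c # w'"
      by (meson list.exhaust)
    have ih: "(shm s (shp s u' v) (basis w) :: 'm list \<Rightarrow>\<^sub>0 'k) = shm s (basis u') (shp s v w)"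
      "(shm s (shp s u v') (basis w) :: 'm list \<Rightarrow>\<^sub>0 'k) = shm s (basis u) (shp s v' w)"
      "(shm s (shp s u v) (basis w') :: 'm list \<Rightarrow>\<^sub>0 'k) = shm s (basis u) (shp s v w')"
      by (rule less; simp)+
    have L: "shm s (consx (basis b') x) (consx (basis c) (basis w')) = consx (basis b') (shm s x (basis w)) +
        sgs (s c * (s b' + m)) (consx (basis c) (shm s (consx (basis b') x) (basis w')))"
      if "\<And>w. w \<in> keys x \<Longrightarrow> wdg s w = m" for b' m and x :: "'m list \<Rightarrow>\<^sub>0 'k"
      by (subst shm_consx[where p = "s b'" and m = m and n = "s c"]) (use that in auto)
    have R: "shm s (consx (basis a) (basis u')) (consx (basis b') x) = consx (basis a) (shm s (basis u') (consx (basis b') x)) +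
        sgs (s b' * wdg s u) (consx (basis b') (shm s (basis u) x))" for b' and x :: "'m list \<Rightarrow>\<^sub>0 'k"
      by (subst shm_consx[where p = "s a" and m = "wdg s u'" and n = "s b'"]) auto
    have "(shm s (shp s u v) (basis w) :: 'm list \<Rightarrow>\<^sub>0 'k) =
      shm s (consx (basis a) (shp s u' v)) (consx (basis c) (basis w')) +
      sgs (s b * wdg s u) (shm s (consx (basis b) (shp s u v')) (consx (basis c) (basis w')))"
      by simp
    also have "\<dots> = consx (basis a) (shm s (shp s u' v) (basis w)) +
        sgs (s b * wdg s u) (consx (basis b) (shm s (shp s u v') (basis w))) +
        sgs (s c * (wdg s u + wdg s v)) (consx (basis c) (shm s (shp s u v) (basis w')))"
      by (subst L[of "shp s u' v" "wdg s u' + wdg s v"], simp add: wdg_shp,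
          subst L[of "shp s u v'" "wdg s u + wdg s v'"], simp add: wdg_shp)
        (simp add: sgs_add sgs_sgs algebra_simps)
    also have "\<dots> = shm s (consx (basis a) (basis u')) (consx (basis b) (shp s v' w)) +
       sgs (s c * wdg s v) (shm s (consx (basis a) (basis u')) (consx (basis c) (shp s v w')))"
      unfolding R ih by (simp add: sgs_add sgs_sgs algebra_simps)
    also have "\<dots> = shm s (basis u) (shp s v w)"
      by simp
    finally show ?thesis .
  qed auto
qed

global_interpretation Sh: salg "shp s :: 'm list \<Rightarrow> 'm list \<Rightarrow> ('m list \<Rightarrow>\<^sub>0 'k::comm_ring_1)" "wdg s" "[]" for s :: "'m \<Rightarrow> nat"
  by unfold_locales (auto simp: wdg_shp intro: shp_comm simp: shp_assoc[unfolded bilin_ext_def, simplified])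

definition snocl :: "'m \<Rightarrow> ('m list \<Rightarrow>\<^sub>0 'k::comm_ring_1) \<Rightarrow> ('m list \<Rightarrow>\<^sub>0 'k)"
  where "snocl a = lin_ext (\<lambda>w. basis (w @ [a]))"

lemma snocl_simps [simp]:
  "snocl a (basis w) = basis (w @ [a])" "snocl a (x + y) = snocl a x + snocl a y"
  "snocl a (x - y) = snocl a x - snocl a y" "snocl a (- x) = - snocl a x"
  "snocl a (sgs n x) = sgs n (snocl a x)" "snocl a 0 = 0"
  by (auto simp: snocl_def)

lemma klinear_snocl [simp]: "klinear f \<Longrightarrow> klinear (\<lambda>x. snocl a (f x))"
  by (simp add: snocl_def)

lemma snocl_consx [simp]: "snocl a (consx z x) = consx z (snocl a x)"
  by (rule klinear_eq2_on[where F = "\<lambda>z x. snocl a (consx z x)" and H = "\<lambda>z x. consx z (snocl a x)"]) auto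

text \<open>Recursion on the last letters. The wrap-around term of the Hochschild boundary takes off
  the last letter, which the definition of \<open>shp\<close> does not see.\<close>

lemma shp_snoc:
  "(shp s (u @ [a]) (v @ [b]) :: 'm list \<Rightarrow>\<^sub>0 'k::comm_ring_1) = sgs (s a * wdg s (v @ [b])) (snocl a (shp s u (v @ [b]))) + snocl b (shp s (u @ [a]) v)"
proof (induction "length u + length v" arbitrary: u v rule: less_induct)
  case less
  show ?case
  proof (cases u)
    case [simp]: Nil
    show ?thesis
    proof (cases v)
      case [simp]: (Cons d v')
      have "(shp s [a] (v' @ [b]) :: 'm list \<Rightarrow>\<^sub>0 'k) = sgs (s a * wdg s (v' @ [b])) (snocl a (basis (v' @ [b]))) + snocl b (shp s [a] v')"
        using less[of "[]" v'] by simp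
      then show ?thesis by (auto simp: sgs_def)
    qed (auto simp: sgs_def)
  next
    case [simp]: (Cons c u')
    have 1: "(shp s (u' @ [a]) (v @ [b]) :: 'm list \<Rightarrow>\<^sub>0 'k) = sgs (s a * wdg s (v @ [b])) (snocl a (shp s u' (v @ [b]))) + snocl b (shp s (u' @ [a]) v)"
      by (rule less) simp
    show ?thesis
    proof (cases v)
      case [simp]: Nil
      show ?thesis using 1 by (auto simp: sgs_def)
    next
      case [simp]: (Cons d v')
      have 2: "(shp s (u @ [a]) (v' @ [b]) :: 'm list \<Rightarrow>\<^sub>0 'k) = sgs (s a * wdg s (v' @ [b])) (snocl a (shp s u (v' @ [b]))) + snocl b (shp s (u @ [a]) v')"
        by (rule less) simp
      show ?thesis using 1 2 by (simp add: sgs_add sgs_sgs) (auto simp: sgs_def)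
    qed
  qed
qed

section \<open>The cyclic bar construction of a differential graded algebra\<close>

text \<open>The differential is a total function on basis elements; the Leibniz rule and square zero
  are required on the multiplicatively closed set \<open>S\<close>, later the set of monomials of
  Lambda V.\<close>

locale dga = A: salg pr dg e
  for pr :: "'m \<Rightarrow> 'm \<Rightarrow> ('m \<Rightarrow>\<^sub>0 'k::comm_ring_1)" and dg :: "'m \<Rightarrow> nat" and e +
  fixes bd :: "'m \<Rightarrow> ('m \<Rightarrow>\<^sub>0 'k)" and S :: "'m set"
  assumes bd_dg: "x \<in> keys (bd a) \<Longrightarrow> dg a = Suc (dg x)"
    and e_S [simp]: "e \<in> S"
    and pr_S: "a \<in> S \<Longrightarrow> b \<in> S \<Longrightarrow> x \<in> keys (pr a b) \<Longrightarrow> x \<in> S"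
    and bd_S: "a \<in> S \<Longrightarrow> x \<in> keys (bd a) \<Longrightarrow> x \<in> S"
    and bd_pr: "a \<in> S \<Longrightarrow> b \<in> S \<Longrightarrow>
      lin_ext bd (pr a b) = A.mul (bd a) (basis b) + sgs (dg a) (A.mul (basis a) (bd b))"
    and bd_bd: "a \<in> S \<Longrightarrow> lin_ext bd (bd a) = 0"
begin

abbreviation s :: "'m \<Rightarrow> nat" where "s a \<equiv> Suc (dg a)"
abbreviation sm where "sm \<equiv> shm s"

sublocale Sh: salg "shp s :: 'm list \<Rightarrow> 'm list \<Rightarrow> ('m list \<Rightarrow>\<^sub>0 'k)" "wdg s" "[]"
  by (rule Sh.salg_axioms)

sublocale U: salg_pair pr dg e "shp s :: 'm list \<Rightarrow> 'm list \<Rightarrow> ('m list \<Rightarrow>\<^sub>0 'k)" "wdg s" "[]" ..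

abbreviation um where "um \<equiv> U.T.mul"

lemma bd_e [simp]: "bd e = 0"
  using bd_pr[of e e] by simp

definition mh :: "'m \<Rightarrow> ('m list \<Rightarrow>\<^sub>0 'k) \<Rightarrow> ('m list \<Rightarrow>\<^sub>0 'k)"
  where "mh c = lin_ext (\<lambda>w. case w of [] \<Rightarrow> 0 | a # v \<Rightarrow> consx (pr c a) (basis v))"

lemma mh_simps [simp]:
  "mh c (basis []) = 0" "mh c (basis (a # v)) = consx (pr c a) (basis v)"
  "mh c (x + y) = mh c x + mh c y" "mh c (x - y) = mh c x - mh c y" "mh c (- x) = - mh c x"
  "mh c 0 = 0" "mh c (sgs n x) = sgs n (mh c x)"
  by (auto simp: mh_def)

lemma klinear_mh [simp]: "klinear f \<Longrightarrow> klinear (\<lambda>x. mh c (f x))"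
  by (simp add: mh_def)

lemma mh_consx [simp]: "mh c (consx (basis a) y) = consx (pr c a) y"
  by (rule klinear_eq[of "\<lambda>y. mh c (consx (basis a) y)"]) auto

text \<open>The multiplication part \<open>bt\<close> and the internal part \<open>dl\<close> of the differential on words.\<close>

fun bt :: "'m list \<Rightarrow> ('m list \<Rightarrow>\<^sub>0 'k)"
  where
    "bt [] = 0"
  | "bt (c # w) = sgs (s c) (mh c (basis w) + consx (basis c) (bt w))"

fun dl :: "'m list \<Rightarrow> ('m list \<Rightarrow>\<^sub>0 'k)"
  where
    "dl [] = 0"
  | "dl (c # w) = sgs (s c) (consx (basis c) (dl w)) - consx (bd c) (basis w)"

lemma bt_consx: "lin_ext bt (consx (basis c) x) = sgs (s c) (mh c x + consx (basis c) (lin_ext bt x))"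
  by (rule klinear_eq[of "\<lambda>x. lin_ext bt (consx (basis c) x)"]) auto

lemma dl_consx: "lin_ext dl (consx (basis c) x) = sgs (s c) (consx (basis c) (lin_ext dl x)) - consx (bd c) x"
  by (rule klinear_eq[of "\<lambda>x. lin_ext dl (consx (basis c) x)"]) auto

lemma wdg_mh: "w \<in> keys (mh c (basis u)) \<Longrightarrow> Suc (wdg s w) = s c + wdg s u"
  by (cases u) (auto dest!: keys_consxD A.pr_dg)

lemma keys_addD: "w \<in> keys (x + y) \<Longrightarrow> w \<in> keys x \<or> w \<in> keys y"
  using Poly_Mapping.keys_add[of x y] by auto

lemma keys_diffD: "w \<in> keys (x - y) \<Longrightarrow> w \<in> keys x \<or> w \<in> keys y"
  using Poly_Mapping.keys_diff[of x y] by auto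

lemma wdg_bt: "w \<in> keys (bt u) \<Longrightarrow> Suc (wdg s w) = wdg s u"
  by (induction u arbitrary: w) (auto dest!: keys_addD keys_consxD wdg_mh)

lemma wdg_dl: "w \<in> keys (dl u) \<Longrightarrow> Suc (wdg s w) = wdg s u"
  by (induction u arbitrary: w) (auto dest!: keys_diffD keys_consxD bd_dg)

text \<open>Multiplying \<open>c\<close> into a shuffle hits the first letter of either word. The
  term with \<open>pr c d\<close> is a mixed one, which has to cancel in the derivation rule for
  \<open>bt\<close>.\<close>

lemma mh_shp_left:
  "mh c (shp s u (d # v)) = sm (mh c (basis u)) (basis (d # v)) + sgs (s d * wdg s u) (consx (pr c d) (shp s u v)) -
     sgs (s d * (s c + wdg s u + 1)) (consx (basis d) (sm (mh c (basis u)) (basis v)))"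
proof (cases u)
  case (Cons a u')
  have "sm (consx (pr c a) (basis u')) (consx (basis d) (basis v)) =
    consx (pr c a) (shp s u' (d # v)) + sgs (s d * (s c + s a + 1 + wdg s u')) (consx (basis d) (sm (consx (pr c a) (basis u')) (basis v)))"
    by (subst shm_consx[where p = "s c + dg a" and m = "wdg s u'" and n = "s d"])
      (auto dest: A.pr_dg intro!: sgs_cong)
  then show ?thesis using Cons by (simp add: algebra_simps)
qed simp

lemma mh_shp_right:
  "sm (basis (c # u)) (mh d (basis v)) = consx (basis c) (sm (basis u) (mh d (basis v))) +
     sgs ((s d + 1) * wdg s (c # u)) (mh d (shp s (c # u) v) - consx (pr d c) (shp s u v))"
proof (cases v)
  case (Cons f v')
  have "sm (consx (basis c) (basis u)) (consx (pr d f) (basis v')) =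
    consx (basis c) (sm (basis u) (consx (pr d f) (basis v'))) +
    sgs ((s d + s f + 1) * wdg s (c # u)) (consx (pr d f) (shp s (c # u) v'))"
    by (subst shm_consx[where p = "s c" and m = "wdg s u" and n = "s d + dg f"])
      (auto dest: A.pr_dg intro!: sgs_cong)
  then show ?thesis using Cons by (auto simp: sgs_sgs sgs_add intro!: sgs_cong)
qed auto

text \<open>Merging neighbours from the same word gives the right-hand side. Merges of a letter of
  \<open>u\<close> with a letter of \<open>v\<close> occur in both orders and cancel by graded
  commutativity.\<close>

lemma bt_shp: "lin_ext bt (shp s u v) = sm (bt u) (basis v) + sgs (wdg s u) (sm (basis u) (bt v))"
proof (induction "length u + length v" arbitrary: u v rule: less_induct)
  case less
  show ?case
  proof (cases "u = [] \<or> v = []")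
    case False
    then obtain c u' d v' where e [simp]: "u = c # u'" "v = d # v'"
      by (meson list.exhaust)
    have ih1: "lin_ext bt (shp s u' v) = sm (bt u') (basis v) + sgs (wdg s u') (sm (basis u') (bt v))"
      and ih2: "lin_ext bt (shp s u v') = sm (bt u) (basis v') + sgs (wdg s u) (sm (basis u) (bt v'))"
      by (rule less; simp)+
    have l: "sm (consx (basis c) (bt u')) (consx (basis d) (basis v')) =
        consx (basis c) (sm (bt u') (basis v)) + sgs (s d * (s c + wdg s u' + 1)) (consx (basis d) (sm (consx (basis c) (bt u')) (basis v')))"
    \<comment> \<open>The terms of \<open>bt u'\<close> have degree one less than \<open>u'\<close>,
      which makes sense in the natural numbers only if there is a term at all.\<close>
    proof (cases "bt u' = 0")
      case False
      then obtain w where "w \<in> keys (bt u')" by (meson keys_eq_empty ex_in_conv)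
      then have "wdg s u' = Suc (wdg s u' - 1)" using wdg_bt by force
      then show ?thesis
        by (subst shm_consx[where p = "s c" and m = "wdg s u' - 1" and n = "s d"])
          (auto simp del: wdg_simps dest: wdg_bt intro!: sgs_cong)
    qed simp
    have r: "sm (consx (basis c) (basis u')) (consx (basis d) (bt v')) =
        consx (basis c) (sm (basis u') (consx (basis d) (bt v'))) + sgs (s d * wdg s u) (consx (basis d) (sm (basis u) (bt v')))"
      by (subst shm_consx[where p = "s c" and m = "wdg s u'" and n = "s d"]) auto
    have comm: "pr d c = sgs (dg d * dg c) (pr c d)"
      by (rule A.pr_comm)
    have L: "lin_ext bt (shp s u v) = sgs (s c) (mh c (shp s u' v) + consx (basis c) (lin_ext bt (shp s u' v))) +
        sgs (s d * wdg s u + s d) (mh d (shp s u v') + consx (basis d) (lin_ext bt (shp s u v')))"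
      by (simp add: bt_consx sgs_sgs)
    have 1: "sm (bt u) (basis v) = sgs (s c) (sm (mh c (basis u')) (basis v) + sm (consx (basis c) (bt u')) (consx (basis d) (basis v')))"
      by simp
    have 2: "sm (basis u) (bt v) = sgs (s d) (sm (basis u) (mh d (basis v')) + sm (consx (basis c) (basis u')) (consx (basis d) (bt v')))"
      by simp
    show ?thesis
      unfolding L ih1 ih2 1 2 l r
      using mh_shp_left[of c u' d v'] mh_shp_right[of c u' d v']
      apply (simp del: shp.simps add: comm sgs_add)
      \<comment> \<open>What is left is a comparison of signs, decided by the parities of three
        degrees.\<close>
      apply (cases "even (dg c)"; cases "even (dg d)"; cases "even (wdg s u')")
      apply (simp_all add: sgs_def del: shp.simps)
      done
  qed auto
qed

text \<open>The differential acts letter by letter, so no mixed terms arise; only the signs of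
  passing the other word have to be matched.\<close>

lemma dl_shp: "lin_ext dl (shp s u v) = sm (dl u) (basis v) + sgs (wdg s u) (sm (basis u) (dl v))"
proof (induction "length u + length v" arbitrary: u v rule: less_induct)
  case less
  show ?case
  proof (cases "u = [] \<or> v = []")
    case False
    then obtain c u' d v' where e [simp]: "u = c # u'" "v = d # v'"
      by (meson list.exhaust)
    have ih1: "lin_ext dl (shp s u' v) = sm (dl u') (basis v) + sgs (wdg s u') (sm (basis u') (dl v))"
      and ih2: "lin_ext dl (shp s u v') = sm (dl u) (basis v') + sgs (wdg s u) (sm (basis u) (dl v'))"
      by (rule less; simp)+
    have l: "sm (consx (basis c) (dl u')) (consx (basis d) (basis v')) =
        consx (basis c) (sm (dl u') (basis v)) + sgs (s d * (s c + wdg s u' + 1)) (consx (basis d) (sm (consx (basis c) (dl u')) (basis v')))"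
    proof (cases "dl u' = 0")
      case False
      then obtain w where "w \<in> keys (dl u')" by (meson keys_eq_empty ex_in_conv)
      then have "wdg s u' = Suc (wdg s u' - 1)" using wdg_dl by force
      then show ?thesis
        by (subst shm_consx[where p = "s c" and m = "wdg s u' - 1" and n = "s d"])
          (auto simp del: wdg_simps dest: wdg_dl intro!: sgs_cong)
    qed simp
    have r: "sm (consx (basis c) (basis u')) (consx (basis d) (dl v')) =
        consx (basis c) (sm (basis u') (consx (basis d) (dl v'))) + sgs (s d * wdg s u) (consx (basis d) (sm (basis u) (dl v')))"
      by (subst shm_consx[where p = "s c" and m = "wdg s u'" and n = "s d"]) auto
    have l': "sm (consx (bd c) (basis u')) (consx (basis d) (basis v')) =
        consx (bd c) (shp s u' v) + sgs (s d * (s c + wdg s u' + 1)) (consx (basis d) (sm (consx (bd c) (basis u')) (basis v')))"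
      by (subst shm_consx[where p = "dg c" and m = "wdg s u'" and n = "s d"])
         (auto dest!: bd_dg intro!: sgs_cong)
    have r': "sm (consx (basis c) (basis u')) (consx (bd d) (basis v')) =
        consx (basis c) (sm (basis u') (consx (bd d) (basis v'))) + sgs ((s d + 1) * wdg s u) (consx (bd d) (shp s u v'))"
      by (subst shm_consx[where p = "s c" and m = "wdg s u'" and n = "dg d"])
         (auto dest!: bd_dg intro!: sgs_cong)
    have L: "lin_ext dl (shp s u v) = sgs (s c) (consx (basis c) (lin_ext dl (shp s u' v))) - consx (bd c) (shp s u' v) +
        sgs (s d * wdg s u) (sgs (s d) (consx (basis d) (lin_ext dl (shp s u v'))) - consx (bd d) (shp s u v'))"
      by (simp add: dl_consx sgs_sgs)
    have 1: "sm (dl u) (basis v) = sgs (s c) (sm (consx (basis c) (dl u')) (consx (basis d) (basis v'))) - sm (consx (bd c) (basis u')) (consx (basis d) (basis v'))"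
      by simp
    have 2: "sm (basis u) (dl v) = sgs (s d) (sm (consx (basis c) (basis u')) (consx (basis d) (dl v'))) - sm (consx (basis c) (basis u')) (consx (bd d) (basis v'))"
      by simp
    show ?thesis
      unfolding L ih1 ih2 1 2 l r l' r'
      apply (simp del: shp.simps add: sgs_add)
      apply (cases "even (dg c)"; cases "even (dg d)"; cases "even (wdg s u')")
      apply (simp_all add: sgs_def del: shp.simps)
      done
  qed auto
qed

definition td :: "'m list \<Rightarrow> ('m list \<Rightarrow>\<^sub>0 'k)"
  where "td u = bt u + dl u"

lemma td_simps [simp]:
  "td [] = 0" "td (c # w) = sgs (s c) (mh c (basis w) + consx (basis c) (td w)) - consx (bd c) (basis w)"
  by (simp_all add: td_def sgs_add)

lemma td_consx: "lin_ext td (consx (basis c) x) = sgs (s c) (mh c x + consx (basis c) (lin_ext td x)) - consx (bd c) x"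
  by (rule klinear_eq[of "\<lambda>x. lin_ext td (consx (basis c) x)"]) auto

lemma lin_ext_td: "lin_ext td x = lin_ext bt x + lin_ext dl x"
  by (rule klinear_eq) (auto simp: td_def)

lemma td_shp: "lin_ext td (shp s u v) = sm (td u) (basis v) + sgs (wdg s u) (sm (basis u) (td v))"
  by (simp add: lin_ext_td bt_shp dl_shp td_def sgs_add)

lemma wdg_td: "w \<in> keys (td u) \<Longrightarrow> Suc (wdg s w) = wdg s u"
  unfolding td_def by (auto dest!: keys_addD wdg_bt wdg_dl)

definition snocx :: "'m list \<Rightarrow> ('m \<Rightarrow>\<^sub>0 'k) \<Rightarrow> ('m list \<Rightarrow>\<^sub>0 'k)"
  where "snocx w = lin_ext (\<lambda>x. basis (w @ [x]))"

definition mr :: "'m list \<Rightarrow> 'm \<Rightarrow> ('m list \<Rightarrow>\<^sub>0 'k)"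
  where "mr w c = (if w = [] then 0 else snocx (butlast w) (pr (last w) c))"

lemma consx_snocx: "consx (basis a) (snocx w x) = snocx (a # w) x"
  by (rule klinear_eq[of "\<lambda>x. consx (basis a) (snocx w x)"]) (auto simp: snocx_def)

lemma consx_Nil: "consx x (basis []) = snocx [] x"
  by (rule klinear_eq[of "\<lambda>x. consx x (basis [])"]) (auto simp: snocx_def)

text \<open>The differential seen from the last letter: it acts on \<open>w\<close>, merges
  \<open>c\<close> into the end of \<open>w\<close>, or differentiates \<open>c\<close>. This is
  needed to commute it with \<open>rgt\<close>.\<close>

lemma td_snoc: "td (w @ [c]) = snocl c (td w) + sgs (wdg s w) (mr w c - snocx w (bd c))"
proof (induction w)
  case Nil
  show ?case by (simp add: mr_def consx_Nil)
next
  case (Cons a w)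
  have "mh a (basis (w @ [c])) = snocl c (mh a (basis w)) + (if w = [] then snocx [] (pr a c) else 0)"
    by (cases w) (auto simp: consx_Nil)
  moreover have "consx (basis a) (mr w c) = mr (a # w) c - (if w = [] then snocx [] (pr a c) else 0)"
    by (auto simp: mr_def consx_snocx)
  ultimately show ?case
    using Cons by (auto simp: consx_snocx sgs_def)
qed

text \<open>\<open>lft\<close> and \<open>rgt\<close> detach the outer letters that the cyclic bar
  boundary multiplies into the coefficient.\<close>

definition lft :: "'m list \<Rightarrow> ('m \<times> 'm list \<Rightarrow>\<^sub>0 'k)"
  where "lft u = (if u = [] then 0 else basis (hd u, tl u))"

definition rgt :: "'m list \<Rightarrow> ('m \<times> 'm list \<Rightarrow>\<^sub>0 'k)"
  where "rgt u = (if u = [] then 0 else sgs (s (last u) * wdg s (butlast u)) (basis (last u, butlast u)))"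

lemma lft_simps [simp]: "lft [] = 0" "lft (c # w) = basis (c, w)"
  and rgt_simps [simp]: "rgt [] = 0" "rgt (w @ [c]) = sgs (s c * wdg s w) (basis (c, w))" "rgt [c] = basis (c, [])"
  by (simp_all add: lft_def rgt_def)

lemma lft_consx: "lin_ext lft (consx x y) = tens x y"
  by (rule klinear_eq2_on[where F = "\<lambda>x y. lin_ext lft (consx x y)"]) auto

lemma rgt_snocl:
  assumes "\<And>w. w \<in> keys x \<Longrightarrow> wdg s w = n"
  shows "lin_ext rgt (snocl c x) = sgs (s c * n) (tens (basis c) x)"
  by (rule klinear_eq_on[of "\<lambda>x. lin_ext rgt (snocl c x)"]) (use assms in auto)

lemma um_left: "um (basis (a, u)) (tens (basis b) y) = sgs (wdg s u * dg b) (tens (pr a b) (sm (basis u) y))"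
  using U.tens_mul[of "wdg s u" "basis u" "dg b" "basis b" "basis a" y] by (simp add: A.hg_def)

lemma um_right:
  assumes "\<And>w. w \<in> keys y \<Longrightarrow> wdg s w = n"
  shows "um (tens x y) (basis (b, v)) = sgs (n * dg b) (tens (A.mul x (basis b)) (sm y (basis v)))"
  using U.tens_mul[of n y "dg b" "basis b" x "basis v"] assms by (simp add: Sh.hg_def)

lemma lft_shp: "lin_ext lft (shp s u v) = um (lft u) (basis (e, v)) + sgs (wdg s u) (um (basis (e, u)) (lft v))"
proof (cases "u = [] \<or> v = []")
  case False
  then obtain c u' d v' where "u = c # u'" "v = d # v'" by (meson list.exhaust)
  then show ?thesis
    by (auto simp: lft_consx tpr_pair sgs_sgs intro!: sgs_cong)
qed (auto simp: tpr_pair)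

text \<open>The last letter of a shuffle is the last letter of one of the two words, by
  \<open>shp_snoc\<close>.\<close>

lemma rgt_shp: "lin_ext rgt (shp s u v) = um (rgt u) (basis (e, v)) + sgs (wdg s u) (um (basis (e, u)) (rgt v))"
proof (cases "u = [] \<or> v = []")
  case False
  then obtain c u' d v' where e: "u = u' @ [c]" "v = v' @ [d]" by (meson rev_exhaust)
  show ?thesis unfolding e shp_snoc
    by (simp add: rgt_snocl[where n = "wdg s u' + wdg s v"] e tpr_pair sgs_sgs wdg_shp
        rgt_snocl[where n = "wdg s u + wdg s v'"])
      (auto simp: sgs_def)
qed (auto simp: tpr_pair)

text \<open>The differential of a word with coefficient 1; the two outer letters leave with opposite
  signs.\<close>

definition phi :: "'m list \<Rightarrow> ('m \<times> 'm list \<Rightarrow>\<^sub>0 'k)"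
  where "phi u = tens (basis e) (td u) + lft u - rgt u"

lemma phi_Nil [simp]: "phi [] = 0" by (simp add: phi_def)

lemma lin_ext_phi: "lin_ext phi x = tens (basis e) (lin_ext td x) + lin_ext lft x - lin_ext rgt x"
  by (rule klinear_eq) (auto simp: phi_def)

lemma phi_shp: "lin_ext phi (shp s u v) = um (phi u) (basis (e, v)) + sgs (wdg s u) (um (basis (e, u)) (phi v))"
proof -
  have 1: "um (tens (basis e) (td u)) (basis (e, v)) = tens (basis e) (sm (td u) (basis v))"
    by (subst um_right[where n = "wdg s u - 1"]) (auto dest: wdg_td)
  have 2: "um (basis (e, u)) (tens (basis e) (td v)) = tens (basis e) (sm (basis u) (td v))"
    by (simp add: um_left)
  show ?thesis
    unfolding lin_ext_phi td_shp lft_shp rgt_shp phi_def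
    by (simp add: 1 2) (simp add: sgs_def)
qed

lemma hg_phi: "U.T.hg (wdg s u - 1) (phi u)"
proof (cases u rule: rev_cases)
  case (snoc v c)
  have "tdg dg (wdg s) (a, w) = wdg s u - 1" if "(a, w) \<in> keys (phi u)" for a w
  proof -
    from that consider "(a, w) \<in> keys (tens (basis e) (td u))" | "(a, w) \<in> keys (lft u)" | "(a, w) \<in> keys (rgt u)"
      unfolding phi_def by (meson keys_addD keys_diffD)
    then show ?thesis
    proof cases
      case 1
      then show ?thesis by (auto dest!: keys_tensD wdg_td)
    next
      case 2
      then show ?thesis by (cases u) (auto simp: tdg_def)
    next
      case 3
      then show ?thesis using snoc by auto
    qed
  qed
  then show ?thesis by (auto simp: U.T.hg_def)
qed simp

text \<open>The total differential, before normalization.\<close>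

definition DU :: "('m \<times> 'm list \<Rightarrow>\<^sub>0 'k) \<Rightarrow> ('m \<times> 'm list \<Rightarrow>\<^sub>0 'k)"
  where "DU x = lin_ext (\<lambda>(a, u). tens (bd a) (basis u)) x + lin_ext (\<lambda>(a, u). sgs (dg a) (um (basis (a, [])) (phi u))) x"

lemma klinear_DU [simp]: "klinear f \<Longrightarrow> klinear (\<lambda>x. DU (f x))"
  by (simp add: DU_def)

lemma DU_basis: "DU (basis (a, u)) = tens (bd a) (basis u) + sgs (dg a) (um (basis (a, [])) (phi u))"
  by (simp add: DU_def)

lemmas DU_simps [simp] = klinearD(1-6)[OF klinear_DU[OF klinear_rules(1)]]

lemma bd_pos:
  assumes "bd a \<noteq> 0" shows "0 < dg a"
proof -
  obtain x where "x \<in> keys (bd a)" using assms by (meson keys_eq_empty ex_in_conv)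
  then show ?thesis using bd_dg by simp
qed

text \<open>Both parts are extensions of derivations, of \<open>bd\<close> from the coefficients and
  of \<open>phi\<close> from the words.\<close>

lemma odd_deriv_DU: "U.T.odd_deriv (S \<times> UNIV) DU"
proof -
  have "U.T.odd_deriv (S \<times> UNIV) (lin_ext (\<lambda>(a, u). tens (lin_ext bd (basis a)) (basis u)))"
    by (rule U.odd_deriv_left[where d' = "\<lambda>a. dg a - 1"])
      (auto simp: A.odd_deriv_def A.hg_def bd_pr bd_pos dest: bd_dg)
  moreover have "U.T.odd_deriv UNIV (lin_ext (\<lambda>(a, u). sgs (dg a) (um (basis (a, [])) (phi u))))"
  proof (rule U.odd_deriv_right[OF phi_shp hg_phi])
    show "phi u \<noteq> 0 \<Longrightarrow> wdg s u = Suc (wdg s u - 1)" for u by (cases u) auto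
  qed
  then have "U.T.odd_deriv (S \<times> UNIV) (lin_ext (\<lambda>(a, u). sgs (dg a) (um (basis (a, [])) (phi u))))"
    by (auto simp: U.T.odd_deriv_def)
  ultimately show ?thesis
    using U.T.odd_deriv_add unfolding DU_def by fastforce
qed

end

lemma lin_ext_zero [simp]: "lin_ext (\<lambda>_. 0) x = 0"
  by (simp add: lin_ext_def)

section \<open>The square of the total differential\<close>

context dga
begin

lemma mh_consx': "mh c (consx x y) = consx (A.mul (basis c) x) y"
  by (rule klinear_eq[of "\<lambda>x. mh c (consx x y)"]) auto

lemma lin_ext_mh_consx: "lin_ext (\<lambda>c. mh c (consx (basis f) y)) x = consx (A.mul x (basis f)) y"
  by (rule klinear_eq[of "\<lambda>x. lin_ext (\<lambda>c. mh c (consx (basis f) y)) x"]) auto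

lemma mh_mh: "mh c (mh f (basis w)) = lin_ext (\<lambda>x. mh x (basis w)) (pr c f)"
proof (cases w)
  case (Cons g w')
  have "mh c (mh f (basis w)) = consx (A.mul (basis c) (pr f g)) (basis w')"
    using Cons by (simp add: mh_consx')
  also have "A.mul (basis c) (pr f g) = A.mul (pr c f) (basis g)"
    using A.mul_assoc[of "basis c" "basis f" "basis g"] by simp
  finally show ?thesis
    using lin_ext_mh_consx[of g "basis w'" "pr c f"] Cons by simp
qed simp

lemma td_consx':
  assumes "A.hg n x"
  shows "lin_ext td (consx x (basis w)) =
    sgs (Suc n) (lin_ext (\<lambda>c. mh c (basis w)) x + consx x (td w)) - consx (lin_ext bd x) (basis w)"
  by (rule klinear_eq_on[of "\<lambda>x. lin_ext td (consx x (basis w))"]) (use assms in \<open>auto simp: A.hg_def\<close>)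

lemma hg_bd: "A.hg (dg c - 1) (bd c)"
  by (auto simp: A.hg_def dest!: bd_dg)

text \<open>The terms at the first two letters are compared: double merges cancel by associativity,
  a merge combined with a differential by the Leibniz rule of \<open>bd\<close>.\<close>

lemma td_td: "set u \<subseteq> S \<Longrightarrow> lin_ext td (td u) = 0"
proof (induction u)
  case (Cons c w)
  have bd: "lin_ext td (consx (bd c) (basis w)) = sgs (dg c) (lin_ext (\<lambda>x. mh x (basis w)) (bd c) + consx (bd c) (td w))"
  proof (cases "bd c = 0")
    case False
    then have "Suc (dg c - 1) = dg c" using bd_pos by simp
    then show ?thesis using td_consx'[OF hg_bd, of c w] bd_bd[of c] Cons(2) by simp
  qed simp
  show ?case
  proof (cases w)
    case Nil
    then show ?thesis using bd by simp
  next
    case w: (Cons f w')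
    have c: "lin_ext td (consx (basis c) (td w)) = sgs (s c) (mh c (td w)) - consx (bd c) (td w)"
      using Cons by (simp add: td_consx)
    have "lin_ext td (mh c (basis w)) = lin_ext td (consx (pr c f) (basis w'))"
      using w by simp
    also have "\<dots> = sgs (Suc (dg c + dg f)) (lin_ext (\<lambda>c. mh c (basis w')) (pr c f) + consx (pr c f) (td w')) -
        consx (lin_ext bd (pr c f)) (basis w')"
      by (rule td_consx'[OF A.hg_pr])
    also have "lin_ext bd (pr c f) = A.mul (bd c) (basis f) + sgs (dg c) (A.mul (basis c) (bd f))"
      using Cons(2) w by (intro bd_pr) auto
    finally have m: "lin_ext td (mh c (basis w)) =
       sgs (Suc (dg c + dg f)) (mh c (mh f (basis w')) + consx (pr c f) (td w')) -
        consx (A.mul (bd c) (basis f) + sgs (dg c) (A.mul (basis c) (bd f))) (basis w')"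
      by (simp only: mh_mh)
    have b: "lin_ext (\<lambda>x. mh x (basis w)) (bd c) = consx (A.mul (bd c) (basis f)) (basis w')"
      using lin_ext_mh_consx[of f "basis w'" "bd c"] w by simp
    have t: "mh c (td w) = sgs (s f) (mh c (mh f (basis w')) + consx (pr c f) (td w')) -
       consx (A.mul (basis c) (bd f)) (basis w')"
      using w by (simp add: mh_consx')
    have "lin_ext td (td (c # w)) =
      sgs (s c) (lin_ext td (mh c (basis w)) + lin_ext td (consx (basis c) (td w))) - lin_ext td (consx (bd c) (basis w))"
      by simp
    then show ?thesis
      unfolding m c bd b t
      by (simp add: sgs_add) (simp add: sgs_def)
  qed
qed simp

lemma DU_right: "DU (tens (basis e) x) = lin_ext phi x"
  by (rule klinear_eq[of "\<lambda>x. DU (tens (basis e) x)"]) (auto simp: DU_basis)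

lemma um_phi: "um (basis (c, [])) (phi w) = tens (basis c) (td w) + um (basis (c, [])) (lft w) - um (basis (c, [])) (rgt w)"
  by (simp add: phi_def um_left)

text \<open>Detaching the first letter anticommutes with the differential except for one term, in
  which the last letter is detached as well. \<open>DU_rgt\<close> has the mirror image of this
  defect.\<close>

lemma DU_lft: "DU (lft (c # w)) + lin_ext lft (td (c # w)) = - sgs (dg c) (um (basis (c, [])) (rgt w))"
proof -
  have "lin_ext lft (mh c (basis w)) = um (basis (c, [])) (lft w)"
    by (cases w) (auto simp: lft_consx tpr_pair)
  then show ?thesis
    by (simp add: DU_basis um_phi lft_consx) (simp add: sgs_def)
qed

lemma DU_rgt: "DU (rgt (w @ [c])) + lin_ext rgt (td (w @ [c])) = sgs (s c * wdg s w + dg c) (um (basis (c, [])) (lft w))"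
proof -
  have 1: "lin_ext rgt (snocl c (td w)) = sgs (s c * (wdg s w + 1)) (tens (basis c) (td w))"
  proof (cases w)
    case (Cons f v)
    then obtain k where k: "wdg s w = Suc k" by simp
    have "lin_ext rgt (snocl c (td w)) = sgs (s c * k) (tens (basis c) (td w))"
      by (rule rgt_snocl) (use k in \<open>auto dest: wdg_td\<close>)
    then show ?thesis using k by (auto intro!: sgs_cong)
  qed simp
  have sn: "lin_ext rgt (snocx w x) = sgs (Suc n * wdg s w) (tens x (basis w))" if "A.hg n x" for x n w
    unfolding snocx_def
    by (rule klinear_eq_on[of "\<lambda>x. lin_ext rgt (lin_ext (\<lambda>x. basis (w @ [x])) x)"]) (use that in \<open>auto simp: A.hg_def\<close>)
  have 3: "lin_ext rgt (snocx w (bd c)) = sgs (dg c * wdg s w) (tens (bd c) (basis w))"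
    using sn[OF hg_bd, of w c] bd_pos[of c] by (cases "bd c = 0") (auto simp: snocx_def)
  have 4: "um (basis (c, [])) (rgt w) = sgs (s c * wdg s w + dg c + wdg s w) (lin_ext rgt (mr w c))"
  proof (cases w rule: rev_cases)
    case (snoc v f)
    have "pr f c = sgs (dg f * dg c) (pr c f)" by (rule A.pr_comm)
    then show ?thesis
      using snoc sn[OF A.hg_pr, of v f c] by (auto simp: mr_def tpr_pair sgs_sgs intro!: sgs_cong)
  qed (simp add: mr_def)
  show ?thesis
    by (simp add: td_snoc DU_basis um_phi 1 3 4) (simp add: sgs_def)
qed

text \<open>The defects of \<open>lft\<close> and \<open>rgt\<close> both detach the two outer
  letters and multiply them, in opposite orders; graded commutativity makes them cancel.\<close>

lemma DU_phi:
  assumes "set u \<subseteq> S"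
  shows "DU (phi u) = 0"
proof -
  have "DU (phi u) = (DU (lft u) + lin_ext lft (td u)) - (DU (rgt u) + lin_ext rgt (td u))"
    by (simp add: phi_def DU_right lin_ext_phi td_td[OF assms])
  also have "\<dots> = 0"
  proof (cases "\<exists>c v f. u = c # v @ [f]")
    case True
    then obtain c v f where u: "u = c # v @ [f]" by blast
    have "pr f c = sgs (dg f * dg c) (pr c f)" by (rule A.pr_comm)
    then show ?thesis
      using DU_lft[of c "v @ [f]"] DU_rgt[of "c # v" f] by (simp add: u tpr_pair sgs_sgs) (auto simp: sgs_def)
  next
    case False
    then consider "u = []" | c where "u = [c]" by (metis append_Cons neq_Nil_conv rev_exhaust)
    then show ?thesis
      using DU_lft[of _ "[]"] DU_rgt[of "[]"] by cases (auto simp: rgt_def)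
  qed
  finally show ?thesis .
qed

definition ucells :: "('m \<times> 'm list) set"
  where "ucells = S \<times> lists S"

lemma keys_mh_S: "w \<in> keys (mh c (basis u)) \<Longrightarrow> c \<in> S \<Longrightarrow> set u \<subseteq> S \<Longrightarrow> set w \<subseteq> S"
  by (cases u) (auto dest!: keys_consxD dest: pr_S)

lemma keys_td_S: "w \<in> keys (td u) \<Longrightarrow> set u \<subseteq> S \<Longrightarrow> set w \<subseteq> S"
proof (induction u arbitrary: w)
  case (Cons c u)
  from Cons(2) consider "w \<in> keys (mh c (basis u))" | "w \<in> keys (consx (basis c) (td u))" | "w \<in> keys (consx (bd c) (basis u))"
    by (auto dest!: keys_addD keys_diffD)
  then show ?case
  proof cases
    case 1
    then show ?thesis using keys_mh_S[OF 1] Cons(3) by simp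
  next
    case 2
    then show ?thesis using Cons(1,3) by (fastforce dest!: keys_consxD)
  next
    case 3
    then show ?thesis using bd_S Cons(3) by (auto dest!: keys_consxD)
  qed
qed simp

lemma keys_phi_ucells: "set u \<subseteq> S \<Longrightarrow> keys (phi u) \<subseteq> ucells"
proof
  fix x assume u: "set u \<subseteq> S" and x: "x \<in> keys (phi u)"
  then consider "x \<in> keys (tens (basis e) (td u))" | "x \<in> keys (lft u)" | "x \<in> keys (rgt u)"
    unfolding phi_def by (meson keys_addD keys_diffD)
  then show "x \<in> ucells"
  proof cases
    case 1
    then show ?thesis using keys_td_S u by (cases x) (auto simp: ucells_def dest!: keys_tensD)
  next
    case 2
    then show ?thesis using u by (cases u) (auto simp: ucells_def)
  next
    case 3
    then show ?thesis using u by (cases u rule: rev_cases) (auto simp: ucells_def)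
  qed
qed

lemma keys_um_ucells: "keys x \<subseteq> ucells \<Longrightarrow> keys y \<subseteq> ucells \<Longrightarrow> keys (um x y) \<subseteq> ucells"
proof
  fix z assume *: "keys x \<subseteq> ucells" "keys y \<subseteq> ucells" "z \<in> keys (um x y)"
  then obtain a u b v where **: "(a, u) \<in> ucells" "(b, v) \<in> ucells" "z \<in> keys (U.prT (a, u) (b, v))"
    using keys_bilin_extD[OF *(3)] * by fast
  obtain c w where z: "z = (c, w)" by (cases z)
  have c: "c \<in> keys (pr a b)" and w: "w \<in> keys (shp s u v :: 'm list \<Rightarrow>\<^sub>0 'k)"
    using **(3) by (auto simp: tpr_pair z dest!: keys_tensD)
  have "set w = set u \<union> set v"
    using arg_cong[OF mset_shp[OF w], of set_mset] by simp
  then show "z \<in> ucells" using c pr_S[of a b c] ** z by (auto simp: ucells_def)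
qed

lemma DU_ucells: "keys x \<subseteq> ucells \<Longrightarrow> keys (DU x) \<subseteq> ucells"
proof (rule klinear_in_span[of DU])
  fix m assume "keys x \<subseteq> ucells" "m \<in> keys x"
  then have "m \<in> S \<times> lists S" by (auto simp: ucells_def)
  then obtain a u where m: "m = (a, u)" "a \<in> S" "set u \<subseteq> S" by auto
  have "keys (tens (bd a) (basis u)) \<subseteq> ucells"
    using m bd_S by (auto simp: ucells_def dest!: keys_tensD)
  moreover have "keys (um (basis (a, [])) (phi u)) \<subseteq> ucells"
    using m by (intro keys_um_ucells keys_phi_ucells) (auto simp: ucells_def)
  ultimately show "keys (DU (basis m)) \<subseteq> ucells"
    unfolding m DU_basis using keys_addD by fastforce
qed simp

lemma DU_mul:
  assumes "U.T.hg n x" "keys x \<subseteq> ucells" "keys y \<subseteq> ucells"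
  shows "DU (um x y) = um (DU x) y + sgs n (um x (DU y))"
  by (rule U.T.odd_deriv_mul[OF odd_deriv_DU assms(1)]) (use assms in \<open>auto simp: ucells_def\<close>)

lemma DU_left: "DU (tens x (basis [])) = tens (lin_ext bd x) (basis [])"
  by (rule klinear_eq[of "\<lambda>x. DU (tens x (basis []))"]) (auto simp: DU_basis)

text \<open>A cell is the product of its coefficient and its word. Applying the Leibniz rule twice
  leaves only \<open>bd_bd\<close> and \<open>DU_phi\<close>.\<close>

lemma DU_DU: "keys x \<subseteq> ucells \<Longrightarrow> DU (DU x) = 0"
proof (rule klinear_eq_on[of "\<lambda>x. DU (DU x)" "\<lambda>x. 0"])
  fix m assume "keys x \<subseteq> ucells" "m \<in> keys x"
  then have "m \<in> S \<times> lists S" by (auto simp: ucells_def)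
  then obtain a u where m: "m = (a, u)" "a \<in> S" "set u \<subseteq> S" by auto
  let ?a = "basis (a, [])" and ?u = "basis (e, u)"
  have Da: "DU ?a = tens (bd a) (basis [])" and Du: "DU ?u = phi u"
    by (simp_all add: DU_basis)
  have au: "basis m = um ?a ?u" using m by (simp add: tpr_pair)
  have c: "keys ?a \<subseteq> ucells" "keys ?u \<subseteq> ucells" using m by (auto simp: ucells_def)
  have h: "U.T.hg (dg a) ?a" using U.T.hg_basis[of "(a, [])"] by simp
  have "DU (basis m) = um (DU ?a) ?u + sgs (dg a) (um ?a (phi u))"
    unfolding au by (subst DU_mul[OF h c]) (simp add: Du)
  then have "DU (DU (basis m)) = DU (um (DU ?a) ?u) + sgs (dg a) (DU (um ?a (phi u)))"
    by simp
  also have "DU (um (DU ?a) ?u) = sgs (dg a + 1) (um (DU ?a) (phi u))"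
  proof (cases "bd a = 0")
    case False
    have "DU (DU ?a) = 0" using bd_bd[OF m(2)] by (simp add: Da DU_left)
    moreover have "U.T.hg (dg a - 1) (DU ?a)"
      unfolding Da U.T.hg_def by (auto dest!: keys_tensD bd_dg)
    ultimately show ?thesis
      using bd_pos[OF False] DU_mul[of "dg a - 1" "DU ?a" ?u] DU_ucells[OF c(1)] c(2) Du
      by (auto intro!: sgs_cong)
  qed (simp add: Da)
  also have "DU (um ?a (phi u)) = um (DU ?a) (phi u)"
    using DU_mul[OF h c(1) keys_phi_ucells[OF m(3)]] DU_phi[OF m(3)] by simp
  finally show "DU (DU (basis m)) = 0" by (simp add: sgs_def)
qed simp_all

end

subsection \<open>Normalization and bidegrees\<close>

text \<open>The condition keeps merges of letters other than the unit away from the unit, so that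
  the multiplication part of the boundary preserves normalized words.\<close>

locale augmented_dga = dga pr dg e bd S
  for pr :: "'m \<Rightarrow> 'm \<Rightarrow> ('m \<Rightarrow>\<^sub>0 'k::comm_ring_1)" and dg :: "'m \<Rightarrow> nat" and e bd S +
  assumes e_pr: "e \<in> keys (pr a b) \<Longrightarrow> a = e \<and> b = e"
begin

definition ncells :: "('m \<times> 'm list) set"
  where "ncells = S \<times> {u \<in> lists S. e \<notin> set u}"

lemma ncells_ucells: "ncells \<subseteq> ucells"
  by (auto simp: ncells_def ucells_def)

definition nrl :: "('m list \<Rightarrow>\<^sub>0 'k) \<Rightarrow> ('m list \<Rightarrow>\<^sub>0 'k)"
  where "nrl = lin_ext (\<lambda>u. if e \<in> set u then 0 else basis u)"

definition nrm :: "('m \<times> 'm list \<Rightarrow>\<^sub>0 'k) \<Rightarrow> ('m \<times> 'm list \<Rightarrow>\<^sub>0 'k)"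
  where "nrm = lin_ext (\<lambda>(a, u). if e \<in> set u then 0 else basis (a, u))"

lemma klinear_nrm [simp]: "klinear f \<Longrightarrow> klinear (\<lambda>x. nrm (f x))" "klinear g \<Longrightarrow> klinear (\<lambda>x. nrl (g x))"
  by (simp_all add: nrm_def nrl_def)

lemmas nrm_simps [simp] = klinearD(1-6)[OF klinear_nrm(1)[OF klinear_rules(1)]]
lemmas nrl_simps [simp] = klinearD(1-6)[OF klinear_nrm(2)[OF klinear_rules(1)]]

lemma nrm_basis: "nrm (basis (a, u)) = (if e \<in> set u then 0 else basis (a, u))"
  and nrl_basis: "nrl (basis u) = (if e \<in> set u then 0 else basis u)"
  by (simp_all add: nrm_def nrl_def)

lemma nrl_consx:
  assumes "e \<notin> keys x"
  shows "nrl (consx x y) = consx x (nrl y)"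
  by (rule klinear_eq2_on[where F = "\<lambda>x y. nrl (consx x y)" and H = "\<lambda>x y. consx x (nrl y)"])
    (use assms in \<open>auto simp: nrl_basis\<close>)

lemma nrl_consx_e: "nrl (consx (basis e) y) = 0"
  by (rule klinear_eq[of "\<lambda>y. nrl (consx (basis e) y)"]) (auto simp: nrl_basis)

lemma nrl_consx_0: "e \<in> set w \<Longrightarrow> nrl (consx x (basis w)) = 0"
  by (rule klinear_eq[of "\<lambda>x. nrl (consx x (basis w))"]) (auto simp: nrl_basis)

lemma nrm_tens: "nrm (tens x y) = tens x (nrl y)"
  by (rule klinear_eq2_on[where F = "\<lambda>x y. nrm (tens x y)" and H = "\<lambda>x y. tens x (nrl y)"])
    (auto simp: nrm_basis nrl_basis)

lemma nrl_id: "(\<And>u. u \<in> keys x \<Longrightarrow> e \<notin> set u) \<Longrightarrow> nrl x = x"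
  by (rule klinear_eq_on[of nrl "\<lambda>x. x"]) (auto simp: nrl_basis nrl_def)

lemma nrl_0: "(\<And>u. u \<in> keys x \<Longrightarrow> e \<in> set u) \<Longrightarrow> nrl x = 0"
  by (rule klinear_eq_on[of nrl "\<lambda>x. 0"]) (auto simp: nrl_basis nrl_def)

lemma nrm_id: "keys x \<subseteq> ncells \<Longrightarrow> nrm x = x"
  by (rule klinear_eq_on[of nrm "\<lambda>x. x"]) (auto simp: nrm_def ncells_def)

lemma keys_nrm: "keys x \<subseteq> ucells \<Longrightarrow> keys (nrm x) \<subseteq> ncells"
  unfolding nrm_def by (auto dest!: keys_lin_extD simp: ucells_def ncells_def split: if_splits)

lemma keys_nrm_subset: "keys (nrm x) \<subseteq> keys x"
  unfolding nrm_def by (auto dest!: keys_lin_extD split: if_splits)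

lemma nrl_shp: "nrl (shp s u v) = sm (nrl (basis u)) (nrl (basis v))"
proof (cases "e \<in> set u \<union> set v")
  case True
  have "nrl (shp s u v) = 0"
    by (rule nrl_0) (use True in \<open>auto dest!: mset_shp arg_cong[where f = set_mset]\<close>)
  then show ?thesis using True by (auto simp: nrl_basis)
next
  case False
  have "nrl (shp s u v) = shp s u v"
    by (rule nrl_id) (use False in \<open>auto dest!: mset_shp arg_cong[where f = set_mset]\<close>)
  then show ?thesis using False by (auto simp: nrl_basis)
qed

lemma nrm_um: "nrm (um x y) = um (nrm x) (nrm y)"
proof (rule klinear_eq2_on[where F = "\<lambda>x y. nrm (um x y)" and H = "\<lambda>x y. um (nrm x) (nrm y)"])
  fix x y :: "'m \<times> 'm list"
  obtain a u b v where "x = (a, u)" "y = (b, v)" by (cases x, cases y)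
  then show "nrm (um (basis x) (basis y)) = um (nrm (basis x)) (nrm (basis y))"
    by (simp add: tpr_pair nrm_tens nrl_shp nrm_basis nrl_basis)
qed simp_all

text \<open>Modulo words containing the unit, the merges of an inner unit with its left and its
  right neighbour cancel; only a unit at an end of the word leaves something.\<close>

lemma nrl_td_e:
  "nrl (td (p @ e # q)) = (if p = [] then (if q = [] then 0 else - nrl (basis q))
     else if q = [] then sgs (wdg s p) (nrl (basis p)) else 0)"
proof (induction p)
  case Nil
  have "mh e (basis q) = (if q = [] then 0 else basis q)" by (cases q) auto
  then show ?case by (simp add: nrl_consx_e sgs_def)
next
  case (Cons c p)
  have m: "nrl (mh c (basis (p @ e # q))) = (if p = [] then nrl (basis (c # q)) else 0)"
    by (cases p) (auto simp: nrl_consx_0)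
  show ?case
  proof (cases "c = e")
    case True
    then show ?thesis by (auto simp: m[unfolded True] nrl_consx_e nrl_consx_0 nrl_basis)
  next
    case False
    then have "nrl (consx (basis c) y) = consx (basis c) (nrl y)" for y
      by (intro nrl_consx) auto
    then show ?thesis by (auto simp: Cons m nrl_consx_0 nrl_basis sgs_sgs False False[symmetric])
  qed
qed

text \<open>The end terms left by the bar part cancel against the detached units. Hence the words
  containing the unit span a subcomplex.\<close>

lemma nrm_phi_e: "nrm (phi (p @ e # q)) = 0"
proof -
  have l: "nrm (lft (p @ e # q)) = (if p = [] then tens (basis e) (nrl (basis q)) else 0)"
    by (cases p) (auto simp: nrm_basis nrl_basis)
  have r: "nrm (rgt (p @ e # q)) = (if q = [] then sgs (wdg s p) (tens (basis e) (nrl (basis p))) else 0)"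
  proof (cases q rule: rev_cases)
    case (snoc q' f)
    then have "rgt (p @ e # q) = rgt ((p @ e # q') @ [f])" by simp
    then show ?thesis using snoc by (simp only: rgt_simps) (simp add: nrm_basis)
  qed (auto simp: nrm_basis nrl_basis)
  show ?thesis
    by (simp add: phi_def nrm_tens nrl_td_e l r nrl_basis)
qed

lemma nrm_DU_nrm: "nrm (DU (nrm x)) = nrm (DU x)"
proof (rule klinear_eq[of "\<lambda>x. nrm (DU (nrm x))" "\<lambda>x. nrm (DU x)"])
  fix m :: "'m \<times> 'm list"
  obtain a u where m: "m = (a, u)" by (cases m)
  show "nrm (DU (nrm (basis m))) = nrm (DU (basis m))"
  proof (cases "e \<in> set u")
    case True
    then obtain p q where "u = p @ e # q" by (meson split_list)
    then show ?thesis using True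
      by (simp add: m nrm_basis DU_basis nrm_um nrm_phi_e nrm_tens nrl_basis)
  qed (simp add: m nrm_basis)
qed simp_all

definition Dn :: "('m \<times> 'm list \<Rightarrow>\<^sub>0 'k) \<Rightarrow> ('m \<times> 'm list \<Rightarrow>\<^sub>0 'k)"
  where "Dn x = nrm (DU x)"

lemma klinear_Dn [simp]: "klinear f \<Longrightarrow> klinear (\<lambda>x. Dn (f x))"
  by (simp add: Dn_def)

lemmas Dn_simps [simp] = klinearD(1-6)[OF klinear_Dn[OF klinear_rules(1)]]

lemma Dn_ncells: "keys x \<subseteq> ncells \<Longrightarrow> keys (Dn x) \<subseteq> ncells"
  unfolding Dn_def using ncells_ucells by (intro keys_nrm DU_ucells) auto

lemma Dn_Dn: "keys x \<subseteq> ncells \<Longrightarrow> Dn (Dn x) = 0"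
  using DU_DU[of x] ncells_ucells by (simp add: Dn_def nrm_DU_nrm)

lemma Dn_mul:
  assumes "U.T.hg n x" "keys x \<subseteq> ncells" "keys y \<subseteq> ncells"
  shows "Dn (um x y) = um (Dn x) y + sgs n (um x (Dn y))"
  using assms DU_mul[of n x y] ncells_ucells nrm_id[of x] nrm_id[of y]
  by (simp add: Dn_def nrm_um)

lemma keys_um_ncells:
  assumes "keys x \<subseteq> ncells" "keys y \<subseteq> ncells"
  shows "keys (um x y) \<subseteq> ncells"
  using keys_nrm[OF keys_um_ucells, of x y] assms ncells_ucells nrm_id[of x] nrm_id[of y]
  by (simp add: nrm_um)

section \<open>Multiplication part, internal part and bidegree of the normalized
  differential\<close>

definition HB :: "('m \<times> 'm list \<Rightarrow>\<^sub>0 'k) \<Rightarrow> ('m \<times> 'm list \<Rightarrow>\<^sub>0 'k)"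
  where "HB = lin_ext (\<lambda>(a, u). sgs (dg a) (tens (basis a) (bt u) + um (basis (a, [])) (lft u - rgt u)))"

definition HD :: "('m \<times> 'm list \<Rightarrow>\<^sub>0 'k) \<Rightarrow> ('m \<times> 'm list \<Rightarrow>\<^sub>0 'k)"
  where "HD = lin_ext (\<lambda>(a, u). tens (bd a) (basis u) + sgs (dg a) (tens (basis a) (dl u)))"

lemma klinear_HB [simp]: "klinear f \<Longrightarrow> klinear (\<lambda>x. HB (f x))" "klinear f \<Longrightarrow> klinear (\<lambda>x. HD (f x))"
  by (simp_all add: HB_def HD_def)

lemmas HB_simps [simp] = klinearD(1-6)[OF klinear_HB(1)[OF klinear_rules(1)]]

lemma HB_basis: "HB (basis (a, u)) = sgs (dg a) (tens (basis a) (bt u) + um (basis (a, [])) (lft u - rgt u))"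
  and HD_basis: "HD (basis (a, u)) = tens (bd a) (basis u) + sgs (dg a) (tens (basis a) (dl u))"
  by (simp_all add: HB_def HD_def)

lemma DU_HB_HD: "DU x = HB x + HD x"
proof (rule klinear_eq[of DU "\<lambda>x. HB x + HD x"])
  fix m :: "'m \<times> 'm list"
  obtain a u where m: "m = (a, u)" by (cases m)
  show "DU (basis m) = HB (basis m) + HD (basis m)"
    by (simp add: m DU_basis HB_def HD_def phi_def td_def um_left sgs_add) (simp add: sgs_def)
qed simp_all

lemma length_mh: "w \<in> keys (mh c (basis u)) \<Longrightarrow> Suc (length w) = Suc (length u) - 1 + 1 \<and> u \<noteq> [] \<and> length w = length u \<and> wdg dg w = dg c + wdg dg u"
  by (cases u) (auto dest!: keys_consxD A.pr_dg)

lemma keys_bt: "w \<in> keys (bt u) \<Longrightarrow> Suc (length w) = length u \<and> wdg dg w = wdg dg u"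
  by (induction u arbitrary: w) (auto dest!: keys_addD keys_consxD length_mh)

lemma keys_dl: "w \<in> keys (dl u) \<Longrightarrow> length w = length u \<and> Suc (wdg dg w) = wdg dg u"
  by (induction u arbitrary: w) (auto dest!: keys_diffD keys_consxD bd_dg)

lemma keys_mh_e: "w \<in> keys (mh c (basis u)) \<Longrightarrow> c \<noteq> e \<Longrightarrow> e \<notin> set u \<Longrightarrow> e \<notin> set w"
  by (cases u) (auto dest!: keys_consxD dest: e_pr)

lemma keys_bt_e: "w \<in> keys (bt u) \<Longrightarrow> e \<notin> set u \<Longrightarrow> e \<notin> set w"
  by (induction u arbitrary: w) (fastforce dest!: keys_addD keys_consxD dest: keys_mh_e)+

definition pdg :: "'m \<times> 'm list \<Rightarrow> nat"
  where "pdg m = dg (fst m) + wdg dg (snd m)"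

definition qdg :: "'m \<times> 'm list \<Rightarrow> nat"
  where "qdg m = length (snd m)"

lemma tdg_pdg: "tdg dg (wdg s) m = pdg m + qdg m"
proof -
  have "wdg s u = wdg dg u + length u" for u by (induction u) auto
  then show ?thesis by (cases m) (simp add: pdg_def qdg_def)
qed

lemma keys_HB_basis:
  assumes "x \<in> keys (HB (basis (a, u)))"
  shows "pdg x = pdg (a, u) \<and> Suc (qdg x) = qdg (a, u) \<and> (e \<notin> set u \<longrightarrow> e \<notin> set (snd x))"
proof -
  obtain b w where x: "x = (b, w)" by (cases x)
  have "x \<in> keys (tens (basis a) (bt u) + (um (basis (a, [])) (lft u) - um (basis (a, [])) (rgt u)))"
    using assms by (simp add: HB_basis)
  then consider "x \<in> keys (tens (basis a) (bt u))" | "x \<in> keys (um (basis (a, [])) (lft u))"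
    | "x \<in> keys (um (basis (a, [])) (rgt u))"
    by (metis keys_addD keys_diffD)
  then show ?thesis
  proof cases
    case 1
    then show ?thesis using keys_bt[of w u] keys_bt_e[of w u]
      by (auto simp: x pdg_def qdg_def dest!: keys_tensD)
  next
    case 2
    then show ?thesis
      by (cases u) (auto simp: x pdg_def qdg_def tpr_pair dest!: keys_tensD A.pr_dg)
  next
    case 3
    then show ?thesis
      by (cases u rule: rev_cases) (auto simp: x pdg_def qdg_def tpr_pair dest!: keys_tensD A.pr_dg)
  qed
qed

lemma keys_HD_basis:
  assumes "x \<in> keys (HD (basis (a, u)))"
  shows "Suc (pdg x) = pdg (a, u) \<and> qdg x = qdg (a, u)"
proof -
  obtain b w where x: "x = (b, w)" by (cases x)
  consider "x \<in> keys (tens (bd a) (basis u))" | "x \<in> keys (tens (basis a) (dl u))"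
    using assms unfolding HD_basis by (metis keys_addD keys_sgs)
  then show ?thesis
    by cases (auto simp: x pdg_def qdg_def dest!: keys_tensD bd_dg keys_dl)
qed

text \<open>By \<open>e_pr\<close>, merging stays among normalized words. The internal part behaves
  differently: \<open>bd\<close> of a letter may contain the unit, whence the \<open>nrm\<close> in
  \<open>Dn_HB\<close>.\<close>

lemma HB_ncells: "keys x \<subseteq> ncells \<Longrightarrow> nrm (HB x) = HB x"
proof (rule klinear_eq_on[of "\<lambda>x. nrm (HB x)" HB])
  fix m assume "keys x \<subseteq> ncells" "m \<in> keys x"
  then have "m \<in> ncells" by auto
  then obtain a u where m: "m = (a, u)" "e \<notin> set u" by (auto simp: ncells_def)
  show "nrm (HB (basis m)) = HB (basis m)"
    unfolding nrm_def
    by (rule trans[OF lin_ext_cong lin_ext_basis_id])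
      (use keys_HB_basis[of _ a u] m in \<open>auto split: prod.splits\<close>)
qed (auto simp: HB_def)

lemma Dn_HB: "keys x \<subseteq> ncells \<Longrightarrow> Dn x = HB x + nrm (HD x)"
  by (simp add: Dn_def DU_HB_HD HB_ncells)

end

section \<open>The algebra of monomials\<close>

lemma linear_order_some: "linear_order (SOME r :: 'a rel. linear_order r)"
proof (rule someI_ex)
  show "\<exists>r :: 'a rel. linear_order r"
    using well_ordering[where 'a = 'a] by (metis well_order_on_def)
qed

lemma gless_total: "g \<noteq> h \<Longrightarrow> gless g h \<or> gless h g"
  using linear_order_some[where 'a = "'v gen"] unfolding gless_def linear_order_on_def total_on_def by blast

lemma gless_asym: "gless g h \<Longrightarrow> \<not> gless h g"
  using linear_order_some[where 'a = "'v gen"]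
  unfolding gless_def linear_order_on_def partial_order_on_def antisym_def by blast

lemma gless_irrefl [simp]: "\<not> gless g g"
  by (simp add: gless_def)

lemma gless_trans: "gless g h \<Longrightarrow> gless h l \<Longrightarrow> gless g l"
proof -
  assume a: "gless g h" "gless h l"
  have "trans (SOME r :: 'a gen rel. linear_order r)"
    using linear_order_some[where 'a = "'a gen"]
    unfolding linear_order_on_def[of _ "SOME r. P r" for P] partial_order_on_def[of _ "SOME r. P r" for P]
      preorder_on_def[of _ "SOME r. P r" for P] by blast
  then have "(g, l) \<in> (SOME r. linear_order r)"
    using a by (auto simp: gless_def elim: transE)
  moreover have "g \<noteq> l" using a gless_asym by blast
  ultimately show "gless g l" by (simp add: gless_def)
qed

lemma keys_plus_nat: "keys (m + n :: 'a \<Rightarrow>\<^sub>0 nat) = keys m \<union> keys n"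
  by (auto simp: in_keys_iff lookup_add)

lemma plus_mono_eq_0: "m + n = 0 \<longleftrightarrow> m = 0 \<and> n = (0 :: 'a \<Rightarrow>\<^sub>0 nat)"
  by (metis add_cancel_right_right keys_plus_nat keys_eq_empty Un_empty)

lemma mdeg_superset:
  assumes "finite A" "keys m \<subseteq> A"
  shows "mdeg deg m = (\<Sum>g\<in>A. lookup m g * gdeg deg g)"
  unfolding mdeg_def by (rule sum.mono_neutral_left) (use assms in \<open>auto simp: in_keys_iff\<close>)

lemma mdeg_0 [simp]: "mdeg deg 0 = 0"
  by (simp add: mdeg_def)

lemma mdeg_single [simp]: "mdeg deg (single g n) = n * gdeg deg g"
  by (simp add: mdeg_def)

lemma mdeg_plus [simp]: "mdeg deg (m + n) = mdeg deg m + mdeg deg n"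
  using mdeg_superset[of "keys m \<union> keys n" m deg] mdeg_superset[of "keys m \<union> keys n" n deg]
  by (simp add: mdeg_def keys_plus_nat lookup_add add_mult_distrib sum.distrib)

definition odd_gen :: "('v \<Rightarrow> nat) \<Rightarrow> 'v gen \<Rightarrow> bool"
  where "odd_gen deg g \<longleftrightarrow> odd (gdeg deg g)"

definition odd_rep :: "('v \<Rightarrow> nat) \<Rightarrow> 'v mono \<Rightarrow> bool"
  where "odd_rep deg m \<longleftrightarrow> (\<exists>g. odd_gen deg g \<and> lookup m g \<ge> 2)"

definition inv_set :: "('v \<Rightarrow> nat) \<Rightarrow> 'v mono \<Rightarrow> 'v mono \<Rightarrow> ('v gen \<times> 'v gen) set"
  where "inv_set deg m n = {(g, h). g \<in> keys m \<and> h \<in> keys n \<and> odd_gen deg g \<and> odd_gen deg h \<and> gless h g}"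

definition dp_gen :: "('v \<Rightarrow> nat) \<Rightarrow> 'v gen set"
  where "dp_gen deg = {g \<in> range DGen. even (gdeg deg g)}"

text \<open>The additional binomials are 1, so the product may run over any finite set of divided
  power generators containing the common ones. This gives one index set for all coefficients of the
  cocycle identity.\<close>

lemma mono_coeff_alt:
  assumes "finite A" "keys m \<inter> keys n \<inter> dp_gen deg \<subseteq> A" "A \<subseteq> dp_gen deg"
  shows "mono_coeff deg m n = (if odd_rep deg (m + n) then 0 else
    (-1) ^ card (inv_set deg m n) * (\<Prod>g\<in>A. of_nat ((lookup m g + lookup n g) choose lookup m g)) :: 'k::comm_ring_1)"
proof -
  have "(\<Prod>g\<in>{g \<in> keys m \<inter> keys n. g \<in> range DGen \<and> even (gdeg deg g)}. of_nat ((lookup m g + lookup n g) choose lookup m g) :: 'k) =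
    (\<Prod>g\<in>A. of_nat ((lookup m g + lookup n g) choose lookup m g))"
    by (rule prod.mono_neutral_left) (use assms in \<open>auto simp: dp_gen_def in_keys_iff\<close>)
  then show ?thesis
    by (auto simp: mono_coeff_def odd_rep_def inv_set_def odd_gen_def lookup_add)
qed

lemma finite_inv_set [simp]: "finite (inv_set deg m n)"
  by (rule finite_subset[of _ "keys m \<times> keys n"]) (auto simp: inv_set_def)

lemma odd_rep_plus: "odd_rep deg m \<Longrightarrow> odd_rep deg (m + n)" "odd_rep deg n \<Longrightarrow> odd_rep deg (m + n)"
  by (auto simp: odd_rep_def lookup_add intro: trans_le_add1 trans_le_add2)

lemma odd_disjoint: "\<not> odd_rep deg (m + n) \<Longrightarrow> odd_gen deg g \<Longrightarrow> g \<in> keys m \<Longrightarrow> g \<notin> keys n"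
  by (force simp: odd_rep_def lookup_add in_keys_iff)

text \<open>Without a repeated odd generator, the odd generators of \<open>a\<close> and of
  \<open>b\<close> are disjoint, so no inversion is counted twice.\<close>

lemma card_inv_set_plus:
  assumes "\<not> odd_rep deg (a + b)"
  shows "card (inv_set deg (a + b) c) = card (inv_set deg a c) + card (inv_set deg b c)"
    and "card (inv_set deg c (a + b)) = card (inv_set deg c a) + card (inv_set deg c b)"
proof -
  have "inv_set deg (a + b) c = inv_set deg a c \<union> inv_set deg b c"
    "inv_set deg c (a + b) = inv_set deg c a \<union> inv_set deg c b"
    by (auto simp: inv_set_def keys_plus_nat)
  moreover have "inv_set deg a c \<inter> inv_set deg b c = {}" "inv_set deg c a \<inter> inv_set deg c b = {}"
    using odd_disjoint[OF assms] by (auto simp: inv_set_def)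
  ultimately show "card (inv_set deg (a + b) c) = card (inv_set deg a c) + card (inv_set deg b c)"
    "card (inv_set deg c (a + b)) = card (inv_set deg c a) + card (inv_set deg c b)"
    by (simp_all add: card_Un_disjoint)
qed

text \<open>Both sides are the trinomial coefficient of \<open>a\<close>, \<open>b\<close>,
  \<open>c\<close>.\<close>

lemma choose_cocycle: "((a + b) choose a) * ((a + b + c) choose (a + b)) = ((b + c) choose b) * ((a + b + c) choose a)"
  using choose_mult[of a "a + b" "a + b + c"] by (simp add: mult.commute)

lemma sign_mult_cong:
  assumes "P * Q = R * T" "i + j = k + l"
  shows "((-1) ^ i * P) * ((-1) ^ j * Q) = ((-1) ^ k * R) * ((-1) ^ l * (T :: 'a::comm_ring_1))"
proof -
  have "((-1) ^ i * P) * ((-1) ^ j * Q) = (-1) ^ (i + j) * (P * Q)" by (simp add: power_add ac_simps)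
  also have "\<dots> = ((-1) ^ k * R) * ((-1) ^ l * T)" unfolding assms by (simp add: power_add ac_simps)
  finally show ?thesis .
qed

text \<open>Associativity on monomials: the exponents of the signs and the binomials satisfy
  separate cocycle identities.\<close>

lemma mono_coeff_cocycle:
  "mono_coeff deg a b * mono_coeff deg (a + b) c = (mono_coeff deg b c * mono_coeff deg a (b + c) :: 'k::comm_ring_1)"
proof (cases "odd_rep deg (a + b + c)")
  case True
  then show ?thesis
    using mono_coeff_alt[of "keys (a + b) \<inter> keys c \<inter> dp_gen deg" "a + b" c deg, where 'k = 'k]
      mono_coeff_alt[of "keys a \<inter> keys (b + c) \<inter> dp_gen deg" a "b + c" deg, where 'k = 'k] by (auto simp: add.assoc)
next
  case False
  then have no: "\<not> odd_rep deg (a + b)" "\<not> odd_rep deg (b + c)" "\<not> odd_rep deg (a + (b + c))"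
    using odd_rep_plus(1)[of deg "a + b" c] odd_rep_plus(2)[of deg "b + c" a] by (auto simp: add.assoc)
  let ?A = "(keys a \<union> keys b \<union> keys c) \<inter> dp_gen deg"
  have A: "finite ?A" "?A \<subseteq> dp_gen deg" by auto
  have coeff: "mono_coeff deg a b = (-1) ^ card (inv_set deg a b) * (\<Prod>g\<in>?A. of_nat ((lookup a g + lookup b g) choose lookup a g))"
    "mono_coeff deg (a + b) c = (-1) ^ card (inv_set deg (a + b) c) * (\<Prod>g\<in>?A. of_nat ((lookup (a + b) g + lookup c g) choose lookup (a + b) g))"
    "mono_coeff deg b c = (-1) ^ card (inv_set deg b c) * (\<Prod>g\<in>?A. of_nat ((lookup b g + lookup c g) choose lookup b g))"
    "mono_coeff deg a (b + c) = ((-1) ^ card (inv_set deg a (b + c)) * (\<Prod>g\<in>?A. of_nat ((lookup a g + lookup (b + c) g) choose lookup a g)) :: 'k)"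
    using no False by (subst mono_coeff_alt[OF A(1) _ A(2)]; auto simp: keys_plus_nat)+
  have "(\<Prod>g\<in>?A. of_nat ((lookup a g + lookup b g) choose lookup a g)) *
      (\<Prod>g\<in>?A. of_nat ((lookup (a + b) g + lookup c g) choose lookup (a + b) g)) =
      (\<Prod>g\<in>?A. of_nat ((lookup b g + lookup c g) choose lookup b g)) *
      (\<Prod>g\<in>?A. of_nat ((lookup a g + lookup (b + c) g) choose lookup a g) :: 'k)"
    unfolding prod.distrib[symmetric] of_nat_mult[symmetric] lookup_add add.assoc[symmetric] choose_cocycle ..
  moreover have "card (inv_set deg a b) + card (inv_set deg (a + b) c) = card (inv_set deg b c) + card (inv_set deg a (b + c))"
    by (simp add: card_inv_set_plus(1)[OF no(1)] card_inv_set_plus(2)[OF no(2)])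
  ultimately show ?thesis
    unfolding coeff by (rule sign_mult_cong)
qed

lemma even_mdeg_iff:
  assumes "\<not> odd_rep deg m"
  shows "even (mdeg deg m) = even (card {g \<in> keys m. odd_gen deg g})"
proof -
  have "even (\<Sum>g\<in>A. lookup m g * gdeg deg g) = even (card {g \<in> A. odd_gen deg g})" if "finite A" "A \<subseteq> keys m" for A
    using that
  proof (induction A rule: finite_induct)
    case (insert g A)
    have "lookup m g = 1" if "odd_gen deg g"
      using insert assms that by (auto simp: odd_rep_def in_keys_iff not_le less_2_cases_iff)
    moreover have "{h \<in> insert g A. odd_gen deg h} = (if odd_gen deg g then insert g {h \<in> A. odd_gen deg h} else {h \<in> A. odd_gen deg h})"
      by auto
    ultimately show ?case using insert by (auto simp: odd_gen_def)
  qed simp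
  then show ?thesis by (simp add: mdeg_def)
qed

text \<open>The inversions of the two orders together are all pairs of an odd generator of
  \<open>m\<close> and one of \<open>n\<close>, and the number of odd generators has the parity of
  the degree.\<close>

lemma mono_coeff_comm: "mono_coeff deg m n = (sgs (mdeg deg m * mdeg deg n) (mono_coeff deg n m) :: 'k::comm_ring_1)"
proof (cases "odd_rep deg (m + n)")
  case True
  then show ?thesis
    using mono_coeff_alt[of "keys m \<inter> keys n \<inter> dp_gen deg" m n deg, where 'k = 'k]
      mono_coeff_alt[of "keys n \<inter> keys m \<inter> dp_gen deg" n m deg, where 'k = 'k] by (auto simp: add.commute)
next
  case False
  let ?A = "keys m \<inter> keys n \<inter> dp_gen deg"
  let ?o = "\<lambda>m. {g \<in> keys m. odd_gen deg g}"
  have A: "finite ?A" "?A \<subseteq> dp_gen deg" by auto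
  have "(\<lambda>(g, h). (h, g)) ` inv_set deg n m \<union> inv_set deg m n = ?o m \<times> ?o n"
  proof (rule Set.set_eqI)
    fix x :: "'a gen \<times> 'a gen"
    obtain g h where x: "x = (g, h)" by (cases x)
    have "g \<noteq> h" if "g \<in> keys m" "h \<in> keys n" "odd_gen deg g"
      using odd_disjoint[OF False] that by auto
    then show "x \<in> (\<lambda>(g, h). (h, g)) ` inv_set deg n m \<union> inv_set deg m n \<longleftrightarrow> x \<in> ?o m \<times> ?o n"
      using gless_total[of g h] by (auto simp: inv_set_def image_iff x)
  qed
  moreover have "(\<lambda>(g, h). (h, g)) ` inv_set deg n m \<inter> inv_set deg m n = {}"
    using gless_asym by (auto simp: inv_set_def)
  moreover have "card ((\<lambda>(g, h). (h, g)) ` inv_set deg n m) = card (inv_set deg n m)"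
    by (rule card_image) (auto simp: inj_on_def)
  ultimately have "card (inv_set deg n m) + card (inv_set deg m n) = card (?o m) * card (?o n)"
    using card_Un_disjoint[of "(\<lambda>(g, h). (h, g)) ` inv_set deg n m" "inv_set deg m n"]
    by (simp add: card_cartesian_product)
  moreover have "\<not> odd_rep deg m" "\<not> odd_rep deg n"
    using False odd_rep_plus(1)[of deg m n] odd_rep_plus(2)[of deg n m] by auto
  ultimately have "even (mdeg deg m * mdeg deg n) = even (card (inv_set deg n m) + card (inv_set deg m n))"
    by (simp add: even_mdeg_iff)
  moreover have "(lookup m g + lookup n g choose lookup m g) = (lookup n g + lookup m g choose lookup n g)" for g
    using binomial_symmetric[of "lookup m g" "lookup m g + lookup n g"] by (simp add: add.commute)
  ultimately show ?thesis
    using False by (auto simp: mono_coeff_alt[OF A(1) _ A(2), of m n] mono_coeff_alt[OF A(1) _ A(2), of n m]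
        sgs_def add.commute[of n m] minus_one_power_iff Int_commute)
qed

text \<open>At the unit, \<open>mono_coeff\<close> vanishes on exponents with a repeated odd
  generator, which would break the unit law there. With the value 1 the algebra axioms hold for all
  exponents, not only for genuine monomials.\<close>

definition mcf :: "('v \<Rightarrow> nat) \<Rightarrow> 'v mono \<Rightarrow> 'v mono \<Rightarrow> 'k::comm_ring_1"
  where "mcf deg m n = (if m = 0 \<or> n = 0 then 1 else mono_coeff deg m n)"

definition mpr :: "('v \<Rightarrow> nat) \<Rightarrow> 'v mono \<Rightarrow> 'v mono \<Rightarrow> ('v mono \<Rightarrow>\<^sub>0 'k::comm_ring_1)"
  where "mpr deg m n = single (m + n) (mcf deg m n)"

lemma keys_mprD: "l \<in> keys (mpr deg m n) \<Longrightarrow> l = m + n"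
  by (auto simp: mpr_def split: if_splits)

global_interpretation Om: salg "mpr deg :: 'v mono \<Rightarrow> 'v mono \<Rightarrow> ('v mono \<Rightarrow>\<^sub>0 'k::comm_ring_1)" "mdeg deg" 0
  for deg :: "'v \<Rightarrow> nat"
proof
  fix a b c n :: "'v mono"
  show "n \<in> keys (mpr deg a b :: _ \<Rightarrow>\<^sub>0 'k) \<Longrightarrow> mdeg deg n = mdeg deg a + mdeg deg b"
    by (auto dest: keys_mprD)
  have "mcf deg a b * mcf deg (a + b) c = (mcf deg b c * mcf deg a (b + c) :: 'k)"
    by (auto simp: mcf_def plus_mono_eq_0 mono_coeff_cocycle)
  then show "lin_ext (\<lambda>x. mpr deg x c) (mpr deg a b) = lin_ext (mpr deg a) (mpr deg b c :: _ \<Rightarrow>\<^sub>0 'k)"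
    by (simp add: mpr_def add.assoc)
  show "mpr deg a b = (sgs (mdeg deg a * mdeg deg b) (mpr deg b a) :: _ \<Rightarrow>\<^sub>0 'k)"
    using mono_coeff_comm[of deg a b, where 'k = 'k]
    by (auto simp: mpr_def mcf_def add.commute sgs_def single_uminus)
  show "mpr deg 0 a = (basis a :: _ \<Rightarrow>\<^sub>0 'k)"
    by (simp add: mpr_def mcf_def)
qed simp

lemma monos_in_odd_rep: "m \<in> monos_in X deg \<longleftrightarrow> keys m \<subseteq> X \<and> \<not> odd_rep deg m"
proof -
  have "(g \<in> keys m \<longrightarrow> lookup m g = 1) \<longleftrightarrow> \<not> 2 \<le> lookup m g" for g
    by (auto simp: in_keys_iff not_le less_2_cases_iff)
  then show ?thesis by (auto simp: monos_in_def odd_rep_def odd_gen_def)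
qed

lemma zero_monos_in [simp]: "0 \<in> monos_in X deg"
  by (simp add: monos_in_def)

lemma mono_coeff_0:
  assumes "m \<in> monos_in X deg"
  shows "mono_coeff deg 0 m = (1 :: 'k::comm_ring_1)" "mono_coeff deg m 0 = (1 :: 'k)"
  using assms mono_coeff_alt[of "{}" 0 m deg, where 'k = 'k] mono_coeff_alt[of "{}" m 0 deg, where 'k = 'k]
  by (auto simp: monos_in_odd_rep inv_set_def)

lemma gmult_eq:
  assumes "x \<in> span_on (monos_in X deg)" "y \<in> span_on (monos_in X deg)"
  shows "gmult deg x y = bilin_ext (mpr deg) x y"
  unfolding gmult_def
  by (rule klinear_eq2_on[where F = "bilin_ext (\<lambda>m n. single (m + n) (mono_coeff deg m n))" and H = "bilin_ext (mpr deg)"])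
    (use assms in \<open>auto simp: span_on_def mpr_def mcf_def mono_coeff_0 subset_iff\<close>)

lemma mpr_monos_in:
  assumes "m \<in> monos_in X deg" "n \<in> monos_in X deg" "l \<in> keys (mpr deg m n :: _ \<Rightarrow>\<^sub>0 'k::comm_ring_1)"
  shows "l \<in> monos_in X deg"
proof -
  have l: "l = m + n" "mcf deg m n \<noteq> (0 :: 'k)"
    using assms(3) by (auto simp: mpr_def split: if_splits)
  then have "\<not> odd_rep deg l"
    using assms(1,2) mono_coeff_alt[of "keys m \<inter> keys n \<inter> dp_gen deg" m n deg, where 'k = 'k]
    by (auto simp: mcf_def monos_in_odd_rep split: if_splits)
  then show ?thesis using l assms by (auto simp: monos_in_odd_rep keys_plus_nat)
qed

declare single_one [simp del]

subsection \<open>Homomorphisms given by families of divided powers\<close>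

definition gmin :: "'v mono \<Rightarrow> 'v gen"
  where "gmin m = (SOME g. g \<in> keys m \<and> (\<forall>h\<in>keys m. h \<noteq> g \<longrightarrow> gless g h))"

lemma ex_gmin:
  assumes "finite A" "A \<noteq> {}"
  shows "\<exists>g\<in>A. \<forall>h\<in>A. h \<noteq> g \<longrightarrow> gless g h"
  using assms
proof (induction A rule: finite_ne_induct)
  case (insert a A)
  then obtain g where g: "g \<in> A" "\<forall>h\<in>A. h \<noteq> g \<longrightarrow> gless g h" by blast
  show ?case
  proof (cases "gless a g")
    case True
    have "gless a h" if "h \<in> A" for h
      using True g that gless_trans[of a g h] by (cases "h = g") auto
    then show ?thesis by auto
  next
    case False
    then have "gless g a" using gless_total[of a g] g(1) insert(3) by auto
    then show ?thesis using g by (intro bexI[of _ g]) auto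
  qed
qed simp

lemma gmin_eq:
  assumes "\<forall>h\<in>keys m. gless g h" "i \<noteq> 0"
  shows "gmin (single g i + m) = g"
  unfolding gmin_def
proof (rule some_equality)
  show "g \<in> keys (single g i + m) \<and> (\<forall>h\<in>keys (single g i + m). h \<noteq> g \<longrightarrow> gless g h)"
    using assms by (auto simp: keys_plus_nat)
  fix h assume "h \<in> keys (single g i + m) \<and> (\<forall>h'\<in>keys (single g i + m). h' \<noteq> h \<longrightarrow> gless h h')"
  then show "h = g" using assms gless_asym by (auto simp: keys_plus_nat)
qed

lemma gmin_in: "m \<noteq> 0 \<Longrightarrow> gmin m \<in> keys m"
  using someI_ex[of "\<lambda>g. g \<in> keys m \<and> (\<forall>h\<in>keys m. h \<noteq> g \<longrightarrow> gless g h)"] ex_gmin[of "keys m"]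
  unfolding gmin_def by force

definition mdrop :: "'v gen \<Rightarrow> 'v mono \<Rightarrow> 'v mono"
  where "mdrop g m = m - single g (lookup m g)"

lemma lookup_mdrop: "lookup (mdrop g m) h = (if h = g then 0 else lookup m h)"
  by (auto simp: mdrop_def lookup_minus lookup_single when_def)

lemma keys_mdrop [simp]: "keys (mdrop g m) = keys m - {g}"
  by (auto simp: in_keys_iff lookup_mdrop split: if_splits)

lemma mdrop_plus: "single g (lookup m g) + mdrop g m = m"
  by (rule poly_mapping_eqI) (auto simp: lookup_add lookup_mdrop lookup_single when_def)

lemma mdrop_single_plus: "g \<notin> keys m \<Longrightarrow> mdrop g (single g i + m) = m"
  by (rule poly_mapping_eqI) (auto simp: lookup_add lookup_mdrop lookup_single when_def in_keys_iff)

text \<open>A generator in front of larger ones is already in order, so neither signs nor binomials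
  occur.\<close>

lemma mpr_single_plus:
  assumes "\<forall>h\<in>keys m. gless g h" "\<not> odd_rep deg (single g i + m)"
  shows "mpr deg (single g i) m = (basis (single g i + m) :: _ \<Rightarrow>\<^sub>0 'k::comm_ring_1)"
proof -
  have "inv_set deg (single g i) m = {}"
    using assms(1) gless_asym by (auto simp: inv_set_def split: if_splits)
  moreover have "keys (single g i) \<inter> keys m \<inter> dp_gen deg \<subseteq> {}"
    using assms(1) by (auto split: if_splits)
  ultimately show ?thesis
    using assms(2) mono_coeff_alt[of "{}" "single g i" m deg, where 'k = 'k] by (simp add: mpr_def mcf_def)
qed

context salg
begin

text \<open>The factors are multiplied in increasing order of the generators, the order in which an
  exponent function stands for a monomial.\<close>

function mono_hom :: "('v gen \<Rightarrow> nat \<Rightarrow> ('b \<Rightarrow>\<^sub>0 'k)) \<Rightarrow> 'v mono \<Rightarrow> ('b \<Rightarrow>\<^sub>0 'k)"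
  where "mono_hom E m = (if m = 0 then basis e
    else mul (E (gmin m) (lookup m (gmin m))) (mono_hom E (mdrop (gmin m) m)))"
  by auto
termination
proof (relation "measure (\<lambda>(E, m). card (keys m))")
  fix m :: "'v mono" assume "m \<noteq> 0"
  then show "((E, mdrop (gmin m) m), E, m) \<in> measure (\<lambda>(E, m). card (keys m))" for E :: "'v gen \<Rightarrow> nat \<Rightarrow> ('b \<Rightarrow>\<^sub>0 'k)"
    using gmin_in[of m] by (simp add: card_gt_0_iff)
qed simp

declare mono_hom.simps [simp del]

lemma mono_hom_0 [simp]: "mono_hom E 0 = basis e"
  by (simp add: mono_hom.simps)

text \<open>The coefficient \<open>mcf\<close> is 1 for a polynomial generator, a binomial for a
  divided power generator and 0 for the square of an odd one, so one condition treats all three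
  kinds of generators.\<close>

definition divpow_family :: "('v \<Rightarrow> nat) \<Rightarrow> ('v gen \<Rightarrow> nat \<Rightarrow> ('b \<Rightarrow>\<^sub>0 'k)) \<Rightarrow> bool"
  where "divpow_family deg E \<longleftrightarrow> (\<forall>g. E g 0 = basis e) \<and> (\<forall>g n. hg (n * gdeg deg g) (E g n)) \<and>
    (\<forall>g i j. mul (E g i) (E g j) = scal (mcf deg (single g i) (single g j)) (E g (i + j)))"

lemma mono_hom_single_plus:
  assumes "\<forall>h\<in>keys m. gless g h" "divpow_family deg E"
  shows "mono_hom E (single g i + m) = mul (E g i) (mono_hom E m)"
proof (cases "i = 0")
  case True
  then show ?thesis using assms by (simp add: divpow_family_def)
next
  case False
  have "g \<notin> keys m" "single g i \<noteq> 0" using assms False by (auto dest: arg_cong[where f = "\<lambda>m. lookup m g"])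
  then show ?thesis
    using False assms gmin_eq[OF assms(1) False] mdrop_single_plus[of g m i]
    by (subst mono_hom.simps) (auto simp: plus_mono_eq_0 lookup_add in_keys_iff)
qed

lemma hg_mono_hom:
  assumes "divpow_family deg E"
  shows "hg (mdeg deg m) (mono_hom E m)"
proof (induction "card (keys m)" arbitrary: m rule: less_induct)
  case less
  show ?case
  proof (cases "m = 0")
    case False
    let ?g = "gmin m"
    have "card (keys (mdrop ?g m)) < card (keys m)"
      using gmin_in[OF False] by (simp add: card_gt_0_iff False)
    from hg_mul[OF _ less[OF this], of "lookup m ?g * gdeg deg ?g" "E ?g (lookup m ?g)"]
    show ?thesis
      using assms False mdeg_plus[of deg "single ?g (lookup m ?g)" "mdrop ?g m"]
      by (subst mono_hom.simps) (simp add: divpow_family_def mdrop_plus)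
  qed (simp add: hg_def)
qed

text \<open>The universal property of the free algebra with divided powers. Splitting the smallest
  generator off both factors needs one exchange, whose sign is the same in source and
  target.\<close>

lemma mono_hom_mpr:
  assumes E: "divpow_family deg E" and "\<not> odd_rep deg m" "\<not> odd_rep deg n"
  shows "lin_ext (mono_hom E) (mpr deg m n) = mul (mono_hom E m) (mono_hom E n)"
  using assms(2,3)
proof (induction "card (keys m \<union> keys n)" arbitrary: m n rule: less_induct)
  case less
  show ?case
  proof (cases "keys m \<union> keys n = {}")
    case True
    then show ?thesis by simp
  next
    case False
    then obtain g where g: "g \<in> keys m \<union> keys n" "\<forall>h\<in>keys m \<union> keys n. h \<noteq> g \<longrightarrow> gless g h"
      using ex_gmin[of "keys m \<union> keys n"] by auto
    define i j m' n' where ij: "i = lookup m g" "j = lookup n g" "m' = mdrop g m" "n' = mdrop g n"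
    have mn: "m = single g i + m'" "n = single g j + n'"
      by (simp_all add: ij mdrop_plus)
    have less_g: "\<forall>h\<in>keys m'. gless g h" "\<forall>h\<in>keys n'. gless g h" "\<forall>h\<in>keys (m' + n'). gless g h"
      using g by (auto simp: ij keys_plus_nat)
    have nrep: "\<not> odd_rep deg m'" "\<not> odd_rep deg n'" "\<not> odd_rep deg (single g i)" "\<not> odd_rep deg (single g j)"
      using less(2,3) odd_rep_plus unfolding mn by blast+
    have "keys m' \<union> keys n' \<subset> keys m \<union> keys n" using g(1) by (auto simp: ij)
    then have ih: "lin_ext (mono_hom E) (mpr deg m' n') = mul (mono_hom E m') (mono_hom E n')"
      using nrep by (intro less(1) psubset_card_mono) auto
    let ?G = "\<lambda>i. basis (single g i) :: _ \<Rightarrow>\<^sub>0 'k"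
    let ?c = "mcf deg (single g i) (single g j) * mcf deg m' n' :: 'k"
    let ?N = "mdeg deg m' * (j * gdeg deg g)"
    \<comment> \<open>If the exponent repeats an odd generator, the product is not the ordered
      monomial; but then one of the two coefficients in \<open>?c\<close> is already zero.\<close>
    have c: "scal ?c (mpr deg (single g (i + j)) (m' + n')) = scal ?c (basis (single g (i + j) + (m' + n')))"
    proof (cases "odd_rep deg (single g (i + j) + (m' + n'))")
      case True
      then obtain h where h: "odd_gen deg h" "2 \<le> lookup (single g (i + j) + (m' + n')) h"
        by (auto simp: odd_rep_def)
      have "mcf deg (single g i) (single g j) = (0 :: 'k) \<or> mcf deg m' n' = (0 :: 'k)"
      proof (cases "h = g")
        case True
        then have r: "odd_rep deg (single g i + single g j)"
          using h by (auto simp: odd_rep_def lookup_add ij lookup_mdrop intro!: exI[of _ g])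
        then have "single g i \<noteq> 0" "single g j \<noteq> 0" using nrep by auto
        then show ?thesis using r mono_coeff_alt[of "keys (single g i) \<inter> keys (single g j) \<inter> dp_gen deg" "single g i" "single g j" deg, where 'k = 'k]
          by (simp add: mcf_def)
      next
        case False
        then have r: "odd_rep deg (m' + n')"
          using h by (auto simp: odd_rep_def lookup_add lookup_single)
        then have "m' \<noteq> 0" "n' \<noteq> 0" using nrep by auto
        then show ?thesis using r mono_coeff_alt[of "keys m' \<inter> keys n' \<inter> dp_gen deg" m' n' deg, where 'k = 'k]
          by (simp add: mcf_def)
      qed
      then show ?thesis by auto
    qed (use mpr_single_plus[OF less_g(3), of deg "i + j", where 'k = 'k] in simp)
    have "mpr deg m n = Om.mul deg (Om.mul deg (?G i) (basis m')) (Om.mul deg (?G j) (basis n'))"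
      using mpr_single_plus[OF less_g(1), of deg i, where 'k = 'k] mpr_single_plus[OF less_g(2), of deg j, where 'k = 'k] less(2,3)
      by (simp add: mn)
    also have "\<dots> = Om.mul deg (?G i) (Om.mul deg (basis m') (Om.mul deg (?G j) (basis n')))"
      by (rule Om.mul_assoc)
    also have "Om.mul deg (basis m') (Om.mul deg (?G j) (basis n')) = sgs ?N (Om.mul deg (?G j) (Om.mul deg (basis m') (basis n')))"
      by (rule Om.mul_left_commute) (auto intro!: Om.hg_basisI)
    also have "Om.mul deg (?G i) (sgs ?N (Om.mul deg (?G j) (Om.mul deg (basis m') (basis n')))) =
       sgs ?N (Om.mul deg (mpr deg (single g i) (single g j)) (mpr deg m' n'))"
      by (simp add: Om.mul_assoc[symmetric])
    also have "\<dots> = sgs ?N (scal ?c (mpr deg (single g (i + j)) (m' + n')))"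
      by (simp add: mpr_def[of deg "single g i"] mpr_def[of deg m'] single_add[symmetric] bilin_ext_def lin_ext_single mult.commute)
    finally have "lin_ext (mono_hom E) (mpr deg m n) = sgs ?N (scal ?c (mul (E g (i + j)) (mono_hom E (m' + n'))))"
      by (simp only: c) (simp add: mono_hom_single_plus[OF less_g(3) E])
    also have "\<dots> = sgs ?N (mul (mul (E g i) (E g j)) (mul (mono_hom E m') (mono_hom E n')))"
      using E unfolding ih[symmetric] by (simp add: divpow_family_def mpr_def lin_ext_single mult.commute)
    also have "\<dots> = mul (E g i) (sgs ?N (mul (E g j) (mul (mono_hom E m') (mono_hom E n'))))"
      by (simp add: mul_assoc)
    also have "sgs ?N (mul (E g j) (mul (mono_hom E m') (mono_hom E n'))) = mul (mono_hom E m') (mul (E g j) (mono_hom E n'))"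
      using E by (intro mul_left_commute[symmetric] hg_mono_hom[OF E]) (simp add: divpow_family_def)
    finally show ?thesis
      by (simp add: mn mono_hom_single_plus[OF less_g(1) E] mono_hom_single_plus[OF less_g(2) E] mul_assoc)
  qed
qed

end

lemma consx_single [simp]: "consx (single a c) (single w d) = single (a # w) (c * d)"
  and tens_single [simp]: "tens (single a c) (single u d) = single (a, u) (c * d)"
  by (simp_all add: consx_def tens_def lin_ext_single)

subsection \<open>Systems of divided powers compatible with the differential\<close>

context augmented_dga
begin

definition "one_u = (basis (e, []) :: 'm \<times> 'm list \<Rightarrow>\<^sub>0 'k)"

lemma one_u_simps [simp]: "um one_u x = x" "um x one_u = x" "Dn one_u = 0" "keys one_u \<subseteq> ncells"
  unfolding one_u_def by (simp_all add: Dn_def DU_basis ncells_def)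

lemma hg_one_u [simp]: "U.T.hg 0 one_u"
  unfolding one_u_def U.T.hg_def by simp

text \<open>\<open>h n\<close> plays the role of the n-th divided power of \<open>h 1\<close>; the
  last condition is the rule of a \<open>\<gamma>\<close>-derivation.\<close>

definition divsys :: "(nat \<Rightarrow> ('m \<times> 'm list \<Rightarrow>\<^sub>0 'k)) \<Rightarrow> bool"
  where "divsys h \<longleftrightarrow> h 0 = one_u \<and> (\<forall>n. keys (h n) \<subseteq> ncells) \<and> (\<forall>n. U.T.hg (2 * n) (h n)) \<and>
    (\<forall>i j. um (h i) (h j) = scal (of_nat ((i + j) choose i)) (h (i + j))) \<and>
    (\<forall>n. Dn (h (Suc n)) = um (h n) (Dn (h 1)))"

lemma divsysD:
  assumes "divsys h"
  shows "h 0 = one_u" "keys (h n) \<subseteq> ncells" "U.T.hg (2 * n) (h n)"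
    "um (h i) (h j) = scal (of_nat ((i + j) choose i)) (h (i + j))" "Dn (h (Suc n)) = um (h n) (Dn (h 1))"
  using assms unfolding divsys_def by blast+

lemma divsys_trivial: "divsys (\<lambda>n. if n = 0 then one_u else 0)"
  unfolding divsys_def
proof (intro conjI allI)
  fix i j :: nat
  show "um (if i = 0 then one_u else 0) (if j = 0 then one_u else 0) =
      scal (of_nat ((i + j) choose i)) (if i + j = 0 then one_u else 0)"
    by (cases i; cases j) simp_all
qed simp_all

lemma um_even_left_commute: "U.T.hg (2 * n) x \<Longrightarrow> um y (um x z) = um x (um y z)"
proof -
  assume x: "U.T.hg (2 * n) x"
  have "um y x = um x y"
  proof (rule klinear_eq[of "\<lambda>y. um y x" "\<lambda>y. um x y"])
    fix m
    show "um (basis m) x = um x (basis m)"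
      unfolding U.T.mul_comm[OF x U.T.hg_basis[of m]] by (simp add: sgs_def)
  qed simp_all
  then show ?thesis by (simp add: U.T.mul_assoc[symmetric])
qed

lemma um_even_commute: "U.T.hg (2 * n) x \<Longrightarrow> um y x = um x y"
  using um_even_left_commute[of n x y one_u] by simp

text \<open>The n-th divided power of x h is x^n times that of h. As \<open>x\<close> is a cycle of
  degree 0, its powers commute with everything and with the differential.\<close>

lemma divsys_mult:
  assumes h: "divsys h" and x: "keys x \<subseteq> ncells" "U.T.hg 0 x" "Dn x = 0"
  shows "divsys (\<lambda>n. ((um x) ^^ n) (h n))"
proof -
  have pw: "((um x) ^^ n) y = um (((um x) ^^ n) one_u) y" for n y
    by (induction n) (simp_all add: U.T.mul_assoc)
  have pw2: "um (((um x) ^^ i) one_u) (((um x) ^^ j) one_u) = ((um x) ^^ (i + j)) one_u" for i j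
    by (simp add: pw[symmetric] funpow_add)
  have hp: "U.T.hg 0 (((um x) ^^ n) one_u)" for n
    by (induction n) (use U.T.hg_mul[OF x(2)] in auto)
  have kp: "keys (((um x) ^^ n) one_u) \<subseteq> ncells" for n
    by (induction n) (use keys_um_ncells[OF x(1)] in auto)
  have dp: "Dn (((um x) ^^ n) one_u) = 0" for n
    by (induction n) (use Dn_mul[OF x(2,1)] kp x in auto)
  have D: "Dn (um (((um x) ^^ n) one_u) (h m)) = um (((um x) ^^ n) one_u) (Dn (h m))" for n m
    using Dn_mul[OF hp kp divsysD(2)[OF h]] dp by simp
  show ?thesis
    unfolding divsys_def
  proof (intro conjI allI)
    fix n i j
    show "((um x) ^^ 0) (h 0) = one_u" using divsysD(1)[OF h] by simp
    show "keys (((um x) ^^ n) (h n)) \<subseteq> ncells"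
      by (subst pw) (intro keys_um_ncells kp divsysD(2)[OF h])
    show "U.T.hg (2 * n) (((um x) ^^ n) (h n))"
      by (subst pw) (use U.T.hg_mul[OF hp divsysD(3)[OF h]] in auto)
    have "um (um (((um x) ^^ i) one_u) (h i)) (um (((um x) ^^ j) one_u) (h j)) =
      um (um (((um x) ^^ i) one_u) (((um x) ^^ j) one_u)) (um (h i) (h j))"
      by (simp add: U.T.mul_assoc um_even_left_commute[OF divsysD(3)[OF h, of i], of "((um x) ^^ j) one_u"])
    then show "um (((um x) ^^ i) (h i)) (((um x) ^^ j) (h j)) = scal (of_nat ((i + j) choose i)) (((um x) ^^ (i + j)) (h (i + j)))"
      unfolding pw[of i "h i"] pw[of j "h j"] pw[of "i + j" "h (i + j)"] pw2 by (simp add: divsysD(4)[OF h])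
    have "Dn (((um x) ^^ Suc n) (h (Suc n))) = um (((um x) ^^ Suc n) one_u) (um (h n) (Dn (h 1)))"
      unfolding pw[of "Suc n" "h (Suc n)"] D divsysD(5)[OF h] ..
    also have "\<dots> = um (um (((um x) ^^ n) one_u) (h n)) (um x (Dn (h 1)))"
      using um_even_left_commute[OF divsysD(3)[OF h, of n], of x, symmetric]
        um_even_left_commute[of 0 x "((um x) ^^ n) one_u"] x(2) by (simp add: U.T.mul_assoc)
    finally show "Dn (((um x) ^^ Suc n) (h (Suc n))) = um (((um x) ^^ n) (h n)) (Dn (((um x) ^^ 1) (h 1)))"
      using D[of 1 1] by (simp add: pw[of n "h n"])
  qed
qed

text \<open>Collects the pairs with the same sum k, so that the factors coming from one system can
  be combined.\<close>

lemma sum_antidiagonal_product: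
  fixes f :: "nat \<Rightarrow> nat \<Rightarrow> nat \<Rightarrow> nat \<Rightarrow> 'c::comm_monoid_add"
  shows "(\<Sum>i\<le>m. \<Sum>j\<le>n. f i (m - i) j (n - j)) =
    (\<Sum>k\<le>m + n. \<Sum>i\<in>{i. i \<le> m \<and> i \<le> k \<and> k - i \<le> n}. f i (m - i) (k - i) (n - (k - i)))"
  unfolding sum.cartesian_product sum.Sigma[OF finite_atMost]
  by (subst sum.Sigma, simp, simp,
      rule sum.reindex_bij_witness[where i = "\<lambda>(k, i). (i, k - i)" and j = "\<lambda>(i, j). (i + j, i)"]) auto

lemma vandermonde_restricted:
  assumes "k \<le> m + n"
  shows "(\<Sum>i\<in>{i. i \<le> m \<and> i \<le> k \<and> k - i \<le> n}. (k choose i) * ((m + n - k) choose (m - i))) = ((m + n) choose m)"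
proof -
  have "(\<Sum>i\<in>{i. i \<le> m \<and> i \<le> k \<and> k - i \<le> n}. (k choose i) * ((m + n - k) choose (m - i))) =
    (\<Sum>i\<le>m. (k choose i) * ((m + n - k) choose (m - i)))"
    by (rule sum.mono_neutral_left) (use assms in \<open>auto simp: not_le binomial_eq_0\<close>)
  also have "\<dots> = ((k + (m + n - k)) choose m)"
    by (rule vandermonde)
  finally show ?thesis using assms by simp
qed

text \<open>Divided powers of a sum are the convolution of the divided powers. The binomials combine
  by Vandermonde's identity, and the derivation rule passes through the convolution by an index
  shift.\<close>

lemma divsys_add:
  assumes h: "divsys h" and g: "divsys g"
  shows "divsys (\<lambda>n. \<Sum>i\<le>n. um (h i) (g (n - i)))" (is "divsys ?s")
  unfolding divsys_def
proof (intro conjI allI)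
  fix n m :: nat
  show "?s 0 = one_u" by (simp add: divsysD(1)[OF h] divsysD(1)[OF g])
  show "keys (?s n) \<subseteq> ncells"
    by (rule order_trans[OF keys_sum]) (use keys_um_ncells divsysD(2)[OF h] divsysD(2)[OF g] in blast)
  show "U.T.hg (2 * n) (?s n)"
    by (rule U.T.hg_sum) (use U.T.hg_mul[OF divsysD(3)[OF h] divsysD(3)[OF g]] in \<open>metis atMost_iff le_add_diff_inverse distrib_left\<close>)
  have four: "um (um (h i) (g i')) (um (h j) (g j')) =
      scal (of_nat (((i + j) choose i) * ((i' + j') choose i'))) (um (h (i + j)) (g (i' + j')))" for i i' j j'
  proof -
    have "um (um (h i) (g i')) (um (h j) (g j')) = um (um (h i) (h j)) (um (g i') (g j'))"
      by (simp add: U.T.mul_assoc um_even_left_commute[OF divsysD(3)[OF h, of j], of "g i'"])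
    then show ?thesis by (simp add: divsysD(4)[OF h] divsysD(4)[OF g] mult.commute)
  qed
  have "um (?s m) (?s n) = (\<Sum>i\<le>m. \<Sum>j\<le>n. um (um (h i) (g (m - i))) (um (h j) (g (n - j))))"
    by (simp only: bilin_ext_sum(1)) (simp only: bilin_ext_sum(2))
  also have "\<dots> = (\<Sum>k\<le>m + n. \<Sum>i\<in>{i. i \<le> m \<and> i \<le> k \<and> k - i \<le> n}.
      um (um (h i) (g (m - i))) (um (h (k - i)) (g (n - (k - i)))))"
    by (rule sum_antidiagonal_product[of "\<lambda>i i' j j'. um (um (h i) (g i')) (um (h j) (g j'))"])
  also have "\<dots> = (\<Sum>k\<le>m + n. \<Sum>i\<in>{i. i \<le> m \<and> i \<le> k \<and> k - i \<le> n}.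
      scal (of_nat ((k choose i) * ((m + n - k) choose (m - i)))) (um (h k) (g (m + n - k))))"
    by (intro sum.cong refl) (auto simp: four)
  also have "\<dots> = (\<Sum>k\<le>m + n. scal (of_nat ((m + n) choose m)) (um (h k) (g (m + n - k))))"
  proof (rule sum.cong[OF refl])
    fix k assume "k \<in> {..m + n}"
    then have "scal (\<Sum>i\<in>{i. i \<le> m \<and> i \<le> k \<and> k - i \<le> n}. of_nat ((k choose i) * ((m + n - k) choose (m - i)))) x =
        scal (of_nat ((m + n) choose m)) x" for x :: "'m \<times> 'm list \<Rightarrow>\<^sub>0 'k"
      using vandermonde_restricted[of k m n] by (simp only: of_nat_sum[symmetric] atMost_iff)
    moreover have "scal (\<Sum>i\<in>A. c i) x = (\<Sum>i\<in>A. scal (c i) x)" for A :: "nat set" and c and x :: "'m \<times> 'm list \<Rightarrow>\<^sub>0 'k"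
      by (induction A rule: infinite_finite_induct) (simp_all add: scal_add_left)
    ultimately show "(\<Sum>i\<in>{i. i \<le> m \<and> i \<le> k \<and> k - i \<le> n}.
      scal (of_nat ((k choose i) * ((m + n - k) choose (m - i)))) (um (h k) (g (m + n - k)))) =
      scal (of_nat ((m + n) choose m)) (um (h k) (g (m + n - k)))" by metis
  qed
  finally show "um (?s m) (?s n) = scal (of_nat ((m + n) choose m)) (?s (m + n))"
    by (simp add: scal_sum)
  have D: "Dn (um (h i) (g j)) = um (Dn (h i)) (g j) + um (h i) (Dn (g j))" for i j
    using Dn_mul[OF divsysD(3)[OF h] divsysD(2)[OF h] divsysD(2)[OF g], of i j] by (simp add: sgs_def)
  have "Dn (?s (Suc n)) = (\<Sum>i\<le>Suc n. um (Dn (h i)) (g (Suc n - i))) + (\<Sum>i\<le>Suc n. um (h i) (Dn (g (Suc n - i))))"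
    by (simp only: klinearD(7)[OF klinear_Dn[OF klinear_rules(1)]] D sum.distrib)
  \<comment> \<open>The term i = 0 vanishes, since \<open>h 0\<close> is the unit; this permits the
    shift.\<close>
  also have "(\<Sum>i\<le>Suc n. um (Dn (h i)) (g (Suc n - i))) = (\<Sum>i\<le>n. um (Dn (h (Suc i))) (g (n - i)))"
    by (simp only: sum.atMost_Suc_shift) (simp add: divsysD(1)[OF h])
  also have "\<dots> = um (?s n) (Dn (h 1))"
    unfolding bilin_ext_sum
    by (intro sum.cong refl) (simp only: divsysD(5)[OF h] U.T.mul_assoc um_even_commute[OF divsysD(3)[OF g], of "Dn (h 1)"])
  also have "(\<Sum>i\<le>Suc n. um (h i) (Dn (g (Suc n - i)))) = (\<Sum>i\<le>n. um (h i) (Dn (g (Suc (n - i)))))"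
    by (simp add: divsysD(1)[OF g] Suc_diff_le)
  also have "\<dots> = um (?s n) (Dn (g 1))"
    unfolding bilin_ext_sum by (intro sum.cong refl) (simp only: divsysD(5)[OF g] U.T.mul_assoc)
  finally show "Dn (?s (Suc n)) = um (?s n) (Dn (?s 1))"
    using D[of 0 1] D[of 1 0] by (simp add: divsysD(1)[OF h] divsysD(1)[OF g])
qed

lemma tens_e_mul: "um (tens (basis e) x) (tens (basis e) y) = tens (basis e) (sm x y)"
  by (rule klinear_eq2_on[where F = "\<lambda>x y. um (tens (basis e) x) (tens (basis e) y)" and H = "\<lambda>x y. tens (basis e) (sm x y)"])
    (auto simp: tpr_pair)

text \<open>With even weight every shuffle of equal letters has sign +, so the coefficient counts
  shuffles.\<close>

lemma shp_replicate:
  assumes "even (s y)"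
  shows "shp s (replicate i y) (replicate j y) = (scal (of_nat ((i + j) choose i)) (basis (replicate (i + j) y)) :: 'm list \<Rightarrow>\<^sub>0 'k)"
proof (induction "i + j" arbitrary: i j)
  case (Suc n)
  show ?case
  proof (cases "i = 0 \<or> j = 0")
    case False
    then obtain i' j' where ij: "i = Suc i'" "j = Suc j'" by (meson not0_implies_Suc)
    have "n = i' + j" "n = i + j'" using Suc(2) ij by auto
    from Suc(1)[OF this(1)] Suc(1)[OF this(2)] have
      "shp s (replicate i y) (replicate j y) = scal (of_nat ((i' + j) choose i') + of_nat ((i + j') choose i)) (basis (replicate (i + j) y) :: 'm list \<Rightarrow>\<^sub>0 'k)"
      using assms by (simp add: ij sgs_def scal_add_left single_add[symmetric])
    also have "of_nat ((i' + j) choose i') + of_nat ((i + j') choose i) = (of_nat ((i + j) choose i) :: 'k)"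
      unfolding of_nat_add[symmetric] by (simp add: ij)
    finally show ?thesis .
  qed auto
qed simp

text \<open>An odd letter has even weight in the bar construction. Merges vanish with
  \<open>pr y y\<close>, the two detached letters are equal and cancel, and only the differential of
  a single letter remains.\<close>

lemma divsys_odd_letter:
  assumes y: "y \<in> S" "odd (dg y)" "dg y = 1" "pr y y = 0"
  shows "divsys (\<lambda>n. basis (e, replicate n y))"
    and "Dn (basis (e, [y])) = - tens (basis e) (nrl (consx (bd y) (basis [])))"
proof -
  have ne: "y \<noteq> e" using y by auto
  have t: "td (replicate (Suc n) y) = - sm (basis (replicate n y)) (consx (bd y) (basis []))" for n
  proof (induction n)
    case (Suc n)
    have "mh y (basis (replicate (Suc n) y)) = 0" using y(4) by simp
    moreover have "sm (basis (replicate (Suc n) y)) (consx x (basis [])) =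
        consx (basis y) (sm (basis (replicate n y)) (consx x (basis []))) + consx x (basis (replicate (Suc n) y))" for x :: "'m \<Rightarrow>\<^sub>0 'k"
      by (rule klinear_eq[of "\<lambda>x. sm (basis (replicate (Suc n) y)) (consx x (basis []))"])
        (use y(2) in \<open>auto simp: sgs_def wdg_def sum_list_replicate\<close>)
    ultimately show ?case
      using Suc y(2) by (subst replicate_Suc, subst td_simps) (simp add: sgs_def)
  qed (use y in \<open>simp add: sgs_def\<close>)
  have lr: "rgt (replicate (Suc n) y) = lft (replicate (Suc n) y)" for n
    using y(2) rgt_simps(2)[of "replicate n y" y] by (simp add: replicate_append_same sgs_def)
  have ph: "phi (replicate (Suc n) y) = um (basis (e, replicate n y)) (phi [y])" for n
  proof -
    have "phi (replicate (Suc n) y) = - tens (basis e) (sm (basis (replicate n y)) (consx (bd y) (basis [])))" for n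
      unfolding phi_def t lr by simp
    from this[of n] this[of 0] show ?thesis using tens_e_mul[of "basis (replicate n y)" "consx (bd y) (basis [])"] by simp
  qed
  have n: "nrm (basis (e, replicate n y)) = basis (e, replicate n y)" for n
    using ne by (simp add: nrm_basis)
  have D: "Dn (basis (e, u)) = nrm (phi u)" for u by (simp add: Dn_def DU_basis)
  show "divsys (\<lambda>n. basis (e, replicate n y))"
    unfolding divsys_def
  proof (intro conjI allI)
    fix n i j
    show "basis (e, replicate 0 y) = one_u" by (simp add: one_u_def)
    show "keys (basis (e, replicate n y) :: _ \<Rightarrow>\<^sub>0 'k) \<subseteq> ncells" using y ne by (auto simp: ncells_def)
    show "U.T.hg (2 * n) (basis (e, replicate n y))"
      by (rule U.T.hg_basisI) (simp add: wdg_def sum_list_replicate y(3))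
    show "um (basis (e, replicate i y)) (basis (e, replicate j y)) = scal (of_nat ((i + j) choose i)) (basis (e, replicate (i + j) y))"
      using tens_e_mul[of "basis (replicate i y)" "basis (replicate j y)"] shp_replicate[of y i j] y(2)
        klinearD(2)[OF klinear_tens(2)[OF klinear_rules(1)], of "basis e" _ "basis (replicate (i + j) y)"] by simp
    show "Dn (basis (e, replicate (Suc n) y)) = um (basis (e, replicate n y)) (Dn (basis (e, replicate 1 y)))"
      unfolding D ph nrm_um n by simp
  qed
  show "Dn (basis (e, [y])) = - tens (basis e) (nrl (consx (bd y) (basis [])))"
    using t[of 0] lr[of 0] by (simp add: D phi_def nrm_tens)
qed

text \<open>The divided powers of the word \<open>ab\<close> in two even letters are the alternating words \<open>abab\<dots>ab\<close>.\<close>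

fun alt :: "'m \<Rightarrow> 'm \<Rightarrow> nat \<Rightarrow> 'm list"
  where "alt a b 0 = []" | "alt a b (Suc n) = a # b # alt a b n"

text \<open>The pair ab has even weight although each letter has odd weight: shuffles that tear
  pairs apart cancel, and the others are counted by binomials. The words starting with
  \<open>b\<close> make the induction on first letters close up.\<close>

lemma shp_alt:
  assumes "even (dg a)" "even (dg b)"
  shows "shp s (alt a b i) (alt a b j) = (scal (of_nat ((i + j) choose i)) (basis (alt a b (i + j))) :: 'm list \<Rightarrow>\<^sub>0 'k)"
    and "shp s (b # alt a b i) (alt a b j) = (scal (of_nat ((i + j) choose i)) (basis (b # alt a b (i + j))) :: 'm list \<Rightarrow>\<^sub>0 'k)"
    and "shp s (alt a b i) (b # alt a b j) = (scal (of_nat ((i + j) choose i)) (basis (b # alt a b (i + j))) :: 'm list \<Rightarrow>\<^sub>0 'k)"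
    and "shp s (b # alt a b i) (b # alt a b j) = (0 :: 'm list \<Rightarrow>\<^sub>0 'k)"
proof (induction "i + j" arbitrary: i j rule: less_induct)
  case less
  have ev: "even (wdg s (alt a b n))" for n by (induction n) (use assms in auto)
  note IH = less
  have 1: "shp s (alt a b i) (alt a b j) = (scal (of_nat ((i + j) choose i)) (basis (alt a b (i + j))) :: 'm list \<Rightarrow>\<^sub>0 'k)"
  proof (cases "i = 0 \<or> j = 0")
    case False
    then obtain i' j' where ij: "i = Suc i'" "j = Suc j'" by (meson not0_implies_Suc)
    have "shp s (alt a b i) (alt a b j) = (consx (basis a) (shp s (b # alt a b i') (alt a b j)) + consx (basis a) (shp s (alt a b i) (b # alt a b j')) :: 'm list \<Rightarrow>\<^sub>0 'k)"
      using ev[of i] assms by (simp add: ij sgs_def)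
    also have "\<dots> = scal (of_nat ((i' + j) choose i') + of_nat ((i + j') choose i)) (basis (alt a b (i + j)))"
      using IH(2)[of i' j] IH(3)[of i j'] by (simp add: ij scal_add_left single_add[symmetric])
    also have "of_nat ((i' + j) choose i') + of_nat ((i + j') choose i) = (of_nat ((i + j) choose i) :: 'k)"
      unfolding of_nat_add[symmetric] by (simp add: ij)
    finally show ?thesis .
  qed auto
  then show "shp s (alt a b i) (alt a b j) = (scal (of_nat ((i + j) choose i)) (basis (alt a b (i + j))) :: 'm list \<Rightarrow>\<^sub>0 'k)" .
  show 2: "shp s (b # alt a b i) (alt a b j) = (scal (of_nat ((i + j) choose i)) (basis (b # alt a b (i + j))) :: 'm list \<Rightarrow>\<^sub>0 'k)"
  proof (cases j)
    case (Suc j')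
    then show ?thesis using 1 IH(4)[of i j'] ev[of i] assms by (simp add: sgs_def)
  qed simp
  have "shp s (alt a b i) (b # alt a b j) = (shp s (b # alt a b j) (alt a b i) :: 'm list \<Rightarrow>\<^sub>0 'k)"
    using shp_comm[of s "alt a b i" "b # alt a b j", where 'k = 'k] ev[of i] by (simp add: sgs_def)
  moreover have "shp s (b # alt a b j) (alt a b i) = (scal (of_nat ((j + i) choose j)) (basis (b # alt a b (j + i))) :: 'm list \<Rightarrow>\<^sub>0 'k)"
  proof (cases i)
    case (Suc i')
    have "shp s (alt a b j) (alt a b i) = (scal (of_nat ((i + j) choose i)) (basis (alt a b (i + j))) :: 'm list \<Rightarrow>\<^sub>0 'k)"
      using 1 shp_comm[of s "alt a b j" "alt a b i", where 'k = 'k] ev[of i] by (simp add: sgs_def)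
    then show ?thesis using IH(4)[of j i'] ev[of j] assms Suc binomial_symmetric[of j "j + i"]
      by (simp add: sgs_def add.commute)
  qed simp
  ultimately show 3: "shp s (alt a b i) (b # alt a b j) = (scal (of_nat ((i + j) choose i)) (basis (b # alt a b (i + j))) :: 'm list \<Rightarrow>\<^sub>0 'k)"
    using binomial_symmetric[of j "j + i"] by (simp add: add.commute)
  show "shp s (b # alt a b i) (b # alt a b j) = (0 :: 'm list \<Rightarrow>\<^sub>0 'k)"
    using 2 3 ev[of i] assms by (simp add: sgs_def)
qed

text \<open>The differential of [a|b] is the failure of the Leibniz rule for the assignment of [f]
  to f, so this word repairs products.\<close>

lemma divsys_alt:
  assumes a: "a \<in> S" "a \<noteq> e" "dg a = 0" and b: "b \<in> S" "b \<noteq> e" "dg b = 0"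
  shows "divsys (\<lambda>n. basis (e, alt a b n))"
    and "Dn (basis (e, [a, b])) = basis (a, [b]) + basis (b, [a]) - tens (basis e) (consx (pr a b) (basis []))"
proof -
  have bd: "bd a = 0" "bd b = 0" using bd_pos[of a] bd_pos[of b] a b by auto
  have wd: "wdg s (alt a b n) = 2 * n" for n by (induction n) (use a b in auto)
  have comm: "pr b a = pr a b" using A.pr_comm[of b a] a by simp
  have sl: "sm (basis (c # u)) (consx x (basis [])) = consx (basis c) (sm (basis u) (consx x (basis []))) + sgs (wdg s (c # u)) (consx x (basis (c # u)))"
    if "A.hg 0 x" for c u and x :: "'m \<Rightarrow>\<^sub>0 'k"
    by (rule klinear_eq_on[of "\<lambda>x. sm (basis (c # u)) (consx x (basis []))"]) (use that in \<open>auto simp: A.hg_def\<close>)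
  have hg: "A.hg 0 (pr a b)" using A.hg_pr[of a b] a b by simp
  have t: "td (alt a b (Suc n)) = - sm (basis (alt a b n)) (consx (pr a b) (basis []))" for n
  proof (induction n)
    case 0
    then show ?case using a b bd by (simp add: sgs_def)
  next
    case (Suc n)
    have "td (b # alt a b (Suc n)) = sm (basis (b # alt a b n)) (consx (pr a b) (basis []))"
      unfolding td_simps(2) Suc sl[OF hg] using a b bd comm wd[of n] by (simp add: sgs_def)
    then have "td (alt a b (Suc (Suc n))) = - (consx (pr a b) (basis (alt a b (Suc n))) + consx (basis a) (sm (basis (b # alt a b n)) (consx (pr a b) (basis []))))"
      using a bd by (simp add: sgs_def)
    also have "\<dots> = - sm (basis (alt a b (Suc n))) (consx (pr a b) (basis []))"
      unfolding alt.simps(2)[of a b n] sl[OF hg, of a] using a b wd[of n] by (simp add: sgs_def)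
    finally show ?case .
  qed
  have alt_snoc: "alt a b (Suc n) = (alt a b n @ [a]) @ [b]" for n by (induction n) auto
  have ga: "shp s (alt a b n) [a] = (basis (alt a b n @ [a]) :: 'm list \<Rightarrow>\<^sub>0 'k)" for n
    by (induction n) (use a b wd in \<open>auto simp: sgs_def\<close>)
  have gb: "shp s (alt a b n) [b] = (basis (b # alt a b n) :: 'm list \<Rightarrow>\<^sub>0 'k)" for n
    using shp_alt(3)[of a b n 0] a b by simp
  \<comment> \<open>The last letter moves past an odd total weight, so its wrap-around sign is
    negative and both detached letters appear with +.\<close>
  have ph: "phi (alt a b (Suc n)) = tens (basis e) (td (alt a b (Suc n))) + basis (a, b # alt a b n) + basis (b, alt a b n @ [a])" for n
    using rgt_simps(2)[of "alt a b n @ [a]" b] a b wd[of n] unfolding phi_def alt_snoc[symmetric] by (simp add: sgs_def)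
  have phm: "phi (alt a b (Suc n)) = um (basis (e, alt a b n)) (phi (alt a b (Suc 0)))" for n
  proof -
    have "um (basis (e, alt a b n)) (tens (basis e) (td (alt a b (Suc 0)))) = tens (basis e) (td (alt a b (Suc n)))"
      using tens_e_mul[of "basis (alt a b n)" "td (alt a b (Suc 0))"] unfolding t by simp
    then show ?thesis
      unfolding ph using ga[of n] gb[of n] a b by (simp add: tpr_pair)
  qed
  have ne: "e \<notin> set (alt a b n)" "set (alt a b n) \<subseteq> S" for n by (induction n) (use a b in auto)
  have n: "nrm (basis (e, alt a b n)) = basis (e, alt a b n)" for n
    using ne by (simp add: nrm_basis)
  have D: "Dn (basis (e, u)) = nrm (phi u)" for u by (simp add: Dn_def DU_basis)
  show "divsys (\<lambda>n. basis (e, alt a b n))"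
    unfolding divsys_def
  proof (intro conjI allI)
    fix n i j
    show "basis (e, alt a b 0) = one_u" by (simp add: one_u_def)
    show "keys (basis (e, alt a b n) :: _ \<Rightarrow>\<^sub>0 'k) \<subseteq> ncells" using ne by (auto simp: ncells_def)
    show "U.T.hg (2 * n) (basis (e, alt a b n))"
      by (rule U.T.hg_basisI) (simp add: wd)
    show "um (basis (e, alt a b i)) (basis (e, alt a b j)) = scal (of_nat ((i + j) choose i)) (basis (e, alt a b (i + j)))"
      using tens_e_mul[of "basis (alt a b i)" "basis (alt a b j)"] shp_alt(1)[of a b i j] a b
        klinearD(2)[OF klinear_tens(2)[OF klinear_rules(1)], of "basis e" _ "basis (alt a b (i + j))"] by simp
    show "Dn (basis (e, alt a b (Suc n))) = um (basis (e, alt a b n)) (Dn (basis (e, alt a b 1)))"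
      unfolding D phm[of n] nrm_um n by simp
  qed
  have "nrl (consx (pr a b) (basis [])) = consx (pr a b) (basis [])"
    by (subst nrl_consx) (use e_pr[of a b] a in \<open>auto simp: nrl_basis\<close>)
  then show "Dn (basis (e, [a, b])) = basis (a, [b]) + basis (b, [a]) - tens (basis e) (consx (pr a b) (basis []))"
    using ph[of 0] t[of 0] a b by (simp add: D nrm_tens nrm_basis bd sgs_def)
qed

end

section \<open>The comparison map\<close>

text \<open>The given derivations are linear only on the algebra, a submodule of all finitely
  supported functions; this turns them into linear extensions of their values on basis
  elements.\<close>

lemma additive_on_span:
  assumes add: "\<And>x y. keys x \<subseteq> M \<Longrightarrow> keys y \<subseteq> M \<Longrightarrow> f (x + y) = f x + f y"
    and scal: "\<And>c x. keys x \<subseteq> M \<Longrightarrow> f (scal c x) = scal c (f x)"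
    and x: "keys x \<subseteq> M"
  shows "f x = lin_ext (\<lambda>m. if m \<in> M then f (basis m) else 0) (x :: 'b \<Rightarrow>\<^sub>0 'k::comm_ring_1)"
proof -
  have f0: "f 0 = 0" using scal[of 0 0] by simp
  have sum: "f (\<Sum>m\<in>A. scal (c m) (basis m)) = (\<Sum>m\<in>A. scal (c m) (f (basis m)))" if "finite A" "A \<subseteq> M" for A and c :: "'b \<Rightarrow> 'k"
    using that
  proof (induction A rule: finite_induct)
    case (insert m A)
    have "keys (\<Sum>m\<in>A. scal (c m) (basis m)) \<subseteq> M"
      by (rule order_trans[OF keys_sum]) (use insert keys_scal in fastforce)
    moreover have "keys (scal (c m) (basis m)) \<subseteq> M"
      using insert keys_scal[of "c m" "basis m"] by auto
    ultimately show ?case using insert by (simp add: add scal del: scal_single)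
  qed (simp add: f0)
  show ?thesis
    unfolding lin_ext_def
    by (subst poly_mapping_decomp[of x], subst sum) (use x in \<open>auto intro!: sum.cong\<close>)
qed

lemma free_algebra_simps [simp]:
  "carrier (free_algebra X deg) = span_on (monos_in X deg)" "monoid.mult (free_algebra X deg) = gmult deg"
  "monoid.one (free_algebra X deg) = basis 0" "ring.zero (free_algebra X deg) = 0" "ring.add (free_algebra X deg) = (+)"
  "smult (free_algebra X deg) = scal" "hpart (free_algebra X deg) n = span_on {m \<in> monos_in X deg. int (mdeg deg m) = n}"
  by (simp_all add: free_algebra_def)

lemma free_derivation:
  fixes \<theta> :: "('v mono \<Rightarrow>\<^sub>0 'k::comm_ring_1) \<Rightarrow> ('v mono \<Rightarrow>\<^sub>0 'k)"
  assumes \<theta>: "graded_derivation (free_algebra X deg) k \<theta>" "odd k"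
  defines "M \<equiv> monos_in X deg"
  shows "keys x \<subseteq> M \<Longrightarrow> keys (\<theta> x) \<subseteq> M"
    and "keys x \<subseteq> M \<Longrightarrow> \<theta> x = lin_ext (\<lambda>m. if m \<in> M then \<theta> (basis m) else 0) x"
    and "m \<in> M \<Longrightarrow> n \<in> keys (\<theta> (basis m)) \<Longrightarrow> int (mdeg deg n) = int (mdeg deg m) + k"
    and "m \<in> M \<Longrightarrow> keys y \<subseteq> M \<Longrightarrow> \<theta> (Om.mul deg (basis m) y) =
      Om.mul deg (\<theta> (basis m)) y + sgs (mdeg deg m) (Om.mul deg (basis m) (\<theta> y))"
proof -
  show c: "keys x \<subseteq> M \<Longrightarrow> keys (\<theta> x) \<subseteq> M" for x
    using \<theta>(1) by (auto simp: graded_derivation_def span_on_def M_def)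
  show "keys x \<subseteq> M \<Longrightarrow> \<theta> x = lin_ext (\<lambda>m. if m \<in> M then \<theta> (basis m) else 0) x"
    by (rule additive_on_span) (use \<theta>(1) in \<open>auto simp: graded_derivation_def span_on_def M_def\<close>)
  show "int (mdeg deg n) = int (mdeg deg m) + k" if "m \<in> M" "n \<in> keys (\<theta> (basis m))" for m n
  proof -
    have "basis m \<in> hpart (free_algebra X deg) (int (mdeg deg m))"
      using that by (simp add: span_on_def M_def)
    then have "\<theta> (basis m) \<in> hpart (free_algebra X deg) (int (mdeg deg m) + k)"
      using \<theta>(1) unfolding graded_derivation_def by blast
    then show ?thesis using that by (auto simp: span_on_def)
  qed
  show "\<theta> (Om.mul deg (basis m) y) =
      Om.mul deg (\<theta> (basis m)) y + sgs (mdeg deg m) (Om.mul deg (basis m) (\<theta> y))" if "m \<in> M" "keys y \<subseteq> M" for m y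
  proof -
    have h: "basis m \<in> hpart (free_algebra X deg) (int (mdeg deg m))" "y \<in> carrier (free_algebra X deg)"
      using that by (simp_all add: span_on_def M_def)
    have L: "\<forall>n. \<forall>x\<in>hpart (free_algebra X deg) n. \<forall>y\<in>carrier (free_algebra X deg).
       \<theta> (x \<otimes>\<^bsub>free_algebra X deg\<^esub> y) = (\<theta> x \<otimes>\<^bsub>free_algebra X deg\<^esub> y) \<oplus>\<^bsub>free_algebra X deg\<^esub>
         ((if even (k * n) then 1 else -1) \<odot>\<^bsub>free_algebra X deg\<^esub> (x \<otimes>\<^bsub>free_algebra X deg\<^esub> \<theta> y))"
      using \<theta>(1) unfolding graded_derivation_def by blast
    have "\<theta> (gmult deg (basis m) y) = gmult deg (\<theta> (basis m)) y + scal (if even (k * int (mdeg deg m)) then 1 else -1) (gmult deg (basis m) (\<theta> y))"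
      using L[rule_format, OF h] by simp
    moreover have "gmult deg (basis m) y = Om.mul deg (basis m) y" "gmult deg (\<theta> (basis m)) y = Om.mul deg (\<theta> (basis m)) y"
      "gmult deg (basis m) (\<theta> y) = Om.mul deg (basis m) (\<theta> y)"
      using that c[of y] c[of "basis m"] by (auto intro!: gmult_eq[of _ X] simp: span_on_def M_def)
    ultimately show ?thesis using \<theta>(2) by (auto simp: sgs_def)
  qed
qed

locale low_degree =
  fixes G :: "'v set" and deg :: "'v \<Rightarrow> nat"
    and bd d \<delta> :: "('v mono \<Rightarrow>\<^sub>0 'k::comm_ring_1) \<Rightarrow> ('v mono \<Rightarrow>\<^sub>0 'k)"
  assumes deg_less: "\<forall>v\<in>G. deg v < 2"
    and bd: "chain_differential (Lambda G deg) bd"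
    and d: "gamma_derivation G deg 1 d"
    and d_Gen: "\<forall>v\<in>G. d (gvar (Gen v)) = gvar (DGen v)"
    and \<delta>: "gamma_derivation G deg (-1) \<delta>"
    and \<delta>_bd: "\<forall>a\<in>carrier (Lambda G deg). \<delta> a = bd a"
    and \<delta>_DGen: "\<forall>v\<in>G. \<delta> (gvar (DGen v)) = - d (bd (gvar (Gen v)))"
begin

definition lam :: "'v mono set" where "lam = monos_in (Gen ` G) deg"
definition om :: "'v mono set" where "om = monos_in (Gen ` G \<union> DGen ` G) deg"
text \<open>Nothing is known of \<open>bd\<close> outside Lambda V; the value zero there keeps
  \<open>bd_dg\<close> true for all exponents.\<close>

definition bdm :: "'v mono \<Rightarrow> ('v mono \<Rightarrow>\<^sub>0 'k)" where "bdm m = (if m \<in> lam then bd (basis m) else 0)"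

lemma lam_om: "lam \<subseteq> om"
  by (auto simp: lam_def om_def monos_in_def)

lemma bd_deriv: "graded_derivation (free_algebra (Gen ` G) deg) (-1) bd"
  using bd by (simp add: chain_differential_def Lambda_def)

lemma d_deriv: "graded_derivation (free_algebra (Gen ` G \<union> DGen ` G) deg) 1 d"
  using d by (simp add: gamma_derivation_def Lambda_Gamma_def)

lemma \<delta>_deriv: "graded_derivation (free_algebra (Gen ` G \<union> DGen ` G) deg) (-1) \<delta>"
  using \<delta> by (simp add: gamma_derivation_def Lambda_Gamma_def)

lemmas bd_facts = free_derivation[OF bd_deriv, folded lam_def, simplified]
lemmas d_facts = free_derivation[OF d_deriv, folded om_def, simplified]
lemmas \<delta>_facts = free_derivation[OF \<delta>_deriv, folded om_def, simplified]

lemma bd_lin: "keys x \<subseteq> lam \<Longrightarrow> bd x = lin_ext bdm x"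
  using bd_facts(2)[of x] by (simp add: bdm_def[abs_def])

sublocale augmented_dga "mpr deg :: 'v mono \<Rightarrow> 'v mono \<Rightarrow> ('v mono \<Rightarrow>\<^sub>0 'k)" "mdeg deg" 0 bdm lam
proof unfold_locales
  show "mdeg deg a = Suc (mdeg deg x)" if "x \<in> keys (bdm a)" for x a
    using bd_facts(3)[of a x] that by (auto simp: bdm_def split: if_splits)
  show "0 \<in> lam" by (simp add: lam_def)
  show pr: "a \<in> lam \<Longrightarrow> b \<in> lam \<Longrightarrow> x \<in> keys (mpr deg a b :: _ \<Rightarrow>\<^sub>0 'k) \<Longrightarrow> x \<in> lam" for a b x
    using mpr_monos_in unfolding lam_def by blast
  show k: "a \<in> lam \<Longrightarrow> x \<in> keys (bdm a) \<Longrightarrow> x \<in> lam" for a x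
    using bd_facts(1)[of "basis a"] by (auto simp: bdm_def)
  show "lin_ext bdm (mpr deg a b) = Om.mul deg (bdm a) (basis b) + sgs (mdeg deg a) (Om.mul deg (basis a) (bdm b))"
    if "a \<in> lam" "b \<in> lam" for a b
  proof -
    have "keys (mpr deg a b :: _ \<Rightarrow>\<^sub>0 'k) \<subseteq> lam" using pr[OF that] by blast
    then show ?thesis using bd_facts(4)[of a "basis b"] bd_lin[of "mpr deg a b"] that by (simp add: bdm_def)
  qed
  show "lin_ext bdm (bdm a) = 0" if "a \<in> lam" for a
  proof -
    have "keys (bdm a) \<subseteq> lam" using k[OF that] by blast
    then have "lin_ext bdm (bdm a) = bd (bd (basis a))"
      using bd_lin[of "bdm a"] that by (simp add: bdm_def)
    then show ?thesis
      using bd that by (simp add: chain_differential_def Lambda_def span_on_def lam_def)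
  qed
  show "0 \<in> keys (mpr deg a b :: _ \<Rightarrow>\<^sub>0 'k) \<Longrightarrow> a = 0 \<and> b = 0" for a b
    using keys_mprD[of 0 deg a b] plus_mono_eq_0[of a b] by auto
qed

definition var :: "'v \<Rightarrow> 'v mono" where "var v = single (Gen v) 1"

lemma deg_cases: "v \<in> G \<Longrightarrow> deg v = 0 \<or> deg v = 1"
  using deg_less by force

lemma mdeg_var [simp]: "mdeg deg (var v) = deg v"
  by (simp add: var_def)

lemma var_lam: "v \<in> G \<Longrightarrow> var v \<in> lam"
  by (auto simp: lam_def monos_in_def var_def)

lemma var_neq_0 [simp]: "var v \<noteq> 0"
  unfolding var_def by (metis lookup_single_eq lookup_zero zero_neq_one)

lemma mpr_odd_var: "odd (deg v) \<Longrightarrow> mpr deg (var v) (var v) = (0 :: _ \<Rightarrow>\<^sub>0 'k)"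
proof -
  assume "odd (deg v)"
  then have "odd_rep deg (var v + var v)"
    unfolding odd_rep_def by (intro exI[of _ "Gen v"]) (simp add: odd_gen_def lookup_add var_def)
  then show ?thesis
    using mono_coeff_alt[of "keys (var v) \<inter> keys (var v) \<inter> dp_gen deg" "var v" "var v" deg, where 'k = 'k]
    by (simp add: mpr_def mcf_def)
qed

lemma bdm_even: "mdeg deg m = 0 \<Longrightarrow> bdm m = 0"
  using bd_pos[of m] by auto

text \<open>
  The divided powers of \<open>dv\<close> for odd \<open>v\<close> are sent to those of \<open>1 \<otimes> v\<close> plus a correction \<open>H v\<close>.
\<close>

fun lift :: "('v \<Rightarrow> nat \<Rightarrow> ('v mono \<times> 'v mono list \<Rightarrow>\<^sub>0 'k)) \<Rightarrow> 'v gen \<Rightarrow> nat \<Rightarrow> ('v mono \<times> 'v mono list \<Rightarrow>\<^sub>0 'k)"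
  where
    "lift H (Gen v) n = basis (single (Gen v) n, [])"
  | "lift H (DGen v) n = (if v \<notin> G then if n = 0 then one_u else 0
      else if deg v = 0 then if n = 0 then one_u else if n = 1 then basis (0, [var v]) else 0
      else \<Sum>i\<le>n. um (basis (0, replicate i (var v))) (H v (n - i)))"

text \<open>With this choice the map \<open>eps\<close> is the plain Hochschild-Kostant-Rosenberg
  map, which serves as leading part.\<close>

definition triv :: "'v \<Rightarrow> nat \<Rightarrow> ('v mono \<times> 'v mono list \<Rightarrow>\<^sub>0 'k)"
  where "triv v n = (if n = 0 then one_u else 0)"

lemma divsys_triv: "divsys (triv v)"
  using divsys_trivial by (simp add: triv_def[abs_def])

lemma divsys_var: "v \<in> G \<Longrightarrow> deg v = 1 \<Longrightarrow> divsys (\<lambda>n. basis (0, replicate n (var v)))"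
  by (intro divsys_odd_letter) (auto simp: var_lam mpr_odd_var)

lemma lift_triv: "v \<in> G \<Longrightarrow> deg v = 1 \<Longrightarrow> lift triv (DGen v) n = basis (0, replicate n (var v))"
proof -
  assume v: "v \<in> G" "deg v = 1"
  have "(\<Sum>i\<le>n. um (basis (0, replicate i (var v))) (triv v (n - i))) = (\<Sum>i\<in>{n}. um (basis (0, replicate i (var v))) (triv v (n - i)))"
    by (rule sum.mono_neutral_right) (auto simp: triv_def)
  then show ?thesis using v by (simp add: triv_def)
qed

lemma divsys_lift:
  assumes "v \<in> G" "deg v = 1" "divsys (H v)"
  shows "divsys (lift H (DGen v))"
proof -
  have "lift H (DGen v) = (\<lambda>n. \<Sum>i\<le>n. um (basis (0, replicate i (var v))) (H v (n - i)))"
    using assms by (intro ext) simp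
  then show ?thesis using divsys_add[OF divsys_var[OF assms(1,2)] assms(3)] by simp
qed

lemma keys_lift:
  assumes "g \<in> Gen ` G \<union> DGen ` G" "single g n \<in> om" "\<And>v. divsys (H v)"
  shows "keys (lift H g n) \<subseteq> ncells"
proof (cases g)
  case (Gen v)
  then have "single (Gen v) n \<in> lam" using assms by (auto simp: om_def lam_def monos_in_def split: if_splits)
  then show ?thesis using Gen by (auto simp: ncells_def)
next
  case (DGen v)
  show ?thesis
  proof (cases "deg v = 0")
    case True
    then show ?thesis using DGen assms(1) var_lam[of v] by (auto simp: ncells_def one_u_def)
  next
    case False
    then have "divsys (lift H g)" using DGen assms deg_cases[of v] divsys_lift[of v H] by auto
    then show ?thesis by (rule divsysD)
  qed
qed

text \<open>For a variable of degree 0 the element dv is odd, and the square of its image vanishes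
  because the two shuffles cancel; for degree 1 the convolution of two divided power systems is
  again one.\<close>

lemma divpow_family_lift:
  assumes "\<And>v. divsys (H v)"
  shows "U.T.divpow_family deg (lift H)"
  unfolding U.T.divpow_family_def
proof (intro conjI allI)
  fix g :: "'v gen" and n i j :: nat
  have ev: "mcf deg (single (DGen v) i) (single (DGen v) j) = (of_nat ((i + j) choose i) :: 'k)" if "deg v = 1" for v
  proof -
    have "inv_set deg (single (DGen v) i) (single (DGen v) j) = {}"
      using that by (auto simp: inv_set_def odd_gen_def split: if_splits)
    moreover have "\<not> odd_rep deg (single (DGen v) i + single (DGen v) j)"
      using that by (auto simp: odd_rep_def odd_gen_def single_add[symmetric] lookup_single when_def)
    moreover have "DGen v \<in> dp_gen deg" using that by (simp add: dp_gen_def)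
    ultimately have "mono_coeff deg (single (DGen v) i) (single (DGen v) j) = (of_nat ((i + j) choose i) :: 'k)"
      using mono_coeff_alt[of "{DGen v}" "single (DGen v) i" "single (DGen v) j" deg, where 'k = 'k] by (auto split: if_splits)
    moreover have "single (DGen v) i = 0 \<longleftrightarrow> i = 0" for i :: nat
      by (metis lookup_single_eq lookup_zero single_zero)
    ultimately show ?thesis by (simp add: mcf_def)
  qed
  have hD: "divsys (lift H g)" if "g = DGen v" "v \<in> G" "deg v \<noteq> 0" for v
    using that divsys_lift[OF that(2) _ assms] deg_cases[OF that(2)] by simp
  show "lift H g 0 = basis (0, [])"
  proof (cases g)
    case (DGen v)
    show ?thesis
    proof (cases "v \<in> G \<and> deg v \<noteq> 0")
      case True
      then show ?thesis using divsysD(1)[OF hD[OF DGen conjunct1[OF True] conjunct2[OF True]]] by (simp only: one_u_def)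
    qed (auto simp: DGen one_u_def)
  qed simp
  show "U.T.hg (n * gdeg deg g) (lift H g n)"
  proof (cases g)
    case (DGen v)
    consider "v \<notin> G" | "v \<in> G" "deg v = 0" | "v \<in> G" "deg v \<noteq> 0" "deg v = 1"
      using deg_cases[of v] by (cases "v \<in> G") auto
    then show ?thesis
    proof cases
      case 3
      then show ?thesis using divsysD(3)[OF hD[OF DGen 3(1,2)], of n] DGen 3 by (simp add: mult_2_right mult_2 del: lift.simps)
    qed (auto simp: DGen one_u_def U.T.hg_def)
  qed (auto simp: U.T.hg_def)
  show "um (lift H g i) (lift H g j) = scal (mcf deg (single g i) (single g j)) (lift H g (i + j))"
  proof (cases g)
    case (Gen v)
    then show ?thesis by (simp add: tpr_pair mpr_def single_add[symmetric])
  next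
    case (DGen v)
    consider "v \<notin> G" | "v \<in> G" "deg v = 0" | "v \<in> G" "deg v \<noteq> 0" "deg v = 1"
      using deg_cases[of v] by (cases "v \<in> G") auto
    then show ?thesis
    proof cases
      case 1
      then show ?thesis using DGen by (cases i; cases j) (auto simp: mcf_def)
    next
      case 2
      have sq: "um (basis (0, [var v])) (basis (0, [var v])) = 0"
        using 2 by (simp add: tpr_pair sgs_def)
      show ?thesis
      proof (cases "i = 0 \<or> j = 0")
        case False
        then show ?thesis using DGen 2 sq by (auto simp del: bilin_ext_basis)
      qed (auto simp: DGen 2 mcf_def)
    next
      case 3
      then show ?thesis using divsysD(4)[OF hD[OF DGen 3(1,2)], of i j] ev[of v] DGen by (simp del: lift.simps)
    qed
  qed
qed

lemma om_not_odd_rep: "m \<in> om \<Longrightarrow> \<not> odd_rep deg m"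
  by (simp add: om_def monos_in_odd_rep)

lemma zero_om [simp]: "0 \<in> om"
  by (simp add: om_def)

lemma om_plusD: "m + n \<in> om \<Longrightarrow> m \<in> om \<and> n \<in> om" "m + n \<in> lam \<Longrightarrow> m \<in> lam \<and> n \<in> lam"
  using odd_rep_plus[of deg m n] odd_rep_plus[of deg n m]
  by (auto simp: om_def lam_def monos_in_odd_rep keys_plus_nat add.commute)

text \<open>Removes the smallest generator with its full power, matching the recursion of
  \<open>mono_hom\<close>.\<close>

lemma om_induct [consumes 1, case_names zero step]:
  assumes "m \<in> om" "P 0"
    and "\<And>g i m. g \<in> Gen ` G \<union> DGen ` G \<Longrightarrow> i > 0 \<Longrightarrow> single g i \<in> om \<Longrightarrow> m \<in> om \<Longrightarrow> \<forall>h\<in>keys m. gless g h \<Longrightarrow>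
      single g i + m \<in> om \<Longrightarrow> P m \<Longrightarrow> P (single g i + m)"
  shows "P m"
  using assms(1)
proof (induction "card (keys m)" arbitrary: m rule: less_induct)
  case less
  show ?case
  proof (cases "m = 0")
    case False
    then obtain g where g: "g \<in> keys m" "\<forall>h\<in>keys m. h \<noteq> g \<longrightarrow> gless g h"
      using ex_gmin[of "keys m"] by auto
    let ?n = "mdrop g m"
    have m: "single g (lookup m g) + ?n = m" by (rule mdrop_plus)
    then have om: "single g (lookup m g) \<in> om" "?n \<in> om" using om_plusD(1)[of "single g (lookup m g)" ?n] less(2) by auto
    have "card (keys ?n) < card (keys m)" using g by (simp add: card_gt_0_iff False)
    then have "P ?n" using less om by blast
    moreover have "g \<in> Gen ` G \<union> DGen ` G" using less(2) g by (auto simp: om_def monos_in_def)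
    moreover have "\<forall>h\<in>keys ?n. gless g h" using g by auto
    ultimately show ?thesis using assms(3)[of g "lookup m g" ?n] m om less(2) g(1) by (simp add: in_keys_iff)
  qed (simp add: assms)
qed

lemma basis_single_plus:
  assumes "\<forall>h\<in>keys m. gless g h" "single g i + m \<in> om"
  shows "basis (single g i + m) = Om.mul deg (basis (single g i)) (basis m :: _ \<Rightarrow>\<^sub>0 'k)"
  using mpr_single_plus[OF assms(1) om_not_odd_rep[OF assms(2)], where 'k = 'k] by simp

definition eps :: "('v \<Rightarrow> nat \<Rightarrow> ('v mono \<times> 'v mono list \<Rightarrow>\<^sub>0 'k)) \<Rightarrow> ('v mono \<Rightarrow>\<^sub>0 'k) \<Rightarrow> ('v mono \<times> 'v mono list \<Rightarrow>\<^sub>0 'k)"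
  where "eps H = lin_ext (U.T.mono_hom (lift H))"

lemma klinear_eps [simp]: "klinear f \<Longrightarrow> klinear (\<lambda>x. eps H (f x))"
  by (simp add: eps_def)

lemmas eps_simps [simp] = klinearD(1-6)[OF klinear_eps[OF klinear_rules(1)]]

context
  fixes H :: "'v \<Rightarrow> nat \<Rightarrow> ('v mono \<times> 'v mono list \<Rightarrow>\<^sub>0 'k)" assumes H: "\<And>v. divsys (H v)"
begin

lemma fam: "U.T.divpow_family deg (lift H)"
  by (rule divpow_family_lift) (rule H)

lemma eps_mul:
  assumes "keys x \<subseteq> om" "keys y \<subseteq> om"
  shows "eps H (Om.mul deg x y) = um (eps H x) (eps H y)"
proof (rule klinear_eq2_on[where F = "\<lambda>x y. eps H (Om.mul deg x y)" and H = "\<lambda>x y. um (eps H x) (eps H y)"])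
  fix m n assume "m \<in> keys x" "n \<in> keys y"
  then show "eps H (Om.mul deg (basis m) (basis n)) = um (eps H (basis m)) (eps H (basis n))"
    using U.T.mono_hom_mpr[OF fam, of m n] om_not_odd_rep assms by (auto simp: eps_def)
qed simp_all

lemma eps_step:
  assumes "\<forall>h\<in>keys m. gless g h"
  shows "eps H (basis (single g i + m)) = um (lift H g i) (eps H (basis m))"
  using U.T.mono_hom_single_plus[OF assms fam] by (simp add: eps_def)

lemma eps_0 [simp]: "eps H (basis 0) = one_u"
  by (simp add: eps_def one_u_def)

lemma eps_single: "eps H (basis (single g i)) = lift H g i"
  using eps_step[of 0 g i] by simp

lemma eps_ncells: "keys x \<subseteq> om \<Longrightarrow> keys (eps H x) \<subseteq> ncells"
proof (rule klinear_in_span[of "eps H"])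
  fix m assume "keys x \<subseteq> om" "m \<in> keys x"
  then have "m \<in> om" by auto
  then show "keys (eps H (basis m)) \<subseteq> ncells"
  proof (induction rule: om_induct)
    case (step g i m)
    then show ?case using keys_um_ncells[OF keys_lift[OF step(1,3) H] step(7)] by (simp only: eps_step)
  qed simp
qed simp

lemma hg_eps: "Om.hg deg n x \<Longrightarrow> U.T.hg n (eps H x)"
  unfolding U.T.hg_def eps_def
  using U.T.hg_mono_hom[OF fam] by (force dest!: keys_lin_extD simp: U.T.hg_def Om.hg_def)

lemma eps_lam: "keys x \<subseteq> lam \<Longrightarrow> eps H x = tens x (basis [])"
proof (rule klinear_eq_on[of "eps H" "\<lambda>x. tens x (basis [])"])
  fix m assume "keys x \<subseteq> lam" "m \<in> keys x"
  then have m: "m \<in> lam" by auto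
  then have "m \<in> om" using lam_om by auto
  then have "m \<in> lam \<longrightarrow> eps H (basis m) = basis (m, [])"
  proof (induction rule: om_induct)
    case (step g i m)
    show ?case
    proof
      assume l: "single g i + m \<in> lam"
      then have "g \<in> Gen ` G" "m \<in> lam"
        using step(2) om_plusD(2)[OF l] by (auto simp: lam_def monos_in_def)
      then obtain v where g: "g = Gen v" by auto
      have "um (basis (single g i, [])) (basis (m, [])) = tens (mpr deg (single g i) m) (basis [])"
        by (simp add: tpr_pair)
      also have "\<dots> = basis (single g i + m, [])"
        by (simp add: mpr_single_plus[OF step(5) om_not_odd_rep[OF step(6)]])
      finally show "eps H (basis (single g i + m)) = basis (single g i + m, [])"
        using eps_step[OF step(5)] step(7) \<open>m \<in> lam\<close> g by simp
    qed
  qed (simp add: one_u_def)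
  then show "eps H (basis m) = tens (basis m) (basis [])" using m by simp
qed simp_all

text \<open>A correction affects only dv for v of degree 1, which has total degree 2. So the map is
  known in total degrees 0 and 1 before the corrections are chosen, which prevents a circular
  choice.\<close>

lemma eps_low_degree:
  assumes "\<And>m. m \<in> keys x \<Longrightarrow> m \<in> om \<and> mdeg deg m \<le> 1"
  shows "eps H x = eps triv x"
proof (rule klinear_eq_on[of "eps H" "eps triv"])
  fix m assume "m \<in> keys x"
  then have m: "m \<in> om" "mdeg deg m \<le> 1" using assms by auto
  from m(1) have "mdeg deg m \<le> 1 \<longrightarrow> U.T.mono_hom (lift H) m = U.T.mono_hom (lift triv) m"
  proof (induction rule: om_induct)
    case (step g i m)
    show ?case
    proof
      assume "mdeg deg (single g i + m) \<le> 1"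
      then have *: "i * gdeg deg g \<le> 1" "mdeg deg m \<le> 1" by auto
      then have "gdeg deg g \<le> 1" using step(2) by (cases i) auto
      then have "lift H g = lift triv g"
        using deg_cases step(1) by (cases g) (auto intro!: ext)
      then show "U.T.mono_hom (lift H) (single g i + m) = U.T.mono_hom (lift triv) (single g i + m)"
        using step(7) * U.T.mono_hom_single_plus[OF step(5) fam]
          U.T.mono_hom_single_plus[OF step(5) divpow_family_lift[where H = triv, OF divsys_triv]] by simp
    qed
  qed simp
  then show "eps H (basis m) = eps triv (basis m)" using m by (simp add: eps_def)
qed simp_all

end

section \<open>Divided power systems bounding the difference of 1[f] and df\<close>

definition pzero :: "('v mono \<times> 'v mono list \<Rightarrow>\<^sub>0 'k) \<Rightarrow> bool"
  where "pzero x \<longleftrightarrow> (\<forall>m\<in>keys x. pdg m = 0)"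

lemma pdg_um:
  assumes "m \<in> keys (um x y)"
  shows "\<exists>a\<in>keys x. \<exists>b\<in>keys y. pdg m = pdg a + pdg b"
proof -
  obtain a u b v where ab: "(a, u) \<in> keys x" "(b, v) \<in> keys y" "m \<in> keys (U.prT (a, u) (b, v))"
    using keys_bilin_extD[OF assms] by fast
  obtain c w where m: "m = (c, w)" by (cases m)
  have "c \<in> keys (mpr deg a b :: _ \<Rightarrow>\<^sub>0 'k)" "w \<in> keys (shp s u v :: _ \<Rightarrow>\<^sub>0 'k)"
    using ab(3) by (auto simp: tpr_pair m dest!: keys_tensD)
  then have "pdg m = pdg (a, u) + pdg (b, v)"
    by (auto simp: pdg_def m wdg_shp dest!: keys_mprD)
  then show ?thesis using ab by blast
qed

lemma pzero_um: "pzero x \<Longrightarrow> pzero y \<Longrightarrow> pzero (um x y)"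
  unfolding pzero_def using pdg_um by fastforce

lemma pzero_one_u [simp]: "pzero one_u"
  by (simp add: pzero_def one_u_def pdg_def)

lemma pzero_scal: "pzero x \<Longrightarrow> pzero (scal c x)"
  using keys_scal[of c x] by (auto simp: pzero_def)

lemma pzero_sum: "(\<And>a. a \<in> A \<Longrightarrow> pzero (f a)) \<Longrightarrow> pzero (sum f A)"
  unfolding pzero_def using keys_sum[of f A] by blast

lemma pzero_funpow: "pzero x \<Longrightarrow> pzero y \<Longrightarrow> pzero ((um x ^^ n) y)"
  by (induction n) (auto intro: pzero_um)

text \<open>The map \<open>eps triv\<close> can stand here for the corrected one, because
  \<open>d f\<close> has total degree 1 for the \<open>f\<close> of degree 0 to which this is
  applied. Internal degree 0 keeps the correction below the leading part.\<close>

definition has_lift :: "('v mono \<Rightarrow>\<^sub>0 'k) \<Rightarrow> bool"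
  where "has_lift f \<longleftrightarrow> (\<exists>h. divsys h \<and> (\<forall>n. pzero (h n)) \<and>
    Dn (h 1) = tens (basis 0) (nrl (consx f (basis []))) - eps triv (d f))"

lemma d_add: "keys x \<subseteq> om \<Longrightarrow> keys y \<subseteq> om \<Longrightarrow> d (x + y) = d x + d y"
  and d_scal: "keys x \<subseteq> om \<Longrightarrow> d (scal c x) = scal c (d x)"
  using d_deriv by (auto simp: graded_derivation_def span_on_def om_def)

lemma has_lift_add:
  assumes "has_lift f" "has_lift g" "keys f \<subseteq> om" "keys g \<subseteq> om"
  shows "has_lift (f + g)"
proof -
  obtain h where h: "divsys h" "\<forall>n. pzero (h n)"
    "Dn (h 1) = tens (basis 0) (nrl (consx f (basis []))) - eps triv (d f)" using assms by (auto simp: has_lift_def)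
  obtain k where k: "divsys k" "\<forall>n. pzero (k n)"
    "Dn (k 1) = tens (basis 0) (nrl (consx g (basis []))) - eps triv (d g)" using assms by (auto simp: has_lift_def)
  let ?s = "\<lambda>n. \<Sum>i\<le>n. um (h i) (k (n - i))"
  have "Dn (?s 1) = Dn (h 1) + Dn (k 1)"
    using divsysD(1)[OF h(1)] divsysD(1)[OF k(1)] by simp
  moreover have "\<forall>n. pzero (?s n)" using h k by (auto intro!: pzero_sum pzero_um)
  ultimately show ?thesis
    unfolding has_lift_def using divsys_add[OF h(1) k(1)] h(3) k(3) assms
    by (intro exI[of _ ?s]) (simp add: d_add)
qed

text \<open>The n-th member is multiplied by the n-th power of the scalar, as for divided powers of
  a multiple.\<close>

lemma has_lift_scal:
  assumes "has_lift f" "keys f \<subseteq> om"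
  shows "has_lift (scal c f)"
proof -
  obtain h where h: "divsys h" "\<forall>n. pzero (h n)"
    "Dn (h 1) = tens (basis 0) (nrl (consx f (basis []))) - eps triv (d f)" using assms by (auto simp: has_lift_def)
  let ?h = "\<lambda>n. (um (scal c one_u) ^^ n) (h n)"
  have "divsys ?h"
    by (rule divsys_mult[OF h(1)])
      (use order_trans[OF keys_scal[of c one_u] one_u_simps(4)] in \<open>simp_all add: U.T.hg_scal\<close>)
  moreover have "\<forall>n. pzero (?h n)" using h by (auto intro!: pzero_funpow pzero_scal)
  ultimately show ?thesis
    unfolding has_lift_def using h assms
    by (intro exI[of _ ?h]) (simp add: d_scal scal_diff klinearD(2)[OF klinear_tens(2)[OF klinear_rules(1)]])
qed

lemma mpr_mdeg_0:
  assumes "m \<in> lam" "n \<in> lam" "mdeg deg m = 0"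
  shows "mpr deg m n = (basis (m + n) :: _ \<Rightarrow>\<^sub>0 'k)" "m + n \<in> lam"
proof -
  have ev: "\<not> odd_gen deg g" if "g \<in> keys m" for g
    using assms(3) that by (auto simp: mdeg_def odd_gen_def in_keys_iff)
  have "\<not> odd_rep deg (m + n)"
  proof
    assume "odd_rep deg (m + n)"
    then obtain g where g: "odd_gen deg g" "2 \<le> lookup m g + lookup n g" by (auto simp: odd_rep_def lookup_add)
    then have "lookup m g = 0" using ev[of g] by (auto simp: in_keys_iff)
    then show False using g assms(2) by (auto simp: lam_def monos_in_odd_rep odd_rep_def)
  qed
  moreover have "inv_set deg m n = {}" using ev by (auto simp: inv_set_def)
  moreover have "keys m \<inter> keys n \<inter> dp_gen deg \<subseteq> {}"
    using assms by (auto simp: lam_def monos_in_def dp_gen_def)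
  ultimately show "mpr deg m n = (basis (m + n) :: _ \<Rightarrow>\<^sub>0 'k)" "m + n \<in> lam"
    using mono_coeff_alt[of "{}" m n deg, where 'k = 'k] assms
    by (auto simp: mpr_def mcf_def lam_def monos_in_odd_rep keys_plus_nat)
qed

text \<open>If h bounds the defect of m, then x h - [x|m] bounds that of x m, by
  \<open>divsys_alt\<close> and the Leibniz rule of \<open>d\<close>; both summands have divided
  powers.\<close>

lemma has_lift_var_plus:
  assumes v: "v \<in> G" "deg v = 0" and m: "m \<in> lam" "mdeg deg m = 0" and l: "has_lift (basis m)"
  shows "has_lift (basis (var v + m))"
proof -
  have eq: "basis (var v + m) = Om.mul deg (basis (var v)) (basis m :: _ \<Rightarrow>\<^sub>0 'k)"
    using mpr_mdeg_0(1)[OF var_lam[OF v(1)] m(1)] v by simp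
  have om: "var v \<in> om" "m \<in> om" using var_lam v m lam_om by auto
  have dm: "keys (d (basis m)) \<subseteq> om" using d_facts(1)[of "basis m"] om by simp
  have dv: "d (basis (var v)) = basis (single (DGen v) 1)" using d_Gen v by (simp add: gvar_def var_def)
  have som: "single (DGen v) 1 \<in> om" using v by (auto simp: om_def monos_in_def)
  have "d (basis (var v + m)) = Om.mul deg (basis (single (DGen v) 1)) (basis m) + Om.mul deg (basis (var v)) (d (basis m))"
    unfolding eq using d_facts(4)[OF om(1), of "basis m"] om v by (simp only: dv) (simp add: sgs_def)
  then have "eps triv (d (basis (var v + m))) = eps triv (Om.mul deg (basis (single (DGen v) 1)) (basis m)) + eps triv (Om.mul deg (basis (var v)) (d (basis m)))"
    by simp
  also have "eps triv (Om.mul deg (basis (single (DGen v) 1)) (basis m)) = um (lift triv (DGen v) 1) (eps triv (basis m))"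
    by (subst eps_mul[where H = triv, OF divsys_triv]) (use som om in \<open>simp_all only: eps_single[where H = triv, OF divsys_triv], auto\<close>)
  also have "\<dots> = basis (m, [var v])"
    using v m by (subst eps_lam[where H = triv, OF divsys_triv]) (auto simp: tpr_pair sgs_def)
  also have "eps triv (Om.mul deg (basis (var v)) (d (basis m))) = um (basis (var v, [])) (eps triv (d (basis m)))"
    using v om dm by (subst eps_mul[where H = triv, OF divsys_triv]) (auto simp: eps_lam[where H = triv, OF divsys_triv] var_lam)
  finally have eta: "eps triv (d (basis (var v + m))) = basis (m, [var v]) + um (basis (var v, [])) (eps triv (d (basis m)))" .
  show ?thesis
  \<comment> \<open>For m = 1 the word [x|m] is degenerate; but [x] is already the image of dx, so
    nothing has to be bounded.\<close>
  proof (cases "m = 0")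
    case True
    have "d (basis m) = 0"
      using True d_facts(4)[of 0 "basis 0"] by simp
    then show ?thesis
      unfolding has_lift_def eta using divsys_triv[of v] True
      by (intro exI[of _ "triv v"]) (auto simp: triv_def nrl_basis pzero_def one_u_def pdg_def)
  next
    case False
    obtain h where h: "divsys h" "\<forall>n. pzero (h n)"
      "Dn (h 1) = tens (basis 0) (nrl (consx (basis m) (basis []))) - eps triv (d (basis m))" using l by (auto simp: has_lift_def)
    note alt = divsys_alt[OF var_lam[OF v(1)] var_neq_0 _ m(1) False m(2)]
    \<comment> \<open>Multiplication by -1 produces the divided powers of -[x|m] from the
      alternating words.\<close>
    let ?x = "- one_u" and ?y = "basis (var v, [])"
    let ?f = "\<lambda>n. (um ?x ^^ n) (basis (0, alt (var v) m n))" and ?g = "\<lambda>n. (um ?y ^^ n) (h n)"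
    have f: "divsys ?f"
      by (rule divsys_mult[OF alt(1)]) (use v one_u_simps(4) in auto)
    have y: "keys ?y \<subseteq> ncells" "U.T.hg 0 ?y" "Dn ?y = 0"
      using v var_lam by (auto simp: ncells_def U.T.hg_def Dn_def DU_basis bdm_even)
    have g: "divsys ?g"
      by (rule divsys_mult[OF h(1) y])
    have "wdg (mdeg deg) (alt (var v) m n) = 0" for n by (induction n) (use v m in auto)
    then have pf: "pzero (?f n)" for n
      by (intro pzero_funpow) (auto simp: pzero_def pdg_def one_u_def)
    have pg: "pzero (?g n)" for n
      using h v by (intro pzero_funpow) (auto simp: pzero_def pdg_def)
    let ?s = "\<lambda>n. \<Sum>i\<le>n. um (?f i) (?g (n - i))"
    have "?s 1 = um ?y (h 1) - basis (0, [var v, m])"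
      using divsysD(1)[OF h(1)] by (simp add: one_u_def[symmetric])
    moreover have "Dn (um ?y (h 1)) = um ?y (Dn (h 1))"
      using Dn_mul[OF y(2,1) divsysD(2)[OF h(1)], of 1] y(3) by simp
    ultimately have "Dn (?s 1) = um ?y (Dn (h 1)) - Dn (basis (0, [var v, m]))" by simp
    also have "um ?y (Dn (h 1)) = basis (var v, [m]) - um ?y (eps triv (d (basis m)))"
      unfolding h(3) using False by (simp add: nrl_basis tpr_pair)
    also have "Dn (basis (0, [var v, m])) = basis (var v, [m]) + basis (m, [var v]) - basis (0, [var v + m])"
      using alt(2) mpr_mdeg_0(1)[OF var_lam[OF v(1)] m(1)] v by simp
    finally have "Dn (?s 1) = tens (basis 0) (nrl (consx (basis (var v + m)) (basis []))) - eps triv (d (basis (var v + m)))"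
      unfolding eta by (simp add: nrl_basis plus_mono_eq_0 algebra_simps)
    then show ?thesis
      unfolding has_lift_def using divsys_add[OF f g] pf pg
      by (intro exI[of _ ?s]) (auto intro!: pzero_sum pzero_um)
  qed
qed

lemma lam_degree_0_induct [consumes 2, case_names zero step]:
  assumes m: "m \<in> lam" "mdeg deg m = 0" and P0: "P 0"
    and step: "\<And>v m. v \<in> G \<Longrightarrow> deg v = 0 \<Longrightarrow> m \<in> lam \<Longrightarrow> mdeg deg m = 0 \<Longrightarrow> P m \<Longrightarrow> P (var v + m)"
  shows "P m"
proof -
  have "m \<in> om" using m lam_om by auto
  then have "m \<in> lam \<and> mdeg deg m = 0 \<longrightarrow> P m"
  proof (induction rule: om_induct)
    case (step g i m)
    show ?case
    proof
      assume l: "single g i + m \<in> lam \<and> mdeg deg (single g i + m) = 0"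
      then have m: "m \<in> lam" "mdeg deg m = 0" "single g i \<in> lam" "gdeg deg g = 0"
        using om_plusD(2)[of "single g i" m] step(2) by auto
      then obtain v where v: "g = Gen v" "v \<in> G" "deg v = 0"
        using step(2) by (auto simp: lam_def monos_in_def)
      have "single g j + m \<in> lam \<and> P (single g j + m)" for j
      proof (induction j)
        case 0
        then show ?case using step(7) m by simp
      next
        case (Suc j)
        have e: "single g (Suc j) + m = var v + (single g j + m)"
          by (simp add: v var_def single_add[symmetric] add.assoc[symmetric])
        have "mdeg deg (single g j + m) = 0" using m v by simp
        then show ?case
          unfolding e using assms(4)[OF v(2,3), of "single g j + m"] Suc
            mpr_mdeg_0(2)[OF var_lam[OF v(2)], of "single g j + m"] v by simp
      qed
      then show "P (single g i + m)" by blast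
    qed
  qed (simp add: P0)
  then show ?thesis using m by blast
qed

lemma has_lift_basis:
  assumes "m \<in> lam" "mdeg deg m = 0"
  shows "has_lift (basis m)"
  using assms
proof (induction rule: lam_degree_0_induct)
  case zero
  have "d (basis 0) = 0" using d_facts(4)[of 0 "basis 0"] by simp
  then show ?case
    unfolding has_lift_def using divsys_trivial
    by (auto intro!: exI[of _ "\<lambda>n. if n = 0 then one_u else 0"] simp: nrl_basis pzero_def one_u_def pdg_def split: if_splits)
qed (rule has_lift_var_plus)

lemma has_lift:
  assumes "\<And>m. m \<in> keys f \<Longrightarrow> m \<in> lam \<and> mdeg deg m = 0"
  shows "has_lift f"
proof -
  have "has_lift (\<Sum>m\<in>A. scal (c m) (basis m))" if "finite A" "A \<subseteq> keys f" for A and c :: "_ \<Rightarrow> 'k"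
    using that
  proof (induction A rule: finite_induct)
    case empty
    have "has_lift (scal 0 (basis 0))"
      by (intro has_lift_scal has_lift_basis) (auto simp: lam_def)
    then show ?case by simp
  next
    case (insert m A)
    have k: "keys (scal (c m) (basis m)) \<subseteq> om"
      if "m \<in> keys f" for m and c :: "_ \<Rightarrow> 'k"
      using assms[OF that] lam_om keys_scal[of "c m" "basis m"] by auto
    have "keys (\<Sum>m\<in>A. scal (c m) (basis m)) \<subseteq> om"
      by (rule order_trans[OF keys_sum]) (use insert k in blast)
    moreover have "has_lift (scal (c m) (basis m))"
      by (rule has_lift_scal) (use insert assms[of m] lam_om in \<open>auto intro: has_lift_basis\<close>)
    ultimately have "has_lift (scal (c m) (basis m) + (\<Sum>m\<in>A. scal (c m) (basis m)))"
      using insert k[of m c] by (intro has_lift_add) blast+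
    then show ?case using insert by (simp del: scal_single)
  qed
  from this[OF finite_keys subset_refl] show ?thesis
    by (subst poly_mapping_decomp[of f])
qed

end

definition wsum :: "('g \<Rightarrow> nat) \<Rightarrow> ('g \<Rightarrow>\<^sub>0 nat) \<Rightarrow> nat"
  where "wsum w m = (\<Sum>g\<in>keys m. lookup m g * w g)"

lemma wsum_superset: "finite A \<Longrightarrow> keys m \<subseteq> A \<Longrightarrow> wsum w m = (\<Sum>g\<in>A. lookup m g * w g)"
  unfolding wsum_def by (rule sum.mono_neutral_left) (auto simp: in_keys_iff)

lemma wsum_simps [simp]: "wsum w 0 = 0" "wsum w (single g n) = n * w g" "wsum w (m + n') = wsum w m + wsum w n'"
proof -
  show "wsum w (m + n') = wsum w m + wsum w n'"
    using wsum_superset[of "keys m \<union> keys n'" m w] wsum_superset[of "keys m \<union> keys n'" n' w]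
    by (simp add: wsum_def keys_plus_nat lookup_add add_mult_distrib sum.distrib)
qed (simp_all add: wsum_def)

lemma divpow_gvar: "divpow n (gvar g) = (basis (single g n) :: _ \<Rightarrow>\<^sub>0 'k::comm_ring_1)"
proof -
  have *: "e = single g n" if e: "\<forall>h\<in>keys e. h = g" "(\<Sum>h\<in>keys e. lookup e h) = n" for e :: "'a mono"
  proof -
    have "lookup e h = 0" if "h \<noteq> g" for h using e(1) that by (meson in_keys_iff)
    then have s: "e = single g (lookup e g)"
      by (intro poly_mapping_eqI) (simp add: lookup_single when_def)
    have "keys e \<subseteq> {g}" using e(1) by blast
    then have "(\<Sum>h\<in>keys e. lookup e h) = (\<Sum>h\<in>{g}. lookup e h)"
      by (intro sum.mono_neutral_left) (auto simp: in_keys_iff)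
    then show ?thesis using e(2) s by simp
  qed
  have inj: "single h (1::nat) = single g 1 \<longleftrightarrow> h = g" for h :: "'a gen"
    by (metis lookup_single_eq lookup_single_not_eq zero_neq_one)
  have "{e. (\<forall>h\<in>keys e. single h 1 \<in> keys (gvar g :: _ \<Rightarrow>\<^sub>0 'k)) \<and> (\<Sum>h\<in>keys e. lookup e h) = n} = {single g n}"
  proof (intro Set.set_eqI iffI)
    fix e :: "'a mono" assume "e \<in> {e. (\<forall>h\<in>keys e. single h 1 \<in> keys (gvar g :: _ \<Rightarrow>\<^sub>0 'k)) \<and> (\<Sum>h\<in>keys e. lookup e h) = n}"
    then have e: "\<forall>h\<in>keys e. h = g" "(\<Sum>h\<in>keys e. lookup e h) = n"
      using inj by (auto simp: gvar_def)
    then show "e \<in> {single g n}" using * by blast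
  qed (auto simp: gvar_def inj)
  then show ?thesis
    by (auto simp: divpow_def gvar_def)
qed

section \<open>Bidegrees on Omega and the chain map property\<close>

context low_degree
begin

text \<open>The bidegree on Omega: internal degree of the underlying variable, and number of factors
  dv.\<close>

definition gpw :: "'v gen \<Rightarrow> nat" where "gpw g = (case g of Gen v \<Rightarrow> deg v | DGen v \<Rightarrow> deg v)"
definition gqw :: "'v gen \<Rightarrow> nat" where "gqw g = (case g of Gen v \<Rightarrow> 0 | DGen v \<Rightarrow> 1)"
abbreviation pw :: "'v mono \<Rightarrow> nat" where "pw \<equiv> wsum gpw"
abbreviation qw :: "'v mono \<Rightarrow> nat" where "qw \<equiv> wsum gqw"

lemma gpw_simps [simp]: "gpw (Gen v) = deg v" "gpw (DGen v) = deg v" "gqw (Gen v) = 0" "gqw (DGen v) = 1"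
  by (simp_all add: gpw_def gqw_def)

lemma mdeg_pw_qw: "mdeg deg m = pw m + qw m"
proof -
  have "gdeg deg g = gpw g + gqw g" for g
    by (cases g) auto
  then show ?thesis by (simp add: mdeg_def wsum_def distrib_left sum.distrib[symmetric])
qed

lemma lam_qw: "m \<in> lam \<Longrightarrow> qw m = 0" "m \<in> lam \<Longrightarrow> pw m = mdeg deg m"
proof -
  show q: "qw m = 0" if "m \<in> lam" for m
    unfolding wsum_def by (rule sum.neutral) (use that in \<open>auto simp: lam_def monos_in_def\<close>)
  show "m \<in> lam \<Longrightarrow> pw m = mdeg deg m" using q[of m] by (simp add: mdeg_pw_qw)
qed

lemma bd_var_lam: "m \<in> keys (bd (gvar (Gen v))) \<Longrightarrow> v \<in> G \<Longrightarrow> m \<in> lam \<and> mdeg deg m = deg v - 1"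
  using bd_facts(1)[of "basis (var v)"] bd_facts(3)[of "var v" m] var_lam[of v]
  by (auto simp: gvar_def var_def)

text \<open>One choice for each odd variable, with f the differential of v, which has degree 0
  because v has degree 1.\<close>

definition corr :: "'v \<Rightarrow> nat \<Rightarrow> ('v mono \<times> 'v mono list \<Rightarrow>\<^sub>0 'k)"
  where "corr v = (if v \<in> G \<and> deg v = 1 then SOME h. divsys h \<and> (\<forall>n. pzero (h n)) \<and>
    Dn (h 1) = tens (basis 0) (nrl (consx (bd (gvar (Gen v))) (basis []))) - eps triv (d (bd (gvar (Gen v))))
    else triv v)"

lemma corr:
  shows "divsys (corr v)" "pzero (corr v n)"
    and "v \<in> G \<Longrightarrow> deg v = 1 \<Longrightarrow>
      Dn (corr v 1) = tens (basis 0) (nrl (consx (bd (gvar (Gen v))) (basis []))) - eps triv (d (bd (gvar (Gen v))))"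
proof -
  have 1: "divsys (corr v) \<and> (\<forall>n. pzero (corr v n)) \<and> Dn (corr v 1) =
      tens (basis 0) (nrl (consx (bd (gvar (Gen v))) (basis []))) - eps triv (d (bd (gvar (Gen v))))"
    if "v \<in> G" "deg v = 1"
  proof -
    have "has_lift (bd (gvar (Gen v)))"
      by (rule has_lift) (use bd_var_lam that in auto)
    from someI_ex[OF this[unfolded has_lift_def]] show ?thesis
      using that by (simp add: corr_def)
  qed
  then show "v \<in> G \<Longrightarrow> deg v = 1 \<Longrightarrow>
      Dn (corr v 1) = tens (basis 0) (nrl (consx (bd (gvar (Gen v))) (basis []))) - eps triv (d (bd (gvar (Gen v))))" by blast
  have 2: "pzero (triv v n)" by (auto simp: triv_def pzero_def one_u_def pdg_def)
  have "divsys (corr v) \<and> pzero (corr v n)"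
  proof (cases "v \<in> G \<and> deg v = 1")
    case False
    then have "corr v = triv v" unfolding corr_def by (rule if_not_P)
    then show ?thesis using 2 divsys_triv by simp
  qed (use 1 in blast)
  then show "divsys (corr v)" "pzero (corr v n)" by blast+
qed

abbreviation cmp where "cmp \<equiv> eps corr"
abbreviation cmp0 where "cmp0 \<equiv> eps triv"

lemma d_0 [simp]: "d 0 = 0" and \<delta>_0 [simp]: "\<delta> 0 = 0"
  using d_facts(2)[of 0] \<delta>_facts(2)[of 0] by auto

lemma d_low:
  assumes "\<And>m. m \<in> keys f \<Longrightarrow> m \<in> lam \<and> mdeg deg m = 0"
  shows "keys (d f) \<subseteq> om" "m \<in> keys (d f) \<Longrightarrow> pw m = 0 \<and> qw m = 1"
proof -
  have f: "keys f \<subseteq> om" using assms lam_om by auto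
  then show "keys (d f) \<subseteq> om" by (rule d_facts(1))
  have b: "\<forall>n\<in>keys (d (basis m)). pw n = 0 \<and> qw n = 1" if "m \<in> lam" "mdeg deg m = 0" for m
    using that
  proof (induction rule: lam_degree_0_induct)
    case zero
    then show ?case using d_facts(4)[of 0 "basis 0"] by simp
  next
    case (step v m)
    have om: "var v \<in> om" "m \<in> om" using var_lam step lam_om by auto
    have eq: "basis (var v + m) = Om.mul deg (basis (var v)) (basis m :: _ \<Rightarrow>\<^sub>0 'k)"
      using mpr_mdeg_0(1)[OF var_lam[OF step(1)] step(3)] step by simp
    have "d (basis (var v + m)) = Om.mul deg (basis (single (DGen v) 1)) (basis m) + Om.mul deg (basis (var v)) (d (basis m))"
      unfolding eq using d_facts(4)[OF om(1), of "basis m"] om step d_Gen by (simp add: sgs_def gvar_def var_def)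
    moreover have "pw n = 0 \<and> qw n = 1" if "n \<in> keys (Om.mul deg (basis (single (DGen v) 1)) (basis m) :: _ \<Rightarrow>\<^sub>0 'k)" for n
      using that step lam_qw[of m] by (auto dest!: keys_mprD)
    moreover have "pw n = 0 \<and> qw n = 1" if "n \<in> keys (Om.mul deg (basis (var v)) (d (basis m)))" for n
      using keys_bilin_extD[OF that] step by (auto dest!: keys_mprD simp: var_def)
    ultimately show ?case by (metis keys_addD)
  qed
  show "m \<in> keys (d f) \<Longrightarrow> pw m = 0 \<and> qw m = 1"
    unfolding d_facts(2)[OF f] by (drule keys_lin_extD) (use assms b in \<open>auto split: if_splits\<close>)
qed

lemma cmp_d:
  assumes "\<And>m. m \<in> keys f \<Longrightarrow> m \<in> lam \<and> mdeg deg m = 0"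
  shows "cmp (d f) = cmp0 (d f)"
  by (rule eps_low_degree) (use d_low[OF assms] corr in \<open>auto simp: mdeg_pw_qw\<close>)

lemma \<delta>_Gen: "single (Gen v) i \<in> lam \<Longrightarrow> \<delta> (basis (single (Gen v) i)) = bdm (single (Gen v) i)"
  using \<delta>_bd by (simp add: bdm_def Lambda_def span_on_def lam_def)

lemma \<delta>_even_DGen: "v \<in> G \<Longrightarrow> deg v = 0 \<Longrightarrow> \<delta> (basis (single (DGen v) 1)) = 0"
proof -
  assume v: "v \<in> G" "deg v = 0"
  have "bd (gvar (Gen v)) = bdm (var v)"
    using var_lam[OF v(1)] by (simp add: bdm_def gvar_def var_def)
  then have "bd (gvar (Gen v)) = 0" using v by (simp add: bdm_even)
  then show ?thesis using \<delta>_DGen v by (simp add: gvar_def)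
qed

text \<open>The rule of a \<open>\<gamma>\<close>-derivation, applied to the single generator dv,
  determines \<delta> on all its divided powers.\<close>

lemma \<delta>_divpow:
  assumes "v \<in> G" "deg v = 1"
  shows "\<delta> (basis (single (DGen v) (Suc n))) = - Om.mul deg (basis (single (DGen v) n)) (d (bd (gvar (Gen v))))"
proof -
  have f: "\<And>m. m \<in> keys (bd (gvar (Gen v))) \<Longrightarrow> m \<in> lam \<and> mdeg deg m = 0" using bd_var_lam assms by auto
  have "gvar (DGen v) \<in> dV_even G deg"
    using assms by (auto simp: dV_even_def span_on_def gvar_def)
  then have "\<delta> (divpow (Suc n) (gvar (DGen v))) = gmult deg (divpow n (gvar (DGen v))) (\<delta> (gvar (DGen v)))"
    using \<delta> unfolding gamma_derivation_def by (metis Suc_eq_plus1 add_diff_cancel_right' le_add2)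
  then have "\<delta> (basis (single (DGen v) (Suc n))) = gmult deg (basis (single (DGen v) n)) (- d (bd (gvar (Gen v))))"
    using \<delta>_DGen assms by (simp add: divpow_gvar)
  also have "\<dots> = Om.mul deg (basis (single (DGen v) n)) (- d (bd (gvar (Gen v))))"
    by (rule gmult_eq[of _ "Gen ` G \<union> DGen ` G"])
      (use d_low(1)[OF f] assms in \<open>auto simp: span_on_def om_def monos_in_def\<close>)
  finally show ?thesis by simp
qed

lemma single_om_cases:
  assumes "g \<in> Gen ` G \<union> DGen ` G" "i > 0" "single g i \<in> om"
  obtains (Gen) v where "g = Gen v" "v \<in> G" "single g i \<in> lam"
  | (even) v where "g = DGen v" "v \<in> G" "deg v = 0" "i = 1"
  | (odd) v n where "g = DGen v" "v \<in> G" "deg v = 1" "i = Suc n"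
proof (cases g)
  case g: (Gen v)
  then show ?thesis using assms Gen by (auto simp: om_def lam_def monos_in_def)
next
  case g: (DGen v)
  then have v: "v \<in> G" using assms by auto
  show ?thesis
  proof (cases "deg v = 0")
    case True
    then show ?thesis using assms even[OF g v True] g by (auto simp: om_def monos_in_def)
  next
    case False
    then show ?thesis using odd[OF g v] deg_cases[OF v] assms(2) not0_implies_Suc by auto
  qed
qed

lemma Dn_lift:
  assumes "g \<in> Gen ` G \<union> DGen ` G" "i > 0" "single g i \<in> om"
  shows "Dn (lift corr g i) = cmp (\<delta> (basis (single g i)))"
  using assms
proof (cases rule: single_om_cases)
  case (Gen v)
  have "keys (bdm (single (Gen v) i)) \<subseteq> lam"
    using bd_facts(1)[of "basis (single (Gen v) i)"] by (simp add: bdm_def)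
  moreover have "Dn (lift corr g i) = tens (bdm (single (Gen v) i)) (basis [])"
    using Gen by (simp add: Dn_def DU_basis nrm_tens nrl_basis)
  ultimately show ?thesis
    using Gen \<delta>_Gen[of v i] eps_lam[OF corr(1)] by simp
next
  case (even v)
  have "Dn (basis (0, [var v])) = 0"
    using even by (simp add: Dn_def DU_basis phi_def bdm_even)
  then show ?thesis using even \<delta>_even_DGen by simp
next
  case (odd v n)
  let ?f = "bd (gvar (Gen v))"
  have f: "\<And>m. m \<in> keys ?f \<Longrightarrow> m \<in> lam \<and> mdeg deg m = 0" using bd_var_lam odd by auto
  have ds: "divsys (lift corr g)" using divsys_lift[of v corr] odd corr(1) by simp
  have "Dn (basis (0, [var v])) = - tens (basis 0) (nrl (consx (bdm (var v)) (basis [])))"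
    using odd by (intro divsys_odd_letter(2)) (auto simp: var_lam mpr_odd_var)
  also have "bdm (var v) = ?f" using var_lam[OF odd(2)] by (simp add: bdm_def gvar_def var_def)
  \<comment> \<open>The linear term [bd v] cancels between the two summands; what remains is the
    image of \<delta>(dv).\<close>
  finally have "Dn (basis (0, [var v])) + Dn (corr v 1) = - cmp0 (d ?f)"
    using corr(3)[of v] odd by simp
  moreover have "lift corr g 1 = basis (0, [var v]) + corr v 1"
    using odd divsysD(1)[OF corr(1)[of v]] by (simp add: one_u_def[symmetric])
  ultimately have D1: "Dn (lift corr g 1) = - cmp (d ?f)"
    by (simp add: cmp_d[OF f])
  have "Dn (lift corr g i) = um (lift corr g n) (Dn (lift corr g 1))"
    using divsysD(5)[OF ds, of n] odd by (simp del: lift.simps)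
  also have "\<dots> = cmp (- Om.mul deg (basis (single g n)) (d ?f))"
  proof -
    have "single g n \<in> om" using odd by (auto simp: om_def monos_in_def)
    then show ?thesis
      unfolding D1 using eps_mul[of corr "basis (single g n)" "d ?f"] eps_single[of corr g n] corr(1) d_low(1)[OF f]
      by (simp del: lift.simps bilin_ext_basis)
  qed
  finally show ?thesis using \<delta>_divpow[of v n] odd by simp
qed

lemma \<delta>_om: "keys x \<subseteq> om \<Longrightarrow> keys (\<delta> x) \<subseteq> om"
  by (rule \<delta>_facts(1))

lemma \<delta>_step:
  assumes "\<forall>h\<in>keys m. gless g h" "single g i + m \<in> om"
  shows "\<delta> (basis (single g i + m)) = Om.mul deg (\<delta> (basis (single g i))) (basis m) +
    sgs (i * gdeg deg g) (Om.mul deg (basis (single g i)) (\<delta> (basis m)))"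
  using \<delta>_facts(4)[of "single g i" "basis m"] om_plusD(1)[OF assms(2)] basis_single_plus[OF assms]
  by (simp del: bilin_ext_basis)

text \<open>Both sides obey the Leibniz rule, so the check on powers of single generators in
  \<open>Dn_lift\<close> suffices.\<close>

lemma Dn_cmp: "keys x \<subseteq> om \<Longrightarrow> Dn (cmp x) = cmp (\<delta> x)"
proof -
  assume x: "keys x \<subseteq> om"
  have b: "Dn (cmp (basis m)) = cmp (\<delta> (basis m))" if "m \<in> om" for m
    using that
  proof (induction rule: om_induct)
    case zero
    have "\<delta> (basis 0) = 0" using \<delta>_facts(4)[of 0 "basis 0"] by simp
    then show ?case using eps_0[OF corr(1)] by simp
  next
    case (step g i m)
    have s: "keys (\<delta> (basis (single g i))) \<subseteq> om" "keys (\<delta> (basis m)) \<subseteq> om"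
      using step \<delta>_om by auto
    have "Dn (cmp (basis (single g i + m))) = Dn (um (lift corr g i) (cmp (basis m)))"
      by (simp only: eps_step[OF corr(1) step(5)])
    also have "\<dots> = um (Dn (lift corr g i)) (cmp (basis m)) + sgs (i * gdeg deg g) (um (lift corr g i) (Dn (cmp (basis m))))"
      using divpow_family_lift[OF corr(1)] step(4)
      by (intro Dn_mul keys_lift step corr eps_ncells) (auto simp: U.T.divpow_family_def)
    also have "\<dots> = cmp (\<delta> (basis (single g i + m)))"
      unfolding \<delta>_step[OF step(5,6)] Dn_lift[OF step(1,2,3)] step(7)
      using eps_mul[OF corr(1) s(1), of "basis m"] eps_mul[OF corr(1) _ s(2), of "basis (single g i)"] step(3,4)
      by (simp add: eps_single[OF corr(1)] del: bilin_ext_basis lift.simps)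
    finally show ?case .
  qed
  have "Dn (cmp x) = cmp (lin_ext (\<lambda>m. if m \<in> om then \<delta> (basis m) else 0) x)"
    by (rule klinear_eq_on[of "\<lambda>x. Dn (cmp x)" "\<lambda>x. cmp (lin_ext (\<lambda>m. if m \<in> om then \<delta> (basis m) else 0) x)"])
      (use x b in auto)
  then show ?thesis by (simp only: \<delta>_facts(2)[OF x, symmetric])
qed

text \<open>The drop is exactly one, so \<delta> can only contribute to the differential of the
  first page. On dv this holds because d(bd v) has internal degree 0 and one factor d.\<close>

lemma \<delta>_bidegree:
  assumes "m \<in> om" "n \<in> keys (\<delta> (basis m))"
  shows "Suc (pw n) = pw m \<and> qw n = qw m"
proof -
  have "\<forall>n\<in>keys (\<delta> (basis m)). Suc (pw n) = pw m \<and> qw n = qw m"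
    using assms(1)
  proof (induction rule: om_induct)
    case zero
    then show ?case using \<delta>_facts(4)[of 0 "basis 0"] by simp
  next
    case (step g i m)
    have b: "Suc (pw n) = pw (single g i) \<and> qw n = qw (single g i)" if n: "n \<in> keys (\<delta> (basis (single g i)))" for n
      using step(1,2,3)
    proof (cases rule: single_om_cases)
      case (Gen v)
      then have "n \<in> lam" "Suc (mdeg deg n) = mdeg deg (single g i)"
        using n \<delta>_Gen[of v i] bd_S[of "single g i" n] bd_dg[of n "single g i"] by auto
      then show ?thesis using lam_qw[of n] lam_qw[of "single g i"] Gen by simp
    next
      case (even v)
      then show ?thesis using n \<delta>_even_DGen by simp
    next
      case (odd v k)
      then have "n \<in> keys (Om.mul deg (basis (single g k)) (d (bd (gvar (Gen v)))))"
        using n \<delta>_divpow[of v k] by simp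
      then obtain l where "l \<in> keys (d (bd (gvar (Gen v))))" "n = single g k + l"
        by (auto dest!: keys_bilin_extD keys_mprD)
      then show ?thesis using d_low(2)[of "bd (gvar (Gen v))" l] bd_var_lam[of _ v] odd by auto
    qed
    show ?case
    proof
      fix n assume "n \<in> keys (\<delta> (basis (single g i + m)))"
      then consider "n \<in> keys (Om.mul deg (\<delta> (basis (single g i))) (basis m))" |
        "n \<in> keys (Om.mul deg (basis (single g i)) (\<delta> (basis m)))"
        unfolding \<delta>_step[OF step(5,6)] by (metis keys_addD keys_sgs)
      then show "Suc (pw n) = pw (single g i + m) \<and> qw n = qw (single g i + m)"
        by cases (use b step(7) in \<open>fastforce dest!: keys_bilin_extD keys_mprD\<close>)+
    qed
  qed
  then show ?thesis using assms(2) by blast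
qed

subsection \<open>Leading parts\<close>

text \<open>\<open>x0\<close> is the component of internal degree \<open>p\<close>, possibly zero,
  and nothing lies above it.\<close>

definition leads :: "nat \<Rightarrow> ('v mono \<times> 'v mono list \<Rightarrow>\<^sub>0 'k) \<Rightarrow> ('v mono \<times> 'v mono list \<Rightarrow>\<^sub>0 'k) \<Rightarrow> bool"
  where "leads p x x0 \<longleftrightarrow> (\<forall>m\<in>keys x0. pdg m = p) \<and> (\<forall>m\<in>keys (x - x0). pdg m < p)"

lemma leads_um:
  assumes "leads p x x0" "leads q y y0"
  shows "leads (p + q) (um x y) (um x0 y0)"
proof -
  have e: "um x y - um x0 y0 = um (x - x0) y + um x0 (y - y0)" by simp
  have y: "pdg m \<le> q" if "m \<in> keys y" for m
    using that assms(2) keys_addD[of m "y - y0" y0] by (auto simp: leads_def)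
  have "pdg m < p + q" if "m \<in> keys (um x y - um x0 y0)" for m
    using that unfolding e
  proof (elim keys_addD[elim_format] disjE)
    assume "m \<in> keys (um (x - x0) y)"
    then show ?thesis using pdg_um[of m "x - x0" y] y assms(1) by (fastforce simp: leads_def)
  next
    assume "m \<in> keys (um x0 (y - y0))"
    then show ?thesis using pdg_um[of m x0 "y - y0"] assms by (fastforce simp: leads_def)
  qed
  moreover have "pdg m = p + q" if "m \<in> keys (um x0 y0)" for m
    using pdg_um[OF that] assms by (auto simp: leads_def)
  ultimately show ?thesis by (simp add: leads_def)
qed

text \<open>In the convolution only the summand without a positive index of \<open>corr\<close>
  reaches internal degree n, since the corrections have internal degree 0.\<close>

lemma leads_lift:
  assumes "g \<in> Gen ` G \<union> DGen ` G"
  shows "leads (pw (single g n)) (lift corr g n) (lift triv g n)"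
proof (cases g)
  case (Gen v)
  then show ?thesis by (simp add: leads_def pdg_def)
next
  case (DGen v)
  then have v: "v \<in> G" using assms by auto
  show ?thesis
  proof (cases "deg v = 0")
    case True
    then show ?thesis using DGen v by (auto simp: leads_def pdg_def one_u_def)
  next
    case False
    then have d1: "deg v = 1" using deg_cases[OF v] by auto
    let ?Y = "\<lambda>i. basis (0, replicate i (var v)) :: 'v mono \<times> 'v mono list \<Rightarrow>\<^sub>0 'k"
    have Y: "pdg m = i" if "m \<in> keys (?Y i)" for m i
      using that d1 by (simp add: pdg_def wdg_def sum_list_replicate)
    have "lift corr g n = (\<Sum>i<n. um (?Y i) (corr v (n - i))) + ?Y n"
      using DGen v d1 divsysD(1)[OF corr(1)[of v]] by (simp add: lessThan_Suc_atMost[symmetric])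
    moreover have "pdg m < n" if m: "m \<in> keys (\<Sum>i<n. um (?Y i) (corr v (n - i)))" for m
    proof -
      obtain i where "i < n" "m \<in> keys (um (?Y i) (corr v (n - i)))"
        using subsetD[OF keys_sum m] by auto
      then show ?thesis using pdg_um[of m "?Y i" "corr v (n - i)"] Y corr(2)[of v "n - i"] by (force simp: pzero_def)
    qed
    ultimately show ?thesis
      using lift_triv[OF v d1, of n] DGen d1 Y by (simp add: leads_def del: lift.simps)
  qed
qed

lemma leads_cmp: "m \<in> om \<Longrightarrow> leads (pw m) (cmp (basis m)) (cmp0 (basis m))"
proof (induction rule: om_induct)
  case zero
  then show ?case using eps_0[OF corr(1)] eps_0[OF divsys_triv] by (simp add: leads_def one_u_def pdg_def)
next
  case (step g i m)
  then show ?case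
    using leads_um[OF leads_lift[OF step(1)] step(7), of i] eps_step[OF corr(1) step(5)] eps_step[OF divsys_triv step(5)] by simp
qed

end

section \<open>Algebraic discrete Morse theory\<close>

text \<open>Lower and upper cells are paired by \<open>up\<close> with invertible incidence;
  \<open>decreasing\<close> makes the incidence matrix from upper to lower cells triangular along
  \<open>R\<close>.\<close>

locale matching =
  fixes b :: "('c \<Rightarrow>\<^sub>0 'k::comm_ring_1) \<Rightarrow> ('c \<Rightarrow>\<^sub>0 'k)" and lower upper :: "'c set" and up :: "'c \<Rightarrow> 'c" and R :: "('c \<times> 'c) set"
  assumes linear: "klinear b"
    and bij: "bij_betw up lower upper"
    and wf: "wf R"
    and unit: "v \<in> lower \<Longrightarrow> \<exists>u. u * lookup (b (basis (up v))) v = 1"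
    and decreasing: "v \<in> lower \<Longrightarrow> w \<in> lower \<Longrightarrow> w \<in> keys (b (basis (up v))) \<Longrightarrow> w \<noteq> v \<Longrightarrow> (up w, up v) \<in> R"
begin

text \<open>Subtracting a multiple of the boundary of \<open>up v\<close> removes \<open>v\<close>
  and brings in only lower cells whose partners are smaller. The sets \<open>X\<close> and
  \<open>Y\<close> carry invariants such as the bidegree through this reduction.\<close>

lemma clear_lower:
  assumes X: "\<And>v. v \<in> lower \<Longrightarrow> v \<in> X \<Longrightarrow> up v \<in> Y" "\<And>v. v \<in> lower \<Longrightarrow> v \<in> X \<Longrightarrow> keys (b (basis (up v))) \<subseteq> X"
    and x: "keys x \<subseteq> X"
  shows "\<exists>y. keys y \<subseteq> upper \<inter> Y \<and> keys (x - b y) \<inter> lower = {}"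
proof -
  let ?P = "\<lambda>x. \<exists>y. keys y \<subseteq> upper \<inter> Y \<and> keys (x - b y) \<inter> lower = {}"
  have add: "?P (x + z)" if P: "?P x" "?P z" for x z
  proof -
    obtain y y' where "keys y \<subseteq> upper \<inter> Y" "keys (x - b y) \<inter> lower = {}" "keys y' \<subseteq> upper \<inter> Y" "keys (z - b y') \<inter> lower = {}"
      using P by blast
    moreover have "x + z - b (y + y') = (x - b y) + (z - b y')" by (simp add: klinearD(1)[OF linear])
    ultimately show ?thesis
      using Poly_Mapping.keys_add[of y y'] Poly_Mapping.keys_add[of "x - b y" "z - b y'"]
      by (intro exI[of _ "y + y'"] conjI) (simp_all only:, blast+)
  qed
  have scal: "?P (scal c x)" if P: "?P x" for c x
  proof -
    obtain y where "keys y \<subseteq> upper \<inter> Y" "keys (x - b y) \<inter> lower = {}"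
      using P by blast
    moreover have "scal c x - b (scal c y) = scal c (x - b y)" by (simp add: klinearD(2)[OF linear] scal_diff)
    ultimately show ?thesis
      using keys_scal[of c y] keys_scal[of c "x - b y"] by (intro exI[of _ "scal c y"]) auto
  qed
  have zero: "?P 0" by (intro exI[of _ 0]) (simp add: klinearD(3)[OF linear])
  have sum: "?P (\<Sum>m\<in>A. scal (c m) (basis m))" if "finite A" "\<And>m. m \<in> A \<Longrightarrow> ?P (basis m)" for A and c :: "'c \<Rightarrow> 'k"
    using that
  proof (induction A rule: finite_induct)
    case (insert m A)
    then show ?case using add[OF scal[of "basis m" "c m"], of "\<Sum>m\<in>A. scal (c m) (basis m)"] by (simp del: scal_single)
  qed (use zero in simp)
  have all: "?P x" if "\<And>m. m \<in> keys x \<Longrightarrow> ?P (basis m)" for x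
    by (subst poly_mapping_decomp[of x]) (rule sum[OF finite_keys that])
  have basis: "?P (basis v)" if "v \<in> X" for v
  proof (cases "v \<in> lower")
    case True
    have "\<forall>v\<in>X. v \<in> lower \<longrightarrow> up v = M \<longrightarrow> ?P (basis v)" for M
      using wf
    proof (induction M rule: wf_induct_rule)
      case (less M)
      show ?case
      proof (intro ballI impI)
        fix v assume v: "v \<in> X" "v \<in> lower" "up v = M"
        obtain u where u: "u * lookup (b (basis (up v))) v = 1" using unit v by blast
        let ?r = "basis v - b (scal u (basis (up v)))"
        have r: "?r = basis v - scal u (b (basis (up v)))" by (simp only: klinearD(2)[OF linear])
        have "?P (basis m)" if m: "m \<in> keys ?r" for m
        proof (cases "m \<in> lower")
          case True
          have "lookup ?r v = 0" unfolding r by (simp add: lookup_minus u)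
          then have "m \<noteq> v" using m by (auto simp: in_keys_iff)
          then have mk: "m \<in> keys (b (basis (up v)))"
            using m[unfolded r] Poly_Mapping.keys_diff[of "basis v" "scal u (b (basis (up v)))"] keys_scal[of u "b (basis (up v))"] by auto
          then have "(up m, M) \<in> R" "m \<in> X" using decreasing[OF v(2) True mk \<open>m \<noteq> v\<close>] v X(2) by auto
          then show ?thesis using less True by blast
        next
          case False
          then show ?thesis by (intro exI[of _ 0]) (auto simp: klinearD(3)[OF linear])
        qed
        then have "?P ?r" by (rule all)
        moreover have "?P (b (scal u (basis (up v))))"
          using X(1) v bij keys_scal[of u "basis (up v)"] by (intro exI[of _ "scal u (basis (up v))"]) (auto simp: bij_betw_def)
        ultimately have "?P (?r + b (scal u (basis (up v))))" by (rule add)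
        then show "?P (basis v)" by (simp del: scal_single)
      qed
    qed
    then show ?thesis using True that by blast
  next
    case False
    then show ?thesis by (intro exI[of _ 0]) (auto simp: klinearD(3)[OF linear])
  qed
  show ?thesis by (rule all) (use basis x in blast)
qed

text \<open>Triangularity: the partner of an \<open>R\<close>-maximal cell of the support occurs in
  the boundary of no other cell of the support.\<close>

lemma upper_injective:
  assumes x: "keys x \<subseteq> upper" "keys (b x) \<inter> lower = {}"
  shows "x = 0"
proof (rule ccontr)
  assume "x \<noteq> 0"
  let ?R = "R \<inter> (keys x \<times> keys x)"
  \<comment> \<open>A maximal cell exists because the support is finite and \<open>R\<close> is
    acyclic.\<close>
  have "wf (?R\<inverse>)"
    by (rule finite_acyclic_wf_converse) (auto intro: wf_acyclic[OF wf_subset[OF wf]])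
  moreover obtain M where "M \<in> keys x" using \<open>x \<noteq> 0\<close> by (meson keys_eq_empty ex_in_conv)
  ultimately obtain M0 where M0: "M0 \<in> keys x" "\<And>M. (M, M0) \<in> ?R\<inverse> \<Longrightarrow> M \<notin> keys x"
    by (metis wfE_min)
  have sur: "\<exists>s\<in>lower. up s = M" if "M \<in> keys x" for M
    using that x(1) bij_betw_imp_surj_on[OF bij] by blast
  obtain s0 where s0: "s0 \<in> lower" "up s0 = M0" using sur[OF M0(1)] by blast
  have z: "lookup (b (basis M)) s0 = 0" if M: "M \<in> keys x" "M \<noteq> M0" for M
  proof (rule ccontr)
    assume a: "lookup (b (basis M)) s0 \<noteq> 0"
    obtain s where s: "s \<in> lower" "up s = M" using sur[OF M(1)] by blast
    then have "(M0, M) \<in> R" using decreasing[of s s0] s0 a M by (auto simp: in_keys_iff)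
    then show False using M0(1) M0(2)[of M] M by blast
  qed
  have "lookup (b x) s0 = (\<Sum>M\<in>keys x. lookup x M * lookup (b (basis M)) s0)"
    by (subst (1) poly_mapping_decomp[of x])
      (simp only: klinearD(7)[OF linear] klinearD(2)[OF linear] lookup_sum lookup_scal)
  also have "\<dots> = (\<Sum>M\<in>{M0}. lookup x M * lookup (b (basis M)) s0)"
    by (rule sum.mono_neutral_right) (use M0(1) z in auto)
  finally have "lookup (b x) s0 = lookup x M0 * lookup (b (basis M0)) s0" by simp
  moreover have "s0 \<notin> keys (b x)" using x(2) s0(1) by blast
  ultimately have 0: "lookup x M0 * lookup (b (basis M0)) s0 = 0"
    by (simp add: in_keys_iff)
  obtain u where u: "u * lookup (b (basis M0)) s0 = 1" using unit[OF s0(1)] s0(2) by auto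
  have "lookup x M0 = lookup x M0 * (u * lookup (b (basis M0)) s0)" by (simp add: u)
  also have "\<dots> = u * (lookup x M0 * lookup (b (basis M0)) s0)" by (simp only: mult.left_commute)
  finally have "lookup x M0 = 0" by (simp add: 0)
  then show False using M0(1) by (simp add: in_keys_iff)
qed

end

section \<open>The matching on the bar construction\<close>

context low_degree
begin

text \<open>Variables are ordered as their generators \<open>DGen\<close>, so that sorted words
  agree with the order of the factors in \<open>mono_hom\<close>; \<open>cmp0_cells\<close> relies
  on this.\<close>

definition vl :: "'v \<Rightarrow> 'v \<Rightarrow> bool" where "vl u v \<longleftrightarrow> gless (DGen u) (DGen v)"

lemma vl_facts: "\<not> vl u u" "vl u v \<Longrightarrow> vl v w \<Longrightarrow> vl u w" "u \<noteq> v \<Longrightarrow> vl u v \<or> vl v u" "vl u v \<Longrightarrow> \<not> vl v u"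
  using gless_total[of "DGen u" "DGen v"] gless_asym[of "DGen u" "DGen v"] gless_trans[of "DGen u" "DGen v" "DGen w"]
  by (auto simp: vl_def)

definition top :: "'v mono \<Rightarrow> 'v"
  where "top m = (THE v. Gen v \<in> keys m \<and> (\<forall>u. Gen u \<in> keys m \<longrightarrow> u = v \<or> vl u v))"

lemma top_eqI: "Gen v \<in> keys m \<Longrightarrow> (\<And>u. Gen u \<in> keys m \<Longrightarrow> u = v \<or> vl u v) \<Longrightarrow> top m = v"
  unfolding top_def by (rule the_equality) (use vl_facts(4) in blast)+

lemma ex_vl_max: "finite A \<Longrightarrow> A \<noteq> {} \<Longrightarrow> \<exists>v\<in>A. \<forall>u\<in>A. u = v \<or> vl u v"
proof (induction A rule: finite_ne_induct)
  case (insert a A)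
  then obtain v where v: "v \<in> A" "\<forall>u\<in>A. u = v \<or> vl u v" by blast
  show ?case
  proof (cases "vl v a")
    case True
    then show ?thesis using v vl_facts(2)[of _ v a] by (intro bexI[of _ a]) auto
  next
    case False
    then show ?thesis using v vl_facts(3)[of v a] by (intro bexI[of _ v]) auto
  qed
qed simp

definition lam1 :: "'v mono set" where "lam1 = lam - {0}"

lemma top_facts:
  assumes "m \<in> lam1"
  shows "Gen (top m) \<in> keys m" "top m \<in> G" "Gen u \<in> keys m \<Longrightarrow> u = top m \<or> vl u (top m)"
proof -
  let ?A = "{v. Gen v \<in> keys m}"
  have k: "keys m \<subseteq> Gen ` G" "keys m \<noteq> {}" using assms by (auto simp: lam1_def lam_def monos_in_def)
  then obtain g where "g \<in> keys m" by blast
  with k have "?A \<noteq> {}" by auto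
  moreover have "finite ?A" by (rule finite_imageD[of Gen]) (auto simp: inj_on_def intro: finite_subset[of _ "keys m"])
  ultimately obtain v where v: "v \<in> ?A" "\<forall>u\<in>?A. u = v \<or> vl u v" using ex_vl_max by metis
  then have "top m = v" by (intro top_eqI) auto
  then show "Gen (top m) \<in> keys m" "top m \<in> G" "Gen u \<in> keys m \<Longrightarrow> u = top m \<or> vl u (top m)"
    using v k by auto
qed

lemma keys_var [simp]: "keys (var v) = {Gen v}"
  by (simp add: var_def)

lemma var_lam1: "v \<in> G \<Longrightarrow> var v \<in> lam1"
  using var_lam by (simp add: lam1_def)

lemma top_var [simp]: "top (var v) = v"
  by (rule top_eqI) auto

lemma var_inj [simp]: "var u = var v \<longleftrightarrow> u = v"
  by (metis top_var)

lemma lam1_plus: "m \<in> lam1 \<Longrightarrow> n \<in> lam1 \<Longrightarrow> m + n \<in> lam \<Longrightarrow> m + n \<in> lam1"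
  by (auto simp: lam1_def plus_mono_eq_0)

lemma top_plus:
  assumes "m \<in> lam1" "n \<in> lam1"
  shows "top (m + n) = (if vl (top m) (top n) then top n else top m)"
proof (cases "vl (top m) (top n)")
  case True
  have "u = top n \<or> vl u (top n)" if "Gen u \<in> keys m \<union> keys n" for u
    using that top_facts(3)[OF assms(1), of u] top_facts(3)[OF assms(2), of u] True vl_facts(2)[of u "top m" "top n"] by blast
  then have "top (m + n) = top n"
    using top_facts(1)[OF assms(2)] by (intro top_eqI) (simp_all add: keys_plus_nat)
  then show ?thesis using True by simp
next
  case False
  then have "top n = top m \<or> vl (top n) (top m)" using vl_facts(3) by blast
  then have "u = top m \<or> vl u (top m)" if "Gen u \<in> keys m \<union> keys n" for u
    using that top_facts(3)[OF assms(1), of u] top_facts(3)[OF assms(2), of u] vl_facts(2)[of u "top n" "top m"] by (metis Un_iff)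
  then have "top (m + n) = top m"
    using top_facts(1)[OF assms(1)] by (intro top_eqI) (simp_all add: keys_plus_nat)
  then show ?thesis using False by simp
qed

lemma plus_neq_var:
  assumes "m \<noteq> 0" "n \<noteq> 0"
  shows "m + n \<noteq> var v"
proof
  assume e: "m + n = var v"
  have k: "keys m \<union> keys n = {Gen v}" using arg_cong[OF e, of keys] by (simp add: keys_plus_nat)
  have "\<exists>g. g \<in> keys m" "\<exists>g. g \<in> keys n" using assms by (meson keys_eq_empty ex_in_conv)+
  then have "Gen v \<in> keys m" "Gen v \<in> keys n" using k by (metis UnI1 UnI2 singletonD)+
  then have "lookup m (Gen v) \<noteq> 0" "lookup n (Gen v) \<noteq> 0" by (simp_all add: in_keys_iff)
  then show False using arg_cong[OF e, of "\<lambda>m. lookup m (Gen v)"] by (simp add: lookup_add var_def)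
qed

text \<open>Repetition is allowed for odd variables, where dv is even and has divided powers; for
  even variables dv is odd and squares to zero.\<close>

fun ok :: "'v option \<Rightarrow> 'v \<Rightarrow> bool"
  where "ok None t = True" | "ok (Some p) t = (vl p t \<or> p = t \<and> odd (deg t))"

text \<open>
  The kinds of words: critical (0), lower end of a matched pair (1), upper end (2).  Reading from the left,
  a word is critical as long as its letters are variables which increase (weakly, if odd).
\<close>

fun kind :: "'v option \<Rightarrow> 'v mono list \<Rightarrow> nat"
  where
    "kind p [] = 0"
  | "kind p (m # w) = (if \<not> ok p (top m) then 2 else if m = var (top m) then kind (Some (top m)) w else 1)"

text \<open>\<open>split\<close> and \<open>merge\<close> are the two directions of the matching:
  the first letter that is not a variable loses its largest variable, or the two letters at the
  first forbidden step are multiplied.\<close>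

fun split :: "'v mono list \<Rightarrow> 'v mono list"
  where
    "split [] = []"
  | "split (m # w) = (if m = var (top m) then m # split w else var (top m) # (m - var (top m)) # w)"

fun merge :: "'v \<Rightarrow> 'v mono list \<Rightarrow> 'v mono list"
  where
    "merge x [] = []"
  | "merge x (m # w) = (if ok (Some x) (top m) then var x # merge (top m) w else (var x + m) # w)"

text \<open>At a forbidden step \<open>x\<close> is at least the largest variable of
  \<open>m\<close>, strictly if odd. So \<open>x\<close> is the largest variable of the product, and
  an odd \<open>x\<close> does not occur in \<open>m\<close>, which makes the coefficient a sign and
  hence invertible.\<close>

lemma not_ok_top_plus:
  assumes "x \<in> G" "m \<in> lam1" "\<not> ok (Some x) (top m)"
  shows "top (var x + m) = x" "var x + m \<noteq> var x" "var x + m \<in> lam"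
    "\<exists>n. mpr deg (var x) m = (sgs n (basis (var x + m)) :: _ \<Rightarrow>\<^sub>0 'k)"
proof -
  show "top (var x + m) = x" using assms top_plus[OF var_lam1[OF assms(1)] assms(2)] by auto
  show "var x + m \<noteq> var x" using assms by (auto simp: lam1_def)
  have rep: "\<not> odd_rep deg (var x + m)"
  proof
    assume "odd_rep deg (var x + m)"
    then obtain g where g: "odd_gen deg g" "2 \<le> lookup (var x) g + lookup m g" by (auto simp: odd_rep_def lookup_add)
    have "\<not> odd_rep deg m" using assms by (auto simp: lam1_def lam_def monos_in_odd_rep)
    then have "lookup m g < 2" using g(1) by (auto simp: odd_rep_def not_le)
    then have "g = Gen x" "g \<in> keys m" using g by (auto simp: var_def lookup_single in_keys_iff when_def split: if_splits)
    then have "x = top m \<or> vl x (top m)" using top_facts(3)[OF assms(2)] by auto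
    then show False using assms(3) g(1) \<open>g = Gen x\<close> by (auto simp: odd_gen_def)
  qed
  then show "var x + m \<in> lam" using assms by (auto simp: lam1_def lam_def monos_in_odd_rep keys_plus_nat)
  have "keys (var x) \<inter> keys m \<inter> dp_gen deg \<subseteq> {}" by (auto simp: dp_gen_def)
  then have "mcf deg (var x) m = ((-1) ^ card (inv_set deg (var x) m) :: 'k)"
    using rep assms mono_coeff_alt[of "{}" "var x" m deg, where 'k = 'k] by (simp add: mcf_def lam1_def)
  then show "\<exists>n. mpr deg (var x) m = (sgs n (basis (var x + m)) :: _ \<Rightarrow>\<^sub>0 'k)"
    by (intro exI[of _ "card (inv_set deg (var x) m)"]) (simp add: mpr_def sgs_def single_uminus minus_one_power_iff)
qed

text \<open>All letters before the first forbidden step are variables, so \<open>split\<close> finds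
  the merged letter again.\<close>

lemma merge_facts:
  assumes "x \<in> G" "set w \<subseteq> lam1" "kind (Some x) w = 2" "ok p x"
  shows "kind p (merge x w) = 1" "split (merge x w) = var x # w" "set (merge x w) \<subseteq> lam1"
proof -
  have "kind p (merge x w) = 1 \<and> split (merge x w) = var x # w \<and> set (merge x w) \<subseteq> lam1"
    using assms
  proof (induction w arbitrary: x p)
    case (Cons m w)
    show ?case
    proof (cases "ok (Some x) (top m)")
      case True
      then have mt: "m = var (top m)" "kind (Some (top m)) w = 2" using Cons(4) by (auto split: if_splits)
      define t where "t = top m"
      have t: "m = var t" "t \<in> G" "ok (Some x) t" "kind (Some t) w = 2"
        using mt top_facts(2) Cons True by (auto simp: t_def)
      then have "kind (Some x) (merge t w) = 1 \<and> split (merge t w) = var t # w \<and> set (merge t w) \<subseteq> lam1"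
        using Cons(1)[OF t(2) _ t(4,3)] Cons(3) by simp
      then show ?thesis using t Cons var_lam1[of x] by auto
    next
      case False
      then show ?thesis using not_ok_top_plus[OF Cons(2) _ False] lam1_plus[OF var_lam1[OF Cons(2)], of m] Cons by auto
    qed
  qed simp
  then show "kind p (merge x w) = 1" "split (merge x w) = var x # w" "set (merge x w) \<subseteq> lam1" by auto
qed

lemma minus_var_lam1:
  assumes "m \<in> lam1" "m \<noteq> var (top m)"
  shows "m - var (top m) \<in> lam1" "var (top m) + (m - var (top m)) = m" "\<not> ok (Some (top m)) (top (m - var (top m)))"
proof -
  let ?n = "m - var (top m)"
  have "1 \<le> lookup m (Gen (top m))" using top_facts(1)[OF assms(1)] by (simp add: in_keys_iff)
  then show e: "var (top m) + ?n = m"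
    by (intro poly_mapping_eqI) (auto simp: lookup_add lookup_minus var_def lookup_single when_def)
  then have "?n \<in> lam" "?n \<noteq> 0" using om_plusD(2)[of "var (top m)" ?n] assms by (auto simp: lam1_def)
  then show l: "?n \<in> lam1" by (simp add: lam1_def)
  have t: "Gen (top ?n) \<in> keys m" using top_facts(1)[OF l] e keys_plus_nat[of "var (top m)" ?n] by auto
  have "even (deg (top m))" if "top ?n = top m"
  proof (rule ccontr)
    assume "odd (deg (top m))"
    moreover have "lookup ?n (Gen (top m)) \<ge> 1" using top_facts(1)[OF l] that by (simp add: in_keys_iff)
    then have "lookup (var (top m) + ?n) (Gen (top m)) \<ge> 2" by (simp add: lookup_add var_def)
    ultimately have "odd_rep deg m" unfolding e by (auto simp: odd_rep_def odd_gen_def intro!: exI[of _ "Gen (top m)"])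
    then show False using assms(1) by (auto simp: lam1_def lam_def monos_in_odd_rep)
  qed
  then show "\<not> ok (Some (top m)) (top ?n)"
    using top_facts(3)[OF assms(1) t] vl_facts(4)[of "top m" "top ?n"] vl_facts(1)[of "top m"] by auto
qed

lemma split_facts:
  assumes "set z \<subseteq> lam1" "kind p z = 1"
  shows "\<exists>x w. split z = var x # w \<and> x \<in> G \<and> ok p x \<and> set w \<subseteq> lam1 \<and> kind (Some x) w = 2 \<and> merge x w = z"
  using assms
proof (induction z arbitrary: p)
  case (Cons m z)
  have okp: "ok p (top m)" using Cons(3) by (auto split: if_splits)
  have m: "m \<in> lam1" "top m \<in> G" using Cons(2) top_facts(2) by auto
  show ?case
  proof (cases "m = var (top m)")
    case True
    then have "kind (Some (top m)) z = 1" using Cons(3) okp by auto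
    then obtain x w where x: "split z = var x # w" "x \<in> G" "ok (Some (top m)) x" "set w \<subseteq> lam1" "kind (Some x) w = 2" "merge x w = z"
      using Cons by fastforce
    have "split (m # z) = var (top m) # var x # w" using x True by simp
    moreover have "merge (top m) (var x # w) = m # z" using x True by simp
    moreover have "kind (Some (top m)) (var x # w) = 2" using x by simp
    ultimately show ?thesis using x m okp var_lam1 by (intro exI[of _ "top m"] exI[of _ "var x # w"]) auto
  next
    case False
    note n = minus_var_lam1[OF m(1) False]
    show ?thesis
      using False n m okp Cons by (intro exI[of _ "top m"] exI[of _ "(m - var (top m)) # z"]) auto
  qed
qed simp

fun greater :: "'v list \<Rightarrow> 'v list \<Rightarrow> bool"
  where
    "greater (x # xs) (y # ys) = (vl y x \<or> x = y \<and> greater xs ys)"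
  | "greater xs ys = False"

lemma keys_bt_Cons:
  assumes "v \<in> keys (bt (m # w))"
  shows "(\<exists>n w'. w = n # w' \<and> v = (m + n) # w' \<and> m + n \<in> keys (mpr deg m n :: _ \<Rightarrow>\<^sub>0 'k)) \<or> (\<exists>v'. v = m # v' \<and> v' \<in> keys (bt w))"
proof -
  have "v \<in> keys (mh m (basis w)) \<or> v \<in> keys (consx (basis m) (bt w))"
    using assms by (auto dest!: keys_addD)
  then show ?thesis
  proof
    assume a: "v \<in> keys (mh m (basis w))"
    then obtain n w' where w: "w = n # w'" by (cases w) auto
    then obtain l where "v = l # w'" "l \<in> keys (mpr deg m n :: _ \<Rightarrow>\<^sub>0 'k)"
      using a by (auto dest!: keys_consxD)
    then show ?thesis using w keys_mprD[of l deg m n] by blast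
  next
    assume "v \<in> keys (consx (basis m) (bt w))"
    then show ?thesis by (auto dest!: keys_consxD)
  qed
qed

text \<open>The estimate that makes the matching acyclic.\<close>

lemma bt_merge:
  assumes "x \<in> G" "set w \<subseteq> lam1" "kind (Some x) w = 2"
  shows "\<exists>n r. bt (var x # w) = sgs n (basis (merge x w)) + r \<and>
    (\<forall>p v. ok p x \<longrightarrow> v \<in> keys r \<longrightarrow> kind p v = 1 \<longrightarrow> greater (map top (split v)) (x # map top w))"
  using assms
proof (induction w arbitrary: x)
  case (Cons m w)
  have m: "m \<in> lam1" "top m \<in> G" using Cons(3) top_facts(2) by auto
  have bt: "bt (var x # m # w) = sgs (s (var x)) (consx (mpr deg (var x) m) (basis w) + consx (basis (var x)) (bt (m # w)))"
    by simp
  show ?case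
  proof (cases "ok (Some x) (top m)")
    case False
    obtain n where n: "mpr deg (var x) m = (sgs n (basis (var x + m)) :: _ \<Rightarrow>\<^sub>0 'k)"
      using not_ok_top_plus(4)[OF Cons(2) m(1) False] by blast
    let ?r = "sgs (s (var x)) (consx (basis (var x)) (bt (m # w)))"
    have "greater (map top (split v)) (x # map top (m # w))" if v: "ok p x" "v \<in> keys ?r" "kind p v = 1" for p v
    proof -
      obtain v' where v': "v = var x # v'" "v' \<in> keys (bt (m # w))"
        using v(2)[unfolded keys_sgs, THEN keys_consxD] by auto
      then have k: "kind (Some x) v' = 1" using v by simp
      from keys_bt_Cons[OF v'(2)] show ?thesis
      proof (elim disjE exE conjE)
        fix n' w' assume h: "w = n' # w'" "v' = (m + n') # w'"
        have n': "n' \<in> lam1" using h Cons(3) by auto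
        have ok: "ok (Some x) (top (m + n'))" "m + n' \<noteq> var (top (m + n'))"
          using k h plus_neq_var[of m n'] m n' by (auto simp: lam1_def split: if_splits)
        \<comment> \<open>The new letter is admissible after \<open>x\<close> while \<open>m\<close>
          is not, so its largest variable comes from \<open>n'\<close> and exceeds that of
          \<open>m\<close>.\<close>
        have "top (m + n') = top n'" "vl (top m) (top n')"
          using top_plus[OF m(1) n'] ok(1) False by (auto split: if_splits)
        then show ?thesis using h v' ok by simp
      next
        fix v'' assume "v' = m # v''"
        then show ?thesis using k False by simp
      qed
    qed
    then show ?thesis
      using False bt n by (intro exI[of _ "s (var x) + n"] exI[of _ ?r]) (auto simp: sgs_sgs sgs_add simp del: bt.simps)
  next
    case True
    then have mt: "m = var (top m)" "kind (Some (top m)) w = 2" using Cons(4) by (auto split: if_splits)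
    define t where "t = top m"
    have t: "m = var t" "t \<in> G" "ok (Some x) t" "kind (Some t) w = 2" using mt m True by (auto simp: t_def)
    obtain n r where r: "bt (var t # w) = sgs n (basis (merge t w)) + r"
      "\<And>p v. ok p t \<Longrightarrow> v \<in> keys r \<Longrightarrow> kind p v = 1 \<Longrightarrow> greater (map top (split v)) (t # map top w)"
      using Cons(1)[OF t(2) _ t(4)] Cons(3) by auto
    let ?r = "sgs (s (var x)) (consx (mpr deg (var x) m) (basis w) + consx (basis (var x)) r)"
    have "greater (map top (split v)) (x # map top (m # w))" if v: "ok p x" "v \<in> keys ?r" "kind p v = 1" for p v
    proof -
      from v(2)[unfolded keys_sgs, THEN keys_addD]
      consider "v \<in> keys (consx (mpr deg (var x) m) (basis w) :: _ \<Rightarrow>\<^sub>0 'k)" | "v \<in> keys (consx (basis (var x)) r)"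
        by blast
      then show ?thesis
      proof cases
        case 1
        then obtain l where l: "v = l # w" "l \<in> keys (mpr deg (var x) (var t) :: _ \<Rightarrow>\<^sub>0 'k)"
          using t(1) by (auto dest!: keys_consxD)
        then have e: "v = (var x + var t) # w" "mpr deg (var x) (var t) \<noteq> (0 :: _ \<Rightarrow>\<^sub>0 'k)"
          using keys_mprD[OF l(2)] by auto
        \<comment> \<open>A repeated variable is admissible only if it is odd, and then its square
          is zero.\<close>
        have "x \<noteq> t" using e(2) t(3) mpr_odd_var[of t] vl_facts(1)[of t] by auto
        then have xt: "vl x t" using t(3) by auto
        then have top: "top (var x + var t) = t" using top_plus[OF var_lam1[OF Cons(2)] var_lam1[OF t(2)]] by simp
        have "var x + var t \<noteq> var t" by simp
        then show ?thesis using e top xt t(1) by simp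
      next
        case 2
        then obtain v' where v': "v = var x # v'" "v' \<in> keys r" by (auto dest!: keys_consxD)
        then have "kind (Some x) v' = 1" using v by simp
        then show ?thesis using r(2)[OF t(3) v'(2)] v' t by simp
      qed
    qed
    moreover have "bt (var x # m # w) = sgs (s (var x) + n) (basis (merge x (m # w))) + ?r"
      unfolding bt using r(1) t by (simp add: sgs_add sgs_sgs del: bt.simps)
    ultimately show ?thesis by blast
  qed
qed simp

section \<open>Termination of the matching for the Hochschild boundary\<close>

definition tot :: "'v mono \<times> 'v mono list \<Rightarrow> 'v mono" where "tot x = fst x + sum_list (snd x)"
text \<open>Counts the variables of the word without those of the coefficient, so that detaching an
  outer letter lowers it.\<close>

definition bs :: "'v mono list \<Rightarrow> nat" where "bs w = wsum (\<lambda>_. 1) (sum_list w)"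

lemma bs_simps [simp]: "bs [] = 0" "bs (m # w) = wsum (\<lambda>_. 1) m + bs w" "bs (v @ w) = bs v + bs w"
  by (simp_all add: bs_def)

lemma wsum_1_pos: "m \<noteq> 0 \<Longrightarrow> 0 < wsum (\<lambda>_. 1) (m :: 'v mono)"
proof -
  assume "m \<noteq> 0"
  then obtain g where "g \<in> keys m" by (meson keys_eq_empty ex_in_conv)
  then show ?thesis unfolding wsum_def by (intro sum_pos2[of _ g]) (auto simp: in_keys_iff)
qed

lemma ncells_iff: "(a, w) \<in> ncells \<longleftrightarrow> a \<in> lam \<and> set w \<subseteq> lam1"
  by (auto simp: ncells_def lam1_def)

lemma sum_list_bt: "v \<in> keys (bt w) \<Longrightarrow> sum_list v = sum_list w"
proof (induction w arbitrary: v)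
  case (Cons m w)
  from keys_bt_Cons[OF Cons(2)] show ?case using Cons(1) by (auto simp: add.assoc)
qed simp

lemma keys_HB_cases:
  assumes "x \<in> keys (HB (basis (a, u)))" "u \<noteq> []"
  obtains w where "x = (a, w)" "w \<in> keys (bt u)"
  | "x = (a + hd u, tl u)" "x \<in> keys (um (basis (a, [])) (lft u))"
  | "x = (a + last u, butlast u)" "x \<in> keys (um (basis (a, [])) (rgt u))"
proof -
  have "x \<in> keys (tens (basis a) (bt u) + (um (basis (a, [])) (lft u) - um (basis (a, [])) (rgt u)))"
    using assms(1) by (simp add: HB_basis)
  then consider "x \<in> keys (tens (basis a) (bt u))" | "x \<in> keys (um (basis (a, [])) (lft u))" | "x \<in> keys (um (basis (a, [])) (rgt u))"
    by (meson keys_addD keys_diffD)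
  then show ?thesis
  proof cases
    case 1
    then show ?thesis using that(1) by (cases x) (auto dest!: keys_tensD)
  next
    case 2
    then have "x = (a + hd u, tl u)" using assms(2)
      by (cases x; cases u) (auto simp: tpr_pair dest!: keys_tensD keys_mprD)
    then show ?thesis using 2 that(2) by blast
  next
    case 3
    then have "x = (a + last u, butlast u)" using assms(2)
      by (cases x; cases u rule: rev_cases) (auto simp: tpr_pair dest!: keys_tensD keys_mprD)
    then show ?thesis using 3 that(3) by blast
  qed
qed

lemma tot_HB: "x \<in> keys (HB (basis (a, u))) \<Longrightarrow> tot x = tot (a, u)"
proof (cases "u = []")
  case False
  assume x: "x \<in> keys (HB (basis (a, u)))"
  from x False show ?thesis
  proof (cases rule: keys_HB_cases)
    case (1 w)
    then show ?thesis using sum_list_bt by (auto simp: tot_def)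
  next
    case 2
    then show ?thesis using False by (cases u) (auto simp: tot_def add.assoc)
  next
    case 3
    then show ?thesis using False by (cases u rule: rev_cases) (auto simp: tot_def ac_simps)
  qed
qed (simp add: HB_basis)

text \<open>Larger variables have smaller rank. Ranks inside the finite support of \<open>m\<close>
  make the comparison of words well-founded, although the order of all variables need not
  be.\<close>

definition rank :: "'v mono \<Rightarrow> 'v \<Rightarrow> nat" where "rank m v = card {u. Gen u \<in> keys m \<and> vl v u}"

lemma rank_less: "vl y x \<Longrightarrow> Gen x \<in> keys m \<Longrightarrow> rank m x < rank m y"
  unfolding rank_def
proof (rule psubset_card_mono)
  assume a: "vl y x" "Gen x \<in> keys m"
  have "finite (Gen -` keys m)" by (rule finite_vimageI) (auto simp: inj_on_def)
  then show "finite {u. Gen u \<in> keys m \<and> vl y u}" by (rule rev_finite_subset) auto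
  have "x \<in> {u. Gen u \<in> keys m \<and> vl y u}" "x \<notin> {u. Gen u \<in> keys m \<and> vl x u}" using a vl_facts(1) by auto
  moreover have "{u. Gen u \<in> keys m \<and> vl x u} \<subseteq> {u. Gen u \<in> keys m \<and> vl y u}" using a(1) vl_facts(2) by blast
  ultimately show "{u. Gen u \<in> keys m \<and> vl x u} \<subset> {u. Gen u \<in> keys m \<and> vl y u}" by blast
qed

lemma greater_lex:
  assumes "greater xs ys" "length xs = length ys" "\<And>x. x \<in> set xs \<Longrightarrow> Gen x \<in> keys m"
  shows "(map (rank m) xs, map (rank m) ys) \<in> lex less_than"
  using assms
proof (induction xs ys rule: greater.induct)
  case (1 x xs y ys)
  then show ?case using rank_less[of y x m] by (auto simp: Cons_in_lex)
qed auto

lemma greater_irrefl: "\<not> greater xs xs"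
  by (induction xs) (auto simp: vl_facts(1))

definition lowers :: "('v mono \<times> 'v mono list) set" where "lowers = {(a, w). (a, w) \<in> ncells \<and> kind None w = 1}"
definition uppers :: "('v mono \<times> 'v mono list) set" where "uppers = {(a, w). (a, w) \<in> ncells \<and> kind None w = 2}"
definition crits :: "('v mono \<times> 'v mono list) set" where "crits = {(a, w). (a, w) \<in> ncells \<and> kind None w = 0}"
definition up :: "'v mono \<times> 'v mono list \<Rightarrow> 'v mono \<times> 'v mono list" where "up x = (fst x, split (snd x))"
text \<open>The boundary preserves the multidegree \<open>tot\<close>, so the ranks of two compared
  words refer to the same monomial.\<close>

definition Rel where "Rel = inv_image (less_than <*lex*> lenlex less_than)
  (\<lambda>x :: 'v mono \<times> 'v mono list. (bs (snd x), map (rank (tot x)) (map top (snd x))))"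

lemma kind_cases: "kind p w = 0 \<or> kind p w = 1 \<or> kind p w = 2"
  by (induction w arbitrary: p) auto

lemma ncells_kinds: "ncells = lowers \<union> uppers \<union> crits"
proof -
  have "(a, w) \<in> ncells \<longleftrightarrow> (a, w) \<in> lowers \<union> uppers \<union> crits" for a w
    using kind_cases[of None w] by (auto simp: lowers_def uppers_def crits_def)
  then show ?thesis by auto
qed

lemma sum_list_split: "set w \<subseteq> lam1 \<Longrightarrow> sum_list (split w) = sum_list w"
  by (induction w) (auto simp: minus_var_lam1(2) add.assoc[symmetric])

lemma length_split: "kind p z = 1 \<Longrightarrow> length (split z) = Suc (length z)"
proof (induction z arbitrary: p)
  case (Cons m z)
  show ?case
  proof (cases "m = var (top m)")
    case True
    have "kind (Some (top m)) z = 1"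
      using Cons(2) if_P[OF True, of "kind (Some (top m)) z" 1] by (simp only: kind.simps split: if_splits)
    moreover have "split (m # z) = m # split z"
      using if_P[OF True] by (simp only: split.simps)
    ultimately show ?thesis using Cons(1) by simp
  next
    case False
    then show ?thesis by simp
  qed
qed simp

lemma lowers_split:
  assumes "(a, w) \<in> lowers"
  obtains x w' where "split w = var x # w'" "x \<in> G" "set w' \<subseteq> lam1" "kind (Some x) w' = 2" "merge x w' = w"
  using split_facts[of w None] assms that by (auto simp: lowers_def ncells_iff)

lemma up_lowers: "x \<in> lowers \<Longrightarrow> up x \<in> uppers"
proof -
  assume x: "x \<in> lowers"
  obtain a w where xw: "x = (a, w)" by (cases x)
  from x[unfolded xw] obtain y w' where "split w = var y # w'" "y \<in> G" "set w' \<subseteq> lam1" "kind (Some y) w' = 2"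
    by (rule lowers_split)
  then show ?thesis using x var_lam1[of y] by (auto simp: xw up_def uppers_def ncells_iff lowers_def)
qed

lemma bij_up: "bij_betw up lowers uppers"
  unfolding bij_betw_def
proof
  show "inj_on up lowers"
  proof (rule inj_onI)
    fix x y assume xy: "x \<in> lowers" "y \<in> lowers" "up x = up y"
    obtain a w b v where e: "x = (a, w)" "y = (b, v)" by (cases x, cases y)
    from xy(1)[unfolded e] obtain s w' where 1: "split w = var s # w'" "merge s w' = w" by (rule lowers_split)
    from xy(2)[unfolded e] obtain t v' where 2: "split v = var t # v'" "merge t v' = v" by (rule lowers_split)
    show "x = y" using 1 2 xy(3) by (auto simp: e up_def)
  qed
  show "up ` lowers = uppers"
  proof
    show "up ` lowers \<subseteq> uppers" using up_lowers by auto
    show "uppers \<subseteq> up ` lowers"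
    proof
      fix x assume x: "x \<in> uppers"
      obtain a u where xu: "x = (a, u)" by (cases x)
      obtain m w where u: "u = m # w" using x by (cases u) (auto simp: xu uppers_def)
      define t where "t = top m"
      have m: "m = var t" "t \<in> G" "kind (Some t) w = 2" "set w \<subseteq> lam1" "a \<in> lam"
        using x top_facts(2)[of m] by (auto simp: xu u uppers_def ncells_iff t_def split: if_splits)
      have "(a, merge t w) \<in> lowers" "up (a, merge t w) = x"
        using merge_facts[OF m(2,4,3), of None] m by (auto simp: lowers_def ncells_iff up_def xu u)
      then show "x \<in> up ` lowers" by force
    qed
  qed
qed

text \<open>Detaching an outer letter lowers \<open>bs\<close>; merges inside the word keep it and
  are controlled by \<open>bt_merge\<close>.\<close>

lemma HB_up:
  assumes v: "(a, w) \<in> lowers" and n: "n \<in> keys (HB (basis (up (a, w))))" "n \<noteq> (a, w)" "n \<in> lowers"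
  shows "(up n, up (a, w)) \<in> Rel"
proof -
  obtain x w' where s: "split w = var x # w'" "x \<in> G" "set w' \<subseteq> lam1" "kind (Some x) w' = 2" "merge x w' = w"
    using lowers_split[OF v] .
  let ?u = "var x # w'"
  have u: "set ?u \<subseteq> lam1" using s var_lam1 by auto
  obtain b z where nz: "n = (b, z)" by (cases n)
  have z: "set z \<subseteq> lam1" "kind None z = 1" using n(3) by (auto simp: nz lowers_def ncells_iff)
  have upu: "up (a, w) = (a, ?u)" by (simp add: up_def s)
  have tot_up: "tot (up n) = tot n" using sum_list_split[OF z(1)] by (simp add: up_def tot_def nz)
  have tot: "tot (up n) = tot (a, ?u)" unfolding tot_up using tot_HB n(1) upu by simp
  have bsz: "bs (split z) = bs z" using sum_list_split[OF z(1)] by (simp add: bs_def)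
  have ne: "?u \<noteq> []" by simp
  from n(1)[unfolded upu] ne show ?thesis
  proof (cases rule: keys_HB_cases)
    case (1 w1)
    obtain k r where r: "bt ?u = sgs k (basis (merge x w')) + r"
      "\<And>p v. ok p x \<Longrightarrow> v \<in> keys r \<Longrightarrow> kind p v = 1 \<Longrightarrow> greater (map top (split v)) (x # map top w')"
      using bt_merge[OF s(2,3,4)] by blast
    have zb: "z \<in> keys (bt ?u)" "z \<noteq> w" using 1 n(2) nz by auto
    then have "z \<in> keys r"
      using keys_addD[of z "sgs k (basis (merge x w'))" r] s(5) unfolding r(1) by auto
    then have g: "greater (map top (split z)) (map top ?u)" using r(2)[of None z] z by simp
    have len: "length (split z) = length ?u"
      using length_split[OF z(2)] keys_bt[OF zb(1)] by simp
    have mem: "Gen y \<in> keys (tot (up n))" if y: "y \<in> set (map top (split z))" for y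
    proof -
      obtain m where m: "m \<in> set (split z)" "y = top m" using y by auto
      have "up n \<in> ncells" using up_lowers[OF n(3)] by (auto simp: uppers_def)
      then have "m \<in> lam1" using m by (auto simp: up_def nz ncells_iff)
      moreover have "keys m \<subseteq> keys (sum_list l)" if "m \<in> set l" for l
        using that by (induction l) (auto simp: keys_plus_nat)
      ultimately show ?thesis using top_facts(1)[of m] m by (auto simp: tot_def up_def nz keys_plus_nat)
    qed
    have "bs z = bs ?u" using sum_list_bt[OF zb(1)] by (simp add: bs_def)
    then show ?thesis
      using greater_lex[OF g _ mem] len tot bsz by (auto simp: Rel_def up_def s(1) nz lenlex_conv simp del: map_map list.map)
  next
    case 2
    then have "bs z < bs ?u" using nz wsum_1_pos[OF var_neq_0[of x]] by auto
    then show ?thesis using bsz by (simp add: Rel_def upu) (simp add: up_def nz)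
  next
    case 3
    have "last ?u \<in> lam1" using u last_in_set[of ?u] by blast
    then have "0 < wsum (\<lambda>_. 1) (last ?u)" by (intro wsum_1_pos) (auto simp: lam1_def)
    moreover have "bs ?u = bs (butlast ?u) + wsum (\<lambda>_. 1) (last ?u)"
      using bs_simps(3)[of "butlast ?u" "[last ?u]"] by (simp del: last.simps butlast.simps)
    ultimately have "bs z < bs ?u" using 3 nz by simp
    then show ?thesis using bsz by (simp add: Rel_def upu) (simp add: up_def nz)
  qed
qed

text \<open>The incidence is the sign in \<open>bt_merge\<close>: a contribution of the remainder
  would make a list greater than itself, and the terms with a detached letter have fewer variables
  in the word.\<close>

lemma HB_unit:
  assumes v: "(a, w) \<in> lowers"
  shows "\<exists>n. lookup (HB (basis (up (a, w)))) (a, w) = (sgs n 1 :: 'k)"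
proof -
  obtain x w' where s: "split w = var x # w'" "x \<in> G" "set w' \<subseteq> lam1" "kind (Some x) w' = 2" "merge x w' = w"
    using lowers_split[OF v] .
  let ?u = "var x # w'"
  have upu: "up (a, w) = (a, ?u)" by (simp add: up_def s)
  have w: "set w \<subseteq> lam1" "kind None w = 1" using v by (auto simp: lowers_def ncells_iff)
  have bsw: "bs w = bs ?u" using sum_list_split[OF w(1)] s by (simp add: bs_def)
  obtain k r where r: "bt ?u = sgs k (basis (merge x w')) + r"
    "\<And>p v. ok p x \<Longrightarrow> v \<in> keys r \<Longrightarrow> kind p v = 1 \<Longrightarrow> greater (map top (split v)) (x # map top w')"
    using bt_merge[OF s(2,3,4)] by blast
  have "w \<notin> keys r" using r(2)[of None w] w greater_irrefl[of "map top ?u"] s(1) by auto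
  then have "(a, w) \<notin> keys (tens (basis a) r)" by (auto dest: keys_tensD)
  then have 1: "lookup (tens (basis a) (bt ?u)) (a, w) = sgs k 1"
    unfolding r(1) s(5) by (simp add: lookup_add lookup_sgs in_keys_iff)
  have 2: "lookup (um (basis (a, [])) (lft ?u)) (a, w) = 0"
  proof -
    have "lookup (um (basis (a, [])) (lft ?u)) (a, w) \<noteq> 0 \<Longrightarrow> w = w'"
      by (auto simp: tpr_pair in_keys_iff[symmetric] dest!: keys_tensD)
    moreover have "w \<noteq> w'" using bsw wsum_1_pos[OF var_neq_0[of x]] by fastforce
    ultimately show ?thesis by blast
  qed
  have 3: "lookup (um (basis (a, [])) (rgt ?u)) (a, w) = 0"
  proof -
    have "lookup (um (basis (a, [])) (rgt ?u)) (a, w) \<noteq> 0 \<Longrightarrow> w = butlast ?u"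
      by (auto simp: rgt_def tpr_pair in_keys_iff[symmetric] dest!: keys_tensD)
    moreover have "last ?u \<in> lam1" using s var_lam1 last_in_set[of ?u] by auto
    then have "0 < wsum (\<lambda>_. 1) (last ?u)" by (intro wsum_1_pos) (auto simp: lam1_def)
    moreover have "bs ?u = bs (butlast ?u) + wsum (\<lambda>_. 1) (last ?u)"
      using bs_simps(3)[of "butlast ?u" "[last ?u]"] by (simp del: last.simps butlast.simps)
    ultimately show ?thesis using bsw by fastforce
  qed
  show ?thesis
    unfolding upu HB_basis using 1 2 3
    by (intro exI[of _ "mdeg deg a + k"]) (simp add: lookup_sgs lookup_add lookup_minus sgs_sgs del: bt.simps)
qed

sublocale HBm: matching HB lowers uppers up Rel
proof
  show "wf Rel" unfolding Rel_def by (intro wf_inv_image wf_lex_prod wf_less_than wf_lenlex)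
  show "klinear HB" by simp
  show "bij_betw up lowers uppers" by (rule bij_up)
  show "\<exists>u. u * lookup (HB (basis (up v))) v = 1" if v: "v \<in> lowers" for v
  proof -
    obtain n where "lookup (HB (basis (up v))) v = (sgs n 1 :: 'k)" using HB_unit[of "fst v" "snd v"] v by auto
    then show ?thesis by (intro exI[of _ "sgs n 1"]) (auto simp: sgs_def)
  qed
  show "(up w, up v) \<in> Rel" if "v \<in> lowers" "w \<in> lowers" "w \<in> keys (HB (basis (up v)))" "w \<noteq> v" for v w
    using HB_up[of "fst v" "snd v" w] that by simp
qed

end

lemma lookup_lin_ext: "lookup (lin_ext f x) y = (\<Sum>m\<in>keys x. lookup x m * lookup (f m) y)"
  by (simp add: lin_ext_def lookup_sum)

lemma lookup_lin_ext_delta: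
  assumes "\<And>m. m \<in> keys x \<Longrightarrow> lookup (f m) y = (if m = m0 then c else 0)"
  shows "lookup (lin_ext f x) y = lookup x m0 * c"
proof -
  have "lookup (lin_ext f x) y = (\<Sum>m\<in>keys x. if m = m0 then lookup x m0 * c else 0)"
    unfolding lookup_lin_ext by (intro sum.cong) (use assms in auto)
  also have "\<dots> = lookup x m0 * c" by (auto simp: in_keys_iff)
  finally show ?thesis .
qed

lemma lookup_consx: "lookup (consx (basis a) x) (c # y) = (if a = c then lookup x y else 0)"
proof -
  have "consx (basis a) x = lin_ext (\<lambda>w. basis (a # w)) x" by (simp add: consx_def)
  then show ?thesis
    using lookup_lin_ext_delta[of x "\<lambda>w. basis (a # w)" "c # y" y "if a = c then 1 else 0"]
    by (auto simp: lookup_single when_def)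
qed

lemma lookup_tens: "lookup (tens (basis a) x) (c, y) = (if a = c then lookup x y else 0)"
proof -
  have "tens (basis a) x = lin_ext (\<lambda>w. basis (a, w)) x" by (simp add: tens_def)
  then show ?thesis
    using lookup_lin_ext_delta[of x "\<lambda>w. basis (a, w)" "(c, y)" y "if a = c then 1 else 0"]
    by (auto simp: lookup_single when_def)
qed

text \<open>A shuffle starting with all the letters \<open>x\<close> leaves the second word intact,
  so concatenation is the only contribution.\<close>

lemma lookup_shp_replicate:
  "x \<notin> set w \<Longrightarrow> lookup (shp s (replicate i x) w) (replicate i x @ z) = (if w = z then 1 else 0 :: 'k::comm_ring_1)"
proof (induction i)
  case (Suc i)
  show ?case
  proof (cases w)
    case Nil
    then show ?thesis by (auto simp: lookup_single when_def)
  next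
    case (Cons b v)
    then have "b \<noteq> x" using Suc by auto
    then have "lookup (shp s (replicate (Suc i) x) w) (replicate (Suc i) x @ z) = (lookup (shp s (replicate i x) w) (replicate i x @ z) :: 'k)"
      using Cons by (simp add: lookup_add lookup_sgs lookup_consx)
    then show ?thesis using Suc by simp
  qed
qed (auto simp: lookup_single when_def)

text \<open>Separates components of different internal degree; identities for leading parts are read
  off in this way from identities for \<open>Dn\<close>.\<close>

lemma disjoint_sum_0:
  assumes "x + y = (0 :: 'b \<Rightarrow>\<^sub>0 'k::comm_ring_1)" "keys x \<inter> keys y = {}"
  shows "x = 0"
proof (rule poly_mapping_eqI)
  fix m
  have "lookup x m + lookup y m = 0" using arg_cong[OF assms(1), of "\<lambda>z. lookup z m"] by (simp add: lookup_add)
  moreover have "lookup x m = 0 \<or> lookup y m = 0" using assms(2) by (auto simp: in_keys_iff)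
  ultimately show "lookup x m = lookup 0 m" by auto
qed

lemma sorted_wrt_mset_unique:
  assumes anti: "\<And>x y. P x y \<Longrightarrow> P y x \<Longrightarrow> x = y"
  shows "sorted_wrt P xs \<Longrightarrow> sorted_wrt P ys \<Longrightarrow> mset xs = mset ys \<Longrightarrow> xs = ys"
proof (induction xs arbitrary: ys)
  case (Cons x xs)
  then obtain y ys' where ys: "ys = y # ys'" by (cases ys) auto
  have "x \<in> set ys" "y \<in> set (x # xs)" using Cons(4) ys mset_eq_setD by (metis list.set_intros(1))+
  then have "x = y" using Cons(2,3) ys anti by auto
  then show ?case using Cons ys by auto
qed simp

section \<open>The Hochschild-Kostant-Rosenberg theorem for the multiplication part\<close>

context low_degree
begin

text \<open>A word of variables is read as the product of its dv, forgetting the order; this labels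
  critical cells by monomials of Omega.\<close>

definition dsw :: "'v mono list \<Rightarrow> 'v mono"
  where "dsw w = sum_mset (image_mset (\<lambda>l. single (DGen (top l)) 1) (mset w))"

lemma dsw_simps [simp]: "dsw [] = 0" "dsw (l # w) = single (DGen (top l)) 1 + dsw w" "dsw (v @ w) = dsw v + dsw w"
  by (simp_all add: dsw_def)

lemma dsw_replicate [simp]: "dsw (replicate i (var v)) = single (DGen v) i"
  by (induction i) (simp_all add: single_add[symmetric])

lemma dsw_shp: "z \<in> keys (shp s u w :: _ \<Rightarrow>\<^sub>0 'k) \<Longrightarrow> dsw z = dsw u + dsw w"
  by (simp add: dsw_def mset_shp)

lemma lookup_dsw [simp]: "lookup (dsw w) (Gen v) = 0" "lookup (dsw w) (DGen v) = count (mset (map top w)) v"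
  by (induction w) (auto simp: lookup_add lookup_single)

abbreviation psi :: "'v mono \<times> 'v mono list \<Rightarrow> 'v mono" where "psi x \<equiv> fst x + dsw (snd x)"

lemma ok_trans: "ok p t \<Longrightarrow> ok (Some t) u \<Longrightarrow> ok p u"
  using vl_facts(2) by (cases p) auto

lemma kind_0:
  assumes "kind p w = 0" "set w \<subseteq> lam1"
  shows "set w \<subseteq> var ` G" "sorted_wrt (\<lambda>a b. ok (Some a) b) (map top w)" "t \<in> set (map top w) \<Longrightarrow> ok p t"
proof -
  have "set w \<subseteq> var ` G \<and> sorted_wrt (\<lambda>a b. ok (Some a) b) (map top w) \<and> (\<forall>t\<in>set (map top w). ok p t)"
    using assms
  proof (induction w arbitrary: p)
    case (Cons m w)
    define t where "t = top m"
    have t: "m = var t" "t \<in> G" "ok p t" "kind (Some t) w = 0"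
      using Cons(2,3) top_facts(2)[of m] by (auto simp: t_def split: if_splits)
    then show ?case using Cons(1)[OF t(4)] Cons(3) ok_trans[OF t(3)] by auto
  qed simp
  then show "set w \<subseteq> var ` G" "sorted_wrt (\<lambda>a b. ok (Some a) b) (map top w)" "t \<in> set (map top w) \<Longrightarrow> ok p t"
    by blast+
qed

lemma kind_var_words: "set w \<subseteq> var ` G \<Longrightarrow> kind p w \<noteq> 1"
  by (induction w arbitrary: p) auto

text \<open>The generators \<open>Gen\<close> give back the coefficient, the generators
  \<open>DGen\<close> the multiset of letters, and a critical word is the sorted list of its
  letters.\<close>

lemma crits_psi_inj:
  assumes x: "x \<in> crits" and y: "y \<in> crits" and e: "psi x = psi y"
  shows "x = y"
proof -
  obtain a w b v where xy: "x = (a, w)" "y = (b, v)" by (cases x, cases y)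
  have xw: "a \<in> lam" "set w \<subseteq> lam1" "kind None w = 0" and yv: "b \<in> lam" "set v \<subseteq> lam1" "kind None v = 0"
    using x y by (auto simp: xy crits_def ncells_iff)
  have "lookup a g = lookup b g" for g
  proof (cases g)
    case (Gen u)
    then show ?thesis using arg_cong[OF e, of "\<lambda>m. lookup m (Gen u)"] by (simp add: xy lookup_add)
  next
    case (DGen u)
    then have "g \<notin> keys a" "g \<notin> keys b" using xw(1) yv(1) by (auto simp: lam_def monos_in_def)
    then show ?thesis by (simp add: in_keys_iff)
  qed
  then have ab: "a = b" by (rule poly_mapping_eqI)
  then have "dsw w = dsw v" using e xy by simp
  then have "count (mset (map top w)) u = count (mset (map top v)) u" for u
    unfolding lookup_dsw(2)[symmetric] by simp
  then have "mset (map top w) = mset (map top v)" by (rule multiset_eqI)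
  moreover have "s = t" if "ok (Some s) t" "ok (Some t) s" for s t using that vl_facts(4) by auto
  ultimately have "map top w = map top v"
    using kind_0(2)[OF xw(3,2)] kind_0(2)[OF yv(3,2)] by (intro sorted_wrt_mset_unique[where P = "\<lambda>a b. ok (Some a) b"])
  moreover have "w = map var (map top w)" if "set w \<subseteq> var ` G" for w
    using that by (induction w) auto
  ultimately have "w = v" using kind_0(1)[OF xw(3,2)] kind_0(1)[OF yv(3,2)] by metis
  then show ?thesis using ab xy by simp
qed

lemma count_sorted: "sorted_wrt P xs \<Longrightarrow> \<not> P v v \<Longrightarrow> count (mset xs) v \<le> 1"
proof (induction xs)
  case (Cons x xs)
  show ?case
  proof (cases "x = v")
    case True
    then have "v \<notin> set xs" using Cons by auto
    then show ?thesis using True by (simp add: count_eq_zero_iff)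
  qed (use Cons in auto)
qed simp

lemma crits_psi_om: "x \<in> crits \<Longrightarrow> psi x \<in> om"
proof -
  assume x: "x \<in> crits"
  obtain a w where xw: "x = (a, w)" by (cases x)
  have w: "a \<in> lam" "set w \<subseteq> lam1" "kind None w = 0" using x by (auto simp: xw crits_def ncells_iff)
  have "keys (dsw w) \<subseteq> DGen ` G"
    using kind_0(1)[OF w(3,2)] by (induction w) (auto simp: keys_plus_nat)
  then have k: "keys (a + dsw w) \<subseteq> Gen ` G \<union> DGen ` G"
    using w(1) by (auto simp: keys_plus_nat lam_def monos_in_def)
  have "\<not> odd_rep deg (a + dsw w)"
  proof
    assume "odd_rep deg (a + dsw w)"
    then obtain g where g: "odd_gen deg g" "2 \<le> lookup a g + lookup (dsw w) g" by (auto simp: odd_rep_def lookup_add)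
    show False
    proof (cases g)
      case (Gen v)
      then have "odd_rep deg a" using g by (auto simp: odd_rep_def)
      then show False using w(1) by (simp add: lam_def monos_in_odd_rep)
    next
      case (DGen v)
      then have "g \<notin> keys a" using w(1) by (auto simp: lam_def monos_in_def)
      then have "2 \<le> count (mset (map top w)) v" using g DGen by (simp add: in_keys_iff)
      moreover have "\<not> ok (Some v) v" using g DGen vl_facts(1) by (auto simp: odd_gen_def)
      ultimately show False using count_sorted[OF kind_0(2)[OF w(3,2)], of v] by simp
    qed
  qed
  then show ?thesis using k by (simp add: xw om_def monos_in_odd_rep)
qed

lemma kind_replicate:
  assumes "v \<in> G" "kind None w = 0" "set w \<subseteq> lam1" "\<And>u. u \<in> set (map top w) \<Longrightarrow> vl v u" "i \<le> 1 \<or> odd (deg v)"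
  shows "kind None (replicate i (var v) @ w) = 0"
proof -
  have k: "kind (Some v) w = 0"
    using assms(2,4) by (cases w) (auto split: if_splits)
  have "kind (Some v) (replicate j (var v) @ w) = 0" if "odd (deg v)" for j
    by (induction j) (use k that in auto)
  then show ?thesis using k assms(2,5) by (cases i) auto
qed

text \<open>The image of a monomial is a signed sum of orderings of its word of variables, and the
  sorted ordering, which is the critical one, has an invertible coefficient.\<close>

lemma cmp0_cells:
  assumes "m \<in> om"
  shows "(\<forall>(a, w)\<in>keys (cmp0 (basis m)). a \<in> lam \<and> set w \<subseteq> var ` G \<and> a + dsw w = m) \<and>
    (\<exists>x\<in>crits. psi x = m \<and> (\<exists>n. lookup (cmp0 (basis m)) x = sgs n 1))"
  using assms
proof (induction rule: om_induct)
  case zero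
  have "(0, []) \<in> crits" by (simp add: crits_def ncells_iff)
  then show ?case using eps_0[OF divsys_triv] by (force simp: one_u_def intro!: bexI[of _ "(0, [])"] exI[of _ 0])
next
  case (step g i m)
  let ?c = "cmp0 (basis m)"
  have IH: "\<And>a w. (a, w) \<in> keys ?c \<Longrightarrow> a \<in> lam \<and> set w \<subseteq> var ` G \<and> a + dsw w = m" using step(7) by auto
  obtain a0 w0 n where x0: "(a0, w0) \<in> crits" "a0 + dsw w0 = m" "lookup ?c (a0, w0) = sgs n 1" using step(7) by auto
  have x0k: "(a0, w0) \<in> keys ?c" using x0(3) by (auto simp: in_keys_iff sgs_def)
  have es: "cmp0 (basis (single g i + m)) = um (lift triv g i) ?c" by (rule eps_step[OF divsys_triv step(5)])
  show ?case
  proof (cases g)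
    case (Gen v)
    have p: "U.prT (single g i, []) x = basis (single g i + fst x, snd x) \<and> single g i + fst x \<in> lam" if x: "x \<in> keys ?c" for x
    proof -
      obtain a w where xw: "x = (a, w)" by (cases x)
      have am: "a + dsw w = m" "a \<in> lam" using IH x xw by auto
      then have "single g i + m = (single g i + a) + dsw w" by (simp add: add.assoc)
      then have rep: "\<not> odd_rep deg (single g i + a)" using om_not_odd_rep[OF step(6)] odd_rep_plus(1) by metis
      have "\<forall>h\<in>keys a. gless g h" using step(5) am(1) keys_plus_nat[of a "dsw w"] by auto
      then show ?thesis using mpr_single_plus[OF _ rep, where 'k = 'k] am(2) rep step(1) Gen
        by (auto simp: xw tpr_pair lam_def monos_in_odd_rep keys_plus_nat)
    qed
    have eq: "cmp0 (basis (single g i + m)) = lin_ext (\<lambda>x. basis (single g i + fst x, snd x)) ?c"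
      unfolding es by (simp add: Gen bilin_ext_basis_left del: mult_zero_left) (rule lin_ext_cong, use p Gen in auto)
    have 1: "\<forall>(a, w)\<in>keys (cmp0 (basis (single g i + m))). a \<in> lam \<and> set w \<subseteq> var ` G \<and> a + dsw w = single g i + m"
      unfolding eq using IH p by (fastforce dest!: keys_lin_extD simp: add.assoc)
    have "lookup (cmp0 (basis (single g i + m))) (single g i + a0, w0) = lookup ?c (a0, w0) * 1"
      unfolding eq by (rule lookup_lin_ext_delta) (auto simp: lookup_single when_def)
    moreover have "(single g i + a0, w0) \<in> crits" using x0(1) p[OF x0k] by (auto simp: crits_def ncells_iff)
    ultimately show ?thesis using 1 x0(2,3) by (intro conjI bexI[of _ "(single g i + a0, w0)"]) (auto simp: add.assoc)
  next
    case (DGen v)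
    have v: "v \<in> G" "i \<le> 1 \<or> odd (deg v)" "lift triv g i = basis (0, replicate i (var v))"
    proof -
      from step(1,2,3) have "v \<in> G \<and> (i \<le> 1 \<or> odd (deg v)) \<and> lift triv g i = basis (0, replicate i (var v))"
      proof (cases rule: single_om_cases)
        case (odd u k)
        then show ?thesis using lift_triv[of u i] DGen by simp
      qed (use DGen in auto)
      then show "v \<in> G" "i \<le> 1 \<or> odd (deg v)" "lift triv g i = basis (0, replicate i (var v))" by auto
    qed
    let ?u = "replicate i (var v)"
    have p: "U.prT (0, ?u) (a, w) = sgs (wdg s ?u * mdeg deg a) (tens (basis a) (shp s ?u w))" for a w
      by (simp add: tpr_pair)
    have eq: "cmp0 (basis (single g i + m)) = lin_ext (U.prT (0, ?u)) ?c"
      unfolding es v(3) bilin_ext_basis_left ..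
    have c1: "a \<in> lam \<and> set z \<subseteq> var ` G \<and> a + dsw z = single g i + m" if az: "(a, z) \<in> keys (cmp0 (basis (single g i + m)))" for a z
    proof -
      obtain b w where bw: "(b, w) \<in> keys ?c" "(a, z) \<in> keys (U.prT (0, ?u) (b, w))"
        using az unfolding eq by (metis keys_lin_extD surj_pair)
      then have "a = b" "z \<in> keys (shp s ?u w :: _ \<Rightarrow>\<^sub>0 'k)" by (auto simp: p dest!: keys_tensD)
      moreover from this(2) have "set z = set ?u \<union> set w" using mset_shp by (metis set_mset_mset set_mset_union)
      moreover have "set ?u \<subseteq> var ` G" using v(1) by (cases i) auto
      ultimately show ?thesis using IH[OF bw(1)] dsw_shp[of z ?u w] DGen by (auto simp: add.left_commute)
    qed
    have nv: "var v \<notin> set w" if "(a, w) \<in> keys ?c" for a w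
    proof
      assume "var v \<in> set w"
      then have "v \<in> set (map top w)" by (metis image_eqI list.set_map top_var)
      then have "0 < lookup (dsw w) (DGen v)" by (simp add: count_greater_zero_iff)
      then have "DGen v \<in> keys m" using IH[OF that] by (metis in_keys_iff keys_plus_nat UnI2 less_numeral_extra(3))
      then show False using step(5) DGen by auto
    qed
    \<comment> \<open>The new variable precedes all letters present, so the sorted word of the
      product is the concatenation, reached by a single shuffle.\<close>
    have "lookup (U.prT (0, ?u) x) (a0, ?u @ w0) = (if x = (a0, w0) then sgs (wdg s ?u * mdeg deg a0) 1 else 0 :: 'k)" if x: "x \<in> keys ?c" for x
    proof -
      obtain a w where xw: "x = (a, w)" by (cases x)
      show ?thesis using lookup_shp_replicate[OF nv, of a w s i w0, where 'k = 'k] x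
        by (auto simp: xw p lookup_sgs lookup_tens)
    qed
    then have "lookup (cmp0 (basis (single g i + m))) (a0, ?u @ w0) = lookup ?c (a0, w0) * sgs (wdg s ?u * mdeg deg a0) 1"
      unfolding eq by (rule lookup_lin_ext_delta)
    also have "\<dots> = sgs (n + wdg s ?u * mdeg deg a0) 1" unfolding x0(3) by (auto simp: sgs_def)
    finally have l: "lookup (cmp0 (basis (single g i + m))) (a0, ?u @ w0) = sgs (n + wdg s ?u * mdeg deg a0) 1" .
    have w0: "a0 \<in> lam" "set w0 \<subseteq> lam1" "kind None w0 = 0" using x0(1) by (auto simp: crits_def ncells_iff)
    have "vl v u" if "u \<in> set (map top w0)" for u
    proof -
      have "0 < lookup (dsw w0) (DGen u)" using that by (simp add: count_greater_zero_iff)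
      then have "DGen u \<in> keys m" using x0(2) by (metis in_keys_iff keys_plus_nat UnI2 less_numeral_extra(3))
      then show ?thesis using step(5) DGen by (simp add: vl_def)
    qed
    then have "kind None (?u @ w0) = 0" by (intro kind_replicate v w0)
    then have "(a0, ?u @ w0) \<in> crits" using w0 v(1) var_lam1[of v] by (auto simp: crits_def ncells_iff split: if_splits)
    moreover have "psi (a0, ?u @ w0) = single g i + m"
      unfolding x0(2)[symmetric] by (simp add: DGen ac_simps)
    ultimately show ?thesis using l c1 by fast
  qed
qed

section \<open>Leading parts of the differential and of the comparison map\<close>

lemma pdg_tot: "pdg x = mdeg deg (tot x)"
proof -
  have "wdg (mdeg deg) w = mdeg deg (sum_list w)" for w by (induction w) auto
  then show ?thesis by (simp add: pdg_def tot_def)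
qed

lemma HB_ncells_keys: "keys x \<subseteq> ncells \<Longrightarrow> keys (HB x) \<subseteq> ncells"
proof (rule klinear_in_span[of HB])
  fix m assume "keys x \<subseteq> ncells" "m \<in> keys x"
  then have m: "keys (basis m :: _ \<Rightarrow>\<^sub>0 'k) \<subseteq> ncells" by auto
  obtain a u where au: "m = (a, u)" by (cases m)
  show "keys (HB (basis m)) \<subseteq> ncells"
  proof
    fix y assume y: "y \<in> keys (HB (basis m))"
    then have "pdg y = pdg m" using keys_HB_basis[of y a u] au by simp
    moreover have "Suc (pdg y) = pdg m" if "y \<in> keys (nrm (HD (basis m)))"
      using keys_nrm_subset[of "HD (basis m)"] keys_HD_basis[of y a u] that au by auto
    ultimately have "y \<notin> keys (nrm (HD (basis m)))" by auto
    then have "y \<in> keys (Dn (basis m))" using y unfolding Dn_HB[OF m] by (simp add: in_keys_iff lookup_add)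
    then show "y \<in> ncells" using Dn_ncells[OF m] by blast
  qed
qed simp

lemma HB_bidegree: "y \<in> keys (HB x) \<Longrightarrow> \<exists>m\<in>keys x. pdg y = pdg m \<and> Suc (qdg y) = qdg m"
proof -
  assume "y \<in> keys (HB x)"
  then have "y \<in> keys (lin_ext (\<lambda>m. HB (basis m)) x)" by (simp add: lin_ext_klinear[of HB])
  then obtain m where "m \<in> keys x" "y \<in> keys (HB (basis m))" using keys_lin_extD by metis
  then show ?thesis using keys_HB_basis[of y "fst m" "snd m"] by auto
qed

lemma Dn_pdg: "y \<in> keys (Dn x - HB x) \<Longrightarrow> keys x \<subseteq> ncells \<Longrightarrow> \<exists>m\<in>keys x. Suc (pdg y) = pdg m \<and> qdg y = qdg m"
proof -
  assume y: "y \<in> keys (Dn x - HB x)" and x: "keys x \<subseteq> ncells"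
  then have "y \<in> keys (HD x)" using keys_nrm_subset[of "HD x"] by (auto simp: Dn_HB)
  then have "y \<in> keys (lin_ext (\<lambda>m. HD (basis m)) x)" by (simp add: lin_ext_klinear[of HD])
  then obtain m where "m \<in> keys x" "y \<in> keys (HD (basis m))" using keys_lin_extD by metis
  then show ?thesis using keys_HD_basis[of y "fst m" "snd m"] by auto
qed

lemma Dn_pdg_le: "y \<in> keys (Dn x) \<Longrightarrow> keys x \<subseteq> ncells \<Longrightarrow> \<exists>m\<in>keys x. pdg y \<le> pdg m"
proof -
  assume y: "y \<in> keys (Dn x)" and x: "keys x \<subseteq> ncells"
  then have "y \<in> keys ((Dn x - HB x) + HB x)" by simp
  then consider "y \<in> keys (Dn x - HB x)" | "y \<in> keys (HB x)" using keys_addD by metis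
  then show ?thesis
  proof cases
    case 1
    then obtain m where "m \<in> keys x" "Suc (pdg y) = pdg m" using Dn_pdg[OF 1 x] by blast
    then show ?thesis by (intro bexI[of _ m]) auto
  next
    case 2
    then obtain m where "m \<in> keys x" "pdg y = pdg m" using HB_bidegree[OF 2] by blast
    then show ?thesis by (intro bexI[of _ m]) auto
  qed
qed

text \<open>\<open>HB\<close> keeps the internal degree and the rest of \<open>Dn\<close> lowers it,
  so this is the top component of \<open>Dn_Dn\<close>.\<close>

lemma HB_HB: "keys x \<subseteq> ncells \<Longrightarrow> HB (HB x) = 0"
proof (rule klinear_eq_on[of "\<lambda>x. HB (HB x)" "\<lambda>x. 0"])
  fix m assume "keys x \<subseteq> ncells" "m \<in> keys x"
  then have m: "keys (basis m :: _ \<Rightarrow>\<^sub>0 'k) \<subseteq> ncells" by auto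
  let ?b = "HB (basis m)" and ?r = "Dn (basis m) - HB (basis m)"
  have k: "keys ?b \<subseteq> ncells" "keys ?r \<subseteq> ncells"
    using HB_ncells_keys[OF m] Dn_ncells[OF m] keys_diffD[of _ "Dn (basis m)" ?b] by auto
  have "HB ?b + ((Dn ?b - HB ?b) + Dn ?r) = Dn (Dn (basis m))" by simp
  also have "\<dots> = 0" by (rule Dn_Dn[OF m])
  finally show "HB (HB (basis m)) = 0"
  proof (rule disjoint_sum_0)
    have "pdg y = pdg m" if "y \<in> keys (HB ?b)" for y
      using HB_bidegree[OF that] HB_bidegree[of _ "basis m"] by fastforce
    moreover have "pdg y < pdg m" if "y \<in> keys ((Dn ?b - HB ?b) + Dn ?r)" for y
      using keys_addD[OF that]
    proof
      assume "y \<in> keys (Dn ?b - HB ?b)"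
      then show ?thesis using Dn_pdg[of y ?b] k HB_bidegree[of _ "basis m"] by fastforce
    next
      assume "y \<in> keys (Dn ?r)"
      then show ?thesis using Dn_pdg_le[of y ?r] k Dn_pdg[of _ "basis m"] m by fastforce
    qed
    ultimately show "keys (HB ?b) \<inter> keys ((Dn ?b - HB ?b) + Dn ?r) = {}" by fastforce
  qed
qed simp_all

lemma cmp0_pdg: "m \<in> om \<Longrightarrow> y \<in> keys (cmp0 (basis m)) \<Longrightarrow> pdg y = pw m \<and> qdg y = qw m"
proof -
  assume m: "m \<in> om" and y: "y \<in> keys (cmp0 (basis m))"
  have p: "pdg y = pw m" using leads_cmp[OF m] y by (auto simp: leads_def)
  have "U.T.hg (mdeg deg m) (cmp0 (basis m))" by (rule hg_eps[OF divsys_triv]) (simp add: Om.hg_def)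
  then have "pdg y + qdg y = pw m + qw m"
    unfolding U.T.hg_def using y tdg_pdg[of y] mdeg_pw_qw[of m] by simp
  then show ?thesis using p by simp
qed

lemma cmp_pdg: "m \<in> om \<Longrightarrow> y \<in> keys (cmp (basis m)) \<Longrightarrow> pdg y \<le> pw m"
  using leads_cmp[of m] keys_addD[of y "cmp (basis m) - cmp0 (basis m)" "cmp0 (basis m)"] by (force simp: leads_def)

lemma keys_epsD: "y \<in> keys (eps H x) \<Longrightarrow> \<exists>m\<in>keys x. y \<in> keys (eps H (basis m))"
  unfolding eps_def using keys_lin_extD[of y "U.T.mono_hom (lift H)" x] by simp

lemma cmp0_ncells: "keys x \<subseteq> om \<Longrightarrow> keys (cmp0 x) \<subseteq> ncells" and cmp_ncells: "keys x \<subseteq> om \<Longrightarrow> keys (cmp x) \<subseteq> ncells"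
  using eps_ncells[OF divsys_triv] eps_ncells[OF corr(1)] by auto

text \<open>The top component of \<open>Dn_cmp\<close>; \<delta> lowers the internal degree and
  contributes nothing to it.\<close>

lemma HB_cmp0: "keys x \<subseteq> om \<Longrightarrow> HB (cmp0 x) = 0"
proof (rule klinear_eq_on[of "\<lambda>x. HB (cmp0 x)" "\<lambda>x. 0"])
  fix m assume "keys x \<subseteq> om" "m \<in> keys x"
  then have m: "m \<in> om" by auto
  let ?c = "cmp0 (basis m)" and ?r = "cmp (basis m) - cmp0 (basis m)"
  have k: "keys ?c \<subseteq> ncells" "keys (cmp (basis m)) \<subseteq> ncells" using m cmp0_ncells[of "basis m"] cmp_ncells[of "basis m"] by auto
  then have kr: "keys ?r \<subseteq> ncells" using keys_diffD[of _ "cmp (basis m)" ?c] by auto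
  have "HB ?c + ((Dn ?c - HB ?c) + Dn ?r - cmp (\<delta> (basis m))) = 0"
    using Dn_cmp[of "basis m"] m by simp
  then show "HB ?c = 0"
  proof (rule disjoint_sum_0)
    have "pdg y = pw m" if "y \<in> keys (HB ?c)" for y
      using HB_bidegree[OF that] cmp0_pdg[OF m] by fastforce
    moreover have "pdg y < pw m" if y: "y \<in> keys ((Dn ?c - HB ?c) + Dn ?r - cmp (\<delta> (basis m)))" for y
    proof -
      consider "y \<in> keys (Dn ?c - HB ?c)" | "y \<in> keys (Dn ?r)" | "y \<in> keys (cmp (\<delta> (basis m)))"
        using y keys_addD keys_diffD by metis
      then show ?thesis
      proof cases
        case 1
        then show ?thesis using Dn_pdg[OF 1 k(1)] cmp0_pdg[OF m] by fastforce
      next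
        case 2
        then obtain z where "z \<in> keys ?r" "pdg y \<le> pdg z" using Dn_pdg_le[OF 2 kr] by blast
        then show ?thesis using leads_cmp[OF m] by (auto simp: leads_def)
      next
        case 3
        then obtain n where n: "n \<in> keys (\<delta> (basis m))" "y \<in> keys (cmp (basis n))" using keys_epsD by blast
        then have "n \<in> om" using \<delta>_om[of "basis m"] m by auto
        then show ?thesis using cmp_pdg[OF _ n(2)] \<delta>_bidegree[OF m n(1)] by simp
      qed
    qed
    ultimately show "keys (HB ?c) \<inter> keys ((Dn ?c - HB ?c) + Dn ?r - cmp (\<delta> (basis m))) = {}" by fastforce
  qed
qed simp_all

text \<open>A word of variables has no letter that could be split.\<close>

lemma cmp0_no_lowers: "keys w \<subseteq> om \<Longrightarrow> keys (cmp0 w) \<inter> lowers = {}"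
proof -
  assume w: "keys w \<subseteq> om"
  have "y \<notin> lowers" if y: "y \<in> keys (cmp0 w)" for y
  proof -
    obtain m where "m \<in> om" "y \<in> keys (cmp0 (basis m))" using keys_epsD[OF y] w by blast
    then have "set (snd y) \<subseteq> var ` G" using cmp0_cells[of m] by fastforce
    then show ?thesis using kind_var_words[of "snd y" None] by (auto simp: lowers_def)
  qed
  then show ?thesis by blast
qed

lemma lookup_cmp0_crit:
  assumes "m \<in> om" "x \<in> crits" "psi x \<noteq> m"
  shows "lookup (cmp0 (basis m)) x = 0"
  using cmp0_cells[OF assms(1)] assms(3) by (cases x) (auto simp: in_keys_iff)

lemma cmp0_unit: "x \<in> crits \<Longrightarrow> \<exists>n. lookup (cmp0 (basis (psi x))) x = sgs n 1"
  using cmp0_cells[OF crits_psi_om[of x]] crits_psi_inj[of _ x] by blast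

lemma sgs_one_square: "sgs n 1 * sgs n (1 :: 'k) = 1"
  by (simp add: sgs_def)

text \<open>On critical cells the images of the monomials form a diagonal matrix of signs. Each
  entry \<open>u c\<close> is its own inverse, so multiplying by it solves for the
  coefficients.\<close>

lemma clear_crits:
  assumes x: "keys x \<subseteq> ncells" "keys x \<inter> lowers = {}"
  shows "\<exists>w. keys w \<subseteq> psi ` (keys x \<inter> crits) \<and> keys (x - cmp0 w) \<subseteq> uppers"
proof -
  define u where "u c = lookup (cmp0 (basis (psi c))) c" for c
  have u: "u c * u c = 1" if "c \<in> crits" for c
    using cmp0_unit[OF that] sgs_one_square by (auto simp: u_def)
  define A where "A = keys x \<inter> crits"
  define w where "w = (\<Sum>c\<in>A. scal (lookup x c * u c) (basis (psi c)))"
  have w: "keys w \<subseteq> psi ` A"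
    unfolding w_def
  proof (rule order_trans[OF keys_sum UN_least])
    fix c assume "c \<in> A"
    then show "keys (scal (lookup x c * u c) (basis (psi c))) \<subseteq> psi ` A"
      using keys_scal[of "lookup x c * u c" "basis (psi c)"] by auto
  qed
  then have wom: "keys w \<subseteq> om" using crits_psi_om by (auto simp: A_def)
  have cw: "cmp0 w = (\<Sum>c\<in>A. scal (lookup x c * u c) (cmp0 (basis (psi c))))"
    unfolding w_def by (simp only: klinearD(7)[OF klinear_eps[OF klinear_rules(1)]] eps_simps)
  have "lookup (x - cmp0 w) y = 0" if y: "y \<in> crits" for y
  proof -
    have "lookup (cmp0 w) y = (\<Sum>c\<in>A. if c = y then lookup x y else 0)"
      unfolding cw lookup_sum
    proof (intro sum.cong refl)
      fix c assume "c \<in> A"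
      then have c: "c \<in> crits" by (simp add: A_def)
      show "lookup (scal (lookup x c * u c) (cmp0 (basis (psi c)))) y = (if c = y then lookup x y else 0)"
      proof (cases "c = y")
        case True
        then show ?thesis using u[OF y] by (simp add: u_def mult.assoc)
      next
        case False
        then have "psi y \<noteq> psi c" using crits_psi_inj[OF c y] by auto
        then show ?thesis using lookup_cmp0_crit[OF crits_psi_om[OF c] y] False by simp
      qed
    qed
    also have "\<dots> = lookup x y" using y by (auto simp: A_def in_keys_iff)
    finally show ?thesis by (simp add: lookup_minus)
  qed
  moreover have "keys (x - cmp0 w) \<subseteq> ncells - lowers"
    using keys_diffD[of _ x "cmp0 w"] x cmp0_ncells[OF wom] cmp0_no_lowers[OF wom] by blast
  ultimately have "keys (x - cmp0 w) \<subseteq> uppers"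
    using ncells_kinds by (auto simp: in_keys_iff subset_iff)
  then show ?thesis using w by (auto simp: A_def)
qed

text \<open>Once lower and critical cells are cleared, a cycle in the span of the upper cells is
  left, which is zero by \<open>upper_injective\<close>. The set \<open>Q\<close> keeps track of
  word lengths.\<close>

lemma HKR_surjective:
  assumes x: "\<And>c. c \<in> keys x \<Longrightarrow> c \<in> ncells \<and> pdg c = p \<and> qdg c \<in> Q" and b: "HB x = 0"
  shows "\<exists>w y. (\<forall>m\<in>keys w. m \<in> om \<and> pw m = p \<and> qw m \<in> Q) \<and>
    (\<forall>c\<in>keys y. c \<in> ncells \<and> pdg c = p \<and> qdg c \<in> Suc ` Q) \<and> x = cmp0 w + HB y"
proof -
  let ?X = "{c \<in> ncells. pdg c = p \<and> qdg c \<in> Q}" and ?Y = "{c \<in> ncells. pdg c = p \<and> qdg c \<in> Suc ` Q}"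
  have upY: "up v \<in> ?Y" if v: "v \<in> lowers" "v \<in> ?X" for v
  proof -
    obtain a w where aw: "v = (a, w)" by (cases v)
    have w: "set w \<subseteq> lam1" "kind None w = 1" using v by (auto simp: aw lowers_def ncells_iff)
    have "tot (up v) = tot v" using sum_list_split[OF w(1)] by (simp add: up_def tot_def aw)
    moreover have "qdg (up v) = Suc (qdg v)" using length_split[OF w(2)] by (simp add: qdg_def up_def aw)
    ultimately show ?thesis using up_lowers[OF v(1)] v(2) by (auto simp: pdg_tot uppers_def)
  qed
  have HBX: "keys (HB y) \<subseteq> ?X" if "keys y \<subseteq> ?Y" for y
  proof
    fix c assume c: "c \<in> keys (HB y)"
    obtain m where "m \<in> keys y" "pdg c = pdg m" "Suc (qdg c) = qdg m" using HB_bidegree[OF c] by blast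
    then show "c \<in> ?X" using that c HB_ncells_keys[of y] by fastforce
  qed
  have "\<exists>y. keys y \<subseteq> uppers \<inter> ?Y \<and> keys (x - HB y) \<inter> lowers = {}"
  proof (rule HBm.clear_lower[of ?X])
    show "keys (HB (basis (up v))) \<subseteq> ?X" if "v \<in> lowers" "v \<in> ?X" for v
      by (rule HBX) (use upY[OF that] in auto)
  qed (use upY x in auto)
  then obtain y where y: "keys y \<subseteq> ?Y" "keys (x - HB y) \<inter> lowers = {}" by blast
  have x': "keys (x - HB y) \<subseteq> ?X" using HBX[OF y(1)] x keys_diffD[of _ x "HB y"] by blast
  then obtain w where w: "keys w \<subseteq> psi ` (keys (x - HB y) \<inter> crits)" "keys (x - HB y - cmp0 w) \<subseteq> uppers"
    using clear_crits[of "x - HB y"] y(2) by blast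
  have wm: "m \<in> om \<and> pw m = p \<and> qw m \<in> Q" if "m \<in> keys w" for m
  proof -
    obtain c where c: "c \<in> keys (x - HB y)" "c \<in> crits" "m = psi c" using w(1) \<open>m \<in> keys w\<close> by blast
    obtain n where "lookup (cmp0 (basis m)) c = sgs n 1" using cmp0_unit[OF c(2)] c(3) by auto
    then have "c \<in> keys (cmp0 (basis m))" by (auto simp: in_keys_iff sgs_def)
    then show ?thesis using cmp0_pdg[of m c] crits_psi_om[OF c(2)] c x' by auto
  qed
  have "HB (x - HB y - cmp0 w) = 0"
    using b HB_HB[of y] HB_cmp0[of w] y(1) wm by (auto simp: subset_iff)
  then have "x - HB y - cmp0 w = 0" using HBm.upper_injective[OF w(2)] by simp
  then have "x = cmp0 w + HB y" by (simp add: algebra_simps)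
  then show ?thesis using wm y(1) by blast
qed

text \<open>Clearing \<open>y\<close> by cycles leaves an element of the span of the upper cells
  with boundary \<open>cmp0 w\<close>. That boundary has no lower cells, so the element and its
  boundary vanish; the critical coefficients then recover \<open>w\<close>.\<close>

lemma HKR_injective:
  assumes w: "keys w \<subseteq> om" and y: "keys y \<subseteq> ncells" and e: "cmp0 w = HB y"
  shows "w = 0"
proof -
  have "\<exists>z. keys z \<subseteq> uppers \<inter> ncells \<and> keys (y - HB z) \<inter> lowers = {}"
  proof (rule HBm.clear_lower[of ncells])
    fix v assume "v \<in> lowers"
    then have "up v \<in> ncells" using up_lowers[of v] by (auto simp: uppers_def)
    then show "up v \<in> ncells" "keys (HB (basis (up v))) \<subseteq> ncells" using HB_ncells_keys[of "basis (up v)"] by auto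
  qed (use y in auto)
  then obtain z where z: "keys z \<subseteq> ncells" "keys (y - HB z) \<inter> lowers = {}" by blast
  have "keys (y - HB z) \<subseteq> ncells" using y HB_ncells_keys[OF z(1)] keys_diffD[of _ y "HB z"] by blast
  then obtain w' where w': "keys w' \<subseteq> psi ` (keys (y - HB z) \<inter> crits)" "keys (y - HB z - cmp0 w') \<subseteq> uppers"
    using clear_crits z(2) by blast
  have "keys w' \<subseteq> om" using w'(1) crits_psi_om by auto
  then have HBe: "HB (y - HB z - cmp0 w') = cmp0 w" using e HB_HB[OF z(1)] HB_cmp0 by simp
  then have "y - HB z - cmp0 w' = 0" using HBm.upper_injective[OF w'(2)] cmp0_no_lowers[OF w] by simp
  then have z0: "cmp0 w = 0" using HBe by simp
  show "w = 0"
  proof (rule poly_mapping_eqI)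
    fix m
    show "lookup w m = lookup 0 m"
    proof (cases "m \<in> om")
      case True
      then obtain x n where x: "x \<in> crits" "psi x = m" "lookup (cmp0 (basis m)) x = sgs n 1" using cmp0_cells by blast
      have "lookup (cmp0 w) x = lookup w m * sgs n 1"
        unfolding eps_def
        by (rule lookup_lin_ext_delta) (use lookup_cmp0_crit[OF _ x(1)] w x in \<open>auto simp: eps_def\<close>)
      then show ?thesis using z0 by (simp add: sgs_def split: if_splits)
    next
      case False
      then show ?thesis using w by (auto simp: in_keys_iff)
    qed
  qed
qed

end

definition restr :: "('b \<Rightarrow> bool) \<Rightarrow> ('b \<Rightarrow>\<^sub>0 'k::comm_ring_1) \<Rightarrow> ('b \<Rightarrow>\<^sub>0 'k)"
  where "restr P = lin_ext (\<lambda>m. if P m then basis m else 0)"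

lemma lookup_restr: "lookup (restr P x) m = (if P m then lookup x m else 0)"
  unfolding restr_def using lookup_lin_ext_delta[of x "\<lambda>m. if P m then basis m else 0" m m "if P m then 1 else 0"]
  by (auto simp: lookup_single when_def)

lemma keys_restr: "keys (restr P x) = {m \<in> keys x. P m}" "keys (x - restr P x) = {m \<in> keys x. \<not> P m}"
  by (auto simp: in_keys_iff lookup_restr lookup_minus split: if_splits)

lemma klinear_restr [simp]: "klinear f \<Longrightarrow> klinear (\<lambda>x. restr P (f x))"
  by (simp add: restr_def)

lemmas restr_simps [simp] = klinearD(1-6)[OF klinear_restr[OF klinear_rules(1)]]

lemma restr_id: "(\<And>m. m \<in> keys x \<Longrightarrow> P m) \<Longrightarrow> restr P x = x"
  and restr_0: "(\<And>m. m \<in> keys x \<Longrightarrow> \<not> P m) \<Longrightarrow> restr P x = 0"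
  by (rule poly_mapping_eqI; force simp: lookup_restr in_keys_iff)+

section \<open>Comparison of the filtered complexes\<close>

context low_degree
begin

text \<open>The bound on the internal degree is strict, so that level 0 contains only zero and
  starts the inductions. A set \<open>N\<close> of total degrees serves single degrees and all
  degrees at once.\<close>

definition FC :: "nat set \<Rightarrow> nat \<Rightarrow> ('v mono \<times> 'v mono list \<Rightarrow>\<^sub>0 'k) set"
  where "FC N p = {x. \<forall>c\<in>keys x. c \<in> ncells \<and> pdg c < p \<and> pdg c + qdg c \<in> N}"

definition WF :: "nat set \<Rightarrow> nat \<Rightarrow> ('v mono \<Rightarrow>\<^sub>0 'k) set"
  where "WF N p = {w. \<forall>m\<in>keys w. m \<in> om \<and> pw m < p \<and> pw m + qw m \<in> N}"

lemma FC_closed: "x \<in> FC N p \<Longrightarrow> y \<in> FC N p \<Longrightarrow> x + y \<in> FC N p" "x \<in> FC N p \<Longrightarrow> y \<in> FC N p \<Longrightarrow> x - y \<in> FC N p"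
  "0 \<in> FC N p" "x \<in> FC N p \<Longrightarrow> p \<le> q \<Longrightarrow> x \<in> FC N q" "x \<in> FC N p \<Longrightarrow> keys x \<subseteq> ncells" "x \<in> FC N p \<Longrightarrow> - x \<in> FC N p"
  unfolding FC_def using keys_addD[of _ x y] keys_diffD[of _ x y] by (blast, blast, simp, fastforce, blast, simp)

lemma WF_closed: "x \<in> WF N p \<Longrightarrow> y \<in> WF N p \<Longrightarrow> x + y \<in> WF N p" "x \<in> WF N p \<Longrightarrow> y \<in> WF N p \<Longrightarrow> x - y \<in> WF N p"
  "0 \<in> WF N p" "x \<in> WF N p \<Longrightarrow> p \<le> q \<Longrightarrow> x \<in> WF N q" "x \<in> WF N p \<Longrightarrow> keys x \<subseteq> om" "x \<in> WF N p \<Longrightarrow> - x \<in> WF N p"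
  unfolding WF_def using keys_addD[of _ x y] keys_diffD[of _ x y] by (blast, blast, simp, fastforce, blast, simp)

lemma Dn_degree:
  assumes y: "y \<in> keys (Dn x)" and x: "keys x \<subseteq> ncells"
  shows "y \<in> ncells" "\<exists>m\<in>keys x. pdg y \<le> pdg m \<and> Suc (pdg y + qdg y) = pdg m + qdg m"
proof -
  show "y \<in> ncells" using Dn_ncells[OF x] y by blast
  have "y \<in> keys ((Dn x - HB x) + HB x)" using y by simp
  then consider "y \<in> keys (Dn x - HB x)" | "y \<in> keys (HB x)" using keys_addD by metis
  then show "\<exists>m\<in>keys x. pdg y \<le> pdg m \<and> Suc (pdg y + qdg y) = pdg m + qdg m"
  proof cases
    case 1
    then obtain m where "m \<in> keys x" "Suc (pdg y) = pdg m" "qdg y = qdg m" using Dn_pdg[OF 1 x] by blast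
    then show ?thesis by (intro bexI[of _ m]) auto
  next
    case 2
    then obtain m where "m \<in> keys x" "pdg y = pdg m" "Suc (qdg y) = qdg m" using HB_bidegree[OF 2] by blast
    then show ?thesis by (intro bexI[of _ m]) auto
  qed
qed

lemma Dn_FC: "x \<in> FC (Suc ` N) p \<Longrightarrow> Dn x \<in> FC N p"
proof -
  assume x: "x \<in> FC (Suc ` N) p"
  have "y \<in> ncells \<and> pdg y < p \<and> pdg y + qdg y \<in> N" if y: "y \<in> keys (Dn x)" for y
  proof -
    obtain m where "m \<in> keys x" "pdg y \<le> pdg m" "Suc (pdg y + qdg y) = pdg m + qdg m"
      using Dn_degree(2)[OF y FC_closed(5)[OF x]] by blast
    then show ?thesis using Dn_degree(1)[OF y FC_closed(5)[OF x]] x by (fastforce simp: FC_def)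
  qed
  then show ?thesis by (simp add: FC_def)
qed

lemma cmp_degree: "m \<in> om \<Longrightarrow> y \<in> keys (cmp (basis m)) \<Longrightarrow> pdg y + qdg y = pw m + qw m"
proof -
  assume m: "m \<in> om" and y: "y \<in> keys (cmp (basis m))"
  have "U.T.hg (mdeg deg m) (cmp (basis m))" by (rule hg_eps[OF corr(1)]) (simp add: Om.hg_def)
  then show ?thesis unfolding U.T.hg_def using y tdg_pdg[of y] mdeg_pw_qw[of m] by simp
qed

lemma cmp_FC: "w \<in> WF N p \<Longrightarrow> cmp w \<in> FC N p"
proof -
  assume w: "w \<in> WF N p"
  have "y \<in> ncells \<and> pdg y < p \<and> pdg y + qdg y \<in> N" if y: "y \<in> keys (cmp w)" for y
  proof -
    obtain m where m: "m \<in> keys w" "y \<in> keys (cmp (basis m))" using keys_epsD[OF y] by blast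
    then have "m \<in> om" "pw m < p" "pw m + qw m \<in> N" using w by (auto simp: WF_def)
    then show ?thesis using cmp_pdg[OF _ m(2)] cmp_degree[OF _ m(2)] cmp_ncells[of w] y WF_closed(5)[OF w] by auto
  qed
  then show ?thesis by (simp add: FC_def)
qed

lemma keys_\<delta>D: "keys w \<subseteq> om \<Longrightarrow> n \<in> keys (\<delta> w) \<Longrightarrow> \<exists>m\<in>keys w. Suc (pw n) = pw m \<and> qw n = qw m"
proof -
  assume w: "keys w \<subseteq> om" and n: "n \<in> keys (\<delta> w)"
  from n have "n \<in> keys (lin_ext (\<lambda>m. if m \<in> om then \<delta> (basis m) else 0) w)"
    by (simp only: \<delta>_facts(2)[OF w])
  from keys_lin_extD[OF this] obtain m where "m \<in> keys w" "n \<in> keys (if m \<in> om then \<delta> (basis m) else 0)"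
    by blast
  then show ?thesis using \<delta>_bidegree[of m n] w by (auto split: if_splits)
qed

lemma \<delta>_add: "keys x \<subseteq> om \<Longrightarrow> keys y \<subseteq> om \<Longrightarrow> \<delta> (x + y) = \<delta> x + \<delta> y"
  using \<delta>_deriv by (auto simp: graded_derivation_def span_on_def om_def)

lemma keys_minus_HB:
  assumes "x \<in> FC N (Suc r)"
  shows "y \<in> keys (Dn x - HB (restr (\<lambda>c. pdg c = r) x)) \<Longrightarrow> pdg y < r"
proof -
  let ?x = "restr (\<lambda>c. pdg c = r) x"
  assume "y \<in> keys (Dn x - HB ?x)"
  moreover have "Dn x - HB ?x = (Dn ?x - HB ?x) + Dn (x - ?x)" by simp
  ultimately consider "y \<in> keys (Dn ?x - HB ?x)" | "y \<in> keys (Dn (x - ?x))" by (metis keys_addD)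
  then show ?thesis
  proof cases
    case 1
    have "keys ?x \<subseteq> ncells" using FC_closed(5)[OF assms] by (auto simp: keys_restr)
    then show ?thesis using Dn_pdg[OF 1] by (fastforce simp: keys_restr)
  next
    case 2
    have "keys (x - ?x) \<subseteq> ncells" using FC_closed(5)[OF assms] by (auto simp: keys_restr)
    then obtain m where "m \<in> keys (x - ?x)" "pdg y \<le> pdg m" using Dn_degree(2)[OF 2] by blast
    then show ?thesis using assms by (force simp: keys_restr FC_def)
  qed
qed

lemma keys_minus_cmp0:
  assumes "w \<in> WF N (Suc r)"
  shows "y \<in> keys (cmp w - cmp0 (restr (\<lambda>m. pw m = r) w)) \<Longrightarrow> pdg y < r"
proof -
  let ?w = "restr (\<lambda>m. pw m = r) w"
  assume "y \<in> keys (cmp w - cmp0 ?w)"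
  moreover have "cmp w - cmp0 ?w = (cmp ?w - cmp0 ?w) + cmp (w - ?w)" by simp
  ultimately consider "y \<in> keys (cmp ?w - cmp0 ?w)" | "y \<in> keys (cmp (w - ?w))" by (metis keys_addD)
  then show ?thesis
  proof cases
    case 1
    have "cmp ?w - cmp0 ?w = lin_ext (\<lambda>m. cmp (basis m) - cmp0 (basis m)) ?w"
      using lin_ext_klinear[of "\<lambda>x. cmp x - cmp0 x" ?w] by simp
    with 1 have "y \<in> keys (lin_ext (\<lambda>m. cmp (basis m) - cmp0 (basis m)) ?w)" by (simp only:)
    from keys_lin_extD[OF this] obtain m where m: "m \<in> keys ?w" "y \<in> keys (cmp (basis m) - cmp0 (basis m))"
      by blast
    then show ?thesis using leads_cmp[of m] assms by (auto simp: keys_restr leads_def WF_def)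
  next
    case 2
    then obtain m where m: "m \<in> keys (w - ?w)" "y \<in> keys (cmp (basis m))" using keys_epsD by blast
    then show ?thesis using cmp_pdg[OF _ m(2)] assms by (force simp: keys_restr WF_def)
  qed
qed

text \<open>In internal degree \<open>r\<close> the hypothesis says that \<open>HB\<close> of one
  leading part equals \<open>cmp0\<close> of the other; by \<open>HKR_injective\<close> both sides
  vanish.\<close>

lemma leading_terms:
  assumes x: "x \<in> FC N (Suc r)" and w: "w \<in> WF N' (Suc r)" and e: "\<And>y. y \<in> keys (Dn x - cmp w) \<Longrightarrow> pdg y < r"
  shows "HB (restr (\<lambda>c. pdg c = r) x) = 0" "restr (\<lambda>m. pw m = r) w = 0"
proof -
  let ?x = "restr (\<lambda>c. pdg c = r) x" and ?w = "restr (\<lambda>m. pw m = r) w"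
  have k: "keys ?x \<subseteq> ncells" "keys ?w \<subseteq> om" using FC_closed(5)[OF x] WF_closed(5)[OF w] by (auto simp: keys_restr)
  have "(HB ?x - cmp0 ?w) + ((Dn x - HB ?x) - (cmp w - cmp0 ?w) - (Dn x - cmp w)) = 0" by simp
  then have "HB ?x - cmp0 ?w = 0"
  proof (rule disjoint_sum_0)
    have "pdg y = r" if "y \<in> keys (HB ?x - cmp0 ?w)" for y
      using keys_diffD[OF that]
    proof
      assume "y \<in> keys (HB ?x)"
      then show ?thesis using HB_bidegree by (fastforce simp: keys_restr)
    next
      assume "y \<in> keys (cmp0 ?w)"
      then obtain m where m: "m \<in> keys ?w" "y \<in> keys (cmp0 (basis m))" using keys_epsD by blast
      then show ?thesis using cmp0_pdg[OF _ m(2)] k by (auto simp: keys_restr)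
    qed
    moreover have "pdg y < r" if "y \<in> keys ((Dn x - HB ?x) - (cmp w - cmp0 ?w) - (Dn x - cmp w))" for y
      using that keys_diffD e keys_minus_HB[OF x] keys_minus_cmp0[OF w] by metis
    ultimately show "keys (HB ?x - cmp0 ?w) \<inter> keys ((Dn x - HB ?x) - (cmp w - cmp0 ?w) - (Dn x - cmp w)) = {}" by fastforce
  qed
  then have "cmp0 ?w = HB ?x" by simp
  then show "?w = 0" by (rule HKR_injective[OF k(2,1)])
  with \<open>cmp0 ?w = HB ?x\<close> show "HB ?x = 0" by simp
qed

lemma WF_restr: "w \<in> WF N (Suc r) \<Longrightarrow> restr (\<lambda>m. pw m = r) w = 0 \<Longrightarrow> w \<in> WF N r"
proof -
  assume x: "w \<in> WF N (Suc r)" "restr (\<lambda>m. pw m = r) w = 0"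
  have "{m \<in> keys w. pw m = r} = {}" using keys_restr(1)[of "\<lambda>m. pw m = r" w] x(2) by simp
  then show ?thesis using x(1) by (force simp: WF_def)
qed

text \<open>\<open>HKR_surjective\<close> writes the leading part as \<open>cmp0 w + HB y\<close>;
  passing to \<open>cmp w\<close> and \<open>Dn y\<close> changes only lower terms.\<close>

lemma peel:
  assumes x: "x \<in> FC N (Suc r)" and b: "HB (restr (\<lambda>c. pdg c = r) x) = 0"
  shows "\<exists>w y. w \<in> WF N (Suc r) \<and> (\<forall>m\<in>keys w. pw m = r) \<and> y \<in> FC (Suc ` N) (Suc r) \<and> x - cmp w - Dn y \<in> FC N r"
proof -
  let ?x = "restr (\<lambda>c. pdg c = r) x"
  have "\<exists>w y. (\<forall>m\<in>keys w. m \<in> om \<and> pw m = r \<and> qw m \<in> {q. r + q \<in> N}) \<and>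
    (\<forall>c\<in>keys y. c \<in> ncells \<and> pdg c = r \<and> qdg c \<in> Suc ` {q. r + q \<in> N}) \<and> ?x = cmp0 w + HB y"
    by (rule HKR_surjective) (use x b in \<open>auto simp: FC_def keys_restr\<close>)
  then obtain w y where wy: "\<forall>m\<in>keys w. m \<in> om \<and> pw m = r \<and> r + qw m \<in> N"
    "\<forall>c\<in>keys y. c \<in> ncells \<and> pdg c = r \<and> r + qdg c \<in> Suc ` N" "?x = cmp0 w + HB y" by force
  have w: "w \<in> WF N (Suc r)" and y: "y \<in> FC (Suc ` N) (Suc r)" using wy by (auto simp: WF_def FC_def)
  let ?z = "x - cmp w - Dn y"
  have z: "?z \<in> FC N (Suc r)" by (intro FC_closed(2) x cmp_FC w Dn_FC y)
  have rw: "restr (\<lambda>m. pw m = r) w = w" and ry: "restr (\<lambda>c. pdg c = r) y = y"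
    using wy(1,2) by (auto intro: restr_id)
  have eq: "?z = (x - ?x) - (cmp w - cmp0 w) - (Dn y - HB y)" using wy(3) by simp
  have "pdg c < r" if "c \<in> keys ?z" for c
  proof -
    consider "c \<in> keys (x - ?x)" | "c \<in> keys (cmp w - cmp0 w)" | "c \<in> keys (Dn y - HB y)"
      using \<open>c \<in> keys ?z\<close> keys_diffD unfolding eq by metis
    then show ?thesis
    proof cases
      case 1
      then have "c \<in> keys x" "pdg c \<noteq> r" by (simp_all add: keys_restr)
      then show ?thesis using x by (fastforce simp: FC_def)
    qed (use keys_minus_cmp0[OF w, unfolded rw] keys_minus_HB[OF y, unfolded ry] in blast)+
  qed
  then have "?z \<in> FC N r" using z by (auto simp: FC_def)
  then show ?thesis using w y wy(1) by blast
qed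

lemma \<delta>_peel:
  assumes "w \<in> WF N (Suc r)" "\<forall>m\<in>keys w. pw m = r"
  shows "n \<in> keys (\<delta> w) \<Longrightarrow> Suc (pw n) = r" "\<delta> w \<in> WF {k. Suc k \<in> N} r"
proof -
  show 1: "Suc (pw n) = r" if "n \<in> keys (\<delta> w)" for n
    using keys_\<delta>D[OF WF_closed(5)[OF assms(1)] that] assms(2) by auto
  have "n \<in> om \<and> pw n < r \<and> Suc (pw n + qw n) \<in> N" if n: "n \<in> keys (\<delta> w)" for n
  proof -
    obtain m where m: "m \<in> keys w" "Suc (pw n) = pw m" "qw n = qw m"
      using keys_\<delta>D[OF WF_closed(5)[OF assms(1)] n] by blast
    then have "pw m + qw m \<in> N" using assms(1) by (auto simp: WF_def)
    then have "Suc (pw n + qw n) \<in> N" unfolding m(2,3)[symmetric] by simp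
    then show ?thesis using 1[OF n] m \<delta>_om[OF WF_closed(5)[OF assms(1)]] n by auto
  qed
  then show "\<delta> w \<in> WF {k. Suc k \<in> N} r" by (simp add: WF_def)
qed

text \<open>As \<delta> lowers the internal degree of \<open>w\<close> by exactly one, \<delta> w is
  the leading part of \<open>v - \<delta> w\<close> in degree r - 1, and
  \<open>leading_terms\<close> forces it to vanish. This turns approximate cycles of Omega into
  cycles.\<close>

lemma \<delta>_zero:
  assumes "w \<in> WF N (Suc r)" "\<forall>m\<in>keys w. pw m = r" "x \<in> FC N' r" "v \<in> WF M r" "\<forall>m\<in>keys v. Suc (pw m) < r"
    and e: "\<And>y. y \<in> keys (Dn x - cmp (v - \<delta> w)) \<Longrightarrow> Suc (pdg y) < r"
  shows "\<delta> w = 0"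
proof (cases r)
  case 0
  then have "keys (\<delta> w) = {}" using \<delta>_peel(1)[OF assms(1,2)] by blast
  then show ?thesis by (simp only: keys_eq_empty)
next
  case (Suc r')
  let ?P = "\<lambda>m. pw m = r'"
  have "v - \<delta> w \<in> WF UNIV r"
    using assms(4) \<delta>_peel(2)[OF assms(1,2)] by (intro WF_closed(2)) (auto simp: WF_def)
  then have "restr ?P (v - \<delta> w) = 0"
    using leading_terms(2)[of x N' r' "v - \<delta> w" UNIV] assms(3) e Suc by simp
  moreover have "restr ?P v = 0" using assms(5) Suc by (intro restr_0) auto
  moreover have "restr ?P (\<delta> w) = \<delta> w" using \<delta>_peel(1)[OF assms(1,2)] Suc by (intro restr_id) auto
  ultimately show ?thesis by simp
qed

text \<open>Leading parts are peeled off down to level 0. Each peeled \<open>w\<close> is a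
  \<delta>-cycle by itself, so the remainder is again a cycle.\<close>

lemma cycles_from_cmp:
  assumes "x \<in> FC N p" "Dn x = 0"
  shows "\<exists>w z. w \<in> WF N p \<and> z \<in> FC (Suc ` N) p \<and> \<delta> w = 0 \<and> x = cmp w + Dn z"
  using assms
proof (induction p arbitrary: x)
  case 0
  then have "\<And>c. c \<notin> keys x" by (auto simp: FC_def)
  then have "keys x = {}" by blast
  then have "x = 0" by (simp only: keys_eq_empty)
  then show ?case using WF_closed(3) FC_closed(3) by (intro exI[of _ 0]) simp
next
  case (Suc p)
  have "HB (restr (\<lambda>c. pdg c = p) x) = 0"
    by (rule leading_terms(1)[OF Suc(2) WF_closed(3)]) (use Suc(3) in simp)
  then obtain w y where wy: "w \<in> WF N (Suc p)" "\<forall>m\<in>keys w. pw m = p" "y \<in> FC (Suc ` N) (Suc p)" "x - cmp w - Dn y \<in> FC N p"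
    using peel[OF Suc(2)] by blast
  have D: "Dn (x - cmp w - Dn y) = cmp (0 - \<delta> w)"
    using Suc(3) Dn_Dn[OF FC_closed(5)[OF wy(3)]] Dn_cmp[OF WF_closed(5)[OF wy(1)]] by simp
  have dw: "\<delta> w = 0"
    by (rule \<delta>_zero[OF wy(1,2,4) WF_closed(3)]) (use D in auto)
  then obtain w' z where w': "w' \<in> WF N p" "z \<in> FC (Suc ` N) p" "\<delta> w' = 0" "x - cmp w - Dn y = cmp w' + Dn z"
    using Suc(1)[OF wy(4)] D by auto
  have "x = cmp (w + w') + Dn (y + z)" using w'(4) by (simp add: algebra_simps)
  moreover have "\<delta> (w + w') = 0" using \<delta>_add WF_closed(5)[OF wy(1)] WF_closed(5)[OF w'(1)] dw w'(3) by simp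
  moreover have "w + w' \<in> WF N (Suc p)" "y + z \<in> FC (Suc ` N) (Suc p)"
    using wy w' WF_closed(1,4) FC_closed(1,4) by (metis le_SucI order_refl)+
  ultimately show ?case by blast
qed

text \<open>As long as \<open>z\<close> reaches above the target level, its leading part is closed
  and can be peeled off by terms with zero differential.\<close>

lemma lower_boundary:
  assumes "z \<in> FC (Suc ` N) r" "w \<in> WF N p" "cmp w = Dn z"
  shows "\<exists>z'\<in>FC (Suc ` N) (Suc p). cmp w = Dn z'"
  using assms
proof (induction r arbitrary: z)
  case 0
  then show ?case using FC_closed(4) by blast
next
  case (Suc r)
  show ?case
  proof (cases "r \<le> p")
    case True
    then show ?thesis using Suc FC_closed(4)[OF Suc(2), of "Suc p"] by auto
  next
    case False
    have "HB (restr (\<lambda>c. pdg c = r) z) = 0"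
      by (rule leading_terms(1)[OF Suc(2) WF_closed(4)[OF Suc(3)]]) (use Suc(4) False in auto)
    then obtain u y where uy: "u \<in> WF (Suc ` N) (Suc r)" "\<forall>m\<in>keys u. pw m = r" "y \<in> FC (Suc ` Suc ` N) (Suc r)" "z - cmp u - Dn y \<in> FC (Suc ` N) r"
      using peel[OF Suc(2)] by blast
    have D: "Dn (z - cmp u - Dn y) = cmp (w - \<delta> u)"
      using Suc(4) Dn_Dn[OF FC_closed(5)[OF uy(3)]] Dn_cmp[OF WF_closed(5)[OF uy(1)]] by simp
    have "w \<in> WF N r" using WF_closed(4)[OF Suc(3)] False by simp
    moreover have "\<forall>m\<in>keys w. Suc (pw m) < r" using Suc(3) False by (force simp: WF_def)
    ultimately have "\<delta> u = 0"
      by (rule \<delta>_zero[OF uy(1,2,4)]) (use D in auto)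
    then show ?thesis using Suc(1)[OF uy(4) Suc(3)] D by simp
  qed
qed

text \<open>Peeling \<open>z\<close> changes \<open>w\<close> by \<delta> of the peeled part, and
  these parts add up to the required \<open>u\<close>.\<close>

lemma boundaries_from_\<delta>:
  assumes "z \<in> FC (Suc ` N) p" "w \<in> WF N p" "cmp w = Dn z"
  shows "\<exists>u\<in>WF (Suc ` N) p. w = \<delta> u"
  using assms
proof (induction p arbitrary: z w)
  case 0
  then have "\<And>m. m \<notin> keys w" by (auto simp: WF_def)
  then have "keys w = {}" by blast
  then have "w = 0" by (simp only: keys_eq_empty)
  then show ?case using WF_closed(3) by (intro bexI[of _ 0]) auto
next
  case (Suc p)
  have l: "HB (restr (\<lambda>c. pdg c = p) z) = 0" "restr (\<lambda>m. pw m = p) w = 0"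
    using leading_terms[OF Suc(2,3)] Suc(4) by auto
  then obtain u y where uy: "u \<in> WF (Suc ` N) (Suc p)" "\<forall>m\<in>keys u. pw m = p" "y \<in> FC (Suc ` Suc ` N) (Suc p)" "z - cmp u - Dn y \<in> FC (Suc ` N) p"
    using peel[OF Suc(2)] by blast
  have D: "cmp (w - \<delta> u) = Dn (z - cmp u - Dn y)"
    using Suc(4) Dn_Dn[OF FC_closed(5)[OF uy(3)]] Dn_cmp[OF WF_closed(5)[OF uy(1)]] by simp
  have "w - \<delta> u \<in> WF N p"
    using WF_restr[OF Suc(3) l(2)] \<delta>_peel(2)[OF uy(1,2)] by (intro WF_closed(2)) (auto simp: WF_def)
  then obtain u' where u': "u' \<in> WF (Suc ` N) p" "w - \<delta> u = \<delta> u'" using Suc(1)[OF uy(4) _ D] by blast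
  have "w = \<delta> (u + u')" using u'(2) \<delta>_add WF_closed(5)[OF uy(1)] WF_closed(5)[OF u'(1)] by (simp add: algebra_simps)
  moreover have "u + u' \<in> WF (Suc ` N) (Suc p)" using uy u' WF_closed(1,4) by (metis le_SucI order_refl)
  ultimately show ?case by blast
qed

text \<open>If the boundary drops by two levels, the peeled \<open>w\<close> satisfies \<delta> w =
  0. So \<open>cmp w + Dn y\<close> is a cycle which differs from \<open>x\<close> in lower levels
  only.\<close>

lemma permanent_cycle:
  assumes x: "x \<in> FC N (Suc p)" and D: "\<And>y. y \<in> keys (Dn x) \<Longrightarrow> Suc (pdg y) < p"
  shows "\<exists>y\<in>FC N p. Dn (x + y) = 0"
proof -
  have "HB (restr (\<lambda>c. pdg c = p) x) = 0"
    by (rule leading_terms(1)[OF x WF_closed(3)]) (use D in fastforce)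
  then obtain w y where wy: "w \<in> WF N (Suc p)" "\<forall>m\<in>keys w. pw m = p" "y \<in> FC (Suc ` N) (Suc p)" "x - cmp w - Dn y \<in> FC N p"
    using peel[OF x] by blast
  have Dx: "Dn (x - cmp w - Dn y) = Dn x - cmp (\<delta> w)"
    using Dn_Dn[OF FC_closed(5)[OF wy(3)]] Dn_cmp[OF WF_closed(5)[OF wy(1)]] by simp
  have e: "Dn (x - cmp w - Dn y) - cmp (0 - \<delta> w) = Dn x"
    unfolding Dx by simp
  have "\<delta> w = 0"
    by (rule \<delta>_zero[OF wy(1,2,4) WF_closed(3)]) (simp, use D in \<open>simp only: e\<close>)
  moreover have "Dn (x + - (x - cmp w - Dn y)) = Dn x - Dn (x - cmp w - Dn y)" by simp
  ultimately have "Dn (x + - (x - cmp w - Dn y)) = 0" unfolding Dx by simp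
  then show ?thesis using FC_closed(6)[OF wy(4)] by blast
qed

text \<open>\<open>x\<close> is \<open>cmp w\<close> plus the boundary of some \<open>y\<close> on
  the same level, and \<open>z - y\<close> bounds \<open>cmp w\<close>; only this part has to be
  lowered.\<close>

lemma boundary_degree:
  assumes x: "x \<in> FC N (Suc p)" and z: "z \<in> FC (Suc ` N) r" and e: "Dn z = x"
  shows "\<exists>z'\<in>FC (Suc ` N) (Suc (Suc p)). Dn z' = x"
proof -
  have "Dn x = 0" using Dn_Dn[OF FC_closed(5)[OF z]] e by simp
  then obtain w y where wy: "w \<in> WF N (Suc p)" "y \<in> FC (Suc ` N) (Suc p)" "x = cmp w + Dn y"
    using cycles_from_cmp[OF x] by blast
  have zy: "z - y \<in> FC (Suc ` N) (max r (Suc p))"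
    using z wy(2) FC_closed(2,4) by (meson max.cobounded1 max.cobounded2)
  have "cmp w = Dn (z - y)" using e wy(3) by simp
  then obtain z' where "z' \<in> FC (Suc ` N) (Suc (Suc p))" "cmp w = Dn z'" using lower_boundary[OF zy wy(1)] by blast
  moreover have "y \<in> FC (Suc ` N) (Suc (Suc p))" using FC_closed(4)[OF wy(2)] by simp
  ultimately show ?thesis using wy(3) FC_closed(1) by (intro bexI[of _ "z' + y"]) auto
qed

end

section \<open>Degeneration of the spectral sequence\<close>

text \<open>By \<open>perm\<close> all Z^r with r at least 2 consist of permanent cycles, and by
  \<open>bdry\<close> all B^r with r at least 2 agree; both halves of degeneration follow.\<close>

lemma ss_degenerates_at_2I:
  fixes C F :: "int \<Rightarrow> int \<Rightarrow> 'a::ab_group_add set"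
  assumes F: "\<And>p n. 0 \<in> F p n" "\<And>p n x y. x \<in> F p n \<Longrightarrow> y \<in> F p n \<Longrightarrow> x - y \<in> F p n"
    and C: "\<And>p q. 0 \<in> C p q" "\<And>p q x y. x \<in> C p q \<Longrightarrow> y \<in> C p q \<Longrightarrow> x - y \<in> C p q"
    and F_mono: "\<And>p p' n. p \<le> p' \<Longrightarrow> F p n \<subseteq> F p' n"
    and D: "\<And>x y. D (x - y) = D x - D y" and DD: "\<And>p n x. x \<in> F p n \<Longrightarrow> D (D x) = 0"
    and perm: "\<And>p q c y. c \<in> C p q \<Longrightarrow> y \<in> F (p - 1) (p + q) \<Longrightarrow> D (c + y) \<in> F (p - 2) (p + q - 1) \<Longrightarrow>
      \<exists>y'\<in>F (p - 1) (p + q). D (c + y') = 0"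
    and bdry: "\<And>p q r c y w. c \<in> C p q \<Longrightarrow> y \<in> F (p - 1) (p + q) \<Longrightarrow> w \<in> F r (p + q + 1) \<Longrightarrow> D w = c + y \<Longrightarrow>
      \<exists>w'\<in>F (p + 1) (p + q + 1). D w' = c + y"
  shows "ss_degenerates_at C F D 2"
proof -
  have D0: "D 0 = 0" using D[of 0 0] by simp
  have Dm: "D (- x) = - D x" for x using D[of 0 x] D0 by simp
  have Da: "D (x + y) = D x + D y" for x y using D[of x "- y"] Dm by simp
  have Fm: "- x \<in> F p n" if "x \<in> F p n" for x p n using F(2)[OF F(1) that] by simp
  have Fa: "x + y \<in> F p n" if "x \<in> F p n" "y \<in> F p n" for x y p n using F(2)[OF that(1) Fm[OF that(2)]] by simp
  have Zle: "{c \<in> C p q. \<exists>y\<in>F (p - 1) (p + q). D (c + y) = 0} \<subseteq> ss_Z C F D r p q" for r p q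
  proof
    fix c assume "c \<in> {c \<in> C p q. \<exists>y\<in>F (p - 1) (p + q). D (c + y) = 0}"
    then obtain y where y: "c \<in> C p q" "y \<in> F (p - 1) (p + q)" "D (c + y) = 0" by blast
    then have "D (c + y) \<in> F (p - int r) (p + q - 1)" using F(1) by simp
    then show "c \<in> ss_Z C F D r p q" using y unfolding ss_Z_def by blast
  qed
  have Z: "ss_Z C F D r p q = {c \<in> C p q. \<exists>y\<in>F (p - 1) (p + q). D (c + y) = 0}" if r: "2 \<le> r" for r p q
  proof
    show "ss_Z C F D r p q \<subseteq> {c \<in> C p q. \<exists>y\<in>F (p - 1) (p + q). D (c + y) = 0}"
    proof
      fix c assume "c \<in> ss_Z C F D r p q"
      then obtain y where y: "c \<in> C p q" "y \<in> F (p - 1) (p + q)" "D (c + y) \<in> F (p - int r) (p + q - 1)"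
        by (auto simp: ss_Z_def)
      moreover have "p - int r \<le> p - 2" using r by simp
      ultimately have "D (c + y) \<in> F (p - 2) (p + q - 1)" using F_mono by blast
      then show "c \<in> {c \<in> C p q. \<exists>y\<in>F (p - 1) (p + q). D (c + y) = 0}"
        using perm[OF y(1,2)] y(1) by simp
    qed
  qed (rule Zle)
  have Ble: "ss_B C F D r p q \<subseteq> ss_B C F D 2 p q" for r p q
  proof
    fix c assume "c \<in> ss_B C F D r p q"
    then obtain y w where y: "c \<in> C p q" "y \<in> F (p - 1) (p + q)" "w \<in> F (p + int r - 1) (p + q + 1)" "D w = c + y"
      by (auto simp: ss_B_def)
    then obtain w' where "w' \<in> F (p + 1) (p + q + 1)" "D w' = c + y" using bdry by blast
    moreover have "p + int 2 - 1 = p + 1" by simp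
    ultimately have "w' \<in> F (p + int 2 - 1) (p + q + 1)" "D w' = c + y" by (simp_all only:)
    then show "c \<in> ss_B C F D 2 p q" using y(1,2) unfolding ss_B_def by blast
  qed
  have B2: "ss_B C F D 2 p q \<subseteq> ss_B C F D r p q" if "2 \<le> r" for r p q
  proof -
    have "F (p + int 2 - 1) (p + q + 1) \<subseteq> F (p + int r - 1) (p + q + 1)" using that by (intro F_mono) simp
    then show ?thesis unfolding ss_B_def by blast
  qed
  have B: "ss_B C F D r p q = ss_B C F D 2 p q" if "2 \<le> r" for r p q
    using Ble B2[OF that] by blast
  have Bsub: "x - y \<in> ss_B C F D r p q" if x: "x \<in> ss_B C F D r p q" and y: "y \<in> ss_B C F D r p q" for r p q x y
  proof -
    obtain a w where 1: "x \<in> C p q" "a \<in> F (p - 1) (p + q)" "w \<in> F (p + int r - 1) (p + q + 1)" "D w = x + a"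
      using x by (auto simp: ss_B_def)
    obtain b v where 2: "y \<in> C p q" "b \<in> F (p - 1) (p + q)" "v \<in> F (p + int r - 1) (p + q + 1)" "D v = y + b"
      using y by (auto simp: ss_B_def)
    have "D (w - v) = (x - y) + (a - b)" using 1 2 D by simp
    then show ?thesis using 1 2 C(2) F(2) unfolding ss_B_def by blast
  qed
  have B0: "0 \<in> ss_B C F D r p q" for r p q
    unfolding ss_B_def using C(1) F(1) D0 by force
  have coset: "(+) c ` ss_B C F D r p q = ss_B C F D r p q" if c: "c \<in> ss_B C F D r p q" for c r p q
  proof
    have "c + b \<in> ss_B C F D r p q" if "b \<in> ss_B C F D r p q" for b
      using Bsub[OF c Bsub[OF B0 that]] by simp
    then show "(+) c ` ss_B C F D r p q \<subseteq> ss_B C F D r p q" by auto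
    show "ss_B C F D r p q \<subseteq> (+) c ` ss_B C F D r p q"
    proof
      fix b assume "b \<in> ss_B C F D r p q"
      then have "b - c \<in> ss_B C F D r p q" using Bsub c by blast
      then show "b \<in> (+) c ` ss_B C F D r p q" by (rule rev_image_eqI) simp
    qed
  qed
  have dzero: "ss_d C F D r p q X = ss_B C F D r (p - int r) (q + int r - 1)"
    if r: "2 \<le> r" and X: "X \<in> ss_E C F D r p q" for r p q X
  proof -
    let ?B = "ss_B C F D r (p - int r) (q + int r - 1)"
    obtain c where c: "c \<in> ss_Z C F D r p q" "X = (+) c ` ss_B C F D r p q"
      using X by (auto simp: ss_E_def cosets_of_def)
    then obtain y1 where y1: "y1 \<in> F (p - 1) (p + q)" "D (c + y1) = 0" using Z[OF r] by auto
    have cX: "c \<in> X" using c(2) B0[of r p q] by force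
    let ?S = "{(+) c' ` ?B | c' c y y'. c \<in> X \<and> y \<in> F (p - 1) (p + q) \<and>
        c' \<in> C (p - int r) (q + int r - 1) \<and> y' \<in> F (p - int r - 1) (p + q - 1) \<and> D (c + y) = c' + y'}"
    have S: "A = ?B" if A: "A \<in> ?S" for A
    proof -
      obtain c' c0 y y' where h: "A = (+) c' ` ?B" "c0 \<in> X" "y \<in> F (p - 1) (p + q)"
        "c' \<in> C (p - int r) (q + int r - 1)" "y' \<in> F (p - int r - 1) (p + q - 1)" "D (c0 + y) = c' + y'"
        using A by blast
      obtain \<beta> where \<beta>: "c0 = c + \<beta>" "\<beta> \<in> ss_B C F D r p q" using h(2) c(2) by auto
      obtain y2 w where w: "y2 \<in> F (p - 1) (p + q)" "w \<in> F (p + int r - 1) (p + q + 1)" "D w = \<beta> + y2"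
        using \<beta>(2) by (auto simp: ss_B_def)
      \<comment> \<open>Correcting \<open>y\<close> by the completion \<open>y1\<close> of the cycle
        and by the boundary of \<open>w\<close> shows that a value of d^r is the differential of an
        element of F (p - 1), hence zero in its target.\<close>
      have "D (y - y1 - y2) = D (c0 + y) - D (c + y1) - D (D w)"
        unfolding w(3) \<beta>(1) by (simp add: D Da)
      then have "D (y - y1 - y2) = c' + y'" using y1(2) DD[OF w(2)] h(6) by simp
      moreover have "y - y1 - y2 \<in> F (p - 1) (p + q)" using F(2) h(3) y1(1) w(1) by blast
      moreover have idx: "p - int r + (q + int r - 1) = p + q - 1" "p - int r + int r - 1 = p - 1" "p + q - 1 + 1 = p + q"
        by simp_all
      ultimately have "c' \<in> ?B"
        using h(4,5) unfolding ss_B_def idx by blast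
      then show ?thesis using coset h(1) by blast
    qed
    have "\<Union>?S = ?B"
    proof (rule equalityI)
      show "\<Union>?S \<subseteq> ?B"
      proof
        fix x assume "x \<in> \<Union>?S"
        then obtain A where A: "A \<in> ?S" "x \<in> A" by (rule UnionE)
        show "x \<in> ?B" using A(2) unfolding S[OF A(1)] .
      qed
      have "c \<in> X \<and> y1 \<in> F (p - 1) (p + q) \<and> 0 \<in> C (p - int r) (q + int r - 1) \<and>
          0 \<in> F (p - int r - 1) (p + q - 1) \<and> D (c + y1) = 0 + 0"
        using cX y1 C(1) F(1) by simp
      then have "(+) 0 ` ?B \<in> ?S" by blast
      then have "(+) 0 ` ?B \<subseteq> \<Union>?S" by (rule Union_upper)
      then show "?B \<subseteq> \<Union>?S" by simp
    qed
    then show ?thesis by (simp add: ss_d_def)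
  qed
  \<comment> \<open>Permanent cycles lie in every Z^r, also for r = 0 and r = 1, so the intersection
    is attained at r = 2.\<close>
  have "(\<Inter>r. ss_Z C F D r p q) = ss_Z C F D 2 p q" for p q
    using Zle[of p q] Z[of 2 p q] by blast
  moreover have "(\<Union>r. ss_B C F D r p q) = ss_B C F D 2 p q" for p q
    using Ble by blast
  ultimately have "ss_E C F D 2 p q = ss_E_inf C F D p q" for p q
    by (simp add: ss_E_def ss_E_inf_def)
  then show ?thesis
    unfolding ss_degenerates_at_def using dzero by blast
qed

section \<open>The Hochschild complex and the cyclic bar construction\<close>

lemma lookup_consx': "lookup (consx x y) (a # w) = lookup x a * lookup y w"
proof -
  have "lookup (consx x y) (a # w) = lookup x a * lookup y w"
    unfolding consx_def
  proof (rule lookup_lin_ext_delta)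
    fix m
    show "lookup (lin_ext (\<lambda>w. basis (m # w)) y) (a # w) = (if m = a then lookup y w else 0)"
      using lookup_consx[of m y a w] by (simp add: consx_def)
  qed
  then show ?thesis .
qed

lemma lookup_consx_Nil [simp]: "lookup (consx x y) [] = 0"
  using keys_consxD[of "[]" x y] by (auto simp: in_keys_iff)

fun word_tensor :: "('m \<Rightarrow>\<^sub>0 'k::comm_ring_1) list \<Rightarrow> ('m list \<Rightarrow>\<^sub>0 'k)"
  where "word_tensor [] = basis []" | "word_tensor (x # xs) = consx x (word_tensor xs)"

lemma lookup_word_tensor: "lookup (word_tensor xs) ms = (if length ms = length xs then prod_list (map2 lookup xs ms) else 0)"
proof (induction xs arbitrary: ms)
  case (Cons x xs)
  then show ?case by (cases ms) (auto simp: lookup_consx')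
qed (auto simp: lookup_single when_def)

lemma word_tensor_basis: "word_tensor (map basis ms) = basis ms"
  by (induction ms) auto

lemma listset_length: "ms \<in> listset As \<Longrightarrow> length ms = length As"
  by (induction As arbitrary: ms) (auto simp: set_Cons_def)

lemma finite_listset: "(\<And>A. A \<in> set As \<Longrightarrow> finite A) \<Longrightarrow> finite (listset As)"
proof (induction As)
  case (Cons A As)
  have "set_Cons A (listset As) = (\<lambda>(a, w). a # w) ` (A \<times> listset As)" by (auto simp: set_Cons_def)
  then show ?case using Cons by simp
qed simp

lemma prod_list_listset: "length ms = length as \<Longrightarrow> ms \<notin> listset (map keys as) \<Longrightarrow> prod_list (map2 lookup as ms) = (0 :: 'k::comm_ring_1)"
proof (induction as arbitrary: ms)
  case (Cons x xs)
  then obtain a w where ms: "ms = a # w" by (cases ms) auto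
  then have "a \<notin> keys x \<or> w \<notin> listset (map keys xs)" using Cons(3) by (auto simp: set_Cons_def)
  then show ?case using Cons ms by (auto simp: in_keys_iff)
qed simp

lemma lookup_pure_tensor:
  "lookup (pure_tensor as) ms = (if length ms = length as \<and> 0 \<notin> set (tl ms) then prod_list (map2 lookup as ms) else (0 :: 'k::comm_ring_1))"
proof -
  let ?S = "{ms \<in> listset (map keys as). 0 \<notin> set (tl ms)}"
  have "finite (listset (map keys as))" by (rule finite_listset) auto
  then have "finite ?S" by simp
  then have "lookup (pure_tensor as) ms = (if ms \<in> ?S then prod_list (map2 lookup as ms) else 0)"
    unfolding pure_tensor_def lookup_sum
    by (simp add: lookup_single when_def)
  also have "\<dots> = (if length ms = length as \<and> 0 \<notin> set (tl ms) then prod_list (map2 lookup as ms) else 0)"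
    using listset_length[of ms "map keys as"] prod_list_listset[of ms as] by auto
  finally show ?thesis .
qed

context low_degree
begin

lemma lookup_nrl: "lookup (nrl x) w = (if 0 \<in> set w then 0 else lookup x w)"
  unfolding nrl_def using lookup_lin_ext_delta[of x "\<lambda>u. if 0 \<in> set u then 0 else basis u" w w "if 0 \<in> set w then 0 else 1"]
  by (auto simp: lookup_single when_def)

text \<open>Reduction modulo k concerns all factors but the first, hence \<open>nrl\<close> on the
  tail only.\<close>

lemma pure_tensor_Cons: "pure_tensor (x # xs) = consx x (nrl (word_tensor xs))"
proof (rule poly_mapping_eqI)
  fix ms
  show "lookup (pure_tensor (x # xs)) ms = lookup (consx x (nrl (word_tensor xs))) ms"
    by (cases ms) (auto simp: lookup_pure_tensor lookup_consx' lookup_nrl lookup_word_tensor)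
qed

text \<open>The sign \<open>jl\<close> turns the bigraded signs of the Hochschild complex into those for the total degree.\<close>

fun jl :: "'v mono list \<Rightarrow> nat"
  where "jl [] = 0" | "jl (c # w) = mdeg deg c * length w + jl w"

definition Jw :: "('v mono list \<Rightarrow>\<^sub>0 'k) \<Rightarrow> ('v mono list \<Rightarrow>\<^sub>0 'k)"
  where "Jw = lin_ext (\<lambda>w. sgs (jl w) (basis w))"

text \<open>Besides the sign this separates the coefficient from the word. The empty list is no
  Hochschild cell and is sent to zero.\<close>

definition J :: "('v mono list \<Rightarrow>\<^sub>0 'k) \<Rightarrow> ('v mono \<times> 'v mono list \<Rightarrow>\<^sub>0 'k)"
  where "J = lin_ext (\<lambda>ms. if ms = [] then 0 else sgs (jl ms) (basis (hd ms, tl ms)))"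

definition Jinv :: "('v mono \<times> 'v mono list \<Rightarrow>\<^sub>0 'k) \<Rightarrow> ('v mono list \<Rightarrow>\<^sub>0 'k)"
  where "Jinv = lin_ext (\<lambda>(a, w). sgs (jl (a # w)) (basis (a # w)))"

lemma klinear_J [simp]: "klinear f \<Longrightarrow> klinear (\<lambda>x. J (f x))" "klinear f \<Longrightarrow> klinear (\<lambda>x. Jw (f x))"
   "klinear g \<Longrightarrow> klinear (\<lambda>x. Jinv (g x))"
  by (simp_all add: J_def Jw_def Jinv_def)

lemmas J_simps [simp] = klinearD(1-6)[OF klinear_J(1)[OF klinear_rules(1)]]
  klinearD(1-6)[OF klinear_J(2)[OF klinear_rules(1)]] klinearD(1-6)[OF klinear_J(3)[OF klinear_rules(1)]]

lemma J_basis: "J (basis (a # w)) = sgs (jl (a # w)) (basis (a, w))" "Jw (basis w) = sgs (jl w) (basis w)"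
  "Jinv (basis (a, w)) = sgs (jl (a # w)) (basis (a # w))"
  by (simp_all add: J_def Jw_def Jinv_def)

lemma J_Jinv [simp]: "J (Jinv x) = x"
proof (rule klinear_eq[of "\<lambda>x. J (Jinv x)" "\<lambda>x. x"])
  fix m :: "'v mono \<times> 'v mono list"
  show "J (Jinv (basis m)) = basis m" by (cases m) (simp add: J_basis sgs_sgs sgs_def)
qed simp_all

lemma Jinv_J: "[] \<notin> keys x \<Longrightarrow> Jinv (J x) = x"
proof (rule klinear_eq_on[of "\<lambda>x. Jinv (J x)" "\<lambda>x. x"])
  fix m assume "[] \<notin> keys x" "m \<in> keys x"
  then obtain a w where "m = a # w" by (cases m) auto
  then show "Jinv (J (basis m)) = basis m" by (simp add: J_basis sgs_sgs sgs_def)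
qed simp_all

lemma lookup_J: "lookup (J x) (a, w) = sgs (jl (a # w)) (lookup x (a # w))"
proof -
  have "lookup (J x) (a, w) = lookup x (a # w) * sgs (jl (a # w)) 1"
    unfolding J_def
  proof (rule lookup_lin_ext_delta)
    fix m
    show "lookup (if m = [] then 0 else sgs (jl m) (basis (hd m, tl m))) (a, w) = (if m = a # w then sgs (jl (a # w)) 1 else (0 :: 'k))"
      by (cases m) (auto simp: lookup_sgs lookup_single when_def)
  qed
  then show ?thesis by (auto simp: sgs_def)
qed

lemma keys_J: "keys (J x) = {(a, w). a # w \<in> keys x}"
  by (auto simp: in_keys_iff lookup_J sgs_def split: if_splits)

lemma J_consx:
  assumes "\<And>a. a \<in> keys x \<Longrightarrow> mdeg deg a = n" "\<And>w. w \<in> keys y \<Longrightarrow> length w = q"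
  shows "J (consx x y) = sgs (n * q) (tens x (Jw y))" "Jw (consx x y) = sgs (n * q) (consx x (Jw y))"
  by (rule klinear_eq2_on[where F = "\<lambda>x y. J (consx x y)" and H = "\<lambda>x y. sgs (n * q) (tens x (Jw y))"],
      use assms in \<open>auto simp: J_basis sgs_sgs\<close>)
    (rule klinear_eq2_on[where F = "\<lambda>x y. Jw (consx x y)" and H = "\<lambda>x y. sgs (n * q) (consx x (Jw y))"],
      use assms in \<open>auto simp: J_basis sgs_sgs\<close>)

lemma Jw_nrl: "Jw (nrl x) = nrl (Jw x)"
  by (rule klinear_eq[of "\<lambda>x. Jw (nrl x)" "\<lambda>x. nrl (Jw x)"]) (auto simp: nrl_basis J_basis)

lemma wdg_Suc: "wdg s w = int_deg deg w + length w"
  by (induction w) (auto simp: int_deg_def)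

end

lemma scal_minus_one_power: "scal ((-1) ^ n) x = sgs n x"
  by (simp add: sgs_def minus_one_power_iff)

lemma sgs_sum: "sgs n (sum f A) = (\<Sum>a\<in>A. sgs n (f a))"
  by (simp add: sgs_def sum_negf)

lemma sgs_Suc_eq: "sgs (Suc n) x = - sgs n x"
  by (simp add: sgs_def)

lemma shuffle_sum_keys: "z \<in> keys (shuffle_sum deg u v :: 'v mono list \<Rightarrow>\<^sub>0 'k::comm_ring_1) \<Longrightarrow> mset z = mset u + mset v"
proof (induction deg u v arbitrary: z rule: shuffle_sum.induct)
  case (3 deg a as b bs)
  let ?x = "lin_ext (\<lambda>ms. basis (a # ms)) (shuffle_sum deg as (b # bs)) :: 'v mono list \<Rightarrow>\<^sub>0 'k"
  let ?y = "lin_ext (\<lambda>ms. basis (b # ms)) (shuffle_sum deg (a # as) bs) :: 'v mono list \<Rightarrow>\<^sub>0 'k"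
  from 3(3) have "z \<in> keys ?x \<union> keys ?y"
    using Poly_Mapping.keys_add[of ?x "scal ((-1) ^ (length (a # as) + mdeg deg b * int_deg deg (a # as))) ?y"]
      keys_scal[of _ ?y] by auto
  then show ?case
    by (auto dest!: keys_lin_extD 3(1,2))
qed auto

lemma consx_lin_ext: "consx (basis a) x = lin_ext (\<lambda>w. basis (a # w)) x"
  by (simp add: consx_def)

section \<open>The Hochschild operations in the re-signed complex\<close>

context low_degree
begin

abbreviation gm where "gm a b \<equiv> gmult deg (basis a) (basis b) :: 'v mono \<Rightarrow>\<^sub>0 'k"

lemma gm_mpr: "a \<in> lam \<Longrightarrow> b \<in> lam \<Longrightarrow> gm a b = mpr deg a b"
  using gmult_eq[of "basis a" "Gen ` G" deg "basis b"] by (simp add: span_on_def lam_def)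

text \<open>\<open>bsum\<close> and \<open>dsum\<close> are sums over positions as in
  \<open>hoch_b\<close> and \<open>hoch_del\<close>; their recursions match them with
  \<open>bt\<close> and \<open>dl\<close>.\<close>

definition bsum :: "'v mono list \<Rightarrow> ('v mono list \<Rightarrow>\<^sub>0 'k)"
  where "bsum w = (\<Sum>i<length w - 1. sgs i (word_tensor (map basis (take i w) @ [gm (w ! i) (w ! Suc i)] @ map basis (drop (i + 2) w))))"

definition dsum :: "'v mono list \<Rightarrow> ('v mono list \<Rightarrow>\<^sub>0 'k)"
  where "dsum w = (\<Sum>i<length w. sgs (int_deg deg (take i w)) (word_tensor (map basis (take i w) @ [bd (basis (w ! i))] @ map basis (drop (Suc i) w))))"

lemma consx_sum: "consx x (sum f A) = (\<Sum>a\<in>A. consx x (f a))"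
  and nrl_sum: "nrl (sum f A) = (\<Sum>a\<in>A. nrl (f a))"
  using klinearD(7)[of "consx x"] klinearD(7)[of nrl] by (simp_all add: klinear_consx(2)[OF klinear_rules(1)] klinear_nrm(2)[OF klinear_rules(1)])

lemma bsum_Cons: "bsum (c # e # w) = consx (gm c e) (basis w) - consx (basis c) (bsum (e # w))"
proof -
  have "bsum (c # e # w) = consx (gm c e) (basis w) + (\<Sum>i<length w. sgs (Suc i) (consx (basis c)
      (word_tensor (map basis (take i (e # w)) @ [gm ((e # w) ! i) ((e # w) ! Suc i)] @ map basis (drop (i + 2) (e # w))))))"
    unfolding bsum_def by (simp add: sum.lessThan_Suc_shift word_tensor_basis del: sum.lessThan_Suc)
  also have "\<dots> = consx (gm c e) (basis w) - consx (basis c) (bsum (e # w))"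
    unfolding bsum_def consx_sum by (simp add: sum_negf[symmetric]) (intro sum.cong refl, simp add: sgs_def)
  finally show ?thesis .
qed

lemma bsum_short [simp]: "bsum [] = 0" "bsum [c] = 0"
  by (simp_all add: bsum_def)

lemma dsum_Cons: "dsum (c # w) = consx (bd (basis c)) (basis w) + sgs (mdeg deg c) (consx (basis c) (dsum w))"
proof -
  have "dsum (c # w) = consx (bd (basis c)) (basis w) + (\<Sum>i<length w. sgs (mdeg deg c + int_deg deg (take i w)) (consx (basis c)
      (word_tensor (map basis (take i w) @ [bd (basis (w ! i))] @ map basis (drop (Suc i) w)))))"
    unfolding dsum_def by (simp add: sum.lessThan_Suc_shift word_tensor_basis int_deg_def del: sum.lessThan_Suc)
  also have "\<dots> = consx (bd (basis c)) (basis w) + sgs (mdeg deg c) (consx (basis c) (dsum w))"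
    unfolding dsum_def consx_sum
    by (simp add: sgs_sum sgs_sgs)
  finally show ?thesis .
qed

lemma dsum_Nil [simp]: "dsum [] = 0"
  by (simp add: dsum_def)

lemma length_bsum: "z \<in> keys (bsum w) \<Longrightarrow> Suc (length z) = length w"
proof (induction w arbitrary: z rule: induct_list012)
  case (3 c e w)
  then show ?case by (fastforce simp: bsum_Cons dest!: keys_diffD keys_consxD)
qed auto

lemma length_dsum: "z \<in> keys (dsum w) \<Longrightarrow> length z = length w"
proof (induction w arbitrary: z)
  case (Cons c w)
  then show ?case by (fastforce simp: dsum_Cons dest!: keys_addD keys_consxD)
qed auto

lemma Jw_bsum: "set w \<subseteq> lam \<Longrightarrow> Jw (bsum w) = - sgs (jl w) (bt w)"
proof (induction w rule: induct_list012)
  case (3 c e w)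
  have 1: "Jw (consx (mpr deg c e) (basis w)) = sgs ((mdeg deg c + mdeg deg e) * length w) (consx (mpr deg c e) (sgs (jl w) (basis w)))"
    by (subst J_consx(2)[where n = "mdeg deg c + mdeg deg e" and q = "length w"]) (auto simp: J_basis dest: keys_mprD)
  have 2: "Jw (consx (basis c) (bsum (e # w))) = sgs (mdeg deg c * length w) (consx (basis c) (Jw (bsum (e # w))))"
    by (rule J_consx(2)) (auto dest: length_bsum)
  have "Jw (bsum (e # w)) = - sgs (jl (e # w)) (bt (e # w))" using 3 by simp
  then show ?case
    using 3(3) by (simp add: bsum_Cons gm_mpr 1 2 sgs_sgs sgs_add del: bt.simps(2)) (simp add: sgs_def)
qed (simp_all add: bsum_def)

lemma Jw_dsum: "set w \<subseteq> lam \<Longrightarrow> Jw (dsum w) = sgs (length w + jl w) (dl w)"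
proof (induction w)
  case (Cons c w)
  have c: "bd (basis c) = bdm c" using Cons(2) by (simp add: bdm_def)
  have 1: "Jw (consx (bdm c) (basis w)) = sgs ((mdeg deg c + 1) * length w) (consx (bdm c) (sgs (jl w) (basis w)))"
  proof (cases "bdm c = 0")
    case False
    then obtain n where n: "mdeg deg c = Suc n" using bd_pos[of c] by (cases "mdeg deg c") auto
    have "Jw (consx (bdm c) (basis w)) = sgs (n * length w) (consx (bdm c) (Jw (basis w)))"
      by (rule J_consx(2)) (use n bd_dg in force)+
    then show ?thesis using n by (auto simp: J_basis intro!: sgs_cong)
  qed simp
  have 2: "Jw (consx (basis c) (dsum w)) = sgs (mdeg deg c * length w) (consx (basis c) (Jw (dsum w)))"
    by (rule J_consx(2)) (auto dest: length_dsum)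
  have "Jw (dsum w) = sgs (length w + jl w) (dl w)" using Cons by simp
  then show ?case
    by (simp add: dsum_Cons c 1 2 sgs_sgs sgs_add) (simp add: sgs_def)
qed simp

text \<open>First multiplication, inner multiplications and wrap-around; up to signs they become
  \<open>lft\<close>, \<open>bt\<close> and \<open>rgt\<close>.\<close>

lemma hoch_b_Cons:
  "hoch_b deg (basis (a # c # w)) = consx (gm a c) (nrl (basis w)) - consx (basis a) (nrl (bsum (c # w))) +
    sgs (Suc (length w) + mdeg deg (last (c # w)) * int_deg deg (a # butlast (c # w)))
      (consx (gm (last (c # w)) a) (nrl (basis (butlast (c # w)))))"
proof -
  have "(\<Sum>i<Suc (length w). sgs i (pure_tensor (map basis (take i (a # c # w)) @
          [gm ((a # c # w) ! i) ((a # c # w) ! Suc i)] @ map basis (drop (i + 2) (a # c # w))))) =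
     pure_tensor (gm a c # map basis w) + (\<Sum>i<length w. sgs (Suc i) (consx (basis a) (nrl
       (word_tensor (map basis (take i (c # w)) @ [gm ((c # w) ! i) ((c # w) ! Suc i)] @ map basis (drop (i + 2) (c # w)))))))"
    by (simp add: sum.lessThan_Suc_shift pure_tensor_Cons del: sum.lessThan_Suc)
  also have "\<dots> = consx (gm a c) (nrl (basis w)) - consx (basis a) (nrl (bsum (c # w)))"
    unfolding bsum_def consx_sum nrl_sum
    by (simp add: sum_negf[symmetric] pure_tensor_Cons word_tensor_basis) (intro sum.cong refl, simp add: sgs_def)
  finally show ?thesis
    by (simp add: hoch_b_def scal_minus_one_power pure_tensor_Cons word_tensor_basis Let_def del: sum.lessThan_Suc)
      (auto simp: sgs_Suc_eq)
qed

lemma hoch_b_single: "hoch_b deg (basis [a]) = 0"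
  by (simp add: hoch_b_def)

lemma hoch_del_Cons:
  "hoch_del deg bd (basis (a # w)) = sgs (length w) (consx (bd (basis a)) (nrl (basis w)) +
     sgs (mdeg deg a) (consx (basis a) (nrl (dsum w))))"
proof -
  have "(\<Sum>i\<le>length w. sgs (length w + int_deg deg (take i (a # w))) (pure_tensor (map basis (take i (a # w)) @
          [bd (basis ((a # w) ! i))] @ map basis (drop (Suc i) (a # w))))) =
     sgs (length w) (consx (bd (basis a)) (nrl (basis w))) + (\<Sum>i<length w. sgs (length w + (mdeg deg a + int_deg deg (take i w))) (consx (basis a) (nrl
       (word_tensor (map basis (take i w) @ [bd (basis (w ! i))] @ map basis (drop (Suc i) w))))))"
    by (simp add: sum.lessThan_Suc_shift pure_tensor_Cons lessThan_Suc_atMost[symmetric] word_tensor_basis int_deg_def del: sum.lessThan_Suc)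
  also have "\<dots> = sgs (length w) (consx (bd (basis a)) (nrl (basis w)) + sgs (mdeg deg a) (consx (basis a) (nrl (dsum w))))"
    unfolding dsum_def consx_sum nrl_sum
    by (simp add: sgs_sum sgs_sgs sgs_add add.assoc)
  finally show ?thesis
    by (simp add: hoch_del_def scal_minus_one_power Let_def)
qed

lemma jl_snoc: "jl (v @ [f]) = jl v + int_deg deg v"
  by (induction v) (auto simp: int_deg_def)

lemma J_hoch_b:
  assumes "(a, w) \<in> ncells"
  shows "J (hoch_b deg (basis (a # w))) = HB (J (basis (a # w)))"
proof (cases w)
  case Nil
  then show ?thesis by (simp add: hoch_b_single J_basis HB_basis)
next
  case (Cons c w')
  obtain f v where snoc: "w = v @ [f]" using Cons by (metis rev_exhaust list.distinct(1))
  have w: "a \<in> lam" "set w \<subseteq> lam" "0 \<notin> set w" using assms by (auto simp: ncells_def)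
  have lf: "c \<in> lam" "f \<in> lam" "length w = length v + 1" "length w' = length v"
    using w arg_cong[OF Cons, of set] arg_cong[OF Cons, of length] unfolding snoc by auto
  have lb: "last (c # w') = f" "butlast (c # w') = v" unfolding Cons[symmetric] snoc by simp_all
  have n: "nrl (basis w') = basis w'" "nrl (basis v) = basis v"
    using w(3) arg_cong[OF Cons, of set] unfolding snoc by (auto simp: nrl_basis)
  have bte: "nrl (bt w) = bt w" using keys_bt_e[of _ w] w(3) by (intro nrl_id) blast
  have "J (consx (mpr deg a c) (basis w')) = sgs ((mdeg deg a + mdeg deg c) * length v + jl w') (tens (mpr deg a c) (basis w'))"
    by (subst J_consx(1)[where n = "mdeg deg a + mdeg deg c" and q = "length v"]) (use lf in \<open>auto simp: J_basis sgs_sgs dest: keys_mprD\<close>)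
  also have "\<dots> = sgs (jl (a # w) + mdeg deg a) (tens (mpr deg a c) (basis w'))"
    using lf Cons by (auto intro!: sgs_cong)
  finally have 1: "J (consx (mpr deg a c) (basis w')) = sgs (jl (a # w) + mdeg deg a) (um (basis (a, [])) (lft w))"
    by (simp add: Cons tpr_pair)
  have "J (consx (basis a) (nrl (bsum w))) = sgs (mdeg deg a * length v) (tens (basis a) (Jw (nrl (bsum w))))"
    by (rule J_consx(1)) (use lf(3) in \<open>auto simp: lookup_nrl split: if_splits dest!: length_bsum[OF iffD2[OF in_keys_iff]] iffD1[OF in_keys_iff]\<close>)
  also have "Jw (nrl (bsum w)) = - sgs (jl w) (bt w)"
    unfolding Jw_nrl Jw_bsum[OF w(2)] by (simp add: bte)
  also have "sgs (mdeg deg a * length v) (tens (basis a) (- sgs (jl w) (bt w))) = - sgs (jl (a # w) + mdeg deg a) (tens (basis a) (bt w))"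
    using lf(3) by (auto simp: sgs_def)
  finally have 2: "J (consx (basis a) (nrl (bsum w))) = - sgs (jl (a # w) + mdeg deg a) (tens (basis a) (bt w))" .
  have comm: "mpr deg f a = (sgs (mdeg deg f * mdeg deg a) (mpr deg a f) :: _ \<Rightarrow>\<^sub>0 'k)" by (rule Om.pr_comm)
  have base: "J (consx (mpr deg a f) (basis v)) = sgs ((mdeg deg a + mdeg deg f) * length v + jl v) (tens (mpr deg a f) (basis v))"
    by (subst J_consx(1)[where n = "mdeg deg a + mdeg deg f" and q = "length v"]) (auto simp: J_basis sgs_sgs dest: keys_mprD)
  have 3: "J (sgs (length w + mdeg deg f * int_deg deg (a # v)) (consx (mpr deg f a) (basis v))) =
      - sgs (jl (a # w) + mdeg deg a) (um (basis (a, [])) (rgt w))"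
    unfolding comm using lf(3)
    by (simp add: base snoc tpr_pair sgs_sgs jl_snoc wdg_Suc int_deg_def) (auto simp: sgs_def)
  have "hoch_b deg (basis (a # w)) = consx (mpr deg a c) (basis w') - consx (basis a) (nrl (bsum w)) +
      sgs (length w + mdeg deg f * int_deg deg (a # v)) (consx (mpr deg f a) (basis v))"
    using hoch_b_Cons[of a c w', unfolded lb, folded Cons] w(1) lf n by (simp add: gm_mpr)
  then have "J (hoch_b deg (basis (a # w))) = sgs (jl (a # w) + mdeg deg a) (um (basis (a, [])) (lft w)) +
      sgs (jl (a # w) + mdeg deg a) (tens (basis a) (bt w)) - sgs (jl (a # w) + mdeg deg a) (um (basis (a, [])) (rgt w))"
    using 1 2 3 by simp
  then show ?thesis
    unfolding J_basis HB_simps HB_basis by (simp add: sgs_sgs) (simp add: sgs_def)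
qed

lemma J_hoch_del:
  assumes "(a, w) \<in> ncells"
  shows "J (hoch_del deg bd (basis (a # w))) = nrm (HD (J (basis (a # w))))"
proof -
  have w: "a \<in> lam" "set w \<subseteq> lam" "0 \<notin> set w" using assms by (auto simp: ncells_def)
  have c: "bd (basis a) = bdm a" using w(1) by (simp add: bdm_def)
  have 1: "J (consx (bdm a) (basis w)) = sgs ((mdeg deg a + 1) * length w + jl w) (tens (bdm a) (basis w))"
  proof (cases "bdm a = 0")
    case False
    then obtain n where n: "mdeg deg a = Suc n" using bd_pos[of a] by (cases "mdeg deg a") auto
    have "J (consx (bdm a) (basis w)) = sgs (n * length w) (tens (bdm a) (Jw (basis w)))"
      by (rule J_consx(1)) (use n bd_dg in force)+
    then show ?thesis using n by (auto simp: J_basis sgs_sgs intro!: sgs_cong)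
  qed simp
  have "J (consx (basis a) (nrl (dsum w))) = sgs (mdeg deg a * length w) (tens (basis a) (Jw (nrl (dsum w))))"
    by (rule J_consx(1)) (auto simp: lookup_nrl split: if_splits dest!: length_dsum[OF iffD2[OF in_keys_iff]] iffD1[OF in_keys_iff])
  then have 2: "J (consx (basis a) (nrl (dsum w))) = sgs (mdeg deg a * length w + length w + jl w) (tens (basis a) (nrl (dl w)))"
    unfolding Jw_nrl Jw_dsum[OF w(2)] by (simp add: sgs_sgs add.assoc)
  show ?thesis
    unfolding hoch_del_Cons J_basis klinearD(6)[OF klinear_HB(2)[OF klinear_rules(1)]] HD_basis
    using w(3) by (simp add: c 1 2 nrm_tens nrl_basis sgs_add sgs_sgs) (simp add: sgs_def)
qed

text \<open>The sign with exponent \<open>int_deg deg u * length v\<close> comes from moving the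
  shifts of \<open>v\<close> past \<open>u\<close>; together with \<open>jl\<close> it accounts for
  the difference between the bigraded shuffle signs and the Koszul signs of shifted degrees.\<close>

lemma Jw_shuffle_sum: "Jw (shuffle_sum deg u v) = sgs (int_deg deg u * length v + jl u + jl v) (shp s u v)"
proof (induction "length u + length v" arbitrary: u v rule: less_induct)
  case less
  show ?case
  proof (cases "u = [] \<or> v = []")
    case True
    then show ?thesis by (cases u) (auto simp: J_basis int_deg_def)
  next
    case False
    then obtain a u' b v' where uv: "u = a # u'" "v = b # v'" by (meson list.exhaust)
    have len: "length z = length x + length y" if "z \<in> keys (shuffle_sum deg x y :: _ \<Rightarrow>\<^sub>0 'k)" for x y z
      using arg_cong[OF shuffle_sum_keys[OF that], of size] by simp
    have 1: "Jw (consx (basis a) (shuffle_sum deg u' v)) = sgs (mdeg deg a * (length u' + length v)) (consx (basis a) (Jw (shuffle_sum deg u' v)))"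
      by (rule J_consx(2)) (auto dest: len)
    have 2: "Jw (consx (basis b) (shuffle_sum deg u v')) = sgs (mdeg deg b * (length u + length v')) (consx (basis b) (Jw (shuffle_sum deg u v')))"
      by (rule J_consx(2)) (auto dest: len)
    have "shuffle_sum deg u v = (consx (basis a) (shuffle_sum deg u' v) +
        sgs (length u + mdeg deg b * int_deg deg u) (consx (basis b) (shuffle_sum deg u v')) :: _ \<Rightarrow>\<^sub>0 'k)"
      by (simp add: uv consx_lin_ext scal_minus_one_power sgs_Suc_eq)
    then have "Jw (shuffle_sum deg u v) = sgs (mdeg deg a * (length u' + length v)) (consx (basis a) (Jw (shuffle_sum deg u' v))) +
       sgs (length u + mdeg deg b * int_deg deg u) (sgs (mdeg deg b * (length u + length v')) (consx (basis b) (Jw (shuffle_sum deg u v'))))"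
      by (simp only: J_simps 1 2)
    also have "Jw (shuffle_sum deg u' v) = sgs (int_deg deg u' * length v + jl u' + jl v) (shp s u' v)"
      by (rule less) (simp add: uv)
    also have "Jw (shuffle_sum deg u v') = sgs (int_deg deg u * length v' + jl u + jl v') (shp s u v')"
      by (rule less) (simp add: uv)
    also have "sgs (mdeg deg a * (length u' + length v)) (consx (basis a) (sgs (int_deg deg u' * length v + jl u' + jl v) (shp s u' v))) =
      sgs (int_deg deg u * length v + jl u + jl v) (consx (basis a) (shp s u' v))"
      by (auto simp: uv sgs_sgs int_deg_def intro!: sgs_cong)
    also have "sgs (length u + mdeg deg b * int_deg deg u) (sgs (mdeg deg b * (length u + length v')) (consx (basis b) (sgs (int_deg deg u * length v' + jl u + jl v') (shp s u v')))) =
      sgs (int_deg deg u * length v + jl u + jl v) (sgs (s b * wdg s u) (consx (basis b) (shp s u v')))"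
      by (auto simp: uv sgs_sgs wdg_Suc int_deg_def intro!: sgs_cong)
    finally show ?thesis by (simp add: uv sgs_add)
  qed
qed

lemma J_shuffle_product:
  assumes x: "(a, u) \<in> ncells" and y: "(b, v) \<in> ncells"
  shows "J (shuffle_product deg (basis (a # u)) (basis (b # v))) = um (J (basis (a # u))) (J (basis (b # v)))"
proof -
  have l: "a \<in> lam" "b \<in> lam" "0 \<notin> set u" "0 \<notin> set v" using x y by (auto simp: ncells_def)
  have len: "length z = length u + length v" if "z \<in> keys (shuffle_sum deg u v :: _ \<Rightarrow>\<^sub>0 'k)" for z
    using arg_cong[OF shuffle_sum_keys[OF that], of size] by simp
  have "lin_ext (\<lambda>ms. pure_tensor (gm a b # map basis ms)) (shuffle_sum deg u v) = consx (mpr deg a b) (shuffle_sum deg u v)"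
  proof (rule klinear_eq_on[of "lin_ext (\<lambda>ms. pure_tensor (gm a b # map basis ms))" "consx (mpr deg a b)"])
    fix ms assume ms: "ms \<in> keys (shuffle_sum deg u v :: _ \<Rightarrow>\<^sub>0 'k)"
    have "set ms = set u \<union> set v" using arg_cong[OF shuffle_sum_keys[OF ms], of set_mset] by simp
    then show "lin_ext (\<lambda>ms. pure_tensor (gm a b # map basis ms)) (basis ms) = consx (mpr deg a b) (basis ms)"
      using l by (simp add: pure_tensor_Cons word_tensor_basis nrl_basis gm_mpr)
  qed (simp_all add: klinear_consx(2)[OF klinear_rules(1)])
  then have "shuffle_product deg (basis (a # u)) (basis (b # v)) =
      (sgs (mdeg deg b * int_deg deg u + int_deg deg (a # u) * length v) (consx (mpr deg a b) (shuffle_sum deg u v)) :: _ \<Rightarrow>\<^sub>0 'k)"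
    by (simp add: shuffle_product_def scal_minus_one_power power_add[symmetric])
  moreover have "J (consx (mpr deg a b) (shuffle_sum deg u v)) =
      sgs ((mdeg deg a + mdeg deg b) * (length u + length v)) (tens (mpr deg a b) (Jw (shuffle_sum deg u v)))"
    by (rule J_consx(1)) (auto dest: keys_mprD len)
  ultimately show ?thesis
    unfolding J_basis by (simp add: Jw_shuffle_sum sgs_sgs tpr_pair wdg_Suc int_deg_def) (auto intro!: sgs_cong)
qed

end

lemma subset_Collect: "A \<subseteq> {m \<in> S. P m} \<longleftrightarrow> A \<subseteq> S \<and> (\<forall>m\<in>A. P m)"
  by blast

section \<open>The filtered Hochschild complex and its spectral sequence\<close>

context low_degree
begin

abbreviation hspan :: "('v mono list \<Rightarrow>\<^sub>0 'k) set" where "hspan \<equiv> span_on (hoch_basis G deg)"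

lemma hoch_basis_Cons: "a # w \<in> hoch_basis G deg \<longleftrightarrow> (a, w) \<in> ncells" "[] \<notin> hoch_basis G deg"
  unfolding ncells_def by (auto simp: hoch_basis_def lam_def)

lemma hspanD: "x \<in> hspan \<Longrightarrow> ms \<in> keys x \<Longrightarrow> \<exists>a w. ms = a # w \<and> (a, w) \<in> ncells"
  using hoch_basis_Cons by (cases ms) (auto simp: span_on_def)

lemma J_ncells: "x \<in> hspan \<Longrightarrow> keys (J x) \<subseteq> ncells"
  using hspanD[of x] by (auto simp: keys_J)

lemma Jinv_hspan: "keys y \<subseteq> ncells \<Longrightarrow> Jinv y \<in> hspan"
proof -
  assume y: "keys y \<subseteq> ncells"
  have "m \<in> hoch_basis G deg" if "m \<in> keys (Jinv y)" for m
    using keys_lin_extD[OF that[unfolded Jinv_def]] y hoch_basis_Cons(1) by (auto simp: sgs_def split: if_splits)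
  then show ?thesis by (auto simp: span_on_def)
qed

lemma Jinv_J_hspan: "x \<in> hspan \<Longrightarrow> Jinv (J x) = x"
  using hspanD[of x "[]"] by (intro Jinv_J) blast

lemma klinear_hoch_D [simp]: "klinear f \<Longrightarrow> klinear (\<lambda>x. hoch_D deg bd (f x))"
  by (simp add: hoch_D_def hoch_b_def hoch_del_def)

lemmas hoch_D_simps = klinearD(1-6)[OF klinear_hoch_D[OF klinear_rules(1)]]

lemma klinear_shuffle_product [simp]: "klinear f \<Longrightarrow> klinear (\<lambda>x. shuffle_product deg (f x) y)"
  "klinear f \<Longrightarrow> klinear (\<lambda>x. shuffle_product deg y (f x))"
  by (simp_all add: shuffle_product_def)

lemma hoch_D_eq:
  assumes "x \<in> hspan"
  shows "hoch_D deg bd x = Jinv (Dn (J x))"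
proof (rule klinear_eq_on[of "hoch_D deg bd" "\<lambda>x. Jinv (Dn (J x))"])
  fix m assume "m \<in> keys x"
  then obtain a w where m: "m = a # w" "(a, w) \<in> ncells" using hspanD[OF assms] by blast
  \<comment> \<open>\<open>J\<close> kills the empty list, so \<open>Jinv\<close> recovers a value
    only if the empty list does not occur in it.\<close>
  have "lookup (hoch_b deg (basis (a # w))) [] = (0 :: 'k)"
    by (cases w) (simp_all add: hoch_b_single hoch_b_Cons lookup_add lookup_minus lookup_sgs)
  moreover have "lookup (hoch_del deg bd (basis (a # w))) [] = 0"
    by (simp add: hoch_del_Cons lookup_add lookup_sgs)
  ultimately have "[] \<notin> keys (hoch_D deg bd (basis (a # w)))"
    by (simp add: hoch_D_def in_keys_iff lookup_add)
  moreover have "J (hoch_D deg bd (basis (a # w))) = Dn (J (basis (a # w)))"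
    using m(2) J_ncells[of "basis (a # w)"] by (simp add: hoch_D_def J_hoch_b J_hoch_del Dn_HB span_on_def hoch_basis_Cons)
  ultimately show "hoch_D deg bd (basis m) = Jinv (Dn (J (basis m)))"
    using Jinv_J m(1) by metis
qed simp_all

lemma J_hoch_D: "x \<in> hspan \<Longrightarrow> J (hoch_D deg bd x) = Dn (J x)"
  by (simp add: hoch_D_eq)

lemma hoch_D_hspan: "x \<in> hspan \<Longrightarrow> hoch_D deg bd x \<in> hspan"
  by (simp add: hoch_D_eq Jinv_hspan Dn_ncells J_ncells)

lemma shuffle_product_eq:
  assumes "x \<in> hspan" "y \<in> hspan"
  shows "shuffle_product deg x y = Jinv (um (J x) (J y))"
proof (rule klinear_eq2_on[where F = "shuffle_product deg" and H = "\<lambda>x y. Jinv (um (J x) (J y))"])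
  fix m n assume "m \<in> keys x" "n \<in> keys y"
  then obtain a u b v where m: "m = a # u" "(a, u) \<in> ncells" "n = b # v" "(b, v) \<in> ncells"
    using hspanD assms by blast
  have "[] \<notin> keys (shuffle_product deg (basis (a # u)) (basis (b # v)) :: _ \<Rightarrow>\<^sub>0 'k)"
  proof
    assume "[] \<in> keys (shuffle_product deg (basis (a # u)) (basis (b # v)) :: _ \<Rightarrow>\<^sub>0 'k)"
    then have "[] \<in> keys (lin_ext (\<lambda>ms. pure_tensor (gm a b # map basis ms)) (shuffle_sum deg u v))"
      using keys_scal by (force simp: shuffle_product_def)
    from keys_lin_extD[OF this] show False by (auto simp: pure_tensor_Cons in_keys_iff)
  qed
  then show "shuffle_product deg (basis m) (basis n) = Jinv (um (J (basis m)) (J (basis n)))"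
    using Jinv_J J_shuffle_product m by metis
qed simp_all

lemma hspan_closed: "0 \<in> hspan" "x \<in> hspan \<Longrightarrow> y \<in> hspan \<Longrightarrow> x + y \<in> hspan"
  "x \<in> hspan \<Longrightarrow> y \<in> hspan \<Longrightarrow> x - y \<in> hspan" "x \<in> hspan \<Longrightarrow> scal c x \<in> hspan"
  using keys_addD[of _ x y] keys_diffD[of _ x y] keys_scal[of c x] unfolding span_on_def by (simp, blast+)

lemma J_FC: "x \<in> hspan \<Longrightarrow> J x \<in> FC N p \<longleftrightarrow>
    (\<forall>ms\<in>keys x. pdg (hd ms, tl ms) < p \<and> pdg (hd ms, tl ms) + qdg (hd ms, tl ms) \<in> N)"
proof
  assume x: "x \<in> hspan"
  {
    assume J: "J x \<in> FC N p"
    show "\<forall>ms\<in>keys x. pdg (hd ms, tl ms) < p \<and> pdg (hd ms, tl ms) + qdg (hd ms, tl ms) \<in> N"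
    proof
      fix ms assume ms: "ms \<in> keys x"
      then obtain a w where "ms = a # w" using hspanD[OF x] by blast
      then show "pdg (hd ms, tl ms) < p \<and> pdg (hd ms, tl ms) + qdg (hd ms, tl ms) \<in> N"
        using J ms by (simp add: FC_def keys_J)
    qed
  next
    assume h: "\<forall>ms\<in>keys x. pdg (hd ms, tl ms) < p \<and> pdg (hd ms, tl ms) + qdg (hd ms, tl ms) \<in> N"
    have "(a, w) \<in> ncells \<and> pdg (a, w) < p \<and> pdg (a, w) + qdg (a, w) \<in> N" if "a # w \<in> keys x" for a w
      using hspanD[OF x that] bspec[OF h that] by simp
    then show "J x \<in> FC N p" by (auto simp: FC_def keys_J)
  }
qed

text \<open>\<open>nat (p + 1)\<close> turns the weak integer bound into the strict one of
  \<open>FC\<close>; for negative p only zero is left on both sides.\<close>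

lemma hoch_F_iff: "x \<in> hoch_F G deg p n \<longleftrightarrow> x \<in> hspan \<and> J x \<in> FC {k. int k = n} (nat (p + 1))"
proof -
  define A where "A ms \<longleftrightarrow> int (int_deg deg ms) \<le> p \<and> int (int_deg deg ms + length (tl ms)) = n" for ms
  define B where "B ms \<longleftrightarrow> pdg (hd ms, tl ms) < nat (p + 1) \<and> pdg (hd ms, tl ms) + qdg (hd ms, tl ms) \<in> {k. int k = n}" for ms
  have "A ms \<longleftrightarrow> B ms" if "ms \<in> hoch_basis G deg" for ms
    using that hoch_basis_Cons(2) unfolding A_def B_def by (cases ms) (auto simp: pdg_def qdg_def int_deg_def wdg_def)
  then have "{ms \<in> hoch_basis G deg. A ms} = {ms \<in> hoch_basis G deg. B ms}" by blast
  then have "x \<in> hoch_F G deg p n \<longleftrightarrow> x \<in> hspan \<and> (\<forall>ms\<in>keys x. B ms)"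
    unfolding hoch_F_def A_def[symmetric] span_on_def mem_Collect_eq by (simp only: subset_Collect)
  then show ?thesis unfolding B_def by (simp only: J_FC cong: conj_cong)
qed

lemma hoch_C_F: "hoch_C G deg p q \<subseteq> hoch_F G deg p (p + q)"
  by (auto simp: hoch_C_def hoch_F_def span_on_def)

lemma FC_empty: "x \<in> FC N p \<Longrightarrow> N = {} \<or> p = 0 \<Longrightarrow> x = 0"
proof -
  assume "x \<in> FC N p" "N = {} \<or> p = 0"
  then have "\<And>c. c \<notin> keys x" by (auto simp: FC_def)
  then have "keys x = {}" by blast
  then show "x = 0" by (simp only: keys_eq_empty)
qed

lemma hochschild_degenerates: "ss_degenerates_at (hoch_C G deg) (hoch_F G deg) (hoch_D deg bd) 2"
proof (rule ss_degenerates_at_2I)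
  let ?F = "hoch_F G deg :: int \<Rightarrow> int \<Rightarrow> ('v, 'k) hoch set" and ?C = "hoch_C G deg :: int \<Rightarrow> int \<Rightarrow> ('v, 'k) hoch set"
  show "0 \<in> ?F p n" for p n by (simp add: hoch_F_def span_on_def)
  show Fd: "x - y \<in> ?F p n" if "x \<in> ?F p n" "y \<in> ?F p n" for p n x y
    using that hspan_closed(3) FC_closed(2) by (simp add: hoch_F_iff)
  show "0 \<in> ?C p q" for p q by (simp add: hoch_C_def span_on_def)
  show "x - y \<in> ?C p q" if "x \<in> ?C p q" "y \<in> ?C p q" for p q x y
    using that keys_diffD[of _ x y] unfolding hoch_C_def span_on_def by blast
  show mono: "?F p n \<subseteq> ?F p' n" if "p \<le> p'" for p p' n
    using that by (auto simp: hoch_F_def span_on_def)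
  show "hoch_D deg bd (x - y) = hoch_D deg bd x - hoch_D deg bd y" for x y
    by (rule hoch_D_simps)
  show "hoch_D deg bd (hoch_D deg bd x) = 0" if "x \<in> ?F p n" for p n x
    using that by (simp add: hoch_F_iff hoch_D_eq Jinv_hspan Dn_ncells J_ncells Dn_Dn)
  fix p q c y
  assume c: "c \<in> ?C p q" and y: "y \<in> ?F (p - 1) (p + q)"
  define N where "N = {k. int k = p + q}"
  have "c \<in> ?F p (p + q)" "y \<in> ?F p (p + q)"
    using subsetD[OF hoch_C_F c] subsetD[OF mono[of "p - 1" p] y] by simp_all
  then have cy: "c + y \<in> hspan" "J (c + y) \<in> FC N (nat (p + 1))"
    using hspan_closed(2) FC_closed(1) by (simp_all add: hoch_F_iff N_def)
  have zero: "c + y = 0" if "nat (p + 1) = 0 \<or> N = {}"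
  proof -
    have "J (c + y) = 0" by (rule FC_empty[OF cy(2)]) (use that in auto)
    then have "Jinv 0 = c + y" using Jinv_J_hspan[OF cy(1)] by (simp only:)
    then show ?thesis by simp
  qed
  {
    assume D: "hoch_D deg bd (c + y) \<in> ?F (p - 2) (p + q - 1)"
    show "\<exists>y'\<in>?F (p - 1) (p + q). hoch_D deg bd (c + y') = 0"
    \<comment> \<open>\<open>permanent_cycle\<close> speaks of natural levels; in a negative column
      everything is zero.\<close>
    proof (cases "p < 0")
      case True
      then have "c + y = 0" by (intro zero) simp
      then show ?thesis using y hoch_D_simps(3) by (intro bexI[of _ y]) simp_all
    next
      case False
      then have P: "nat (p + 1) = Suc (nat p)" by simp
      have "Suc (pdg z) < nat p" if "z \<in> keys (Dn (J (c + y)))" for z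
        using D that J_hoch_D[OF cy(1)] by (auto simp: hoch_F_iff FC_def)
      then obtain z where z: "z \<in> FC N (nat p)" "Dn (J (c + y) + z) = 0"
        using permanent_cycle[OF cy(2)[unfolded P]] by blast
      have zC: "Jinv z \<in> hspan" using Jinv_hspan FC_closed(5)[OF z(1)] .
      have "c + (y + Jinv z) \<in> hspan" using hspan_closed(2)[OF cy(1) zC] by (simp add: add.assoc)
      moreover have "J (c + (y + Jinv z)) = J (c + y) + z" by (simp add: add.assoc)
      ultimately have "hoch_D deg bd (c + (y + Jinv z)) = 0" by (simp only: hoch_D_eq z(2) J_simps(3) klinearD(3)[OF klinear_J(3)[OF klinear_rules(1)]])
      moreover have "y + Jinv z \<in> ?F (p - 1) (p + q)"
        using y z(1) zC hspan_closed(2) FC_closed(1) by (simp add: hoch_F_iff N_def)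
      ultimately show ?thesis by blast
    qed
  next
    fix r w assume w: "w \<in> ?F r (p + q + 1)" and e: "hoch_D deg bd w = c + y"
    show "\<exists>w'\<in>?F (p + 1) (p + q + 1). hoch_D deg bd w' = c + y"
    proof (cases "p < 0 \<or> p + q < 0")
      case True
      then have "c + y = 0" by (intro zero) (auto simp: N_def)
      then show ?thesis using hoch_D_simps(3) by (intro bexI[of _ 0]) (simp_all add: hoch_F_def span_on_def)
    next
      case False
      then have P: "nat (p + 1) = Suc (nat p)" "nat (p + 1 + 1) = Suc (Suc (nat p))" by linarith+
      \<comment> \<open>Here p + q must not be negative: otherwise total degree 0 would need a
        predecessor in \<open>N\<close>.\<close>
      have "k \<in> Suc ` N" if "int k = p + q + 1" for k
        using that False by (cases k) (auto simp: N_def)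
      then have N: "{k. int k = p + q + 1} = Suc ` N" by (auto simp: N_def)
      have w': "w \<in> hspan" "J w \<in> FC (Suc ` N) (nat (r + 1))" using w by (simp_all add: hoch_F_iff N)
      have "Dn (J w) = J (c + y)" using J_hoch_D[OF w'(1)] e by simp
      then obtain z where z: "z \<in> FC (Suc ` N) (Suc (Suc (nat p)))" "Dn z = J (c + y)"
        using boundary_degree[OF cy(2)[unfolded P] w'(2)] by blast
      have zC: "Jinv z \<in> hspan" using Jinv_hspan FC_closed(5)[OF z(1)] .
      then have "hoch_D deg bd (Jinv z) = c + y" using z(2) Jinv_J_hspan[OF cy(1)] by (simp only: hoch_D_eq J_Jinv)
      moreover have "Jinv z \<in> ?F (p + 1) (p + q + 1)" using zC z(1) by (simp only: hoch_F_iff N P J_Jinv simp_thms)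
      ultimately show ?thesis by blast
    qed
  }
qed

end

section \<open>Isomorphisms of homology algebras\<close>

text \<open>The conditions on products are those that make multiplication of classes well defined.
  They are stated for cycles and boundaries instead of a Leibniz rule, so inhomogeneous elements
  need no signs.\<close>

locale diff_algebra =
  fixes A :: "('k::comm_ring_1, 'a::ab_group_add) graded_algebra" and D :: "'a \<Rightarrow> 'a"
  assumes add_eq [simp]: "ring.add A = (+)" and zero_eq [simp]: "ring.zero A = 0"
    and zero_mem [simp]: "0 \<in> carrier A" and diff_mem: "x \<in> carrier A \<Longrightarrow> y \<in> carrier A \<Longrightarrow> x - y \<in> carrier A"
    and D_mem: "x \<in> carrier A \<Longrightarrow> D x \<in> carrier A"
    and D_diff: "x \<in> carrier A \<Longrightarrow> y \<in> carrier A \<Longrightarrow> D (x - y) = D x - D y"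
    and DD: "x \<in> carrier A \<Longrightarrow> D (D x) = 0"
    and mult_cycles: "x \<in> carrier A \<Longrightarrow> y \<in> carrier A \<Longrightarrow> D x = 0 \<Longrightarrow> D y = 0 \<Longrightarrow>
      x \<otimes>\<^bsub>A\<^esub> y \<in> carrier A \<and> D (x \<otimes>\<^bsub>A\<^esub> y) = 0"
    and mult_boundary: "x \<in> carrier A \<Longrightarrow> y \<in> carrier A \<Longrightarrow> D x = 0 \<Longrightarrow> D y = 0 \<Longrightarrow> b \<in> carrier A \<Longrightarrow>
      (D b + x) \<otimes>\<^bsub>A\<^esub> y - x \<otimes>\<^bsub>A\<^esub> y \<in> D ` carrier A \<and> x \<otimes>\<^bsub>A\<^esub> (D b + y) - x \<otimes>\<^bsub>A\<^esub> y \<in> D ` carrier A"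
    and one_cycle: "\<one>\<^bsub>A\<^esub> \<in> carrier A \<and> D (\<one>\<^bsub>A\<^esub>) = 0"
    and smult_mem: "x \<in> carrier A \<Longrightarrow> c \<odot>\<^bsub>A\<^esub> x \<in> carrier A"
    and D_smult: "x \<in> carrier A \<Longrightarrow> D (c \<odot>\<^bsub>A\<^esub> x) = c \<odot>\<^bsub>A\<^esub> D x"
    and smult_add: "x \<in> carrier A \<Longrightarrow> y \<in> carrier A \<Longrightarrow> c \<odot>\<^bsub>A\<^esub> (x + y) = c \<odot>\<^bsub>A\<^esub> x + c \<odot>\<^bsub>A\<^esub> y"
    and hpart_mem: "hpart A n \<subseteq> carrier A"
begin

definition cyc :: "'a set" where "cyc = {x \<in> carrier A. D x = 0}"
definition bnd :: "'a set" where "bnd = D ` carrier A"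
definition cl :: "'a \<Rightarrow> 'a set" where "cl x = (\<lambda>b. b + x) ` bnd"

lemma D_0: "D 0 = 0" using D_diff[of 0 0] by simp

lemma add_mem: "x \<in> carrier A \<Longrightarrow> y \<in> carrier A \<Longrightarrow> x + y \<in> carrier A"
  using diff_mem[of x "0 - y"] diff_mem[of 0 y] by simp

lemma D_add: "x \<in> carrier A \<Longrightarrow> y \<in> carrier A \<Longrightarrow> D (x + y) = D x + D y"
  using D_diff[of x "0 - y"] D_diff[of 0 y] diff_mem[of 0 y] by (simp add: D_0)

lemma bnd_closed: "0 \<in> bnd" "x \<in> bnd \<Longrightarrow> y \<in> bnd \<Longrightarrow> x - y \<in> bnd" "x \<in> bnd \<Longrightarrow> y \<in> bnd \<Longrightarrow> x + y \<in> bnd"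
proof -
  show 0: "0 \<in> bnd" unfolding bnd_def using D_0 zero_mem by force
  show d: "x - y \<in> bnd" if "x \<in> bnd" "y \<in> bnd" for x y
    using that D_diff diff_mem unfolding bnd_def by (metis (no_types, lifting) imageE imageI)
  show "x + y \<in> bnd" if "x \<in> bnd" "y \<in> bnd"
    using d[OF that(1) d[OF 0 that(2)]] by simp
qed

lemma bnd_cyc: "bnd \<subseteq> cyc"
  using D_mem DD by (auto simp: bnd_def cyc_def)

lemma cyc_closed: "x \<in> cyc \<Longrightarrow> y \<in> cyc \<Longrightarrow> x + y \<in> cyc" "x \<in> cyc \<Longrightarrow> y \<in> cyc \<Longrightarrow> x - y \<in> cyc"
  by (simp_all add: cyc_def add_mem D_add diff_mem D_diff)

lemma mem_cl: "y \<in> cl x \<longleftrightarrow> y - x \<in> bnd"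
  unfolding cl_def by (metis (no_types, lifting) add_diff_cancel_right' diff_add_cancel imageE imageI)

lemma cl_eq: "x - y \<in> bnd \<Longrightarrow> cl x = cl y"
proof -
  assume xy: "x - y \<in> bnd"
  have "z - x \<in> bnd \<longleftrightarrow> z - y \<in> bnd" for z
    using bnd_closed(2)[OF _ xy, of "z - y"] bnd_closed(3)[OF _ xy, of "z - x"] by auto
  then show ?thesis by (auto simp: mem_cl)
qed

lemma cl_self: "x \<in> cl x"
  by (simp add: mem_cl bnd_closed)

lemma cl_cyc: "x \<in> cyc \<Longrightarrow> y \<in> cl x \<Longrightarrow> y \<in> cyc"
  using cyc_closed(1)[of x "y - x"] bnd_cyc by (auto simp: mem_cl)

lemma coset: "(D ` carrier A) +>\<^bsub>A\<lparr>carrier := Z\<rparr>\<^esub> x = cl x"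
  by (auto simp: a_r_coset_def r_coset_def cl_def bnd_def)

lemma cl_mult: 
  assumes "x \<in> cyc" "y \<in> cyc" "a \<in> cl x" "b \<in> cl y"
  shows "cl (a \<otimes>\<^bsub>A\<^esub> b) = cl (x \<otimes>\<^bsub>A\<^esub> y)"
proof -
  have m: "a \<in> cyc" using cl_cyc assms by blast
  obtain u v where u: "u \<in> carrier A" "a = D u + x" and v: "v \<in> carrier A" "b = D v + y"
    using assms(3,4) by (auto simp: cl_def bnd_def)
  have "a \<otimes>\<^bsub>A\<^esub> b - a \<otimes>\<^bsub>A\<^esub> y \<in> bnd" "a \<otimes>\<^bsub>A\<^esub> y - x \<otimes>\<^bsub>A\<^esub> y \<in> bnd"
    using mult_boundary[of a y v] mult_boundary[of x y u] m assms(1,2) u v by (simp_all add: cyc_def bnd_def)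
  then have "cl (a \<otimes>\<^bsub>A\<^esub> b) = cl (a \<otimes>\<^bsub>A\<^esub> y)" "cl (a \<otimes>\<^bsub>A\<^esub> y) = cl (x \<otimes>\<^bsub>A\<^esub> y)" by (simp_all add: cl_eq)
  then show ?thesis by simp
qed

lemma cl_smult: "x \<in> cyc \<Longrightarrow> a \<in> cl x \<Longrightarrow> cl (c \<odot>\<^bsub>A\<^esub> a) = cl (c \<odot>\<^bsub>A\<^esub> x)"
proof -
  assume x: "x \<in> cyc" "a \<in> cl x"
  then obtain u where u: "u \<in> carrier A" "a = D u + x" by (auto simp: cl_def bnd_def)
  have "c \<odot>\<^bsub>A\<^esub> a - c \<odot>\<^bsub>A\<^esub> x = D (c \<odot>\<^bsub>A\<^esub> u)"
    using u x(1) by (simp add: smult_add D_mem D_smult cyc_def)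
  then show ?thesis by (intro cl_eq) (use u smult_mem in \<open>auto simp: bnd_def\<close>)
qed

lemma homology_simps:
  shows "carrier (homology A D) = cl ` cyc"
    and "x \<in> cyc \<Longrightarrow> y \<in> cyc \<Longrightarrow> cl x \<otimes>\<^bsub>homology A D\<^esub> cl y = cl (x \<otimes>\<^bsub>A\<^esub> y)"
    and "cl x \<oplus>\<^bsub>homology A D\<^esub> cl y = cl (x + y)"
    and "\<one>\<^bsub>homology A D\<^esub> = cl (\<one>\<^bsub>A\<^esub>)"
    and "x \<in> cyc \<Longrightarrow> c \<odot>\<^bsub>homology A D\<^esub> cl x = cl (c \<odot>\<^bsub>A\<^esub> x)"
    and "hpart (homology A D) n = cl ` (hpart A n \<inter> cyc)"
proof -
  show "carrier (homology A D) = cl ` cyc"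
    by (auto simp: homology_def Let_def FactRing_def A_RCOSETS_def RCOSETS_def cyc_def cl_def r_coset_def bnd_def)
  show "\<one>\<^bsub>homology A D\<^esub> = cl (\<one>\<^bsub>A\<^esub>)"
    by (simp add: homology_def Let_def FactRing_def coset)
  show "hpart (homology A D) n = cl ` (hpart A n \<inter> cyc)"
    by (simp add: homology_def Let_def coset cyc_def)
  show "cl x \<otimes>\<^bsub>homology A D\<^esub> cl y = cl (x \<otimes>\<^bsub>A\<^esub> y)" if "x \<in> cyc" "y \<in> cyc"
  proof -
    have "cl x \<otimes>\<^bsub>homology A D\<^esub> cl y = (\<Union>a\<in>cl x. \<Union>b\<in>cl y. cl (a \<otimes>\<^bsub>A\<^esub> b))"
      by (simp add: homology_def Let_def FactRing_def rcoset_mult_def coset)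
    also have "\<dots> = (\<Union>a\<in>cl x. \<Union>b\<in>cl y. cl (x \<otimes>\<^bsub>A\<^esub> y))" using cl_mult[OF that] by simp
    finally show ?thesis using cl_self by blast
  qed
  show "c \<odot>\<^bsub>homology A D\<^esub> cl x = cl (c \<odot>\<^bsub>A\<^esub> x)" if "x \<in> cyc"
  proof -
    have "c \<odot>\<^bsub>homology A D\<^esub> cl x = (\<Union>a\<in>cl x. cl (c \<odot>\<^bsub>A\<^esub> a))"
      by (simp add: homology_def Let_def coset)
    also have "\<dots> = (\<Union>a\<in>cl x. cl (c \<odot>\<^bsub>A\<^esub> x))" using cl_smult[OF that] by simp
    finally show ?thesis using cl_self by blast
  qed
  have "cl x \<oplus>\<^bsub>homology A D\<^esub> cl y = {a + b | a b. a \<in> cl x \<and> b \<in> cl y}"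
    by (auto simp: homology_def Let_def FactRing_def set_add_def set_mult_def)
  also have "\<dots> = cl (x + y)"
  proof
    show "{a + b | a b. a \<in> cl x \<and> b \<in> cl y} \<subseteq> cl (x + y)"
    proof
      fix z assume "z \<in> {a + b | a b. a \<in> cl x \<and> b \<in> cl y}"
      then obtain a b where "z = a + b" "a - x \<in> bnd" "b - y \<in> bnd" by (auto simp: mem_cl)
      moreover have "z - (x + y) = (a - x) + (b - y)" using \<open>z = a + b\<close> by simp
      ultimately show "z \<in> cl (x + y)" by (simp only: mem_cl bnd_closed)
    qed
    show "cl (x + y) \<subseteq> {a + b | a b. a \<in> cl x \<and> b \<in> cl y}"
    proof
      fix z assume "z \<in> cl (x + y)"
      then have "z - y \<in> cl x" by (simp add: mem_cl algebra_simps)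
      moreover have "z = (z - y) + y" by simp
      ultimately show "z \<in> {a + b | a b. a \<in> cl x \<and> b \<in> cl y}" using cl_self by blast
    qed
  qed
  finally show "cl x \<oplus>\<^bsub>homology A D\<^esub> cl y = cl (x + y)" .
qed

end

text \<open>The isomorphism runs against \<open>E\<close>: a class of \<open>A\<close> goes to the
  set of cycles of \<open>B\<close> whose images lie in it. This set is a coset, so no
  representatives have to be chosen.\<close>

lemma homology_isomorphic:
  fixes A :: "('k::comm_ring_1, 'a::ab_group_add) graded_algebra" and B :: "('k, 'b::ab_group_add) graded_algebra"
  assumes A: "diff_algebra A D" and B: "diff_algebra B D'"
    and E: "\<And>w. w \<in> carrier B \<Longrightarrow> E w \<in> carrier A" "\<And>w. w \<in> carrier B \<Longrightarrow> D (E w) = E (D' w)"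
      "\<And>v w. v \<in> carrier B \<Longrightarrow> w \<in> carrier B \<Longrightarrow> E (v - w) = E v - E w"
      "\<And>v w. v \<in> carrier B \<Longrightarrow> w \<in> carrier B \<Longrightarrow> E (v \<otimes>\<^bsub>B\<^esub> w) = E v \<otimes>\<^bsub>A\<^esub> E w"
      "E (\<one>\<^bsub>B\<^esub>) = \<one>\<^bsub>A\<^esub>" "\<And>c w. w \<in> carrier B \<Longrightarrow> E (c \<odot>\<^bsub>B\<^esub> w) = c \<odot>\<^bsub>A\<^esub> E w"
      "\<And>n w. w \<in> hpart B n \<Longrightarrow> E w \<in> hpart A n"
    and surj: "\<And>x. x \<in> carrier A \<Longrightarrow> D x = 0 \<Longrightarrow> \<exists>w\<in>carrier B. D' w = 0 \<and> x - E w \<in> D ` carrier A"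
    and surj_hpart: "\<And>n x. x \<in> hpart A n \<Longrightarrow> D x = 0 \<Longrightarrow> \<exists>w\<in>hpart B n. D' w = 0 \<and> x - E w \<in> D ` carrier A"
    and inj: "\<And>w. w \<in> carrier B \<Longrightarrow> D' w = 0 \<Longrightarrow> E w \<in> D ` carrier A \<Longrightarrow> w \<in> D' ` carrier B"
  shows "graded_algebra_isomorphic (homology A D) (homology B D')"
proof -
  interpret A: diff_algebra A D by (rule A)
  interpret B: diff_algebra B D' by (rule B)
  define h where "h X = {w \<in> B.cyc. E w \<in> X}" for X
  have Ecyc: "E w \<in> A.cyc" if "w \<in> B.cyc" for w
    using that E(1,2)[of w] E(3)[of 0 0] by (simp add: A.cyc_def B.cyc_def)
  have Ebnd: "E w \<in> A.bnd \<longleftrightarrow> w \<in> B.bnd" if "w \<in> B.cyc" for w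
  proof
    show "E w \<in> A.bnd \<Longrightarrow> w \<in> B.bnd" using that inj by (simp add: A.bnd_def B.bnd_def B.cyc_def)
    assume "w \<in> B.bnd"
    then obtain u where u: "u \<in> carrier B" "w = D' u" by (auto simp: B.bnd_def)
    have "E w = D (E u)" unfolding u(2) using E(2)[OF u(1)] by simp
    then show "E w \<in> A.bnd" unfolding A.bnd_def using E(1)[OF u(1)] by blast
  qed
  have h: "h (A.cl (E w)) = B.cl w" if w: "w \<in> B.cyc" for w
  proof -
    have "v \<in> h (A.cl (E w)) \<longleftrightarrow> v \<in> B.cl w" for v
    proof (cases "v \<in> B.cyc")
      case True
      then have "E v - E w = E (v - w)" using w E(3) by (simp add: B.cyc_def)
      then show ?thesis using True Ebnd[OF B.cyc_closed(2)[OF True w]] by (simp add: h_def A.mem_cl B.mem_cl)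
    next
      case False
      then show ?thesis using B.cl_cyc[OF w] by (auto simp: h_def)
    qed
    then show ?thesis by blast
  qed
  have car: "carrier (homology A D) = (\<lambda>w. A.cl (E w)) ` B.cyc"
  proof
    show "(\<lambda>w. A.cl (E w)) ` B.cyc \<subseteq> carrier (homology A D)" using Ecyc by (auto simp: A.homology_simps)
    show "carrier (homology A D) \<subseteq> (\<lambda>w. A.cl (E w)) ` B.cyc"
    proof
      fix X assume "X \<in> carrier (homology A D)"
      then obtain x where x: "x \<in> A.cyc" "X = A.cl x" by (auto simp: A.homology_simps)
      then obtain w where "w \<in> B.cyc" "x - E w \<in> A.bnd" using surj by (force simp: A.cyc_def B.cyc_def A.bnd_def)
      then show "X \<in> (\<lambda>w. A.cl (E w)) ` B.cyc" using A.cl_eq x(2) by blast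
    qed
  qed
  have Eadd: "E (v + w) = E v + E w" if "v \<in> carrier B" "w \<in> carrier B" for v w
    using E(3)[of v "0 - w"] E(3)[of 0 w] E(3)[of 0 0] that B.diff_mem[of 0 w] by simp
  have mul: "v \<otimes>\<^bsub>B\<^esub> w \<in> B.cyc" if "v \<in> B.cyc" "w \<in> B.cyc" for v w
    using that B.mult_cycles by (simp add: B.cyc_def)
  have smul: "c \<odot>\<^bsub>B\<^esub> w \<in> B.cyc" if "w \<in> B.cyc" for c w
  proof -
    have "c \<odot>\<^bsub>B\<^esub> (0 + 0) = c \<odot>\<^bsub>B\<^esub> 0 + c \<odot>\<^bsub>B\<^esub> 0" by (rule B.smult_add) simp_all
    then have "c \<odot>\<^bsub>B\<^esub> 0 = 0" by simp
    then show ?thesis using that by (simp add: B.cyc_def B.smult_mem B.D_smult)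
  qed
  have one: "\<one>\<^bsub>B\<^esub> \<in> B.cyc" using B.one_cycle by (simp add: B.cyc_def)
  have cB: "w \<in> carrier B" if "w \<in> B.cyc" for w using that by (simp add: B.cyc_def)
  have "h \<in> ring_hom (homology A D) (homology B D')"
  proof (rule ring_hom_memI)
    show "h X \<in> carrier (homology B D')" if "X \<in> carrier (homology A D)" for X
      using that h by (auto simp: car B.homology_simps)
    fix X Y assume "X \<in> carrier (homology A D)" "Y \<in> carrier (homology A D)"
    then obtain v w where v: "v \<in> B.cyc" "X = A.cl (E v)" and w: "w \<in> B.cyc" "Y = A.cl (E w)" by (auto simp: car)
    have "X \<otimes>\<^bsub>homology A D\<^esub> Y = A.cl (E (v \<otimes>\<^bsub>B\<^esub> w))"
      using v w Ecyc cB by (simp add: A.homology_simps E(4))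
    then show "h (X \<otimes>\<^bsub>homology A D\<^esub> Y) = h X \<otimes>\<^bsub>homology B D'\<^esub> h Y"
      using v w h mul by (simp add: B.homology_simps)
    have "X \<oplus>\<^bsub>homology A D\<^esub> Y = A.cl (E (v + w))"
      using v w cB by (simp add: A.homology_simps Eadd)
    then show "h (X \<oplus>\<^bsub>homology A D\<^esub> Y) = h X \<oplus>\<^bsub>homology B D'\<^esub> h Y"
      using v w h B.cyc_closed(1) by (simp add: B.homology_simps)
  next
    show "h \<one>\<^bsub>homology A D\<^esub> = \<one>\<^bsub>homology B D'\<^esub>"
      using h[OF one] by (simp add: A.homology_simps B.homology_simps E(5))
  qed
  moreover have "bij_betw h (carrier (homology A D)) (carrier (homology B D'))"
  proof (rule bij_betw_imageI)
    show "inj_on h (carrier (homology A D))"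
    proof (rule inj_onI)
      fix X Y assume XY: "X \<in> carrier (homology A D)" "Y \<in> carrier (homology A D)" "h X = h Y"
      then obtain v w where v: "v \<in> B.cyc" "X = A.cl (E v)" and w: "w \<in> B.cyc" "Y = A.cl (E w)" by (auto simp: car)
      have "v \<in> B.cl w" using XY(3) v w h B.cl_self[of v] by simp
      then have "E (v - w) \<in> A.bnd" using Ebnd[OF B.cyc_closed(2)[OF v(1) w(1)]] by (simp add: B.mem_cl)
      then show "X = Y" using A.cl_eq v w E(3) cB by simp
    qed
    show "h ` carrier (homology A D) = carrier (homology B D')"
      using h unfolding car B.homology_simps image_image by (simp cong: image_cong)
  qed
  ultimately have iso: "h \<in> ring_iso (homology A D) (homology B D')" by (simp add: ring_iso_def)
  have "h (c \<odot>\<^bsub>homology A D\<^esub> X) = c \<odot>\<^bsub>homology B D'\<^esub> h X" if X: "X \<in> carrier (homology A D)" for c X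
  proof -
    obtain v where v: "v \<in> B.cyc" "X = A.cl (E v)" using X by (auto simp: car)
    have "c \<odot>\<^bsub>homology A D\<^esub> X = A.cl (E (c \<odot>\<^bsub>B\<^esub> v))" using v Ecyc cB by (simp add: A.homology_simps E(6))
    then show ?thesis using h v smul by (simp add: B.homology_simps)
  qed
  moreover have "h ` hpart (homology A D) n = hpart (homology B D') n" for n
  proof -
    have "hpart (homology A D) n = (\<lambda>w. A.cl (E w)) ` (hpart B n \<inter> B.cyc)"
    proof
      show "(\<lambda>w. A.cl (E w)) ` (hpart B n \<inter> B.cyc) \<subseteq> hpart (homology A D) n"
        using E(7) Ecyc by (auto simp: A.homology_simps)
      show "hpart (homology A D) n \<subseteq> (\<lambda>w. A.cl (E w)) ` (hpart B n \<inter> B.cyc)"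
      proof
        fix X assume "X \<in> hpart (homology A D) n"
        then obtain x where x: "x \<in> hpart A n" "x \<in> A.cyc" "X = A.cl x" by (auto simp: A.homology_simps)
        then obtain w where w: "w \<in> hpart B n" "D' w = 0" "x - E w \<in> A.bnd"
          using surj_hpart by (force simp: A.cyc_def A.bnd_def)
        then have "w \<in> hpart B n \<inter> B.cyc" using B.hpart_mem by (auto simp: B.cyc_def)
        then show "X \<in> (\<lambda>w. A.cl (E w)) ` (hpart B n \<inter> B.cyc)" using A.cl_eq[OF w(3)] x(3) by blast
      qed
    qed
    moreover have "(\<lambda>w. h (A.cl (E w))) ` (hpart B n \<inter> B.cyc) = B.cl ` (hpart B n \<inter> B.cyc)"
      by (rule image_cong) (simp_all add: h)
    ultimately show ?thesis by (simp add: B.homology_simps image_image)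
  qed
  ultimately show ?thesis using iso unfolding graded_algebra_isomorphic_def by blast
qed

context low_degree
begin

section \<open>The comparison map on homology\<close>

text \<open>Twisting by the signs of the total degree turns the Leibniz rule into an identity for inhomogeneous elements.\<close>

definition sign_involution :: "('v mono \<times> 'v mono list \<Rightarrow>\<^sub>0 'k) \<Rightarrow> ('v mono \<times> 'v mono list \<Rightarrow>\<^sub>0 'k)"
  where "sign_involution = lin_ext (\<lambda>c. sgs (pdg c + qdg c) (basis c))"

lemma klinear_sign_involution [simp]: "klinear f \<Longrightarrow> klinear (\<lambda>x. sign_involution (f x))"
  by (simp add: sign_involution_def)

lemma sign_involution_basis: "sign_involution (basis c) = sgs (pdg c + qdg c) (basis c)"
  by (simp add: sign_involution_def)

lemma sign_involution_twice: "sign_involution (sign_involution x) = x"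
  by (rule klinear_eq[of "\<lambda>x. sign_involution (sign_involution x)" "\<lambda>x. x"])
    (simp_all add: sign_involution_basis klinearD(6)[OF klinear_sign_involution[OF klinear_rules(1)]], simp add: sgs_def)

lemma sign_involution_ncells: "keys x \<subseteq> ncells \<Longrightarrow> keys (sign_involution x) \<subseteq> ncells"
  using keys_lin_extD[of _ _ x] unfolding sign_involution_def by (fastforce simp: sgs_def split: if_splits)

lemma sign_involution_Dn:
  assumes "keys x \<subseteq> ncells"
  shows "sign_involution (Dn x) = - Dn (sign_involution x)"
proof (rule klinear_eq_on[of "\<lambda>x. sign_involution (Dn x)" "\<lambda>x. - Dn (sign_involution x)"])
  fix m assume "m \<in> keys x"
  then have m: "keys (basis m :: _ \<Rightarrow>\<^sub>0 'k) \<subseteq> ncells" using assms by auto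
  have "sign_involution (Dn (basis m)) = - sgs (pdg m + qdg m) (Dn (basis m))"
  proof (rule klinear_eq_on[of sign_involution "\<lambda>z. - sgs (pdg m + qdg m) z"])
    fix y assume "y \<in> keys (Dn (basis m))"
    then have "Suc (pdg y + qdg y) = pdg m + qdg m" using Dn_degree(2)[OF _ m] by fastforce
    then show "sign_involution (basis y) = - sgs (pdg m + qdg m) (basis y)"
      by (simp add: sign_involution_basis sgs_Suc_eq flip: \<open>Suc _ = _\<close>)
  qed simp_all
  then show "sign_involution (Dn (basis m)) = - Dn (sign_involution (basis m))"
    by (simp add: sign_involution_basis)
qed simp_all

lemma Dn_um:
  assumes "keys x \<subseteq> ncells" "keys y \<subseteq> ncells"
  shows "Dn (um x y) = um (Dn x) y + um (sign_involution x) (Dn y)"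
proof (rule klinear_eq_on[of "\<lambda>x. Dn (um x y)" "\<lambda>x. um (Dn x) y + um (sign_involution x) (Dn y)"])
  fix m assume "m \<in> keys x"
  then have m: "keys (basis m :: _ \<Rightarrow>\<^sub>0 'k) \<subseteq> ncells" using assms by auto
  have "U.T.hg (pdg m + qdg m) (basis m)" by (simp add: U.T.hg_def tdg_pdg)
  then show "Dn (um (basis m) y) = um (Dn (basis m)) y + um (sign_involution (basis m)) (Dn y)"
    using Dn_mul[OF _ m assms(2)] by (simp add: sign_involution_basis)
qed simp_all

text \<open>The twist of a cycle is a cycle, and twisting twice is the identity; hence an
  inhomogeneous cycle times a boundary is the boundary of a twisted product.\<close>

lemma um_boundary:
  assumes "keys x \<subseteq> ncells" "keys b \<subseteq> ncells" "Dn x = 0"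
  shows "um (Dn b) x = Dn (um b x)" "um x (Dn b) = Dn (um (sign_involution x) b)"
proof -
  show "um (Dn b) x = Dn (um b x)" using Dn_um[OF assms(2,1)] assms(3) by simp
  have "Dn (sign_involution x) = - sign_involution (Dn x)" using sign_involution_Dn[OF assms(1)] by simp
  then show "um x (Dn b) = Dn (um (sign_involution x) b)"
    using Dn_um[OF sign_involution_ncells[OF assms(1)] assms(2)] assms(3)
    by (simp add: sign_involution_twice klinearD(3)[OF klinear_sign_involution[OF klinear_rules(1)]])
qed

lemma FC_exists: "keys x \<subseteq> ncells \<Longrightarrow> (\<And>c. c \<in> keys x \<Longrightarrow> pdg c + qdg c \<in> N) \<Longrightarrow> \<exists>p. x \<in> FC N p"
proof -
  assume x: "keys x \<subseteq> ncells" "\<And>c. c \<in> keys x \<Longrightarrow> pdg c + qdg c \<in> N"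
  obtain p where "\<forall>n\<in>pdg ` keys x. n < p" using finite_nat_set_iff_bounded[of "pdg ` keys x"] by auto
  then show ?thesis using x by (intro exI[of _ p]) (auto simp: FC_def)
qed

lemma WF_exists: "keys x \<subseteq> om \<Longrightarrow> (\<And>c. c \<in> keys x \<Longrightarrow> pw c + qw c \<in> N) \<Longrightarrow> \<exists>p. x \<in> WF N p"
proof -
  assume x: "keys x \<subseteq> om" "\<And>c. c \<in> keys x \<Longrightarrow> pw c + qw c \<in> N"
  obtain p where "\<forall>n\<in>pw ` keys x. n < p" using finite_nat_set_iff_bounded[of "pw ` keys x"] by auto
  then show ?thesis using x by (intro exI[of _ p]) (auto simp: WF_def)
qed

text \<open>Leading parts of the kernel vanish by \<open>leading_terms\<close> applied to
  \<open>x = 0\<close>. Injectivity lets identities in Omega be checked after applying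
  \<open>cmp\<close>.\<close>

lemma cmp_inj: "w \<in> WF UNIV p \<Longrightarrow> cmp w = 0 \<Longrightarrow> w = 0"
proof (induction p)
  case 0
  then have "\<And>m. m \<notin> keys w" by (auto simp: WF_def)
  then have "keys w = {}" by blast
  then show ?case by (simp only: keys_eq_empty)
next
  case (Suc p)
  have "restr (\<lambda>m. pw m = p) w = 0"
    by (rule leading_terms(2)[OF FC_closed(3) Suc(2)]) (use Suc(3) in auto)
  then show ?case using WF_restr[OF Suc(2)] Suc by blast
qed

lemma cmp_eqD: "keys v \<subseteq> om \<Longrightarrow> keys w \<subseteq> om \<Longrightarrow> cmp v = cmp w \<Longrightarrow> v = w"
proof -
  assume h: "keys v \<subseteq> om" "keys w \<subseteq> om" "cmp v = cmp w"
  have "keys (v - w) \<subseteq> om" using keys_diffD[of _ v w] h by blast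
  then obtain p where "v - w \<in> WF UNIV p" using WF_exists[of "v - w" UNIV] by auto
  moreover have "cmp (v - w) = 0" using h(3) by simp
  ultimately show "v = w" using cmp_inj[of "v - w" p] by simp
qed

text \<open>\<open>boundaries_from_\<delta>\<close> asks for positive total degrees in
  \<open>z\<close>; the part of total degree 0 has zero differential and is dropped.\<close>

lemma cmp_boundaryD:
  assumes "keys z \<subseteq> ncells" "keys w \<subseteq> om" "cmp w = Dn z"
  shows "\<exists>u. keys u \<subseteq> om \<and> w = \<delta> u"
proof -
  let ?P = "\<lambda>c. pdg c + qdg c \<in> Suc ` UNIV"
  have r: "keys (restr ?P z) \<subseteq> ncells" "keys (z - restr ?P z) \<subseteq> ncells" using assms(1) by (auto simp: keys_restr)
  have "y \<notin> keys (Dn (z - restr ?P z))" for y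
  proof
    assume "y \<in> keys (Dn (z - restr ?P z))"
    then obtain m where m: "m \<in> keys (z - restr ?P z)" "Suc (pdg y + qdg y) = pdg m + qdg m" using Dn_degree(2)[OF _ r(2)] by blast
    have "?P m" unfolding m(2)[symmetric] by (rule imageI) simp
    then show False using m(1) by (simp add: keys_restr)
  qed
  then have "keys (Dn (z - restr ?P z)) = {}" by blast
  then have "Dn (z - restr ?P z) = 0" by (simp only: keys_eq_empty)
  then have D: "cmp w = Dn (restr ?P z)" using assms(3) by simp
  have "?P c" if "c \<in> keys (restr ?P z)" for c using that unfolding keys_restr by blast
  then obtain p where p: "restr ?P z \<in> FC (Suc ` UNIV) p" using FC_exists[OF r(1)] by blast
  obtain p' where p': "w \<in> WF UNIV p'" using WF_exists[OF assms(2), of UNIV] by auto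
  have "restr ?P z \<in> FC (Suc ` UNIV) (max p p')" "w \<in> WF UNIV (max p p')"
    using FC_closed(4)[OF p] WF_closed(4)[OF p'] by simp_all
  then obtain u where "u \<in> WF (Suc ` UNIV) (max p p')" "w = \<delta> u" using boundaries_from_\<delta>[OF _ _ D] by blast
  then show ?thesis using WF_closed(5) by blast
qed

lemma \<delta>_diff: "keys x \<subseteq> om \<Longrightarrow> keys y \<subseteq> om \<Longrightarrow> \<delta> (x - y) = \<delta> x - \<delta> y"
proof -
  assume xy: "keys x \<subseteq> om" "keys y \<subseteq> om"
  then have "keys (x - y) \<subseteq> om" using keys_diffD[of _ x y] by blast
  then show ?thesis using \<delta>_facts(2)[OF xy(1)] \<delta>_facts(2)[OF xy(2)] \<delta>_facts(2) by simp
qed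

lemma \<delta>_scal: "keys x \<subseteq> om \<Longrightarrow> \<delta> (scal c x) = scal c (\<delta> x)"
  using \<delta>_deriv by (auto simp: graded_derivation_def span_on_def om_def)

lemma omul: "keys x \<subseteq> om \<Longrightarrow> keys y \<subseteq> om \<Longrightarrow> gmult deg x y = (Om.mul deg x y :: _ \<Rightarrow>\<^sub>0 'k)"
  by (rule gmult_eq[of _ "Gen ` G \<union> DGen ` G"]) (simp_all add: span_on_def om_def)

lemma omul_om: "keys x \<subseteq> om \<Longrightarrow> keys y \<subseteq> om \<Longrightarrow> keys (Om.mul deg x y :: _ \<Rightarrow>\<^sub>0 'k) \<subseteq> om"
proof
  fix n assume h: "keys x \<subseteq> om" "keys y \<subseteq> om" and "n \<in> keys (Om.mul deg x y)"
  then have "n \<in> keys (lin_ext (\<lambda>a. lin_ext (mpr deg a) y) x)" by (simp add: bilin_ext_def)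
  from keys_lin_extD[OF this] obtain a where a: "a \<in> keys x" "n \<in> keys (lin_ext (mpr deg a) y)" by blast
  from keys_lin_extD[OF a(2)] obtain b where b: "b \<in> keys y" "n \<in> keys (mpr deg a b :: _ \<Rightarrow>\<^sub>0 'k)" by blast
  show "n \<in> om" unfolding om_def
    by (rule mpr_monos_in[OF _ _ b(2)]) (use h a(1) b(1) in \<open>auto simp flip: om_def\<close>)
qed

text \<open>All laws are transported through \<open>J\<close> and \<open>Jinv\<close> from the
  re-signed complex.\<close>

lemma diff_algebra_hoch: "diff_algebra (hoch_algebra G deg) (hoch_D deg bd)"
proof -
  let ?A = "hoch_algebra G deg :: ('k, ('v, 'k) hoch) graded_algebra"
  have A: "carrier ?A = hspan" "monoid.mult ?A = shuffle_product deg" "\<one>\<^bsub>?A\<^esub> = basis [0]" "\<zero>\<^bsub>?A\<^esub> = 0" "ring.add ?A = (+)"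
      "smult ?A = scal" "hpart ?A n \<subseteq> hspan" for n
    by (auto simp: hoch_algebra_def span_on_def)
  have D0: "Dn (J x) = 0" if "x \<in> hspan" "hoch_D deg bd x = 0" for x
    using J_hoch_D[OF that(1)] that(2) by simp
  have bd: "Jinv (Dn z) \<in> hoch_D deg bd ` hspan" if "keys z \<subseteq> ncells" for z
    using hoch_D_eq[OF Jinv_hspan[OF that]] Jinv_hspan[OF that] by (intro image_eqI[of _ _ "Jinv z"]) simp_all
  have mb: "shuffle_product deg (hoch_D deg bd b + x) y - shuffle_product deg x y \<in> hoch_D deg bd ` hspan \<and>
      shuffle_product deg x (hoch_D deg bd b + y) - shuffle_product deg x y \<in> hoch_D deg bd ` hspan"
    if h: "x \<in> hspan" "y \<in> hspan" "hoch_D deg bd x = 0" "hoch_D deg bd y = 0" "b \<in> hspan" for x y b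
  proof
    have "shuffle_product deg (hoch_D deg bd b + x) y - shuffle_product deg x y = shuffle_product deg (hoch_D deg bd b) y"
      using klinearD(1)[of "\<lambda>x. shuffle_product deg x y" "hoch_D deg bd b" x] by simp
    also have "\<dots> = Jinv (Dn (um (J b) (J y)))"
      using h by (simp add: shuffle_product_eq hoch_D_hspan J_hoch_D um_boundary(1) J_ncells D0)
    finally show "shuffle_product deg (hoch_D deg bd b + x) y - shuffle_product deg x y \<in> hoch_D deg bd ` hspan"
      using bd[OF keys_um_ncells[OF J_ncells[OF h(5)] J_ncells[OF h(2)]]] by simp
    have "shuffle_product deg x (hoch_D deg bd b + y) - shuffle_product deg x y = shuffle_product deg x (hoch_D deg bd b)"
      using klinearD(1)[OF klinear_shuffle_product(2)[OF klinear_rules(1)], where x = "hoch_D deg bd b" and y = y] by simp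
    also have "\<dots> = Jinv (Dn (um (sign_involution (J x)) (J b)))"
      using h by (simp add: shuffle_product_eq hoch_D_hspan J_hoch_D um_boundary(2) J_ncells D0)
    finally show "shuffle_product deg x (hoch_D deg bd b + y) - shuffle_product deg x y \<in> hoch_D deg bd ` hspan"
      using bd[OF keys_um_ncells[OF sign_involution_ncells[OF J_ncells[OF h(1)]] J_ncells[OF h(5)]]] by simp
  qed
  have mc: "shuffle_product deg x y \<in> hspan \<and> hoch_D deg bd (shuffle_product deg x y) = 0"
    if h: "x \<in> hspan" "y \<in> hspan" "hoch_D deg bd x = 0" "hoch_D deg bd y = 0" for x y
  proof -
    have k: "keys (um (J x) (J y)) \<subseteq> ncells" using keys_um_ncells J_ncells h by blast
    have "Dn (um (J x) (J y)) = 0" using Dn_um[OF J_ncells[OF h(1)] J_ncells[OF h(2)]] D0 h by simp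
    then show ?thesis using h k by (simp add: shuffle_product_eq Jinv_hspan hoch_D_eq)
  qed
  have one: "basis [0] \<in> hspan" by (simp add: span_on_def hoch_basis_def)
  have "J (basis [0]) = one_u" by (simp add: J_basis one_u_def)
  then have one': "hoch_D deg bd (basis [0]) = 0" using hoch_D_eq[OF one] by simp
  have DD: "hoch_D deg bd (hoch_D deg bd x) = 0" if "x \<in> hspan" for x
    using that by (simp add: hoch_D_eq Jinv_hspan J_ncells Dn_ncells Dn_Dn)
  show ?thesis
    by unfold_locales (use A hspan_closed hoch_D_hspan hoch_D_simps mc mb one one' DD in \<open>simp_all add: scal_add\<close>)
qed

text \<open>The laws for \<delta> are pulled back along \<open>cmp\<close>: equalities by
  injectivity, membership in the boundaries by \<open>cmp_boundaryD\<close>.\<close>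

lemma diff_algebra_Lambda_Gamma: "diff_algebra (Lambda_Gamma G deg) \<delta>"
proof -
  let ?S = "span_on om :: ('v mono \<Rightarrow>\<^sub>0 'k) set"
  have S: "x \<in> ?S \<longleftrightarrow> keys x \<subseteq> om" for x by (simp add: span_on_def)
  have cl: "x - y \<in> ?S" "scal c x \<in> ?S" if "x \<in> ?S" "y \<in> ?S" for x y c
    using that keys_diffD[of _ x y] keys_scal[of c x] unfolding span_on_def by blast+
  have DD: "\<delta> (\<delta> x) = 0" if x: "x \<in> ?S" for x
  proof (rule cmp_eqD)
    show "cmp (\<delta> (\<delta> x)) = cmp 0"
      using x Dn_Dn[OF cmp_ncells] by (simp add: S Dn_cmp[symmetric] \<delta>_om)
  qed (use x in \<open>simp_all add: S \<delta>_om\<close>)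
  have mc: "gmult deg x y \<in> ?S \<and> \<delta> (gmult deg x y) = 0" if h: "x \<in> ?S" "y \<in> ?S" "\<delta> x = 0" "\<delta> y = 0" for x y
  proof -
    have k: "keys (gmult deg x y) \<subseteq> om" using h omul_om omul by (simp add: S)
    have "cmp (\<delta> (gmult deg x y)) = cmp 0"
      using h k Dn_um[OF cmp_ncells cmp_ncells, of x y] by (simp add: Dn_cmp[symmetric] S omul eps_mul[OF corr(1)]) (simp add: Dn_cmp)
    then show ?thesis using cmp_eqD[of "\<delta> (gmult deg x y)" 0] k by (simp add: S \<delta>_om)
  qed
  have mb: "gmult deg (\<delta> b + x) y - gmult deg x y \<in> \<delta> ` ?S \<and> gmult deg x (\<delta> b + y) - gmult deg x y \<in> \<delta> ` ?S"
    if h: "x \<in> ?S" "y \<in> ?S" "\<delta> x = 0" "\<delta> y = 0" "b \<in> ?S" for x y b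
  proof
    have k: "keys x \<subseteq> om" "keys y \<subseteq> om" "keys b \<subseteq> om" "keys (\<delta> b) \<subseteq> om" using h by (simp_all add: S \<delta>_om)
    have k': "keys (\<delta> b + x) \<subseteq> om" "keys (\<delta> b + y) \<subseteq> om" using k keys_addD[of _ "\<delta> b"] by blast+
    have c: "Dn (cmp x) = 0" "Dn (cmp y) = 0" using Dn_cmp k h by simp_all
    have "gmult deg (\<delta> b + x) y - gmult deg x y = Om.mul deg (\<delta> b) y"
      using k k' by (simp add: omul)
    moreover have "cmp (Om.mul deg (\<delta> b) y) = Dn (um (cmp b) (cmp y))"
      using k c by (simp add: eps_mul[OF corr(1)] Dn_cmp[symmetric] um_boundary(1) cmp_ncells)
    ultimately show "gmult deg (\<delta> b + x) y - gmult deg x y \<in> \<delta> ` ?S"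
      using cmp_boundaryD[OF keys_um_ncells[OF cmp_ncells[OF k(3)] cmp_ncells[OF k(2)]] omul_om[OF k(4,2)]] by (auto simp: S)
    have "gmult deg x (\<delta> b + y) - gmult deg x y = Om.mul deg x (\<delta> b)"
      using k k' by (simp add: omul)
    moreover have "cmp (Om.mul deg x (\<delta> b)) = Dn (um (sign_involution (cmp x)) (cmp b))"
      using k c by (simp add: eps_mul[OF corr(1)] Dn_cmp[symmetric] um_boundary(2) cmp_ncells)
    ultimately show "gmult deg x (\<delta> b + y) - gmult deg x y \<in> \<delta> ` ?S"
      using cmp_boundaryD[OF keys_um_ncells[OF sign_involution_ncells[OF cmp_ncells[OF k(1)]] cmp_ncells[OF k(3)]] omul_om[OF k(1,4)]]
      by (auto simp: S)
  qed
  have one: "keys (\<delta> (basis 0)) \<subseteq> om" by (rule \<delta>_om) simp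
  have "cmp (\<delta> (basis 0)) = cmp 0" using Dn_cmp[of "basis 0"] by (simp add: eps_0[OF corr(1)])
  then have "\<delta> (basis 0) = 0" using cmp_eqD[OF one, of 0] by simp
  then show ?thesis unfolding Lambda_Gamma_def
    by unfold_locales (use cl DD mc mb in \<open>simp_all flip: om_def add: S \<delta>_om \<delta>_diff \<delta>_scal scal_add\<close>, auto simp: span_on_def om_def)
qed

lemma homology_comparison:
  "graded_algebra_isomorphic (HH G deg bd) (homology (Lambda_Gamma G deg) \<delta>)"
  unfolding HH_def
proof (rule homology_isomorphic[OF diff_algebra_hoch diff_algebra_Lambda_Gamma, where E = "\<lambda>w. Jinv (cmp w)"])
  let ?A = "hoch_algebra G deg :: ('k, ('v, 'k) hoch) graded_algebra" and ?B = "Lambda_Gamma G deg :: ('k, 'v mono \<Rightarrow>\<^sub>0 'k) graded_algebra"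
  have A: "carrier ?A = hspan" "monoid.mult ?A = shuffle_product deg" "\<one>\<^bsub>?A\<^esub> = basis [0]" "smult ?A = scal"
    by (simp_all add: hoch_algebra_def)
  have B: "w \<in> carrier ?B \<longleftrightarrow> keys w \<subseteq> om" "monoid.mult ?B = gmult deg" "\<one>\<^bsub>?B\<^esub> = basis 0" "smult ?B = scal" for w
    by (simp_all add: Lambda_Gamma_def span_on_def om_def)
  have E: "Jinv (cmp w) \<in> hspan" if "keys w \<subseteq> om" for w using that by (simp add: Jinv_hspan cmp_ncells)
  have hA: "x \<in> hpart ?A n \<longleftrightarrow> x \<in> hspan \<and> (\<exists>p. J x \<in> FC {k. int k = n} p)" for x n
  proof -
    define P where "P ms \<longleftrightarrow> int (int_deg deg ms + length (tl ms)) = n" for ms :: "'v mono list"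
    define Q where "Q ms \<longleftrightarrow> pdg (hd ms, tl ms) + qdg (hd ms, tl ms) \<in> {k. int k = n}" for ms
    have "P ms \<longleftrightarrow> Q ms" if "ms \<in> hoch_basis G deg" for ms
      using that hoch_basis_Cons(2) unfolding P_def Q_def by (cases ms) (auto simp: pdg_def qdg_def int_deg_def wdg_def)
    then have PQ: "{ms \<in> hoch_basis G deg. P ms} = {ms \<in> hoch_basis G deg. Q ms}" by blast
    have "x \<in> hpart ?A n \<longleftrightarrow> keys x \<subseteq> {ms \<in> hoch_basis G deg. P ms}"
      by (simp add: hoch_algebra_def span_on_def P_def)
    also have "\<dots> \<longleftrightarrow> x \<in> hspan \<and> (\<forall>ms\<in>keys x. Q ms)"
      unfolding PQ subset_Collect span_on_def by simp
    also have "\<dots> \<longleftrightarrow> x \<in> hspan \<and> (\<exists>p. J x \<in> FC {k. int k = n} p)"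
    proof (rule conj_cong[OF refl])
      assume x: "x \<in> hspan"
      show "(\<forall>ms\<in>keys x. Q ms) \<longleftrightarrow> (\<exists>p. J x \<in> FC {k. int k = n} p)"
      proof
        assume "\<forall>ms\<in>keys x. Q ms"
        then show "\<exists>p. J x \<in> FC {k. int k = n} p"
          by (intro FC_exists[OF J_ncells[OF x]]) (force simp: keys_J Q_def)
      qed (auto simp: J_FC[OF x] Q_def)
    qed
    finally show ?thesis .
  qed
  have hB: "w \<in> hpart ?B n \<longleftrightarrow> (\<exists>p. w \<in> WF {k. int k = n} p)" for w n
  proof
    assume "w \<in> hpart ?B n"
    then have "keys w \<subseteq> om" "\<And>m. m \<in> keys w \<Longrightarrow> pw m + qw m \<in> {k. int k = n}"
      by (auto simp: Lambda_Gamma_def span_on_def om_def mdeg_pw_qw)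
    then show "\<exists>p. w \<in> WF {k. int k = n} p" using WF_exists by blast
  next
    assume "\<exists>p. w \<in> WF {k. int k = n} p"
    then show "w \<in> hpart ?B n" by (auto simp: Lambda_Gamma_def span_on_def om_def mdeg_pw_qw WF_def)
  qed
  have bd: "Jinv (Dn z) \<in> hoch_D deg bd ` hspan" if "keys z \<subseteq> ncells" for z
    using hoch_D_eq[OF Jinv_hspan[OF that]] Jinv_hspan[OF that] by (intro image_eqI[of _ _ "Jinv z"]) simp_all
  \<comment> \<open>Applied with a single total degree for the grading and with \<open>UNIV\<close>
    for the whole algebra.\<close>
  have surj: "\<exists>w\<in>WF N p. \<delta> w = 0 \<and> x - Jinv (cmp w) \<in> hoch_D deg bd ` hspan"
    if x: "x \<in> hspan" "hoch_D deg bd x = 0" "J x \<in> FC N p" for x N p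
  proof -
    have "Dn (J x) = 0" using J_hoch_D[OF x(1)] x(2) by simp
    then obtain w z where wz: "w \<in> WF N p" "z \<in> FC (Suc ` N) p" "\<delta> w = 0" "J x = cmp w + Dn z"
      using cycles_from_cmp[OF x(3)] by blast
    have "x = Jinv (cmp w + Dn z)" using Jinv_J_hspan[OF x(1)] wz(4) by simp
    then have "x - Jinv (cmp w) = Jinv (Dn z)" by simp
    then show ?thesis using wz(1,3) bd[OF FC_closed(5)[OF wz(2)]] by (intro bexI[of _ w]) simp_all
  qed
  show "Jinv (cmp w) \<in> carrier ?A" "hoch_D deg bd (Jinv (cmp w)) = Jinv (cmp (\<delta> w))" if "w \<in> carrier ?B" for w
    using that E by (simp_all add: A B hoch_D_eq Dn_cmp)
  show "Jinv (cmp (v - w)) = Jinv (cmp v) - Jinv (cmp w)" for v w by simp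
  show "Jinv (cmp (v \<otimes>\<^bsub>?B\<^esub> w)) = Jinv (cmp v) \<otimes>\<^bsub>?A\<^esub> Jinv (cmp w)" if "v \<in> carrier ?B" "w \<in> carrier ?B" for v w
    using that E by (simp add: A B omul shuffle_product_eq eps_mul[OF corr(1)])
  show "Jinv (cmp (\<one>\<^bsub>?B\<^esub>)) = \<one>\<^bsub>?A\<^esub>"
    by (simp add: A B eps_0[OF corr(1)]) (simp add: one_u_def J_basis)
  show "Jinv (cmp (c \<odot>\<^bsub>?B\<^esub> w)) = c \<odot>\<^bsub>?A\<^esub> Jinv (cmp w)" for c w
    by (simp add: A B)
  show "Jinv (cmp w) \<in> hpart ?A n" if "w \<in> hpart ?B n" for n w
    using that cmp_FC E WF_closed(5) by (auto simp: hA hB)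
  show "\<exists>w\<in>hpart ?B n. \<delta> w = 0 \<and> x - Jinv (cmp w) \<in> hoch_D deg bd ` carrier ?A"
    if x: "x \<in> hpart ?A n" "hoch_D deg bd x = 0" for n x
  proof -
    obtain p where p: "x \<in> hspan" "J x \<in> FC {k. int k = n} p" using x(1) unfolding hA by blast
    obtain w where "w \<in> WF {k. int k = n} p" "\<delta> w = 0" "x - Jinv (cmp w) \<in> hoch_D deg bd ` hspan"
      using surj[OF p(1) x(2) p(2)] by blast
    then show ?thesis unfolding A using hB by blast
  qed
  show "\<exists>w\<in>carrier ?B. \<delta> w = 0 \<and> x - Jinv (cmp w) \<in> hoch_D deg bd ` carrier ?A"
    if x: "x \<in> carrier ?A" "hoch_D deg bd x = 0" for x
  proof -
    obtain p where p: "J x \<in> FC UNIV p" using FC_exists[OF J_ncells, of x UNIV] x(1) by (auto simp: A)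
    obtain w where "w \<in> WF UNIV p" "\<delta> w = 0" "x - Jinv (cmp w) \<in> hoch_D deg bd ` carrier ?A"
      using surj[OF _ x(2) p] x(1) unfolding A by blast
    then show ?thesis using WF_closed(5) B(1) by blast
  qed
  show "w \<in> \<delta> ` carrier ?B" if w: "w \<in> carrier ?B" "\<delta> w = 0" "Jinv (cmp w) \<in> hoch_D deg bd ` carrier ?A" for w
  proof -
    obtain z where z: "z \<in> hspan" "Jinv (cmp w) = hoch_D deg bd z" using w(3) by (auto simp: A)
    then have "cmp w = Dn (J z)" using J_hoch_D[OF z(1)] J_Jinv[of "cmp w"] by simp
    then obtain u where "keys u \<subseteq> om" "w = \<delta> u" using cmp_boundaryD[OF J_ncells[OF z(1)]] w(1) by (auto simp: B)
    then show ?thesis using B(1) by blast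
  qed
qed

end

theorem theorem2p3:
  fixes G :: "'v set" and deg :: "'v \<Rightarrow> nat"
    and bd d \<delta> :: "('v mono \<Rightarrow>\<^sub>0 'k::comm_ring_1) \<Rightarrow> ('v mono \<Rightarrow>\<^sub>0 'k)"
  assumes "\<forall>v\<in>G. deg v < 2"
    and "chain_differential (Lambda G deg) bd"
    and "gamma_derivation G deg 1 d"
    and "\<forall>v\<in>G. d (gvar (Gen v)) = gvar (DGen v)"
    and "\<forall>v\<in>G. d (gvar (DGen v)) = 0"
    and "gamma_derivation G deg (-1) \<delta>"
    and "\<forall>a\<in>carrier (Lambda G deg). \<delta> a = bd a"
    and "\<forall>v\<in>G. \<delta> (gvar (DGen v)) = - d (bd (gvar (Gen v)))"
  shows "ss_degenerates_at (hoch_C G deg) (hoch_F G deg) (hoch_D deg bd) 2 \<and>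
    graded_algebra_isomorphic (HH G deg bd) (homology (Lambda_Gamma G deg) \<delta>)"
proof -
  interpret low_degree G deg bd d \<delta>
    using assms by unfold_locales
  show ?thesis
    using hochschild_degenerates homology_comparison by blast
qed

end
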